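(* Let $\Omega\subset\mathbb{R}^n$ be open and bounded, let $\mathbb{A}$ be a $k$-th order $\mathbb{C}$-elliptic differential operator from $V$ to $W$, and let $(X(\Omega),\|\cdot\|_{X(\Omega)})$ be an infinite-dimensional Banach function space (used for $V$-valued maps) with $X(\Omega)\subset L^1_{\mathrm{loc}}(\Omega;V)$. Suppose that the embedding $W^kX(\Omega)\hookrightarrow X(\Omega)$ is compact. Then the following statements (i') and (ii') are equivalent: (i') There is a constant $C>0$ with $\|\mathbf{u}\|_{W^kX(\Omega)}\le C\big(\|\mathbf{u}\|_{X(\Omega)}+\|\mathbb{A}\mathbf{u}\|_{X(\Omega)}\big)$ for all $\mathbf{u}\in W^kX(\Omega;V)$. (ii') For every seminorm $|||\cdot|||$ on $W^kX(\Omega;V)$, the following are equivalent: (a) $|||\cdot|||$ is a norm on $\ker(\mathbb{A};\Omega)\cap W^kX(\Omega;V)$; (b) there is $c>0$ with $\|\mathbf{u}\|_{W^kX(\Omega)}\le c\big(|||\mathbf{u}|||+\|\mathbb{A}\mathbf{u}\|_{X(\Omega)}\big)$ for all $\mathbf{u}\in W^kX(\Omega;V)$; (c) there is $c>0$ with $\|\mathbf{u}\|_{W^kX(\Omega)}\le c\,\|\mathbb{A}\mathbf{u}\|_{X(\Omega)}$ for all $\mathbf{u}\in W^kX(\Omega;V)$ with $|||\mathbf{u}|||=0$. Moreover, if (i') or (ii') holds, then automatically $$\ker(\mathbb{A};\Omega)=\ker(\mathbb{A};\Omega)\cap W^kX(\Omega;V)=\ker(\mathbb{A};\Omega)\cap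 C^\infty(\overline{\Omega};V),$$ and there is a constant $c>0$ such that $$\inf_{\boldsymbol{\rho}\in\ker(\mathbb{A};\Omega)}\|\mathbf{u}-\boldsymbol{\rho}\|_{X(\Omega)}\le c\,\|\mathbb{A}\mathbf{u}\|_{X(\Omega)}\qquad\text{for all }\mathbf{u}\in W^kX(\Omega;V).$$
   Context: Throughout $n\ge 2$ and $k\in\mathbb{N}$, $k\geq 1$. $V,W$ are finite-dimensional inner product spaces. A $k$-th order differential operator is a linear, homogeneous, constant-coefficient operator $\mathbb{A}=\sum_{|\alpha|=k}\mathbb{A}_\alpha\partial^\alpha$ on $\mathbb{R}^n$ with fixed linear maps $\mathbb{A}_\alpha:V\to W$; its Fourier symbol is $\mathbb{A}[\xi]=\sum_{|\alpha|=k}\xi^\alpha\mathbb{A}_\alpha$. $\mathbb{A}$ is $\mathbb{C}$-elliptic if $\mathbb{A}[\xi]:V+\mathrm{i}V\to W+\mathrm{i}W$ is injective for every $\xi\in\mathbb{C}^n\setminus\{0\}$. Put $\ker(\mathbb{A};\Omega)=\{\mathbf{u}\in\mathscr{D}'(\Omega;V):\mathbb{A}\mathbf{u}=0\}$. ($\Omega$ is not assumed connected.) $C^\infty(\overline{\Omega};V)$ denotes the usual space of $V$-valued maps that are smooth up to the boundary. Banach function spaces (Bennett–Sharpley): a Banach function norm is a map $\rho$ from the $[0,\infty]$-valued measurable functions on $\Omega$ to $[0,\infty]$ such that for all such $u,v,u_i$ and $\lambda\ge0$: (B1) $\rho(u)=0$ implies $u=0$ a.e., $\rho(\lambda u)=\lambda\rho(u)$,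 $\rho(u+v)\le\rho(u)+\rho(v)$; (B2) $u\le v$ a.e. implies $\rho(u)\le\rho(v)$; (B3) $u_i\nearrow u$ a.e. implies $\rho(u_i)\nearrow\rho(u)$; (B4) $\rho(\mathbf{1}_A)<\infty$ for measurable $A\subset\Omega$ with $\mathscr{L}^n(A)<\infty$; (B5) for measurable $A\subset\Omega$ with $\mathscr{L}^n(A)<\infty$ there is $c=c(A,\rho)$ with $\|u\|_{L^1(A)}\le c\rho(u)$. Here $\mathscr{L}^n$ is Lebesgue measure. The Banach function space is $X(\Omega)=\{u\text{ measurable}:\|u\|_{X(\Omega)}:=\rho(|u|)<\infty\}$; for maps with values in a finite-dimensional inner product space, $\|\mathbf{u}\|_{X(\Omega)}:=\rho(|\mathbf{u}|)$. The Sobolev space $W^kX(\Omega;V)$ consists of the $k$-times weakly differentiable $\mathbf{u}:\Omega\to V$ with $\|\mathbf{u}\|_{W^kX(\Omega)}:=\sum_{|\alpha|\le k}\|\partial^\alpha\mathbf{u}\|_{X(\Omega)}<\infty$.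
   Formalization: Seminorms in (ii') are taken continuous on W^kX (false for discontinuous ones), and C^∞(Ω̄) means all derivatives extend continuously to the closure of each connected component of Ω (false for Ω̄ as a whole when components touch). *)

theory Defs
  imports "HOL-Analysis.Analysis"
begin

section \<open>Multi-indices and derivatives of smooth maps\<close>

definition mi_abs :: "('n::finite \<Rightarrow> nat) \<Rightarrow> nat" where
  "mi_abs \<alpha> = (\<Sum>i\<in>UNIV. \<alpha> i)"

lemma finite_mi_abs_le: "finite {\<alpha>::'n::finite \<Rightarrow> nat. mi_abs \<alpha> \<le> k}"
proof (rule finite_subset)
  show "{\<alpha>::'n \<Rightarrow> nat. mi_abs \<alpha> \<le> k} \<subseteq> PiE UNIV (\<lambda>_. {..k})"
  proof
    fix \<alpha> :: "'n \<Rightarrow> nat"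
    assume "\<alpha> \<in> {\<alpha>. mi_abs \<alpha> \<le> k}"
    then have "mi_abs \<alpha> \<le> k" by simp
    moreover have "\<alpha> i \<le> mi_abs \<alpha>" for i
      unfolding mi_abs_def by (rule member_le_sum) simp_all
    ultimately have "\<alpha> i \<le> k" for i
      by (rule order_trans[rotated])
    then show "\<alpha> \<in> PiE UNIV (\<lambda>_. {..k})" by (simp add: PiE_UNIV_domain)
  qed
  show "finite (PiE (UNIV::'n set) (\<lambda>_. {..k}))"
    by (intro finite_PiE) auto
qed

lemma finite_mi_abs_eq: "finite {\<alpha>::'n::finite \<Rightarrow> nat. mi_abs \<alpha> = k}"
  by (rule finite_subset[OF _ finite_mi_abs_le[of k]]) auto

definition partial_deriv ::
  "'n::finite \<Rightarrow> (real^'n \<Rightarrow> 'a::real_normed_vector) \<Rightarrow> real^'n \<Rightarrow> 'a" where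
  "partial_deriv i f = (\<lambda>x. frechet_derivative f (at x) (axis i 1))"

text \<open>Intended for open \<open>S\<close>: all iterated partial derivatives, in every order of the
  directions, are differentiable (hence continuous) on \<open>S\<close>.\<close>

definition smooth_on :: "(real^'n::finite) set \<Rightarrow> (real^'n \<Rightarrow> 'a::real_normed_vector) \<Rightarrow> bool" where
  "smooth_on S f \<longleftrightarrow> (\<forall>is. \<forall>x\<in>S. foldr partial_deriv is f differentiable (at x))"

text \<open>The index type carries no order, so \<open>\<partial>\<^sup>\<alpha>\<close> applies the powers of the partial derivatives
  along an arbitrary fixed enumeration of the coordinates.  For smooth maps the
  choice is immaterial, and \<open>mi_deriv\<close> is only applied to such maps.\<close>

definition coord_list :: "'n::finite list" where
  "coord_list = (SOME is. distinct is \<and> set is = UNIV)"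

definition mi_deriv ::
  "('n::finite \<Rightarrow> nat) \<Rightarrow> (real^'n \<Rightarrow> 'a::real_normed_vector) \<Rightarrow> real^'n \<Rightarrow> 'a" where
  "mi_deriv \<alpha> f = foldr (\<lambda>i. partial_deriv i ^^ \<alpha> i) coord_list f"

text \<open>Maps that are smooth up to the boundary: all derivatives extend continuously to the
  boundary, which is approached from within each connected component separately.  For connected
  \<open>\<Omega>\<close> this is the requirement that they extend continuously to \<open>closure \<Omega>\<close>.
  If two components touch (e.g. a ball with a hyperplane removed), a map equal to a nonzero
  constant on one and zero on the other is smooth up to the boundary in this sense, but has no
  continuous extension to \<open>closure \<Omega>\<close>.\<close>

definition smooth_upto_boundary ::
  "(real^'n::finite) set \<Rightarrow> (real^'n \<Rightarrow> 'a::real_normed_vector) set" where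
  "smooth_upto_boundary \<Omega> = {u. smooth_on \<Omega> u \<and>
     (\<forall>\<omega>\<in>components \<Omega>. \<forall>\<alpha>. \<exists>g. continuous_on (closure \<omega>) g \<and> (\<forall>x\<in>\<omega>. g x = mi_deriv \<alpha> u x))}"


section \<open>Distributions and weak derivatives\<close>

definition test_functions :: "(real^'n::finite) set \<Rightarrow> (real^'n \<Rightarrow> real) set" where
  "test_functions \<Omega> = {\<phi>. smooth_on UNIV \<phi> \<and>
     compact (closure {x. \<phi> x \<noteq> 0}) \<and> closure {x. \<phi> x \<noteq> 0} \<subseteq> \<Omega>}"

text \<open>\<open>\<D>'(\<Omega>;V)\<close> as \<open>V\<close>-valued continuous linear maps on the scalar test functions.
  The value 0 is prescribed off the test functions, so that equality of distributions is equality
  of functions.\<close>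

definition distributions ::
  "(real^'n::finite) set \<Rightarrow> ((real^'n \<Rightarrow> real) \<Rightarrow> 'v::euclidean_space) set" where
  "distributions \<Omega> = {T.
     (\<forall>\<phi>. \<phi> \<notin> test_functions \<Omega> \<longrightarrow> T \<phi> = 0) \<and>
     (\<forall>\<phi>\<in>test_functions \<Omega>. \<forall>\<psi>\<in>test_functions \<Omega>. T (\<lambda>x. \<phi> x + \<psi> x) = T \<phi> + T \<psi>) \<and>
     (\<forall>\<phi>\<in>test_functions \<Omega>. \<forall>c. T (\<lambda>x. c * \<phi> x) = c *\<^sub>R T \<phi>) \<and>
     (\<forall>K. compact K \<and> K \<subseteq> \<Omega> \<longrightarrow>
        (\<exists>C m. \<forall>\<phi>\<in>test_functions \<Omega>. closure {x. \<phi> x \<noteq> 0} \<subseteq> K \<longrightarrow>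
           norm (T \<phi>) \<le> C * (\<Sum>\<alpha> | mi_abs \<alpha> \<le> m. SUP x. \<bar>mi_deriv \<alpha> \<phi> x\<bar>)))}"

definition L1_loc :: "(real^'n::finite) set \<Rightarrow> (real^'n \<Rightarrow> 'v::euclidean_space) set" where
  "L1_loc \<Omega> = {u. \<forall>K. compact K \<and> K \<subseteq> \<Omega> \<longrightarrow> u absolutely_integrable_on K}"

definition dist_of ::
  "(real^'n::finite) set \<Rightarrow> (real^'n \<Rightarrow> 'v::euclidean_space) \<Rightarrow> (real^'n \<Rightarrow> real) \<Rightarrow> 'v" where
  "dist_of \<Omega> u = (\<lambda>\<phi>. if \<phi> \<in> test_functions \<Omega>
     then integral\<^sup>L (lebesgue_on \<Omega>) (\<lambda>x. \<phi> x *\<^sub>R u x) else 0)"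

definition dist_deriv ::
  "(real^'n::finite) set \<Rightarrow> ('n \<Rightarrow> nat) \<Rightarrow> ((real^'n \<Rightarrow> real) \<Rightarrow> 'v::euclidean_space)
    \<Rightarrow> (real^'n \<Rightarrow> real) \<Rightarrow> 'v" where
  "dist_deriv \<Omega> \<alpha> T = (\<lambda>\<phi>. if \<phi> \<in> test_functions \<Omega>
     then (-1) ^ mi_abs \<alpha> *\<^sub>R T (mi_deriv \<alpha> \<phi>) else 0)"

definition is_weak_deriv ::
  "(real^'n::finite) set \<Rightarrow> ('n \<Rightarrow> nat) \<Rightarrow> (real^'n \<Rightarrow> 'v::euclidean_space)
    \<Rightarrow> (real^'n \<Rightarrow> 'v) \<Rightarrow> bool" where
  "is_weak_deriv \<Omega> \<alpha> u g \<longleftrightarrow> u \<in> L1_loc \<Omega> \<and> g \<in> L1_loc \<Omega> \<and>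
     dist_deriv \<Omega> \<alpha> (dist_of \<Omega> u) = dist_of \<Omega> g"

text \<open>Weak derivatives are unique a.e. on \<open>\<Omega>\<close>; \<open>weak_deriv\<close> is some representative.\<close>

definition weak_deriv ::
  "(real^'n::finite) set \<Rightarrow> ('n \<Rightarrow> nat) \<Rightarrow> (real^'n \<Rightarrow> 'v::euclidean_space) \<Rightarrow> real^'n \<Rightarrow> 'v" where
  "weak_deriv \<Omega> \<alpha> u = (SOME g. is_weak_deriv \<Omega> \<alpha> u g)"


section \<open>Differential operators\<close>

text \<open>The family \<open>A\<close> of coefficients represents the operator \<open>\<Sum>\<^bsub>|\<alpha>|=k\<^esub> A \<alpha> \<partial>\<^sup>\<alpha>\<close>; only the
  coefficients with \<open>|\<alpha>| = k\<close> matter.\<close>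

definition diff_operator ::
  "nat \<Rightarrow> (('n::finite \<Rightarrow> nat) \<Rightarrow> 'v::euclidean_space \<Rightarrow> 'w::euclidean_space) \<Rightarrow> bool" where
  "diff_operator k A \<longleftrightarrow> (\<forall>\<alpha>. mi_abs \<alpha> = k \<longrightarrow> linear (A \<alpha>))"

text \<open>The complexification \<open>V + \<i>V\<close> is represented by pairs, \<open>(a, b)\<close> standing for \<open>a + \<i>b\<close>.\<close>

definition cscale :: "complex \<Rightarrow> 'v::real_vector \<times> 'v \<Rightarrow> 'v \<times> 'v" where
  "cscale z p = (Re z *\<^sub>R fst p - Im z *\<^sub>R snd p, Im z *\<^sub>R fst p + Re z *\<^sub>R snd p)"

definition complex_symbol ::
  "nat \<Rightarrow> (('n::finite \<Rightarrow> nat) \<Rightarrow> 'v::euclidean_space \<Rightarrow> 'w::euclidean_space)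
    \<Rightarrow> complex^'n \<Rightarrow> 'v \<times> 'v \<Rightarrow> 'w \<times> 'w" where
  "complex_symbol k A \<xi> = (\<lambda>(a, b).
     \<Sum>\<alpha> | mi_abs \<alpha> = k. cscale (\<Prod>i\<in>UNIV. (\<xi> $ i) ^ \<alpha> i) (A \<alpha> a, A \<alpha> b))"

definition C_elliptic ::
  "nat \<Rightarrow> (('n::finite \<Rightarrow> nat) \<Rightarrow> 'v::euclidean_space \<Rightarrow> 'w::euclidean_space) \<Rightarrow> bool" where
  "C_elliptic k A \<longleftrightarrow> (\<forall>\<xi>. \<xi> \<noteq> 0 \<longrightarrow> inj (complex_symbol k A \<xi>))"

definition dist_op ::
  "(real^'n::finite) set \<Rightarrow> nat \<Rightarrow> (('n \<Rightarrow> nat) \<Rightarrow> 'v::euclidean_space \<Rightarrow> 'w::euclidean_space)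
    \<Rightarrow> ((real^'n \<Rightarrow> real) \<Rightarrow> 'v) \<Rightarrow> (real^'n \<Rightarrow> real) \<Rightarrow> 'w" where
  "dist_op \<Omega> k A T = (\<lambda>\<phi>. \<Sum>\<alpha> | mi_abs \<alpha> = k. A \<alpha> (dist_deriv \<Omega> \<alpha> T \<phi>))"

definition dist_kernel ::
  "(real^'n::finite) set \<Rightarrow> nat \<Rightarrow> (('n \<Rightarrow> nat) \<Rightarrow> 'v::euclidean_space \<Rightarrow> 'w::euclidean_space)
    \<Rightarrow> ((real^'n \<Rightarrow> real) \<Rightarrow> 'v) set" where
  "dist_kernel \<Omega> k A = {T \<in> distributions \<Omega>. dist_op \<Omega> k A T = (\<lambda>_. 0)}"

definition weak_op ::
  "(real^'n::finite) set \<Rightarrow> nat \<Rightarrow> (('n \<Rightarrow> nat) \<Rightarrow> 'v::euclidean_space \<Rightarrow> 'w::euclidean_space)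
    \<Rightarrow> (real^'n \<Rightarrow> 'v) \<Rightarrow> real^'n \<Rightarrow> 'w" where
  "weak_op \<Omega> k A u = (\<lambda>x. \<Sum>\<alpha> | mi_abs \<alpha> = k. A \<alpha> (weak_deriv \<Omega> \<alpha> u x))"


section \<open>Banach function spaces and their Sobolev spaces\<close>

text \<open>Functions on \<open>\<Omega>\<close> are total functions whose values off \<open>\<Omega>\<close> are irrelevant
  (for \<open>\<rho>\<close> this follows from the monotonicity axiom).\<close>

definition banach_function_norm ::
  "(real^'n::finite) set \<Rightarrow> ((real^'n \<Rightarrow> ennreal) \<Rightarrow> ennreal) \<Rightarrow> bool" where
  "banach_function_norm \<Omega> \<rho> \<longleftrightarrow> (let M = borel_measurable (lebesgue_on \<Omega>) in
     (\<forall>u\<in>M. \<rho> u = 0 \<longrightarrow> (AE x in lebesgue_on \<Omega>. u x = 0)) \<and>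
     (\<forall>u\<in>M. \<forall>c::real. 0 \<le> c \<longrightarrow> \<rho> (\<lambda>x. ennreal c * u x) = ennreal c * \<rho> u) \<and>
     (\<forall>u\<in>M. \<forall>v\<in>M. \<rho> (\<lambda>x. u x + v x) \<le> \<rho> u + \<rho> v) \<and>
     (\<forall>u\<in>M. \<forall>v\<in>M. (AE x in lebesgue_on \<Omega>. u x \<le> v x) \<longrightarrow> \<rho> u \<le> \<rho> v) \<and>
     (\<forall>U. \<forall>u\<in>M. (\<forall>j. U j \<in> M) \<longrightarrow>
        (AE x in lebesgue_on \<Omega>. incseq (\<lambda>j::nat. U j x) \<and> (\<lambda>j. U j x) \<longlonglongrightarrow> u x) \<longrightarrow>
        incseq (\<lambda>j. \<rho> (U j)) \<and> (\<lambda>j. \<rho> (U j)) \<longlonglongrightarrow> \<rho> u) \<and>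
     (\<forall>A\<in>sets lebesgue. A \<subseteq> \<Omega> \<longrightarrow> emeasure lebesgue A < \<infinity> \<longrightarrow> \<rho> (indicator A) < \<infinity>) \<and>
     (\<forall>A\<in>sets lebesgue. A \<subseteq> \<Omega> \<longrightarrow> emeasure lebesgue A < \<infinity> \<longrightarrow>
        (\<exists>c::real. 0 < c \<and> (\<forall>u\<in>M. (\<integral>\<^sup>+x. u x \<partial>lebesgue_on A) \<le> ennreal c * \<rho> u))))"

definition X_norm ::
  "((real^'n::finite \<Rightarrow> ennreal) \<Rightarrow> ennreal) \<Rightarrow> (real^'n \<Rightarrow> 'a::real_normed_vector) \<Rightarrow> ennreal" where
  "X_norm \<rho> u = \<rho> (\<lambda>x. ennreal (norm (u x)))"

definition X_space ::
  "(real^'n::finite) set \<Rightarrow> ((real^'n \<Rightarrow> ennreal) \<Rightarrow> ennreal)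
    \<Rightarrow> (real^'n \<Rightarrow> 'a::real_normed_vector) set" where
  "X_space \<Omega> \<rho> = {u \<in> borel_measurable (lebesgue_on \<Omega>). X_norm \<rho> u < \<infinity>}"

definition infinite_dim_ae :: "(real^'n::finite) set \<Rightarrow> (real^'n \<Rightarrow> 'a::real_vector) set \<Rightarrow> bool" where
  "infinite_dim_ae \<Omega> S \<longleftrightarrow> \<not> (\<exists>B. finite B \<and> B \<subseteq> S \<and>
     (\<forall>u\<in>S. \<exists>c. AE x in lebesgue_on \<Omega>. u x = (\<Sum>b\<in>B. c b *\<^sub>R b x)))"

definition W_norm ::
  "(real^'n::finite) set \<Rightarrow> nat \<Rightarrow> ((real^'n \<Rightarrow> ennreal) \<Rightarrow> ennreal)
    \<Rightarrow> (real^'n \<Rightarrow> 'v::euclidean_space) \<Rightarrow> ennreal" where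
  "W_norm \<Omega> k \<rho> u = (\<Sum>\<alpha> | mi_abs \<alpha> \<le> k. X_norm \<rho> (weak_deriv \<Omega> \<alpha> u))"

definition W_space ::
  "(real^'n::finite) set \<Rightarrow> nat \<Rightarrow> ((real^'n \<Rightarrow> ennreal) \<Rightarrow> ennreal)
    \<Rightarrow> (real^'n \<Rightarrow> 'v::euclidean_space) set" where
  "W_space \<Omega> k \<rho> = {u. (\<forall>\<alpha>. mi_abs \<alpha> \<le> k \<longrightarrow> (\<exists>g. is_weak_deriv \<Omega> \<alpha> u g)) \<and> W_norm \<Omega> k \<rho> u < \<infinity>}"

definition compact_embedding ::
  "(real^'n::finite) set \<Rightarrow> nat \<Rightarrow> ((real^'n \<Rightarrow> ennreal) \<Rightarrow> ennreal)
    \<Rightarrow> (real^'n \<Rightarrow> 'v::euclidean_space) itself \<Rightarrow> bool" where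
  "compact_embedding \<Omega> k \<rho> _ \<longleftrightarrow>
     (\<forall>U :: nat \<Rightarrow> real^'n \<Rightarrow> 'v.
        (\<forall>j. U j \<in> W_space \<Omega> k \<rho>) \<and> (\<exists>m::real. \<forall>j. W_norm \<Omega> k \<rho> (U j) \<le> ennreal m) \<longrightarrow>
        (\<exists>r. \<exists>u\<in>X_space \<Omega> \<rho>. strict_mono r \<and>
           (\<lambda>j. X_norm \<rho> (\<lambda>x. U (r j) x - u x)) \<longlonglongrightarrow> 0))"


section \<open>Seminorms and the two statements\<close>

text \<open>The space \<open>S\<close> consists of functions modulo equality a.e. on \<open>\<Omega>\<close>.\<close>

definition seminorm_ae ::
  "(real^'n::finite) set \<Rightarrow> (real^'n \<Rightarrow> 'v::real_vector) set \<Rightarrow> ((real^'n \<Rightarrow> 'v) \<Rightarrow> real) \<Rightarrow> bool" where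
  "seminorm_ae \<Omega> S N \<longleftrightarrow>
     (\<forall>u\<in>S. 0 \<le> N u) \<and>
     (\<forall>u\<in>S. \<forall>c. N (\<lambda>x. c *\<^sub>R u x) = \<bar>c\<bar> * N u) \<and>
     (\<forall>u\<in>S. \<forall>v\<in>S. N (\<lambda>x. u x + v x) \<le> N u + N v) \<and>
     (\<forall>u\<in>S. \<forall>v\<in>S. (AE x in lebesgue_on \<Omega>. u x = v x) \<longrightarrow> N u = N v)"

definition norm_ae ::
  "(real^'n::finite) set \<Rightarrow> (real^'n \<Rightarrow> 'v::real_vector) set \<Rightarrow> ((real^'n \<Rightarrow> 'v) \<Rightarrow> real) \<Rightarrow> bool" where
  "norm_ae \<Omega> S N \<longleftrightarrow> seminorm_ae \<Omega> S N \<and>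
     (\<forall>u\<in>S. N u = 0 \<longrightarrow> (AE x in lebesgue_on \<Omega>. u x = 0))"

definition W_continuous ::
  "(real^'n::finite) set \<Rightarrow> nat \<Rightarrow> ((real^'n \<Rightarrow> ennreal) \<Rightarrow> ennreal)
    \<Rightarrow> ((real^'n \<Rightarrow> 'v::euclidean_space) \<Rightarrow> real) \<Rightarrow> bool" where
  "W_continuous \<Omega> k \<rho> N \<longleftrightarrow>
     (\<forall>U. \<forall>u\<in>W_space \<Omega> k \<rho>. (\<forall>j. U j \<in> W_space \<Omega> k \<rho>) \<longrightarrow>
        (\<lambda>j. W_norm \<Omega> k \<rho> (\<lambda>x. U j x - u x)) \<longlonglongrightarrow> 0 \<longrightarrow> (\<lambda>j. N (U j)) \<longlonglongrightarrow> N u)"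

definition W_kernel ::
  "(real^'n::finite) set \<Rightarrow> nat \<Rightarrow> ((real^'n \<Rightarrow> ennreal) \<Rightarrow> ennreal)
    \<Rightarrow> (('n \<Rightarrow> nat) \<Rightarrow> 'v::euclidean_space \<Rightarrow> 'w::euclidean_space) \<Rightarrow> (real^'n \<Rightarrow> 'v) set" where
  "W_kernel \<Omega> k \<rho> A = {u \<in> W_space \<Omega> k \<rho>. dist_of \<Omega> u \<in> dist_kernel \<Omega> k A}"

definition korn_estimate ::
  "(real^'n::finite) set \<Rightarrow> nat \<Rightarrow> ((real^'n \<Rightarrow> ennreal) \<Rightarrow> ennreal)
    \<Rightarrow> (('n \<Rightarrow> nat) \<Rightarrow> 'v::euclidean_space \<Rightarrow> 'w::euclidean_space) \<Rightarrow> bool" where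
  "korn_estimate \<Omega> k \<rho> A \<longleftrightarrow> (\<exists>C::real. 0 < C \<and> (\<forall>u\<in>W_space \<Omega> k \<rho>.
     W_norm \<Omega> k \<rho> u \<le> ennreal C * (X_norm \<rho> u + X_norm \<rho> (weak_op \<Omega> k A u))))"

text \<open>Seminorms on the normed space \<open>W\<^sup>kX\<close> are understood to be continuous.  Without this,
  (a) does not imply (b): the absolute value of a discontinuous linear functional that is
  injective on a one-dimensional kernel satisfies (a) only.\<close>

definition seminorm_equivalences ::
  "(real^'n::finite) set \<Rightarrow> nat \<Rightarrow> ((real^'n \<Rightarrow> ennreal) \<Rightarrow> ennreal)
    \<Rightarrow> (('n \<Rightarrow> nat) \<Rightarrow> 'v::euclidean_space \<Rightarrow> 'w::euclidean_space) \<Rightarrow> bool" where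
  "seminorm_equivalences \<Omega> k \<rho> A \<longleftrightarrow>
     (\<forall>N. seminorm_ae \<Omega> (W_space \<Omega> k \<rho>) N \<and> W_continuous \<Omega> k \<rho> N \<longrightarrow>
       (let a = norm_ae \<Omega> (W_kernel \<Omega> k \<rho> A) N;
            b = (\<exists>c::real. 0 < c \<and> (\<forall>u\<in>W_space \<Omega> k \<rho>.
                  W_norm \<Omega> k \<rho> u \<le> ennreal c * (ennreal (N u) + X_norm \<rho> (weak_op \<Omega> k A u))));
            c = (\<exists>c::real. 0 < c \<and> (\<forall>u\<in>W_space \<Omega> k \<rho>. N u = 0 \<longrightarrow>
                  W_norm \<Omega> k \<rho> u \<le> ennreal c * X_norm \<rho> (weak_op \<Omega> k A u)))
        in (a \<longleftrightarrow> b) \<and> (b \<longleftrightarrow> c)))"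

end

theory Submission
  imports Defs "HOL-Library.Function_Algebras" "HOL-Computational_Algebra.Fundamental_Theorem_Algebra"
begin

text \<open>Let \<open>\<A> u = 0\<close> in the sense of distributions. If no power \<open>\<xi>\<^sub>i\<^sup>m v\<close> lay in the module generated by
  the rows of the symbol, dehomogenising at \<open>\<xi>\<^sub>i = 1\<close> and passing to a maximal submodule would produce a
  complex \<open>\<xi> \<noteq> 0\<close> at which the symbol is not injective; on the simple quotient, which has countable
  dimension, every variable acts as a scalar because \<open>\<complex>\<close> is uncountable and algebraically closed. So
  some power of every \<open>\<partial>\<^sub>i\<close> annihilates \<open>u\<close>, and \<open>u\<close> is a polynomial on each component of \<open>\<Omega>\<close>.
  A distribution with vanishing gradient is seen to be constant without regularisation: up to a
  divergence \<open>\<phi> \<integral>\<psi>\<close> equals \<open>\<phi> * \<psi>\<close>, which is symmetric in \<open>\<phi>\<close> and \<open>\<psi>\<close>.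

  Compactness of the embedding forces \<open>\<Omega>\<close> to have finitely many components, since the normalised
  indicator functions of the components are bounded in \<open>W\<^sup>kX\<close> and have mutual distance at least \<open>1\<close>
  in \<open>X\<close>. Hence the whole kernel consists of bounded functions in \<open>W\<^sup>kX\<close>.

  Given the Korn estimate, a bounded sequence in \<open>W\<^sup>kX\<close> whose images under \<open>\<A>\<close> tend to \<open>0\<close> has a
  subsequence converging in \<open>W\<^sup>kX\<close> to an element of the kernel: extract a limit in \<open>X\<close> and apply the
  estimate to differences. The seminorm estimate and the distance estimate both follow from this by
  contradiction. Conversely, the Korn estimate is the seminorm estimate for \<open>\<parallel>\<cdot>\<parallel>\<^sub>X\<close>.\<close>

section \<open>Commuting operators on a complex vector space of countable dimension\<close>

text \<open>No regularity of the boundary is assumed, so neither extension operators nor traces are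
  at hand; all control up to the boundary comes from the kernel being polynomial on each component,
  which is derived from ellipticity by local arguments. The obstacle on the algebraic side is the
  point 0: a homogeneous symbol of positive order always vanishes there, so a common zero is
  worthless unless it is forced away from 0. This is why one variable is set to 1.

  The two estimates need different normalisations. For the seminorm, the violating sequence has norm
  1 in \<open>W^kX\<close>, so its limit cannot vanish, yet it lies in the kernel and is annihilated
  by the seminorm. For the distance, the violating sequence is normalised by its distance to the
  kernel and becomes bounded only after a nearly optimal kernel element has been subtracted; the
  limit then yields a better approximation than that distance permits.\<close>

lemma (in vector_space) independent_countable_span:
  assumes "countable B" "independent S" "S \<subseteq> span B"
  shows "countable S"
proof -
  \<comment> \<open>Every vector of the span lies in the span of a finite subset of
    \<open>B\<close>. There are countably many such subsets, and each contributes only finitely many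
    members of the independent set \<open>S\<close>.\<close>
  have "S \<subseteq> (\<Union>F\<in>{F. finite F \<and> F \<subseteq> B}. S \<inter> span F)"
  proof
    fix s assume "s \<in> S"
    then have "s \<in> span B" using assms(3) by auto
    then obtain F r where "finite F" "F \<subseteq> B" "s = (\<Sum>a\<in>F. scale (r a) a)"
      unfolding span_explicit by auto
    then have "s \<in> span F" by (simp only:) (intro span_sum span_scale span_base)
    with \<open>s \<in> S\<close> \<open>finite F\<close> \<open>F \<subseteq> B\<close> show "s \<in> (\<Union>F\<in>{F. finite F \<and> F \<subseteq> B}. S \<inter> span F)" by auto
  qed
  moreover have "finite (S \<inter> span F)" if "finite F" for F
    using independent_span_bound[OF that, of "S \<inter> span F"] independent_mono[OF assms(2)] by auto
  then have "countable (\<Union>F\<in>{F. finite F \<and> F \<subseteq> B}. S \<inter> span F)"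
    by (intro countable_UN countable_Collect_finite_subset assms(1)) (auto intro: countable_finite)
  ultimately show ?thesis by (rule countable_subset)
qed

text \<open>A module over the polynomial ring in the commuting variables \<open>X i\<close>, with
  carrier \<open>E\<close> inside an ambient vector space. Keeping one ambient type allows
  equalities in a quotient to be written as membership of a difference in a submodule, without a
  quotient type.\<close>

locale commuting_operators = vector_space sc
  for sc :: "complex \<Rightarrow> 'e::ab_group_add \<Rightarrow> 'e" +
  fixes X :: "'n \<Rightarrow> 'e \<Rightarrow> 'e" and E :: "'e set"
  assumes X_add: "X i (f + g) = X i f + X i g"
    and X_sc: "X i (sc c f) = sc c (X i f)"
    and X_comm: "X i (X j f) = X j (X i f)"
    and E_sub: "subspace E"
    and X_E: "f \<in> E \<Longrightarrow> X i f \<in> E"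
begin

definition stable :: "'e set \<Rightarrow> bool" where
  "stable P \<longleftrightarrow> subspace P \<and> P \<subseteq> E \<and> (\<forall>i. \<forall>f\<in>P. X i f \<in> P)"

text \<open>Maximality of \<open>P\<close> says that the quotient of \<open>E\<close> by
  \<open>P\<close> is a simple module.\<close>

definition max_stable :: "'e set \<Rightarrow> bool" where
  "max_stable P \<longleftrightarrow> stable P \<and> P \<noteq> E \<and> (\<forall>Q. stable Q \<and> P \<subseteq> Q \<longrightarrow> Q = P \<or> Q = E)"

lemma X_0: "X i 0 = 0"
  using X_sc[of i 0 0] by simp

lemma X_diff: "X i (f - g) = X i f - X i g"
  using X_add[of i "f - g" g] by (simp add: algebra_simps)

text \<open>Zorn's lemma; \<open>G\<close> generates \<open>E\<close>, and its finiteness keeps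
  unions of chains proper, because a finite set contained in the union of a chain is contained in
  one of its members.\<close>

lemma ex_max_stable:
  assumes G: "finite G" "G \<subseteq> E" "\<And>P. stable P \<Longrightarrow> G \<subseteq> P \<Longrightarrow> P = E"
    and P0: "stable P0" "P0 \<noteq> E"
  obtains P where "max_stable P" "P0 \<subseteq> P"
proof -
  \<comment> \<open>For stable subspaces, missing a generator is equivalent to being proper, and it
    is the form that visibly survives unions of chains.\<close>
  define \<A> where "\<A> = {P. stable P \<and> P0 \<subseteq> P \<and> \<not> G \<subseteq> P}"
  have "P0 \<in> \<A>" using P0 G(3) by (auto simp: \<A>_def)
  have "\<Union>C \<in> \<A>" if C: "C \<noteq> {}" "subset.chain \<A> C" for C
  proof -
    have CA: "C \<subseteq> \<A>" using C by (auto simp: subset.chain_def)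
    have two: "\<exists>P\<in>C. f \<in> P \<and> g \<in> P" if fg: "f \<in> \<Union>C" "g \<in> \<Union>C" for f g
    proof -
      obtain P Q where "P \<in> C" "f \<in> P" "Q \<in> C" "g \<in> Q" using fg by auto
      moreover from this C have "P \<subseteq> Q \<or> Q \<subseteq> P" by (auto simp: subset.chain_def)
      ultimately show ?thesis by auto
    qed
    have st: "stable P" if "P \<in> C" for P using that CA by (auto simp: \<A>_def)
    have "subspace (\<Union>C)"
    proof (rule subspaceI)
      obtain P where "P \<in> C" using C(1) by auto
      then show "0 \<in> \<Union>C" using st[of P] by (auto simp: stable_def intro!: subspace_0)
    next
      fix f g assume "f \<in> \<Union>C" "g \<in> \<Union>C"
      from two[OF this] obtain P where "P \<in> C" "f \<in> P" "g \<in> P" by auto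
      then show "f + g \<in> \<Union>C" using st[of P] by (auto simp: stable_def intro!: subspace_add)
    next
      fix c f assume "f \<in> \<Union>C"
      then obtain P where "P \<in> C" "f \<in> P" by auto
      then show "sc c f \<in> \<Union>C" using st[of P] by (auto simp: stable_def intro!: subspace_scale)
    qed
    moreover have "\<Union>C \<subseteq> E" "\<forall>i. \<forall>f\<in>\<Union>C. X i f \<in> \<Union>C"
      using st unfolding stable_def by blast+
    ultimately have "stable (\<Union>C)" by (simp add: stable_def)
    moreover have "P0 \<subseteq> \<Union>C" using C(1) CA by (auto simp: \<A>_def)
    moreover have "\<not> G \<subseteq> \<Union>C"
    proof
      assume "G \<subseteq> \<Union>C"
      with G(1) C obtain P where "P \<in> C" "G \<subseteq> P"
        using finite_subset_Union_chain[of G C \<A>] by auto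
      then show False using CA by (auto simp: \<A>_def)
    qed
    ultimately show ?thesis by (simp add: \<A>_def)
  qed
  moreover have "\<A> \<noteq> {}" using \<open>P0 \<in> \<A>\<close> by auto
  ultimately have "\<exists>P\<in>\<A>. \<forall>Q\<in>\<A>. P \<subseteq> Q \<longrightarrow> Q = P" by (intro subset_Zorn_nonempty)
  then obtain P where P: "P \<in> \<A>" "\<And>Q. Q \<in> \<A> \<Longrightarrow> P \<subseteq> Q \<Longrightarrow> Q = P" by auto
  have "max_stable P"
    unfolding max_stable_def
  proof (intro conjI allI impI)
    show "stable P" "P \<noteq> E" using P(1) G(2) by (auto simp: \<A>_def)
    fix Q assume Q: "stable Q \<and> P \<subseteq> Q"
    show "Q = P \<or> Q = E"
    proof (cases "G \<subseteq> Q")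
      case True then show ?thesis using G(3) Q by auto
    next
      case False
      then have "Q \<in> \<A>" using Q P(1) by (auto simp: \<A>_def)
      then show ?thesis using P(2) Q by auto
    qed
  qed
  moreover have "P0 \<subseteq> P" using P(1) by (auto simp: \<A>_def)
  ultimately show ?thesis using that by auto
qed

text \<open>The vector \<open>q(X i) f\<close>, evaluated by Horner's scheme so that it recurses
  along \<open>pCons\<close>.\<close>

definition act :: "'n \<Rightarrow> complex poly \<Rightarrow> 'e \<Rightarrow> 'e" where
  "act i q f = fold_coeffs (\<lambda>a g. sc a f + X i g) q 0"

lemma act_0 [simp]: "act i 0 f = 0"
  by (simp add: act_def)

lemma act_pCons: "act i (pCons a q) f = sc a f + X i (act i q f)"
  by (cases "pCons a q = 0") (auto simp: act_def fold_coeffs_pCons_eq X_0)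

lemma act_add: "act i (p + q) f = act i p f + act i q f"
  by (induction p q rule: poly_induct2) (simp_all add: act_pCons X_add scale_left_distrib algebra_simps)

lemma act_smult: "act i (smult c q) f = sc c (act i q f)"
  by (induction q) (simp_all add: act_pCons X_sc scale_right_distrib)

lemma act_sum: "act i (sum p F) f = (\<Sum>a\<in>F. act i (p a) f)"
  by (induction F rule: infinite_finite_induct) (simp_all add: act_add)

lemma act_linear_factor: "act i ([:-\<mu>, 1:] * q) f = X i (act i q f) - sc \<mu> (act i q f)"
proof -
  have "[:-\<mu>, 1:] * q = pCons 0 q + smult (-\<mu>) q" by simp
  then show ?thesis by (simp only: act_add act_smult act_pCons) simp
qed

lemma act_arg_add: "act i q (f + g) = act i q f + act i q g"
  by (induction q) (simp_all add: act_pCons X_add scale_right_distrib algebra_simps)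

lemma act_arg_sc: "act i q (sc c f) = sc c (act i q f)"
  by (induction q) (simp_all add: act_pCons X_sc scale_right_distrib scale_left_commute)

lemma act_arg_X: "act i q (X i f) = X i (act i q f)"
  by (induction q) (simp_all add: act_pCons X_sc X_add X_0)

lemma act_arg_0: "act i q 0 = 0"
  by (induction q) (simp_all add: act_pCons X_0)

lemma act_arg_sum: "act i q (sum g F) = (\<Sum>a\<in>F. act i q (g a))"
  by (induction F rule: infinite_finite_induct) (simp_all add: act_arg_add act_arg_0)

lemma act_mem: "stable P \<Longrightarrow> f \<in> P \<Longrightarrow> act i q f \<in> P"
  by (induction q) (auto simp: act_pCons stable_def intro: subspace_0 subspace_add subspace_scale)

lemma stable_E: "stable E"
  using E_sub X_E by (simp add: stable_def)

text \<open>Here the complex numbers are used twice: they are uncountable, which makes the vectors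
  \<open>(X\<^sub>i - \<lambda>)\<^sup>-\<^sup>1 w\<close> linearly dependent, and algebraically closed.\<close>

lemma max_stable_eigenvalue:
  assumes P: "max_stable P" and B: "countable B" "E \<subseteq> span B"
  shows "\<exists>\<mu>. \<forall>f\<in>E. X i f - sc \<mu> f \<in> P"
proof (rule ccontr)
  assume "\<not> ?thesis"
  then have no: "\<exists>f\<in>E. X i f - sc \<mu> f \<notin> P" for \<mu> by auto
  define D where "D \<mu> f = X i f - sc \<mu> f" for \<mu> f
  have D_add: "D \<mu> (f + g) = D \<mu> f + D \<mu> g" for \<mu> f g
    by (simp add: D_def X_add scale_right_distrib algebra_simps)
  have D_sc: "D \<mu> (sc c f) = sc c (D \<mu> f)" for \<mu> c f
    by (simp add: D_def X_sc scale_right_diff_distrib scale_left_commute)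
  have D_X: "D \<mu> (X j f) = X j (D \<mu> f)" for \<mu> j f
    by (simp add: D_def X_diff X_sc X_comm)
  have D_0: "D \<mu> 0 = 0" for \<mu> by (simp add: D_def X_0)
  have st: "stable P" and PE: "P \<noteq> E" and mx: "\<And>Q. stable Q \<Longrightarrow> P \<subseteq> Q \<Longrightarrow> Q = P \<or> Q = E"
    using P by (auto simp: max_stable_def)
  have sP: "subspace P" and PsE: "P \<subseteq> E" and XP: "\<And>j f. f \<in> P \<Longrightarrow> X j f \<in> P"
    using st by (auto simp: stable_def)
  have DP: "D \<mu> f \<in> P" if "f \<in> P" for \<mu> f
    unfolding D_def using that sP XP by (intro subspace_diff subspace_scale)
  have DE: "D \<mu> f \<in> E" if "f \<in> E" for \<mu> f
    unfolding D_def using that E_sub X_E by (intro subspace_diff subspace_scale)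
  \<comment> \<open>Schur's lemma in the simple quotient: the kernel of the map induced by
    \<open>D \<mu>\<close> is a submodule, and it is proper because \<open>D \<mu>\<close> does not
    map all of \<open>E\<close> into \<open>P\<close>; hence it is zero.\<close>
  have inj: "f \<in> P" if "f \<in> E" "D \<mu> f \<in> P" for \<mu> f
  proof -
    define Q where "Q = {f\<in>E. D \<mu> f \<in> P}"
    have "stable Q"
      unfolding stable_def Q_def using sP E_sub XP X_E
      by (auto intro!: subspaceI simp: D_add D_sc D_X D_0 intro: subspace_0 subspace_add subspace_scale)
    moreover have "P \<subseteq> Q" using PsE DP by (auto simp: Q_def)
    moreover have "Q \<noteq> E" using no[of \<mu>] by (auto simp: Q_def D_def)
    ultimately have "Q = P" using mx by auto
    then show ?thesis using that by (auto simp: Q_def)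
  qed
  \<comment> \<open>The other half of Schur's lemma: the image of the induced map is a nonzero
    submodule, hence everything.\<close>
  have surj: "\<exists>g\<in>E. D \<mu> g - w \<in> P" if w: "w \<in> E" for \<mu> w
  proof -
    define Q where "Q = {D \<mu> g + p |g p. g \<in> E \<and> p \<in> P}"
    have "stable Q"
      unfolding stable_def
    proof (intro conjI allI ballI)
      show "subspace Q"
      proof (rule subspaceI)
        show "0 \<in> Q" unfolding Q_def using D_0[of \<mu>] E_sub sP by (force intro: subspace_0)
      next
        fix x y assume "x \<in> Q" "y \<in> Q"
        then obtain g p g' p' where "x = D \<mu> g + p" "y = D \<mu> g' + p'" "g \<in> E" "g' \<in> E" "p \<in> P" "p' \<in> P"
          by (auto simp: Q_def)
        then have "x + y = D \<mu> (g + g') + (p + p')" "g + g' \<in> E" "p + p' \<in> P"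
          using E_sub sP by (auto simp: D_add subspace_add)
        then show "x + y \<in> Q" by (auto simp: Q_def)
      next
        fix c x assume "x \<in> Q"
        then obtain g p where "x = D \<mu> g + p" "g \<in> E" "p \<in> P" by (auto simp: Q_def)
        then have "sc c x = D \<mu> (sc c g) + sc c p" "sc c g \<in> E" "sc c p \<in> P"
          using E_sub sP by (auto simp: D_sc scale_right_distrib subspace_scale)
        then show "sc c x \<in> Q" by (auto simp: Q_def)
      qed
      show "Q \<subseteq> E" using E_sub DE PsE by (auto simp: Q_def intro!: subspace_add)
      fix j x assume "x \<in> Q"
      then obtain g p where "x = D \<mu> g + p" "g \<in> E" "p \<in> P" by (auto simp: Q_def)
      then have "X j x = D \<mu> (X j g) + X j p" "X j g \<in> E" "X j p \<in> P"
        using X_E XP by (auto simp: D_X X_add)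
      then show "X j x \<in> Q" by (auto simp: Q_def)
    qed
    moreover have "P \<subseteq> Q" unfolding Q_def using D_0[of \<mu>] E_sub by (force intro: subspace_0)
    moreover have "Q \<noteq> P"
    proof
      assume "Q = P"
      moreover obtain f where "f \<in> E" "D \<mu> f \<notin> P" using no[of \<mu>] by (auto simp: D_def)
      moreover have "D \<mu> f \<in> Q" unfolding Q_def using \<open>f \<in> E\<close> sP by (force intro: subspace_0)
      ultimately show False by auto
    qed
    ultimately have "Q = E" using mx by auto
    then have "w \<in> Q" using w by simp
    then obtain g p where "w = D \<mu> g + p" "g \<in> E" "p \<in> P" by (auto simp: Q_def)
    then have "D \<mu> g - w = - p" "- p \<in> P" using sP by (auto simp: subspace_neg)
    then show ?thesis using \<open>g \<in> E\<close> by metis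
  qed
  \<comment> \<open>No nonzero polynomial in \<open>X i\<close> annihilates a nonzero class: over
    the complex numbers it splits into linear factors, and each of them acts injectively modulo
    \<open>P\<close>.\<close>
  have kill: "f \<in> P" if "q \<noteq> 0" "f \<in> E" "act i q f \<in> P" for q f
    using that
  proof (induction "degree q" arbitrary: q)
    case 0
    then obtain a where "q = [:a:]" by (metis degree_eq_zeroE)
    then have "a \<noteq> 0" "sc a f \<in> P" using 0 by (auto simp: act_pCons X_0)
    then show ?case using subspace_scale[OF sP, of "sc a f" "inverse a"] by simp
  next
    case (Suc n)
    then have "\<not> constant (poly q)" by (auto simp: constant_degree)
    then obtain \<mu> where "poly q \<mu> = 0" using fundamental_theorem_of_algebra by auto
    then obtain q' where q': "q = [:-\<mu>, 1:] * q'" by (auto simp: poly_eq_0_iff_dvd)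
    then have "q' \<noteq> 0" using Suc.prems by auto
    then have "degree q' = n" using Suc.hyps(2) by (subst (asm) q', subst (asm) degree_mult_eq) auto
    have "D \<mu> (act i q' f) \<in> P" using Suc.prems(3) unfolding q' D_def act_linear_factor .
    then have "act i q' f \<in> P" using inj act_mem[OF stable_E Suc.prems(2)] by auto
    then show ?case using Suc.hyps(1)[OF \<open>degree q' = n\<close>[symmetric] \<open>q' \<noteq> 0\<close>] Suc.prems(2) by auto
  qed
  obtain w where w: "w \<in> E" "w \<notin> P" using PE PsE by auto
  have "\<exists>g. \<forall>\<mu>. g \<mu> \<in> E \<and> D \<mu> (g \<mu>) - w \<in> P" using surj[OF w(1)] by metis
  then obtain g where g: "\<And>\<mu>. g \<mu> \<in> E" "\<And>\<mu>. D \<mu> (g \<mu>) - w \<in> P" by auto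
  \<comment> \<open>If \<open>g \<theta> = g \<mu>\<close>, subtracting the two congruences puts
    \<open>(\<mu> - \<theta>) g \<mu>\<close> into \<open>P\<close>; then \<open>g \<mu>\<close>,
    and with it \<open>w\<close>, would lie in \<open>P\<close>.\<close>
  have "inj g"
  proof (rule injI, rule ccontr)
    fix \<theta> \<mu> assume eq: "g \<theta> = g \<mu>" and ne: "\<theta> \<noteq> \<mu>"
    have "(D \<theta> (g \<theta>) - w) - (D \<mu> (g \<mu>) - w) \<in> P" by (rule subspace_diff[OF sP g(2) g(2)])
    also have "(D \<theta> (g \<theta>) - w) - (D \<mu> (g \<mu>) - w) = sc (\<mu> - \<theta>) (g \<mu>)"
      by (simp add: D_def eq scale_left_diff_distrib)
    finally have "sc (inverse (\<mu> - \<theta>)) (sc (\<mu> - \<theta>) (g \<mu>)) \<in> P" by (rule subspace_scale[OF sP])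
    then have "g \<mu> \<in> P" unfolding scale_scale using ne by simp
    then have "D \<mu> (g \<mu>) - (D \<mu> (g \<mu>) - w) \<in> P" using subspace_diff[OF sP DP g(2)] by blast
    then show False using w by simp
  qed
  have "dependent (range g)"
  proof (rule ccontr)
    assume "independent (range g)"
    then have "countable (range g)"
      using independent_countable_span[OF B(1), of "range g"] B(2) g(1) by blast
    then have "countable (UNIV :: complex set)" using \<open>inj g\<close> by (simp add: countable_image_inj_eq)
    moreover have "range complex_of_real \<subseteq> UNIV" by simp
    ultimately have "countable (range complex_of_real)" using countable_subset by blast
    then have "countable (UNIV :: real set)" by (subst (asm) countable_image_inj_eq) (auto simp: inj_def)
    then show False using uncountable_UNIV_real by simp
  qed
  then obtain S u where S: "finite S" "S \<subseteq> range g" "(\<Sum>v\<in>S. sc (u v) v) = 0" "\<exists>v\<in>S. u v \<noteq> 0"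
    unfolding dependent_explicit by auto
  define F where "F = g -` S"
  have F: "finite F" "S = g ` F"
    using S(1,2) \<open>inj g\<close> by (auto simp: F_def intro: finite_vimageI)
  define c where "c = u \<circ> g"
  have c0: "(\<Sum>\<mu>\<in>F. sc (c \<mu>) (g \<mu>)) = 0"
    using S(3) \<open>inj g\<close> unfolding F(2) c_def by (subst (asm) sum.reindex) (auto intro: inj_on_subset)
  obtain \<nu> where \<nu>: "\<nu> \<in> F" "c \<nu> \<noteq> 0" using S(4) F(2) by (auto simp: c_def)
  \<comment> \<open>Clearing denominators: formally \<open>g \<mu>\<close> is \<open>w\<close>
    divided by \<open>X i - \<mu>\<close>, so multiplying the linear relation by the product of all
    \<open>X i - \<theta>\<close> turns it into \<open>q(X i) w = 0\<close> modulo \<open>P\<close>.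
    The value of \<open>q\<close> at \<open>\<nu>\<close> is \<open>c \<nu>\<close> times a product
    of nonzero differences, hence \<open>q \<noteq> 0\<close>.\<close>
  define R where "R \<mu> = (\<Prod>\<theta>\<in>F - {\<mu>}. [:-\<theta>, 1:])" for \<mu> :: complex
  define q where "q = (\<Sum>\<mu>\<in>F. smult (c \<mu>) (R \<mu>))"
  have "poly q \<nu> = (\<Sum>\<mu>\<in>F. c \<mu> * poly (R \<mu>) \<nu>)" by (simp add: q_def poly_sum)
  also have "\<dots> = (\<Sum>\<mu>\<in>F. if \<mu> = \<nu> then c \<nu> * poly (R \<nu>) \<nu> else 0)"
    using F(1) \<nu> by (intro sum.cong) (auto simp: R_def poly_prod)
  also have "\<dots> = c \<nu> * poly (R \<nu>) \<nu>" using F(1) \<nu> by simp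
  finally have "poly q \<nu> \<noteq> 0" using \<nu> F(1) by (auto simp: R_def poly_prod)
  then have "q \<noteq> 0" by auto
  have full: "act i (\<Prod>\<theta>\<in>F. [:-\<theta>, 1:]) (g \<mu>) = act i (R \<mu>) (D \<mu> (g \<mu>))" if "\<mu> \<in> F" for \<mu>
  proof -
    have "(\<Prod>\<theta>\<in>F. [:-\<theta>, 1:]) = [:-\<mu>, 1:] * R \<mu>" using F(1) that by (simp add: R_def prod.remove)
    then have "act i (\<Prod>\<theta>\<in>F. [:-\<theta>, 1:]) (g \<mu>) = X i (act i (R \<mu>) (g \<mu>)) - sc \<mu> (act i (R \<mu>) (g \<mu>))"
      by (simp only: act_linear_factor)
    also have "\<dots> = act i (R \<mu>) (D \<mu> (g \<mu>))"
      using act_arg_add[of i "R \<mu>" "D \<mu> (g \<mu>)" "sc \<mu> (g \<mu>)"]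
      by (simp add: D_def act_arg_X act_arg_sc)
    finally show ?thesis .
  qed
  have "0 = act i (\<Prod>\<theta>\<in>F. [:-\<theta>, 1:]) (\<Sum>\<mu>\<in>F. sc (c \<mu>) (g \<mu>))" by (simp add: c0 act_arg_0)
  also have "\<dots> = (\<Sum>\<mu>\<in>F. sc (c \<mu>) (act i (R \<mu>) (D \<mu> (g \<mu>))))"
    by (simp add: act_arg_sum act_arg_sc full)
  also have "\<dots> = (\<Sum>\<mu>\<in>F. sc (c \<mu>) (act i (R \<mu>) w) + sc (c \<mu>) (act i (R \<mu>) (D \<mu> (g \<mu>) - w)))"
  proof (intro sum.cong refl)
    fix \<mu>
    show "sc (c \<mu>) (act i (R \<mu>) (D \<mu> (g \<mu>))) =
      sc (c \<mu>) (act i (R \<mu>) w) + sc (c \<mu>) (act i (R \<mu>) (D \<mu> (g \<mu>) - w))"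
      using act_arg_add[of i "R \<mu>" w "D \<mu> (g \<mu>) - w"] by (simp add: scale_right_distrib)
  qed
  also have "\<dots> = act i q w + (\<Sum>\<mu>\<in>F. sc (c \<mu>) (act i (R \<mu>) (D \<mu> (g \<mu>) - w)))"
    by (simp add: sum.distrib q_def act_sum act_smult)
  finally have "act i q w = - (\<Sum>\<mu>\<in>F. sc (c \<mu>) (act i (R \<mu>) (D \<mu> (g \<mu>) - w)))"
    by (simp add: eq_neg_iff_add_eq_0)
  also have "\<dots> \<in> P"
    using g(2) sP by (intro subspace_neg subspace_sum subspace_scale act_mem[OF st])
  finally show False using kill[OF \<open>q \<noteq> 0\<close> w(1)] w(2) by auto
qed

end


section \<open>The module generated by the rows of the symbol\<close>

text \<open>Vectors of polynomials in the variables \<open>x\<^sub>i\<close> with entries indexed by a basis of \<open>V\<close> are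
  represented by their finitely supported coefficient families \<open>(\<beta>, b) \<mapsto> f (\<beta>, b)\<close>.\<close>

type_synonym ('n, 'v) coeffs = "('n \<Rightarrow> nat) \<times> 'v \<Rightarrow> complex"

definition cscal :: "complex \<Rightarrow> ('n, 'v) coeffs \<Rightarrow> ('n, 'v) coeffs" where
  "cscal c f = (\<lambda>p. c * f p)"

text \<open>Multiplication by the variable \<open>x_i\<close>, read off on coefficients.\<close>

definition shift :: "'n \<Rightarrow> ('n, 'v) coeffs \<Rightarrow> ('n, 'v) coeffs" where
  "shift i f = (\<lambda>(\<beta>, b). if \<beta> i = 0 then 0 else f (\<beta>(i := \<beta> i - 1), b))"

definition monom_vec :: "('n \<Rightarrow> nat) \<Rightarrow> 'v \<Rightarrow> ('n, 'v) coeffs" where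
  "monom_vec \<beta> b = (\<lambda>p. if p = (\<beta>, b) then 1 else 0)"

definition poly_vecs :: "('n, 'v::euclidean_space) coeffs set" where
  "poly_vecs = {f. finite {p. f p \<noteq> 0} \<and> (\<forall>p. f p \<noteq> 0 \<longrightarrow> snd p \<in> Basis)}"

text \<open>The vector of polynomials with entries \<open>A[x] b \<bullet> w\<close>, that is, the
  linear combination of rows of the symbol selected by \<open>w\<close>.\<close>

definition symbol_row ::
  "nat \<Rightarrow> (('n::finite \<Rightarrow> nat) \<Rightarrow> 'v::euclidean_space \<Rightarrow> 'w::euclidean_space) \<Rightarrow> 'w \<Rightarrow> ('n, 'v) coeffs" where
  "symbol_row k A w = (\<lambda>(\<beta>, b). if mi_abs \<beta> = k \<and> b \<in> Basis then of_real (A \<beta> b \<bullet> w) else 0)"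

text \<open>The submodule generated by the rows. Its induction rule is what later transports the
  grading, and the vanishing on a distribution of the kernel, from the rows to the whole
  module.\<close>

inductive_set row_module ::
  "nat \<Rightarrow> (('n::finite \<Rightarrow> nat) \<Rightarrow> 'v::euclidean_space \<Rightarrow> 'w::euclidean_space) \<Rightarrow> ('n, 'v) coeffs set"
  for k :: nat and A :: "('n \<Rightarrow> nat) \<Rightarrow> 'v \<Rightarrow> 'w" where
  row: "symbol_row k A w \<in> row_module k A"
| zero: "0 \<in> row_module k A"
| add: "f \<in> row_module k A \<Longrightarrow> g \<in> row_module k A \<Longrightarrow> f + g \<in> row_module k A"
| scal: "f \<in> row_module k A \<Longrightarrow> cscal c f \<in> row_module k A"
| shift: "f \<in> row_module k A \<Longrightarrow> shift i f \<in> row_module k A"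

interpretation cv: vector_space "cscal :: complex \<Rightarrow> ('n, 'v) coeffs \<Rightarrow> ('n, 'v) coeffs"
  by unfold_locales (auto simp: cscal_def fun_eq_iff algebra_simps)

lemma shift_monom_vec: "shift i (monom_vec \<beta> b) = monom_vec (\<beta>(i := Suc (\<beta> i))) b"
proof
  fix p :: "('a \<Rightarrow> nat) \<times> 'b"
  obtain \<gamma> c where p: "p = (\<gamma>, c)" by fastforce
  have "\<gamma> i \<noteq> 0 \<and> \<gamma>(i := \<gamma> i - 1) = \<beta> \<longleftrightarrow> \<gamma> = \<beta>(i := Suc (\<beta> i))" by (auto simp: fun_eq_iff)
  then show "shift i (monom_vec \<beta> b) p = monom_vec (\<beta>(i := Suc (\<beta> i))) b p"
    by (auto simp: shift_def monom_vec_def p)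
qed

lemma shift_commute: "shift i (shift j f) = shift j (shift i f)"
proof (cases "i = j")
  case False
  have "shift i (shift j f) (\<beta>, b) = shift j (shift i f) (\<beta>, b)" for \<beta> b
    using False by (auto simp: shift_def fun_upd_twist[OF False])
  then show ?thesis by auto
qed simp

lemma poly_vecs_subspace: "cv.subspace (poly_vecs :: ('n, 'v::euclidean_space) coeffs set)"
proof (rule cv.subspaceI)
  fix f g :: "('n, 'v) coeffs" and c
  assume f: "f \<in> poly_vecs"
  show "cscal c f \<in> poly_vecs"
    using f by (auto simp: poly_vecs_def cscal_def elim: finite_subset[rotated])
  assume g: "g \<in> poly_vecs"
  have "{p. (f + g) p \<noteq> 0} \<subseteq> {p. f p \<noteq> 0} \<union> {p. g p \<noteq> 0}" by auto
  then have "finite {p. (f + g) p \<noteq> 0}" using f g finite_subset by (fastforce simp: poly_vecs_def)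
  moreover have "\<forall>p. (f + g) p \<noteq> 0 \<longrightarrow> snd p \<in> Basis"
  proof (intro allI impI)
    fix p assume "(f + g) p \<noteq> 0"
    then have "f p \<noteq> 0 \<or> g p \<noteq> 0" by auto
    then show "snd p \<in> Basis" using f g unfolding poly_vecs_def by blast
  qed
  ultimately show "f + g \<in> poly_vecs" by (simp add: poly_vecs_def)
qed (simp add: poly_vecs_def)

lemma shift_poly_vecs: "f \<in> poly_vecs \<Longrightarrow> shift i f \<in> poly_vecs"
proof -
  assume f: "f \<in> poly_vecs"
  have "{p. shift i f p \<noteq> 0} \<subseteq> (\<lambda>(\<beta>, b). (\<beta>(i := Suc (\<beta> i)), b)) ` {p. f p \<noteq> 0}"
  proof
    fix p assume p: "p \<in> {p. shift i f p \<noteq> 0}"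
    obtain \<beta> b where pb: "p = (\<beta>, b)" by fastforce
    have "\<beta> i \<noteq> 0" "f (\<beta>(i := \<beta> i - 1), b) \<noteq> 0"
      using p by (auto simp: shift_def pb split: if_splits)
    moreover have "p = (\<lambda>(\<beta>, b). (\<beta>(i := Suc (\<beta> i)), b)) (\<beta>(i := \<beta> i - 1), b)"
      using \<open>\<beta> i \<noteq> 0\<close> by (simp add: pb)
    ultimately show "p \<in> (\<lambda>(\<beta>, b). (\<beta>(i := Suc (\<beta> i)), b)) ` {p. f p \<noteq> 0}" by blast
  qed
  then have "finite {p. shift i f p \<noteq> 0}" using f finite_surj by (fastforce simp: poly_vecs_def)
  moreover have "snd p \<in> Basis" if "shift i f p \<noteq> 0" for p
    using f that by (auto simp: poly_vecs_def shift_def split: prod.splits if_splits)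
  ultimately show ?thesis by (auto simp: poly_vecs_def)
qed

lemma monom_vec_poly_vecs: "b \<in> Basis \<Longrightarrow> monom_vec \<beta> b \<in> poly_vecs"
proof -
  assume "b \<in> Basis"
  have "{p. monom_vec \<beta> b p \<noteq> 0} \<subseteq> {(\<beta>, b)}" by (auto simp: monom_vec_def)
  then have "finite {p. monom_vec \<beta> b p \<noteq> 0}" using finite_subset by blast
  then show ?thesis using \<open>b \<in> Basis\<close> by (auto simp: poly_vecs_def monom_vec_def)
qed

lemma symbol_row_poly_vecs: "symbol_row k A w \<in> poly_vecs"
proof -
  have "{p. symbol_row k A w p \<noteq> 0} \<subseteq> {\<beta>. mi_abs \<beta> = k} \<times> Basis"
    by (auto simp: symbol_row_def split: if_splits)
  then have "finite {p. symbol_row k A w p \<noteq> 0}"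
    using finite_subset finite_mi_abs_eq by (metis finite_Basis finite_SigmaI)
  then show ?thesis by (auto simp: poly_vecs_def symbol_row_def split: if_splits)
qed

lemma row_module_poly_vecs: "f \<in> row_module k A \<Longrightarrow> f \<in> poly_vecs"
proof (induction rule: row_module.induct)
  case (row w) then show ?case by (rule symbol_row_poly_vecs)
next
  case zero then show ?case using cv.subspace_0[OF poly_vecs_subspace] .
next
  case (add f g) then show ?case using cv.subspace_add[OF poly_vecs_subspace] by blast
next
  case (scal f c) then show ?case using cv.subspace_scale[OF poly_vecs_subspace] by blast
next
  case (shift f i) show ?case by (rule shift_poly_vecs[OF shift.IH])
qed

lemma sum_fun_apply: "(\<Sum>a\<in>S. F a) x = (\<Sum>a\<in>S. F a x)"
  by (induction S rule: infinite_finite_induct) simp_all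

lemma poly_vecs_expansion:
  assumes "f \<in> poly_vecs"
  shows "f = (\<Sum>p\<in>{p. f p \<noteq> 0}. cscal (f p) (monom_vec (fst p) (snd p)))"
proof
  fix q
  have fin: "finite {p. f p \<noteq> 0}" using assms by (simp add: poly_vecs_def)
  have "(\<Sum>p\<in>{p. f p \<noteq> 0}. cscal (f p) (monom_vec (fst p) (snd p))) q =
    (\<Sum>p\<in>{p. f p \<noteq> 0}. if q = p then f p else 0)"
    unfolding sum_fun_apply using fin
    by (induction rule: finite_induct) (auto simp: cscal_def monom_vec_def)
  also have "\<dots> = f q" using fin by (simp add: sum.delta')
  finally show "f q = (\<Sum>p\<in>{p. f p \<noteq> 0}. cscal (f p) (monom_vec (fst p) (snd p))) q" ..
qed

interpretation co: commuting_operators "cscal :: complex \<Rightarrow> ('n, 'v::euclidean_space) coeffs \<Rightarrow> _"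
  shift poly_vecs
  by unfold_locales (auto simp: shift_commute poly_vecs_subspace shift_poly_vecs,
      auto simp: shift_def cscal_def fun_eq_iff)

lemma mi_abs_eq_0_iff: "mi_abs \<beta> = 0 \<longleftrightarrow> (\<forall>i. \<beta> i = 0)"
  by (simp add: mi_abs_def)

lemma monom_vec_stable:
  fixes P :: "('n::finite, 'v::euclidean_space) coeffs set"
  assumes "co.stable P" "monom_vec 0 b \<in> P"
  shows "monom_vec \<beta> b \<in> P"
proof (induction "\<Sum>i\<in>UNIV. \<beta> i" arbitrary: \<beta>)
  case 0
  then have "\<beta> = 0" by (auto simp: fun_eq_iff)
  with assms(2) show ?case by (simp only:)
next
  case (Suc m)
  then have "mi_abs \<beta> \<noteq> 0" unfolding mi_abs_def by linarith
  then obtain i where i: "\<beta> i \<noteq> 0" unfolding mi_abs_eq_0_iff by blast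
  have "(\<Sum>j\<in>UNIV. \<beta> j) = \<beta> i + (\<Sum>j\<in>UNIV - {i}. (\<beta>(i := \<beta> i - 1)) j)"
    by (subst sum.remove[of _ i]) auto
  moreover have "(\<Sum>j\<in>UNIV. (\<beta>(i := \<beta> i - 1)) j) = \<beta> i - 1 + (\<Sum>j\<in>UNIV - {i}. (\<beta>(i := \<beta> i - 1)) j)"
    by (subst sum.remove[of _ i]) auto
  ultimately have "m = (\<Sum>j\<in>UNIV. (\<beta>(i := \<beta> i - 1)) j)" using Suc.hyps(2) i by linarith
  then have "monom_vec (\<beta>(i := \<beta> i - 1)) b \<in> P" by (rule Suc.hyps(1))
  then have "shift i (monom_vec (\<beta>(i := \<beta> i - 1)) b) \<in> P" using assms(1) by (auto simp: co.stable_def)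
  then show ?case using i by (simp add: shift_monom_vec)
qed

text \<open>The constant basis vectors generate the module. This is the finite generation required
  for maximal submodules to exist, and it guarantees that a proper submodule misses one of these
  vectors.\<close>

lemma stable_eq_poly_vecs:
  fixes P :: "('n::finite, 'v::euclidean_space) coeffs set"
  assumes "co.stable P" "monom_vec 0 ` Basis \<subseteq> P"
  shows "P = poly_vecs"
proof
  show "P \<subseteq> poly_vecs" using assms(1) by (simp add: co.stable_def)
  show "poly_vecs \<subseteq> P"
  proof
    fix f :: "('n, 'v) coeffs" assume f: "f \<in> poly_vecs"
    have "cv.subspace P" using assms(1) by (simp add: co.stable_def)
    moreover have "monom_vec \<beta> b \<in> P" if "b \<in> Basis" for \<beta> b
      using assms that by (rule_tac monom_vec_stable[OF assms(1)]) auto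
    ultimately have "(\<Sum>p\<in>{p. f p \<noteq> 0}. cscal (f p) (monom_vec (fst p) (snd p))) \<in> P"
      using f by (intro cv.subspace_sum[of P] cv.subspace_scale[of P]) (auto simp: poly_vecs_def)
    then show "f \<in> P" by (subst poly_vecs_expansion[OF f])
  qed
qed

section \<open>The grading by total degree\<close>

definition grade :: "nat \<Rightarrow> ('n::finite, 'v) coeffs \<Rightarrow> ('n, 'v) coeffs" where
  "grade d f = (\<lambda>(\<beta>, b). if mi_abs \<beta> = d then f (\<beta>, b) else 0)"

lemma mi_abs_upd_Suc: "mi_abs (\<beta>(i := Suc (\<beta> i))) = Suc (mi_abs \<beta>)"
proof -
  have "mi_abs (\<beta>(i := Suc (\<beta> i))) = Suc (\<beta> i) + (\<Sum>j\<in>UNIV - {i}. \<beta> j)"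
    unfolding mi_abs_def by (subst sum.remove[of _ i]) auto
  also have "\<dots> = Suc (mi_abs \<beta>)"
    unfolding mi_abs_def by (subst (2) sum.remove[of _ i]) auto
  finally show ?thesis .
qed

lemma mi_abs_upd_pred: "\<beta> i \<noteq> 0 \<Longrightarrow> Suc (mi_abs (\<beta>(i := \<beta> i - 1))) = mi_abs \<beta>"
  using mi_abs_upd_Suc[of "\<beta>(i := \<beta> i - 1)" i] by (simp add: fun_upd_idem)

lemma grade_shift: "grade (Suc d) (shift i f) = shift i (grade d f)" "grade 0 (shift i f) = 0"
  using mi_abs_upd_pred[of _ i] mi_abs_upd_pred[of _ i, symmetric]
  by (auto simp: grade_def shift_def fun_eq_iff)

lemma grade_add: "grade d (f + g) = grade d f + grade d g"
  and grade_diff: "grade d (f - g) = grade d f - grade d g"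
  and grade_0: "grade d 0 = 0"
  and grade_cscal: "grade d (cscal c f) = cscal c (grade d f)"
  by (auto simp: grade_def cscal_def fun_eq_iff)

text \<open>All rows are homogeneous of the same degree \<open>k\<close>, and \<open>shift\<close>
  raises the degree by one, so the generated module is graded.\<close>

lemma grade_row_module: "f \<in> row_module k A \<Longrightarrow> grade d f \<in> row_module k A"
proof (induction arbitrary: d rule: row_module.induct)
  case (row w)
  have "grade d (symbol_row k A w) = (if d = k then symbol_row k A w else 0)"
    by (auto simp: grade_def symbol_row_def fun_eq_iff)
  then show ?case by (auto intro: row_module.intros)
next
  case zero
  show ?case unfolding grade_0 by (rule row_module.zero)
next
  case (add f g)
  then show ?case unfolding grade_add by (intro row_module.add)
next
  case (scal f c)
  then show ?case unfolding grade_cscal by (intro row_module.scal)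
next
  case (shift f i)
  show ?case
  proof (cases d)
    case 0
    then show ?thesis by (simp only: grade_shift row_module.zero)
  next
    case (Suc e)
    then show ?thesis by (simp only: grade_shift row_module.shift shift.IH)
  qed
qed

lemma grade_eventually_0:
  assumes "f \<in> poly_vecs"
  shows "\<exists>N. \<forall>d\<ge>N. grade d f = 0"
proof -
  have "finite ((\<lambda>p. mi_abs (fst p)) ` {p. f p \<noteq> 0})" using assms by (simp add: poly_vecs_def)
  then obtain N where "\<And>d. d \<in> (\<lambda>p. mi_abs (fst p)) ` {p. f p \<noteq> 0} \<Longrightarrow> d < N"
    using finite_nat_set_iff_bounded by metis
  then have "\<forall>d\<ge>N. grade d f = 0" by (force simp: grade_def fun_eq_iff)
  then show ?thesis ..
qed

text \<open>Dehomogenising at \<open>x\<^sub>i = 1\<close>: if no \<open>x\<^sub>i\<^sup>m b\<close> lies in the graded module, then \<open>b\<close> does not lie in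
  the module obtained by adding all multiples of \<open>x\<^sub>i - 1\<close>.\<close>

lemma dehomogenise:
  assumes u: "u \<in> row_module k A" and f: "f \<in> poly_vecs"
    and eq: "monom_vec 0 b = u + (shift i f - f)"
  shows "\<exists>m. (shift i ^^ m) (monom_vec 0 b) \<in> row_module k A"
proof -
  let ?U = "row_module k A"
  \<comment> \<open>In degree \<open>d + 1\<close> the equation reads
    \<open>f_(d+1) = u_(d+1) + x_i f_d\<close>, so the membership propagates from each degree to the
    next. Beyond the degree of \<open>f\<close> only the power of \<open>x_i\<close> is
    left.\<close>
  have "grade d f + (shift i ^^ d) (monom_vec 0 b) \<in> ?U" for d
  proof (induction d)
    case 0
    have "grade 0 (monom_vec 0 b :: ('a, 'b) coeffs) = monom_vec 0 b"
      by (auto simp: grade_def monom_vec_def mi_abs_def fun_eq_iff)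
    then have "monom_vec 0 b = grade 0 u - grade 0 f"
      using arg_cong[OF eq, of "grade 0"] by (simp add: grade_add grade_diff grade_shift)
    then have "grade 0 f + (shift i ^^ 0) (monom_vec 0 b) = grade 0 u" by simp
    then show ?case using grade_row_module[OF u, of 0] by (simp only:)
  next
    case (Suc d)
    have "grade (Suc d) (monom_vec 0 b :: ('a, 'b) coeffs) = 0"
    proof
      show "grade (Suc d) (monom_vec 0 b :: ('a, 'b) coeffs) p = 0 p" for p
        by (cases p) (auto simp: grade_def monom_vec_def mi_abs_def)
    qed
    then have "grade (Suc d) f = grade (Suc d) u + shift i (grade d f)"
      using arg_cong[OF eq, of "grade (Suc d)"] by (simp add: grade_add grade_diff grade_shift algebra_simps)
    then have "grade (Suc d) f + (shift i ^^ Suc d) (monom_vec 0 b) =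
      grade (Suc d) u + shift i (grade d f + (shift i ^^ d) (monom_vec 0 b))"
      by (simp add: co.X_add)
    also have "\<dots> \<in> ?U" by (rule row_module.add[OF grade_row_module[OF u] row_module.shift[OF Suc]])
    finally show ?case .
  qed
  moreover obtain N where "\<forall>d\<ge>N. grade d f = 0" using grade_eventually_0[OF f] by auto
  ultimately show ?thesis by (metis add_0 order_refl)
qed

text \<open>A Nullstellensatz for modules. If the claim fails, a maximal submodule containing the
  rows and all multiples of \<open>x_i - 1\<close> turns out to be the kernel of an evaluation:
  modulo it, \<open>x^\<beta> b\<close> equals \<open>\<xi>^\<beta> a_b\<close> times one fixed
  constant vector. That the rows lie in it says exactly that the symbol at \<open>\<xi>\<close>
  annihilates the vector with entries \<open>a_b\<close>.\<close>

theorem row_module_contains_powers: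
  fixes A :: "('n::finite \<Rightarrow> nat) \<Rightarrow> 'v::euclidean_space \<Rightarrow> 'w::euclidean_space"
  assumes A: "diff_operator k A" "C_elliptic k A" and b0: "b0 \<in> Basis"
  shows "\<exists>m. (shift i ^^ m) (monom_vec 0 b0) \<in> row_module k A"
proof (rule ccontr)
  assume no: "\<not> ?thesis"
  let ?U = "row_module k A" and ?E = "poly_vecs :: ('n, 'v) coeffs set"
  let ?e = "monom_vec 0 :: 'v \<Rightarrow> ('n, 'v) coeffs"
  have sE: "cv.subspace ?E" by (rule poly_vecs_subspace)
  \<comment> \<open>The rows together with all multiples of \<open>x_i - 1\<close>; the latter force
    \<open>\<xi> i = 1\<close> and so keep the point to be found away from 0.\<close>
  define P0 where "P0 = {u + (shift i f - f) |u f. u \<in> ?U \<and> f \<in> ?E}"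
  have "co.stable P0"
    unfolding co.stable_def
  proof (intro conjI allI ballI)
    show "cv.subspace P0"
    proof (rule cv.subspaceI)
      have "0 = 0 + (shift i 0 - 0 :: ('n, 'v) coeffs)" by (simp add: co.X_0)
      then show "0 \<in> P0" unfolding P0_def using row_module.zero cv.subspace_0[OF sE] by blast
    next
      fix x y assume "x \<in> P0" "y \<in> P0"
      then obtain u f u' f' where "x = u + (shift i f - f)" "y = u' + (shift i f' - f')"
        "u \<in> ?U" "u' \<in> ?U" "f \<in> ?E" "f' \<in> ?E" by (auto simp: P0_def)
      then have "x + y = (u + u') + (shift i (f + f') - (f + f'))" "u + u' \<in> ?U" "f + f' \<in> ?E"
        using cv.subspace_add[OF sE] by (simp_all only: co.X_add row_module.add) simp_all
      then show "x + y \<in> P0" unfolding P0_def by blast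
    next
      fix c x assume "x \<in> P0"
      then obtain u f where "x = u + (shift i f - f)" "u \<in> ?U" "f \<in> ?E" by (auto simp: P0_def)
      then have "cscal c x = cscal c u + (shift i (cscal c f) - cscal c f)"
        "cscal c u \<in> ?U" "cscal c f \<in> ?E"
        using cv.subspace_scale[OF sE]
        by (simp_all only: co.X_sc cv.scale_right_distrib cv.scale_right_diff_distrib row_module.scal simp_thms)
      then show "cscal c x \<in> P0" unfolding P0_def by blast
    qed
    show "P0 \<subseteq> ?E"
    proof
      fix x assume "x \<in> P0"
      then obtain u f where x: "x = u + (shift i f - f)" "u \<in> ?U" "f \<in> ?E" by (auto simp: P0_def)
      show "x \<in> ?E"
        unfolding x(1) using x(2,3)
        using row_module_poly_vecs[of u k A]
        by (intro cv.subspace_add[OF sE] cv.subspace_diff[OF sE] shift_poly_vecs)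
    qed
    fix j x assume "x \<in> P0"
    then obtain u f where "x = u + (shift i f - f)" "u \<in> ?U" "f \<in> ?E" by (auto simp: P0_def)
    then have "shift j x = shift j u + (shift i (shift j f) - shift j f)"
      "shift j u \<in> ?U" "shift j f \<in> ?E"
      by (auto simp only: co.X_add co.X_diff shift_commute[of j i] intro: row_module.shift shift_poly_vecs)
    then show "shift j x \<in> P0" unfolding P0_def by blast
  qed
  moreover have "P0 \<noteq> ?E"
  proof
    assume "P0 = ?E"
    then have "?e b0 \<in> P0" using b0 monom_vec_poly_vecs by auto
    then obtain u f where "?e b0 = u + (shift i f - f)" "u \<in> ?U" "f \<in> ?E" by (auto simp: P0_def)
    then show False using dehomogenise no by metis
  qed
  moreover have "?e ` Basis \<subseteq> ?E" using monom_vec_poly_vecs by auto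
  ultimately obtain P where P: "co.max_stable P" "P0 \<subseteq> P"
    using co.ex_max_stable[of "?e ` Basis" P0] stable_eq_poly_vecs by auto
  have st: "co.stable P" and sP: "cv.subspace P" and PE: "P \<noteq> ?E"
    using P(1) by (auto simp: co.max_stable_def co.stable_def)
  have UP: "?U \<subseteq> P"
  proof
    fix u assume "u \<in> ?U"
    then have "u + (shift i 0 - 0) \<in> P0"
      unfolding P0_def using cv.subspace_0[OF sE] by blast
    then show "u \<in> P" using P(2) by (auto simp: co.X_0)
  qed
  define B where "B = (\<lambda>p. monom_vec (fst p) (snd p)) ` ((UNIV :: ('n \<Rightarrow> nat) set) \<times> (Basis :: 'v set))"
  have "countable B"
    unfolding B_def by (intro countable_image countable_SIGMA) (auto intro: countable_finite)
  moreover have "?E \<subseteq> cv.span B"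
  proof
    fix f assume f: "f \<in> ?E"
    have "(\<Sum>p\<in>{p. f p \<noteq> 0}. cscal (f p) (monom_vec (fst p) (snd p))) \<in> cv.span B"
      using f by (intro cv.span_sum cv.span_scale cv.span_base) (auto simp: poly_vecs_def B_def)
    then show "f \<in> cv.span B" by (subst poly_vecs_expansion[OF f])
  qed
  ultimately have "\<forall>j. \<exists>\<mu>. \<forall>f\<in>?E. shift j f - cscal \<mu> f \<in> P"
    using co.max_stable_eigenvalue[OF P(1)] by blast
  then obtain \<xi> where \<xi>: "\<And>j f. f \<in> ?E \<Longrightarrow> shift j f - cscal (\<xi> j) f \<in> P" by metis
  have P_E: "P \<subseteq> ?E" using st by (simp add: co.stable_def)
  \<comment> \<open>A proper submodule cannot contain all constant basis vectors. The class of this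
    one will span the quotient.\<close>
  obtain b1 where b1: "b1 \<in> Basis" "?e b1 \<notin> P"
    using stable_eq_poly_vecs[OF st] PE by auto
  \<comment> \<open>Both \<open>(x_i - 1) b1\<close> and \<open>(x_i - \<xi> i) b1\<close> lie in
    \<open>P\<close>, whereas \<open>b1\<close> does not.\<close>
  have \<xi>i: "\<xi> i = 1"
  proof (rule ccontr)
    assume ne: "\<xi> i \<noteq> 1"
    have eE: "?e b1 \<in> ?E" using b1 monom_vec_poly_vecs by auto
    have "0 + (shift i (?e b1) - ?e b1) \<in> P0" unfolding P0_def using row_module.zero eE by blast
    then have "shift i (?e b1) - ?e b1 \<in> P" using P(2) by auto
    then have "(shift i (?e b1) - ?e b1) - (shift i (?e b1) - cscal (\<xi> i) (?e b1)) \<in> P"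
      using \<xi>[OF eE] cv.subspace_diff[OF sP] by blast
    moreover have "(shift i (?e b1) - ?e b1) - (shift i (?e b1) - cscal (\<xi> i) (?e b1)) =
      cscal (\<xi> i - 1) (?e b1)"
      by (simp add: cv.scale_left_diff_distrib)
    ultimately have "cscal (inverse (\<xi> i - 1)) (cscal (\<xi> i - 1) (?e b1)) \<in> P"
      using cv.subspace_scale[OF sP] by metis
    then show False using ne b1 by simp
  qed
  \<comment> \<open>Each variable acts as its scalar modulo \<open>P\<close>, so a monomial acts as
    its value at \<open>\<xi>\<close>.\<close>
  have ev: "monom_vec \<beta> b - cscal (\<Prod>j\<in>UNIV. \<xi> j ^ \<beta> j) (?e b) \<in> P" if b: "b \<in> Basis" for \<beta> b
  proof (induction "mi_abs \<beta>" arbitrary: \<beta>)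
    case 0
    then have "\<beta> = 0" by (auto simp: mi_abs_def fun_eq_iff)
    then have "monom_vec \<beta> b - cscal (\<Prod>j\<in>UNIV. \<xi> j ^ \<beta> j) (?e b) = 0" by simp
    then show ?case using cv.subspace_0[OF sP] by (simp only:)
  next
    case (Suc m)
    then have "mi_abs \<beta> \<noteq> 0" by linarith
    then obtain j where j: "\<beta> j \<noteq> 0" unfolding mi_abs_eq_0_iff by blast
    define \<gamma> where "\<gamma> = \<beta>(j := \<beta> j - 1)"
    have "m = mi_abs \<gamma>" using mi_abs_upd_pred[of \<beta> j] j Suc.hyps(2) by (simp add: \<gamma>_def)
    then have "monom_vec \<gamma> b - cscal (\<Prod>j\<in>UNIV. \<xi> j ^ \<gamma> j) (?e b) \<in> P" by (rule Suc.hyps(1))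
    then have "cscal (\<xi> j) (monom_vec \<gamma> b - cscal (\<Prod>j\<in>UNIV. \<xi> j ^ \<gamma> j) (?e b)) \<in> P"
      using cv.subspace_scale[OF sP] by blast
    moreover have "shift j (monom_vec \<gamma> b) - cscal (\<xi> j) (monom_vec \<gamma> b) \<in> P"
      using \<xi> monom_vec_poly_vecs b by blast
    ultimately have "shift j (monom_vec \<gamma> b) - cscal (\<xi> j) (monom_vec \<gamma> b) +
      cscal (\<xi> j) (monom_vec \<gamma> b - cscal (\<Prod>j\<in>UNIV. \<xi> j ^ \<gamma> j) (?e b)) \<in> P"
      using cv.subspace_add[OF sP] by blast
    moreover have "shift j (monom_vec \<gamma> b) = monom_vec \<beta> b"
      using j by (simp add: \<gamma>_def shift_monom_vec)
    moreover have "\<xi> j * (\<Prod>j\<in>UNIV. \<xi> j ^ \<gamma> j) = (\<Prod>j\<in>UNIV. \<xi> j ^ \<beta> j)"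
    proof -
      have "(\<Prod>l\<in>UNIV. \<xi> l ^ \<gamma> l) = \<xi> j ^ (\<beta> j - 1) * (\<Prod>l\<in>UNIV - {j}. \<xi> l ^ \<beta> l)"
        by (subst prod.remove[of _ j]) (auto simp: \<gamma>_def)
      moreover have "(\<Prod>l\<in>UNIV. \<xi> l ^ \<beta> l) = \<xi> j ^ \<beta> j * (\<Prod>l\<in>UNIV - {j}. \<xi> l ^ \<beta> l)"
        by (subst prod.remove[of _ j]) auto
      moreover have "\<xi> j * \<xi> j ^ (\<beta> j - 1) = \<xi> j ^ \<beta> j" using j by (simp add: power_eq_if)
      ultimately show ?thesis by (simp add: mult.assoc[symmetric])
    qed
    ultimately show ?case by (simp add: cv.scale_right_diff_distrib)
  qed
  \<comment> \<open>The quotient is one-dimensional: since the variables act as scalars,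
    \<open>P\<close> together with the line through \<open>b1\<close> is already stable, and by
    maximality it is everything.\<close>
  have "\<exists>a. ?e b - cscal a (?e b1) \<in> P" if b: "b \<in> Basis" for b
  proof -
    define Q where "Q = {p + cscal a (?e b1) |p a. p \<in> P}"
    have e1E: "?e b1 \<in> ?E" using b1 monom_vec_poly_vecs by auto
    have "co.stable Q"
      unfolding co.stable_def
    proof (intro conjI allI ballI)
      show "cv.subspace Q"
      proof (rule cv.subspaceI)
        have "0 = 0 + cscal 0 (?e b1)" by simp
        then show "0 \<in> Q" unfolding Q_def using cv.subspace_0[OF sP] by blast
      next
        fix x y assume "x \<in> Q" "y \<in> Q"
        then obtain p a p' a' where "x = p + cscal a (?e b1)" "y = p' + cscal a' (?e b1)" "p \<in> P" "p' \<in> P"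
          by (auto simp: Q_def)
        then have "x + y = (p + p') + cscal (a + a') (?e b1)" "p + p' \<in> P"
          using cv.subspace_add[OF sP] by (auto simp: cv.scale_left_distrib)
        then show "x + y \<in> Q" unfolding Q_def by blast
      next
        fix c x assume "x \<in> Q"
        then obtain p a where "x = p + cscal a (?e b1)" "p \<in> P" by (auto simp: Q_def)
        then have "cscal c x = cscal c p + cscal (c * a) (?e b1)" "cscal c p \<in> P"
          using cv.subspace_scale[OF sP] by (auto simp: cv.scale_right_distrib)
        then show "cscal c x \<in> Q" unfolding Q_def by blast
      qed
      show "Q \<subseteq> ?E"
      proof
        fix x assume "x \<in> Q"
        then obtain p a where x: "x = p + cscal a (?e b1)" "p \<in> P" by (auto simp: Q_def)
        show "x \<in> ?E"
          unfolding x(1) using x(2) P_E e1E by (intro cv.subspace_add[OF sE] cv.subspace_scale[OF sE]) auto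
      qed
      fix j x assume "x \<in> Q"
      then obtain p a where x: "x = p + cscal a (?e b1)" "p \<in> P" by (auto simp: Q_def)
      have "shift j x = (shift j p + cscal a (shift j (?e b1) - cscal (\<xi> j) (?e b1))) + cscal (a * \<xi> j) (?e b1)"
        by (simp add: x co.X_add co.X_sc cv.scale_right_diff_distrib)
      moreover have "shift j p + cscal a (shift j (?e b1) - cscal (\<xi> j) (?e b1)) \<in> P"
        using x(2) st \<xi>[OF e1E] cv.subspace_add[OF sP] cv.subspace_scale[OF sP]
        by (auto simp: co.stable_def)
      ultimately show "shift j x \<in> Q" unfolding Q_def by blast
    qed
    moreover have "P \<subseteq> Q"
    proof
      fix p assume "p \<in> P"
      then have "p + cscal 0 (?e b1) \<in> Q" unfolding Q_def by blast
      then show "p \<in> Q" by simp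
    qed
    moreover have "Q \<noteq> P"
    proof
      assume "Q = P"
      moreover have "0 + cscal 1 (?e b1) \<in> Q" unfolding Q_def using cv.subspace_0[OF sP] by blast
      ultimately show False using b1 by simp
    qed
    ultimately have "Q = ?E" using P(1) by (auto simp: co.max_stable_def)
    then have "?e b \<in> Q" using b monom_vec_poly_vecs by auto
    then obtain p a where "?e b = p + cscal a (?e b1)" "p \<in> P" by (auto simp: Q_def)
    then have "?e b - cscal a (?e b1) \<in> P" by simp
    then show ?thesis ..
  qed
  then obtain a where a: "\<And>b. b \<in> Basis \<Longrightarrow> ?e b - cscal (a b) (?e b1) \<in> P" by metis
  have a1: "a b1 = 1"
  proof (rule ccontr)
    assume ne: "a b1 \<noteq> 1"
    have "cscal (inverse (1 - a b1)) (?e b1 - cscal (a b1) (?e b1)) \<in> P"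
      using a[OF b1(1)] cv.subspace_scale[OF sP] by blast
    moreover have "?e b1 - cscal (a b1) (?e b1) = cscal (1 - a b1) (?e b1)"
      by (simp add: cv.scale_left_diff_distrib)
    ultimately show False using ne b1 by simp
  qed
  define mon where "mon \<beta> = (\<Prod>j\<in>UNIV. \<xi> j ^ \<beta> j)" for \<beta>
  have mon_b1: "monom_vec \<beta> b - cscal (mon \<beta> * a b) (?e b1) \<in> P" if b: "b \<in> Basis" for \<beta> b
  proof -
    have "(monom_vec \<beta> b - cscal (mon \<beta>) (?e b)) + cscal (mon \<beta>) (?e b - cscal (a b) (?e b1)) \<in> P"
      using ev[OF b] a[OF b] cv.subspace_add[OF sP] cv.subspace_scale[OF sP] by (auto simp: mon_def)
    then show ?thesis by (simp add: cv.scale_right_diff_distrib)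
  qed
  \<comment> \<open>Every row lies in \<open>P\<close> and is congruent to this number times
    \<open>b1\<close>, which is not in \<open>P\<close>; so the number is zero.\<close>
  have rows: "(\<Sum>\<beta> | mi_abs \<beta> = k. mon \<beta> * (\<Sum>b\<in>Basis. a b * of_real (A \<beta> b \<bullet> w))) = 0" for w
  proof -
    let ?s = "\<Sum>\<beta> | mi_abs \<beta> = k. mon \<beta> * (\<Sum>b\<in>Basis. a b * complex_of_real (A \<beta> b \<bullet> w))"
    let ?I = "{\<beta>::'n \<Rightarrow> nat. mi_abs \<beta> = k} \<times> (Basis :: 'v set)"
    let ?r = "symbol_row k A w"
    have finI: "finite ?I" by (intro finite_cartesian_product finite_mi_abs_eq finite_Basis)
    have rP: "?r \<in> P" using UP row_module.row by blast
    have exp: "?r = (\<Sum>p\<in>?I. cscal (?r p) (monom_vec (fst p) (snd p)))"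
    proof -
      have "?r = (\<Sum>p\<in>{p. ?r p \<noteq> 0}. cscal (?r p) (monom_vec (fst p) (snd p)))"
        by (rule poly_vecs_expansion[OF symbol_row_poly_vecs])
      also have "\<dots> = (\<Sum>p\<in>?I. cscal (?r p) (monom_vec (fst p) (snd p)))"
        by (rule sum.mono_neutral_left[OF finI]) (auto simp: symbol_row_def split: if_splits)
      finally show ?thesis .
    qed
    have sum_P: "(\<Sum>p\<in>?I. cscal (?r p) (monom_vec (fst p) (snd p) - cscal (mon (fst p) * a (snd p)) (?e b1))) \<in> P"
      using mon_b1 by (intro cv.subspace_sum[OF sP] cv.subspace_scale[OF sP]) auto
    have s: "?s = (\<Sum>p\<in>?I. ?r p * (mon (fst p) * a (snd p)))"
      by (simp add: sum_distrib_left sum.cartesian_product case_prod_unfold)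
        (intro sum.cong, auto simp: symbol_row_def)
    have "cscal ?s (?e b1) = (\<Sum>p\<in>?I. cscal (?r p) (cscal (mon (fst p) * a (snd p)) (?e b1)))"
      unfolding s by (simp add: cv.scale_sum_left)
    then have "?r - (\<Sum>p\<in>?I. cscal (?r p) (monom_vec (fst p) (snd p) - cscal (mon (fst p) * a (snd p)) (?e b1)))
      = cscal ?s (?e b1)"
      using exp by (simp add: cv.scale_right_diff_distrib sum_subtractf)
    then have "cscal ?s (?e b1) \<in> P" using cv.subspace_diff[OF sP rP sum_P] by simp
    then have "cscal (inverse ?s) (cscal ?s (?e b1)) \<in> P" by (rule cv.subspace_scale[OF sP])
    then show ?thesis using b1 by (cases "?s = 0") simp_all
  qed
  \<comment> \<open>The point and the vector that contradict ellipticity. The entries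
    \<open>a b\<close> are split into real and imaginary parts to match the encoding of the
    complexification by pairs; \<open>\<xi> i = 1\<close> keeps the point nonzero and
    \<open>a b1 = 1\<close> keeps the vector nonzero.\<close>
  define z where "z = (\<chi> j. \<xi> j)"
  define p where "p = (\<Sum>b\<in>Basis. Re (a b) *\<^sub>R b, \<Sum>b\<in>Basis. Im (a b) *\<^sub>R (b::'v))"
  have lin: "linear (A \<beta>)" if "mi_abs \<beta> = k" for \<beta> using A(1) that by (simp add: diff_operator_def)
  have A_p: "A \<beta> (\<Sum>b\<in>Basis. r b *\<^sub>R b) \<bullet> w = (\<Sum>b\<in>Basis. r b * (A \<beta> b \<bullet> w))"
    if "mi_abs \<beta> = k" for \<beta> r w
    by (simp add: linear_sum[OF lin[OF that]] linear_scale[OF lin[OF that]] inner_sum_left)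
  have "complex_symbol k A z p = (0, 0)"
  proof -
    let ?S = "\<Sum>\<beta> | mi_abs \<beta> = k. cscale (mon \<beta>) (A \<beta> (fst p), A \<beta> (snd p))"
    have cs: "complex_symbol k A z p = ?S"
      by (simp add: complex_symbol_def p_def mon_def z_def)
    have "fst ?S \<bullet> w = Re (\<Sum>\<beta> | mi_abs \<beta> = k. mon \<beta> * (\<Sum>b\<in>Basis. a b * of_real (A \<beta> b \<bullet> w)))" for w
      unfolding fst_sum inner_sum_left Re_sum
      by (intro sum.cong refl) (simp add: cscale_def p_def A_p inner_diff_left)
    then have "fst ?S \<bullet> fst ?S = 0" unfolding rows by simp
    then have fst0: "fst ?S = 0" by (simp only: inner_eq_zero_iff)
    have "snd ?S \<bullet> w = Im (\<Sum>\<beta> | mi_abs \<beta> = k. mon \<beta> * (\<Sum>b\<in>Basis. a b * of_real (A \<beta> b \<bullet> w)))" for w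
      unfolding snd_sum inner_sum_left Im_sum
      by (intro sum.cong refl) (simp add: cscale_def p_def A_p inner_add_left)
    then have "snd ?S \<bullet> snd ?S = 0" unfolding rows by simp
    then have "snd ?S = 0" by (simp only: inner_eq_zero_iff)
    with fst0 show ?thesis unfolding cs by (intro prod_eqI) simp_all
  qed
  moreover have "complex_symbol k A z (0, 0) = (0, 0)"
    using lin by (auto simp: complex_symbol_def cscale_def linear_0 sum_prod intro!: sum.neutral)
  moreover have "z \<noteq> 0" using \<xi>i by (auto simp: z_def vec_eq_iff intro!: exI[of _ i])
  ultimately have "p = (0, 0)" using A(2) by (metis C_elliptic_def injD)
  then have "(\<Sum>b\<in>Basis. Re (a b) *\<^sub>R (b::'v)) \<bullet> b1 = 0" by (simp add: p_def)
  then have "Re (a b1) = 0"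
    using b1(1) by (simp add: inner_sum_left inner_Basis if_distrib sum.delta cong: if_cong)
  then show False using a1 by simp
qed

section \<open>Smooth functions\<close>

lemma has_derivative_partial_deriv:
  fixes f :: "real^'n::finite \<Rightarrow> 'a::real_normed_vector"
  assumes "f differentiable (at x)"
  shows "(f has_derivative (\<lambda>v. \<Sum>i\<in>UNIV. v $ i *\<^sub>R partial_deriv i f x)) (at x)"
proof -
  define D where "D = frechet_derivative f (at x)"
  have D: "(f has_derivative D) (at x)" using assms by (simp add: D_def frechet_derivative_works)
  interpret D: linear D using has_derivative_linear[OF D] .
  have "D v = (\<Sum>i\<in>UNIV. v $ i *\<^sub>R partial_deriv i f x)" for v
  proof -
    have "v = (\<Sum>i\<in>UNIV. v $ i *\<^sub>R axis i 1)"
      using basis_expansion[of v] by (simp add: scalar_mult_eq_scaleR)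
    then have "D v = D (\<Sum>i\<in>UNIV. v $ i *\<^sub>R axis i 1)" by simp
    also have "\<dots> = (\<Sum>i\<in>UNIV. v $ i *\<^sub>R D (axis i 1))" by (simp add: D.sum D.scale)
    finally show ?thesis by (simp add: partial_deriv_def D_def)
  qed
  then have "D = (\<lambda>v. \<Sum>i\<in>UNIV. v $ i *\<^sub>R partial_deriv i f x)" by (rule ext)
  then show ?thesis using D by (simp only:)
qed

lemma partial_deriv_eqI: "(f has_derivative D) (at x) \<Longrightarrow> partial_deriv i f x = D (axis i 1)"
  by (simp add: partial_deriv_def frechet_derivative_at[symmetric])

lemma has_derivative_cong_open:
  assumes "open S" "x \<in> S" "\<And>y. y \<in> S \<Longrightarrow> f y = g y"
  shows "(f has_derivative D) (at x) \<longleftrightarrow> (g has_derivative D) (at x)"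
  using assms has_derivative_transform_within_open[of f D x UNIV S g]
    has_derivative_transform_within_open[of g D x UNIV S f] by auto

lemma partial_deriv_cong_open:
  assumes "open S" "x \<in> S" "\<And>y. y \<in> S \<Longrightarrow> f y = g y"
  shows "partial_deriv i f x = partial_deriv i g x"
  using has_derivative_cong_open[OF assms] by (simp add: partial_deriv_def frechet_derivative_def)

lemma foldr_partial_deriv_cong_open:
  assumes "open S" "x \<in> S" "\<And>y. y \<in> S \<Longrightarrow> f y = g y"
  shows "foldr partial_deriv is f x = foldr partial_deriv is g x"
  using assms(2)
proof (induction "is" arbitrary: x)
  case Nil then show ?case using assms(3) by simp
next
  case (Cons i "is")
  then show ?case using assms(1) by (auto intro: partial_deriv_cong_open)
qed

text \<open>Smoothness quantifies over all lists of directions at once. Counting the order instead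
  lets the closure properties be proved by induction: the derivative of a sum or product is built
  from functions of one order less.\<close>

primrec k_diff :: "nat \<Rightarrow> (real^'n::finite) set \<Rightarrow> (real^'n \<Rightarrow> 'a::real_normed_vector) \<Rightarrow> bool" where
  "k_diff 0 S f \<longleftrightarrow> True"
| "k_diff (Suc N) S f \<longleftrightarrow> (\<forall>x\<in>S. f differentiable (at x)) \<and> (\<forall>i. k_diff N S (partial_deriv i f))"

lemma k_diff_iff:
  "k_diff N S f \<longleftrightarrow> (\<forall>is. length is < N \<longrightarrow> (\<forall>x\<in>S. foldr partial_deriv is f differentiable (at x)))"
proof (induction N arbitrary: f)
  case (Suc N)
  show ?case
  proof
    assume *: "k_diff (Suc N) S f"
    show "\<forall>is. length is < Suc N \<longrightarrow> (\<forall>x\<in>S. foldr partial_deriv is f differentiable (at x))"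
    proof (intro allI impI)
      fix "is" :: "'a list" assume l: "length is < Suc N"
      show "\<forall>x\<in>S. foldr partial_deriv is f differentiable (at x)"
      proof (cases "is" rule: rev_cases)
        case Nil then show ?thesis using * by simp
      next
        case (snoc js j) then show ?thesis using * l Suc by simp
      qed
    qed
  next
    assume *: "\<forall>is. length is < Suc N \<longrightarrow> (\<forall>x\<in>S. foldr partial_deriv is f differentiable (at x))"
    have "foldr partial_deriv js (partial_deriv i f) differentiable at x" if "length js < N" "x \<in> S" for js i x
      using *[rule_format, of "js @ [i]" x] that by simp
    moreover have "f differentiable at x" if "x \<in> S" for x using *[rule_format, of "[]" x] that by simp
    ultimately show "k_diff (Suc N) S f" using Suc by simp
  qed
qed simp

lemma smooth_on_iff_k_diff: "smooth_on S f \<longleftrightarrow> (\<forall>N. k_diff N S f)"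
  unfolding k_diff_iff smooth_on_def by blast

lemma smooth_onD: "smooth_on S f \<Longrightarrow> x \<in> S \<Longrightarrow> f differentiable (at x)"
  unfolding smooth_on_def by (metis foldr_Nil id_apply)

lemma smooth_on_partial_deriv: "smooth_on S f \<Longrightarrow> smooth_on S (partial_deriv i f)"
  unfolding smooth_on_iff_k_diff using k_diff.simps(2) by blast

lemma smooth_on_foldr_partial_deriv: "smooth_on S f \<Longrightarrow> smooth_on S (foldr partial_deriv is f)"
  by (induction "is") (auto intro: smooth_on_partial_deriv)

lemma smooth_on_subset: "smooth_on S f \<Longrightarrow> T \<subseteq> S \<Longrightarrow> smooth_on T f"
  unfolding smooth_on_def by blast

lemma smooth_on_imp_continuous_on: "smooth_on S f \<Longrightarrow> continuous_on S f"
  using smooth_onD differentiable_imp_continuous_within by (metis continuous_at_imp_continuous_on)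

lemma k_diff_Suc_D: "k_diff (Suc N) S f \<Longrightarrow> k_diff N S f"
  unfolding k_diff_iff by (meson less_SucI)

lemma k_diff_cong:
  assumes "open S" "\<And>y. y \<in> S \<Longrightarrow> f y = g y"
  shows "k_diff N S f \<longleftrightarrow> k_diff N S g"
proof -
  have "foldr partial_deriv is f differentiable at x \<longleftrightarrow> foldr partial_deriv is g differentiable at x"
    if "x \<in> S" for "is" x
  proof -
    have "foldr partial_deriv is f y = foldr partial_deriv is g y" if "y \<in> S" for y
      using foldr_partial_deriv_cong_open[OF assms(1) that] assms(2) by blast
    then show ?thesis
      using has_derivative_cong_open[OF assms(1) that] unfolding differentiable_def by blast
  qed
  then show ?thesis unfolding k_diff_iff by blast
qed

lemma smooth_on_cong:
  assumes "open S" "\<And>y. y \<in> S \<Longrightarrow> f y = g y"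
  shows "smooth_on S f \<longleftrightarrow> smooth_on S g"
  unfolding smooth_on_iff_k_diff using k_diff_cong[OF assms] by simp

lemma smooth_on_Un:
  "smooth_on S f \<Longrightarrow> smooth_on T f \<Longrightarrow> smooth_on (S \<union> T) f"
  unfolding smooth_on_def by blast

section \<open>Differentiation rules and closure of smooth functions\<close>

lemma partial_deriv_const [simp]: "partial_deriv i (\<lambda>x. c) = (\<lambda>x. 0)"
  by (intro ext) (simp add: partial_deriv_eqI[OF has_derivative_const])

lemma k_diff_const: "k_diff N S (\<lambda>x. c)"
  by (induction N arbitrary: c) auto

lemma smooth_on_const [simp]: "smooth_on S (\<lambda>x. c)"
  by (simp add: smooth_on_iff_k_diff k_diff_const)

lemma foldr_partial_deriv_0: "foldr partial_deriv is (\<lambda>x. 0) = (\<lambda>x. 0)"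
  by (induction "is") auto

lemma partial_deriv_add:
  assumes "f differentiable (at x)" "g differentiable (at x)"
  shows "partial_deriv i (\<lambda>x. f x + g x) x = partial_deriv i f x + partial_deriv i g x"
  using assms[unfolded frechet_derivative_works]
  by (subst partial_deriv_eqI[OF has_derivative_add]) (auto simp: partial_deriv_def)

lemma partial_deriv_bounded_linear:
  assumes "f differentiable (at x)" "bounded_linear h"
  shows "partial_deriv i (\<lambda>x. h (f x)) x = h (partial_deriv i f x)"
  using assms(1)[unfolded frechet_derivative_works]
  by (subst partial_deriv_eqI[OF bounded_linear.has_derivative[OF assms(2)]]) (auto simp: partial_deriv_def)

lemma partial_deriv_scaleR:
  fixes u :: "real^'n::finite \<Rightarrow> real"
  assumes "u differentiable (at x)" "f differentiable (at x)"
  shows "partial_deriv i (\<lambda>x. u x *\<^sub>R f x) x = u x *\<^sub>R partial_deriv i f x + partial_deriv i u x *\<^sub>R f x"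
  using assms[unfolded frechet_derivative_works]
  by (subst partial_deriv_eqI[OF has_derivative_scaleR]) (auto simp: partial_deriv_def)

lemma k_diff_add:
  assumes "open S"
  shows "k_diff N S f \<Longrightarrow> k_diff N S g \<Longrightarrow> k_diff N S (\<lambda>x. f x + g x)"
proof (induction N arbitrary: f g)
  case (Suc N)
  have "k_diff N S (\<lambda>x. partial_deriv i f x + partial_deriv i g x)" for i
    using Suc by simp
  then have "k_diff N S (partial_deriv i (\<lambda>x. f x + g x))" for i
    using Suc.prems by (subst k_diff_cong[OF assms partial_deriv_add]) auto
  then show ?case using Suc.prems by auto
qed simp

lemma k_diff_bounded_linear:
  assumes "open S" "bounded_linear h"
  shows "k_diff N S f \<Longrightarrow> k_diff N S (\<lambda>x. h (f x))"
proof (induction N arbitrary: f)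
  case (Suc N)
  have "k_diff N S (\<lambda>x. h (partial_deriv i f x))" for i
    using Suc by simp
  then have "k_diff N S (partial_deriv i (\<lambda>x. h (f x)))" for i
    using Suc.prems by (subst k_diff_cong[OF assms(1) partial_deriv_bounded_linear[OF _ assms(2)]]) auto
  moreover have "(\<lambda>x. h (f x)) differentiable at x" if "x \<in> S" for x
    using Suc.prems that bounded_linear.has_derivative[OF assms(2)]
    unfolding differentiable_def k_diff.simps by blast
  ultimately show ?case by auto
qed simp

lemma k_diff_scaleR:
  fixes u :: "real^'n::finite \<Rightarrow> real"
  assumes "open S"
  shows "k_diff N S u \<Longrightarrow> k_diff N S f \<Longrightarrow> k_diff N S (\<lambda>x. u x *\<^sub>R f x)"
proof (induction N arbitrary: u f)
  case (Suc N)
  have "k_diff N S (\<lambda>x. u x *\<^sub>R partial_deriv i f x + partial_deriv i u x *\<^sub>R f x)" for i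
    using Suc k_diff_Suc_D[OF Suc.prems(1)] k_diff_Suc_D[OF Suc.prems(2)]
    by (intro k_diff_add[OF assms]) auto
  then have "k_diff N S (partial_deriv i (\<lambda>x. u x *\<^sub>R f x))" for i
    using Suc.prems by (subst k_diff_cong[OF assms partial_deriv_scaleR]) auto
  then show ?case using Suc.prems by auto
qed simp

lemma smooth_on_add:
  "open S \<Longrightarrow> smooth_on S f \<Longrightarrow> smooth_on S g \<Longrightarrow> smooth_on S (\<lambda>x. f x + g x)"
  by (simp add: smooth_on_iff_k_diff k_diff_add)

lemma smooth_on_bounded_linear:
  "open S \<Longrightarrow> bounded_linear h \<Longrightarrow> smooth_on S f \<Longrightarrow> smooth_on S (\<lambda>x. h (f x))"
  by (simp add: smooth_on_iff_k_diff k_diff_bounded_linear)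

lemma smooth_on_scaleR:
  fixes u :: "real^'n::finite \<Rightarrow> real"
  shows "open S \<Longrightarrow> smooth_on S u \<Longrightarrow> smooth_on S f \<Longrightarrow> smooth_on S (\<lambda>x. u x *\<^sub>R f x)"
  by (simp add: smooth_on_iff_k_diff k_diff_scaleR)

lemma smooth_on_mult:
  fixes u :: "real^'n::finite \<Rightarrow> real"
  shows "open S \<Longrightarrow> smooth_on S u \<Longrightarrow> smooth_on S f \<Longrightarrow> smooth_on S (\<lambda>x. u x * f x)"
  using smooth_on_scaleR[of S u f] by simp

lemma smooth_on_cmult:
  fixes u :: "real^'n::finite \<Rightarrow> real"
  shows "open S \<Longrightarrow> smooth_on S u \<Longrightarrow> smooth_on S (\<lambda>x. c * u x)"
  using smooth_on_mult[of S "\<lambda>_. c" u] by simp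

lemma smooth_on_minus:
  fixes u :: "real^'n::finite \<Rightarrow> real"
  shows "open S \<Longrightarrow> smooth_on S u \<Longrightarrow> smooth_on S (\<lambda>x. - u x)"
  using smooth_on_cmult[of S u "-1"] by simp

lemma smooth_on_diff:
  fixes u :: "real^'n::finite \<Rightarrow> real"
  shows "open S \<Longrightarrow> smooth_on S u \<Longrightarrow> smooth_on S f \<Longrightarrow> smooth_on S (\<lambda>x. u x - f x)"
  using smooth_on_add[of S u "\<lambda>x. - f x"] smooth_on_minus[of S f] by simp

lemma partial_deriv_mult:
  fixes u f :: "real^'n::finite \<Rightarrow> real"
  assumes "u differentiable (at x)" "f differentiable (at x)"
  shows "partial_deriv i (\<lambda>x. u x * f x) x = u x * partial_deriv i f x + partial_deriv i u x * f x"
  using partial_deriv_scaleR[OF assms] by simp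

lemma partial_deriv_cmult:
  fixes u :: "real^'n::finite \<Rightarrow> real"
  assumes "u differentiable (at x)"
  shows "partial_deriv i (\<lambda>x. c * u x) x = c * partial_deriv i u x"
  using partial_deriv_bounded_linear[OF assms bounded_linear_mult_right] .

text \<open>The family \<open>H\<close> lists a function together with all its derivatives, so the
  induction stays within the family: the chain rule replaces \<open>H m\<close> by
  \<open>H (Suc m)\<close> times a derivative of \<open>q\<close>.\<close>

lemma k_diff_compose_real:
  fixes q :: "real^'n::finite \<Rightarrow> real"
  assumes S: "open S" and q: "smooth_on S q"
    and H: "\<And>m t. (H m has_real_derivative H (Suc m) t) (at t)"
  shows "k_diff N S (\<lambda>x. H m (q x))"
proof (induction N arbitrary: m)
  case (Suc N)
  have D: "((\<lambda>x. H m (q x)) has_derivative (\<lambda>v. H (Suc m) (q x) * frechet_derivative q (at x) v)) (at x)"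
    if "x \<in> S" for x
  proof -
    have 1: "(q has_derivative frechet_derivative q (at x)) (at x)"
      using smooth_onD[OF q that] by (simp add: frechet_derivative_works)
    have "(H m has_derivative (\<lambda>h. H (Suc m) (q x) * h)) (at (q x))"
      using H[of m "q x"] by (simp add: has_field_derivative_def)
    from has_derivative_compose[OF 1 this] show ?thesis .
  qed
  have "k_diff N S (\<lambda>x. H (Suc m) (q x) * partial_deriv i q x)" for i
    using k_diff_scaleR[OF S Suc[of "Suc m"], of "partial_deriv i q"] smooth_on_partial_deriv[OF q]
    by (simp add: smooth_on_iff_k_diff)
  moreover have "partial_deriv i (\<lambda>x. H m (q x)) x = H (Suc m) (q x) * partial_deriv i q x" if "x \<in> S" for i x
    using partial_deriv_eqI[OF D[OF that]] by (simp add: partial_deriv_def)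
  ultimately have "k_diff N S (partial_deriv i (\<lambda>x. H m (q x)))" for i
    by (subst k_diff_cong[OF S]) auto
  then show ?case using D unfolding differentiable_def k_diff.simps by blast
qed simp

section \<open>Smoothness of polynomial functions\<close>

lemma polynomial_function_partial_deriv_real:
  fixes p :: "real^'n::finite \<Rightarrow> real"
  assumes "real_polynomial_function p"
  shows "real_polynomial_function (partial_deriv i p)"
  using assms
proof (induction rule: real_polynomial_function.induct)
  case (linear f)
  then have "partial_deriv i f = (\<lambda>x. f (axis i 1))"
    by (intro ext) (rule partial_deriv_eqI[OF bounded_linear_imp_has_derivative])
  then show ?case by (simp add: real_polynomial_function.intros)
next
  case (const c) then show ?case by (simp add: real_polynomial_function.intros)
next
  case (add f g)
  then have "partial_deriv i (\<lambda>x. f x + g x) = (\<lambda>x. partial_deriv i f x + partial_deriv i g x)"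
    by (intro ext partial_deriv_add differentiable_at_real_polynomial_function)
  then show ?case using add by (simp add: real_polynomial_function.intros)
next
  case (mult f g)
  then have "partial_deriv i (\<lambda>x. f x * g x) = (\<lambda>x. f x * partial_deriv i g x + partial_deriv i f x * g x)"
    by (intro ext partial_deriv_mult differentiable_at_real_polynomial_function)
  then show ?case using mult by (simp add: real_polynomial_function.intros)
qed

lemma polynomial_function_partial_deriv:
  fixes p :: "real^'n::finite \<Rightarrow> 'a::euclidean_space"
  assumes p: "polynomial_function p"
  shows "polynomial_function (partial_deriv i p)"
  unfolding polynomial_function_iff_Basis_inner
proof
  fix b :: 'a assume "b \<in> Basis"
  have "partial_deriv i (\<lambda>x. p x \<bullet> b) = (\<lambda>x. partial_deriv i p x \<bullet> b)"
    by (intro ext partial_deriv_bounded_linear bounded_linear_inner_left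
        differentiable_at_polynomial_function p)
  moreover have "real_polynomial_function (\<lambda>x. p x \<bullet> b)"
    using p \<open>b \<in> Basis\<close> unfolding polynomial_function_iff_Basis_inner by blast
  ultimately show "real_polynomial_function (\<lambda>x. partial_deriv i p x \<bullet> b)"
    using polynomial_function_partial_deriv_real by metis
qed

lemma polynomial_function_foldr_partial_deriv:
  fixes p :: "real^'n::finite \<Rightarrow> 'a::euclidean_space"
  shows "polynomial_function p \<Longrightarrow> polynomial_function (foldr partial_deriv is p)"
  by (induction "is") (auto intro: polynomial_function_partial_deriv)

lemma smooth_on_polynomial_function:
  fixes p :: "real^'n::finite \<Rightarrow> 'a::euclidean_space"
  shows "polynomial_function p \<Longrightarrow> smooth_on S p"
  unfolding smooth_on_def
  by (intro allI ballI differentiable_at_polynomial_function polynomial_function_foldr_partial_deriv)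

text \<open>The parameter \<open>t\<close> ranges over a box in an arbitrary Euclidean space, so that both convolutions
  and integrals of translates along segments are covered.\<close>

lemma parameter_integral:
  fixes \<phi> :: "real^'n::finite \<Rightarrow> real" and L :: "'p::euclidean_space \<Rightarrow> real^'n"
  assumes \<phi>: "smooth_on UNIV \<phi>" and g: "continuous_on (cbox a b) g" and L: "continuous_on (cbox a b) L"
  defines "F \<equiv> \<lambda>\<psi> x. integral (cbox a b) (\<lambda>t. g t * \<psi> (x + L t))"
  shows "F \<phi> differentiable (at x)" and "partial_deriv i (F \<phi>) = F (partial_deriv i \<phi>)"
    and "smooth_on UNIV (F \<phi>)"
proof -
  \<comment> \<open>Stated for every smooth \<open>\<psi>\<close>, because smoothness of
    \<open>F \<phi>\<close> is obtained by applying it to the successive derivatives of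
    \<open>\<phi>\<close>.\<close>
  have D: "(F \<psi> has_derivative (\<lambda>v. \<Sum>j\<in>UNIV. v $ j * F (partial_deriv j \<psi>) x)) (at x)"
    if \<psi>: "smooth_on UNIV \<psi>" for \<psi> x
  proof -
    have cpd: "continuous_on UNIV (partial_deriv j \<psi>)" for j
      by (intro smooth_on_imp_continuous_on smooth_on_partial_deriv \<psi>)
    have cont: "continuous_on UNIV \<psi>" by (intro smooth_on_imp_continuous_on \<psi>)
    have int: "(\<lambda>t. g t * \<kappa> (x + L t)) integrable_on cbox a b"
      if "continuous_on UNIV \<kappa>" for \<kappa> :: "real^'n \<Rightarrow> real" and x
      by (intro integrable_continuous continuous_intros g L continuous_on_compose2[OF that]) auto
    \<comment> \<open>The derivative as an element of the normed space of bounded linear maps, the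
      form in which the Leibniz rule asks for its continuity.\<close>
    define fx where "fx x t = (\<Sum>j\<in>UNIV. (g t * partial_deriv j \<psi> (x + L t)) *\<^sub>R Blinfun (\<lambda>v::real^'n. v $ j))"
      for x t
    have bl: "bounded_linear (\<lambda>v::real^'n. v $ j)" for j by (rule bounded_linear_vec_nth)
    have fx_apply: "blinfun_apply (fx x t) = (\<lambda>v. \<Sum>j\<in>UNIV. g t * partial_deriv j \<psi> (x + L t) * v $ j)" for x t
      by (intro ext) (simp add: fx_def blinfun.sum_left blinfun.scaleR_left bounded_linear_Blinfun_apply[OF bl])
    have "((\<lambda>x. integral (cbox a b) ((\<lambda>x t. g t * \<psi> (x + L t)) x)) has_derivative
      blinfun_apply (integral (cbox a b) (fx x))) (at x within UNIV)"
    proof (rule leibniz_rule)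
      fix x t assume "t \<in> cbox a b"
      have "(\<psi> has_derivative (\<lambda>v. \<Sum>i\<in>UNIV. v $ i *\<^sub>R partial_deriv i \<psi> (x + L t))) (at (x + L t))"
        by (intro has_derivative_partial_deriv smooth_onD[OF \<psi>]) simp
      then have "((\<lambda>x. \<psi> (x + L t)) has_derivative (\<lambda>v. \<Sum>i\<in>UNIV. v $ i *\<^sub>R partial_deriv i \<psi> (x + L t))) (at x)"
        by (rule has_derivative_compose[rotated]) (auto intro!: derivative_eq_intros)
      from has_derivative_mult_right[OF this, of "g t"]
      show "((\<lambda>x. g t * \<psi> (x + L t)) has_derivative blinfun_apply (fx x t)) (at x within UNIV)"
        by (simp add: fx_apply sum_distrib_left mult_ac)
    next
      show "continuous_on (UNIV \<times> cbox a b) (\<lambda>(x, t). fx x t)"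
        unfolding fx_def case_prod_unfold
        by (intro continuous_intros continuous_on_compose2[OF g] continuous_on_compose2[OF cpd]
            continuous_on_compose2[OF L]) auto
    qed (auto intro: int[OF cont])
    moreover have "blinfun_apply (integral (cbox a b) (fx x)) v = (\<Sum>j\<in>UNIV. v $ j * F (partial_deriv j \<psi>) x)" for v
    proof -
      have "fx x integrable_on cbox a b"
        unfolding fx_def
        by (intro integrable_continuous continuous_intros g continuous_on_compose2[OF cpd] L) auto
      then have "blinfun_apply (integral (cbox a b) (fx x)) v = integral (cbox a b) (\<lambda>t. blinfun_apply (fx x t) v)"
        by (subst integral_linear[of "fx x" "cbox a b" "\<lambda>h. blinfun_apply h v", unfolded o_def, symmetric])
          (auto intro: blinfun.bounded_linear_left)
      also have "\<dots> = integral (cbox a b) (\<lambda>t. \<Sum>j\<in>UNIV. g t * partial_deriv j \<psi> (x + L t) * v $ j)"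
        by (simp add: fx_apply)
      also have "\<dots> = (\<Sum>j\<in>UNIV. integral (cbox a b) (\<lambda>t. g t * partial_deriv j \<psi> (x + L t) * v $ j))"
        by (intro integral_sum finite integrable_on_mult_left int[OF cpd])
      also have "\<dots> = (\<Sum>j\<in>UNIV. v $ j * F (partial_deriv j \<psi>) x)"
        by (simp add: F_def mult.commute)
      finally show ?thesis .
    qed
    then have "blinfun_apply (integral (cbox a b) (fx x)) = (\<lambda>v. \<Sum>j\<in>UNIV. v $ j * F (partial_deriv j \<psi>) x)"
      by (rule ext)
    ultimately show ?thesis by (simp only: F_def)
  qed
  have pd: "partial_deriv i (F \<psi>) = F (partial_deriv i \<psi>)" if "smooth_on UNIV \<psi>" for \<psi> i
    by (intro ext, subst partial_deriv_eqI[OF D[OF that]])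
      (simp add: axis_def if_distrib[of "\<lambda>z. z * _"] cong: if_cong)
  show "F \<phi> differentiable (at x)" using D[OF \<phi>] unfolding differentiable_def by blast
  show "partial_deriv i (F \<phi>) = F (partial_deriv i \<phi>)" by (rule pd[OF \<phi>])
  have "k_diff N UNIV (F \<psi>)" if "smooth_on UNIV \<psi>" for N \<psi>
    using that
  proof (induction N arbitrary: \<psi>)
    case (Suc N)
    then show ?case
      using D[OF Suc.prems] smooth_on_partial_deriv[OF Suc.prems]
      by (auto simp: pd differentiable_def)
  qed simp
  then show "smooth_on UNIV (F \<phi>)" using \<phi> by (simp add: smooth_on_iff_k_diff)
qed

section \<open>Symmetry of mixed derivatives\<close>

lemma has_real_derivative_line:
  fixes \<phi> :: "real^'n::finite \<Rightarrow> real"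
  assumes "smooth_on UNIV \<phi>"
  shows "((\<lambda>t. \<phi> (x + t *\<^sub>R h)) has_real_derivative (\<Sum>i\<in>UNIV. h $ i * partial_deriv i \<phi> (x + t *\<^sub>R h))) (at t within S)"
proof -
  have "(\<phi> has_derivative (\<lambda>v. \<Sum>i\<in>UNIV. v $ i *\<^sub>R partial_deriv i \<phi> (x + t *\<^sub>R h))) (at (x + t *\<^sub>R h))"
    by (intro has_derivative_partial_deriv smooth_onD[OF assms]) simp
  moreover have "((\<lambda>t. x + t *\<^sub>R h) has_derivative (\<lambda>s. s *\<^sub>R h)) (at t within S)"
    by (auto intro!: derivative_eq_intros)
  ultimately have "((\<lambda>t. \<phi> (x + t *\<^sub>R h)) has_derivative
      (\<lambda>s. \<Sum>i\<in>UNIV. (s *\<^sub>R h) $ i *\<^sub>R partial_deriv i \<phi> (x + t *\<^sub>R h))) (at t within S)"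
    by (rule has_derivative_compose[rotated])
  then show ?thesis
    unfolding has_field_derivative_def
    by (rule has_derivative_eq_rhs) (auto simp: sum_distrib_right sum_distrib_left mult_ac)
qed

text \<open>The increment of \<open>\<phi>\<close> in direction \<open>i\<close> is the integral of
  \<open>\<partial>_i \<phi>\<close> along a segment of length \<open>s\<close>. Differentiating
  under the integral in direction \<open>j\<close> and then in \<open>s\<close> at 0 yields one
  mixed derivative; differentiating \<open>\<partial>_j \<phi>\<close> along the segment yields the
  other.\<close>

lemma partial_deriv_commute:
  fixes \<phi> :: "real^'n::finite \<Rightarrow> real"
  assumes \<phi>: "smooth_on UNIV \<phi>"
  shows "partial_deriv i (partial_deriv j \<phi>) = partial_deriv j (partial_deriv i \<phi>)"
proof
  fix x
  let ?e = "axis i 1 :: real^'n"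
  have line: "((\<lambda>t. \<psi> (x + t *\<^sub>R ?e)) has_real_derivative partial_deriv i \<psi> (x + t *\<^sub>R ?e)) (at t within S)"
    if "smooth_on UNIV \<psi>" for \<psi> x t S
    using has_real_derivative_line[OF that, of x ?e t S]
    by (simp add: axis_def if_distrib[of "\<lambda>z. z * _"] cong: if_cong)
  have sm: "smooth_on UNIV (partial_deriv i \<phi>)" "smooth_on UNIV (partial_deriv j \<phi>)"
    using \<phi> by (auto intro: smooth_on_partial_deriv)
  define G where "G \<psi> s x = integral (cbox 0 s) (\<lambda>t::real. 1 * \<psi> (x + t *\<^sub>R ?e))"
    for \<psi> :: "real^'n \<Rightarrow> real" and s x
  have FTC: "\<phi> (x + s *\<^sub>R ?e) = \<phi> x + G (partial_deriv i \<phi>) s x" if "s \<ge> 0" for s x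
  proof -
    have "((\<lambda>t. partial_deriv i \<phi> (x + t *\<^sub>R ?e)) has_integral \<phi> (x + s *\<^sub>R ?e) - \<phi> (x + 0 *\<^sub>R ?e)) {0..s}"
      using that line[OF \<phi>] by (intro fundamental_theorem_of_calculus)
        (auto simp: has_real_derivative_iff_has_vector_derivative)
    then show ?thesis by (simp add: G_def has_integral_iff)
  qed
  have "partial_deriv j \<phi> (x + s *\<^sub>R ?e) - partial_deriv j \<phi> x = G (partial_deriv j (partial_deriv i \<phi>)) s x"
    if "s \<ge> 0" for s
  proof -
    have cL: "continuous_on (cbox 0 s) (\<lambda>t. t *\<^sub>R ?e)" by (intro continuous_intros)
    have c1: "continuous_on (cbox 0 s) (\<lambda>t::real. 1::real)" by simp
    note PI = parameter_integral[OF sm(1) c1 cL, folded G_def]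
    have "(\<phi> has_derivative frechet_derivative \<phi> (at (x + s *\<^sub>R ?e))) (at (x + s *\<^sub>R ?e))"
      using smooth_onD[OF \<phi>] by (simp add: frechet_derivative_works)
    then have "((\<lambda>x. \<phi> (x + s *\<^sub>R ?e)) has_derivative frechet_derivative \<phi> (at (x + s *\<^sub>R ?e))) (at x)"
      by (rule has_derivative_compose[rotated]) (auto intro!: derivative_eq_intros)
    then have "partial_deriv j \<phi> (x + s *\<^sub>R ?e) = partial_deriv j (\<lambda>x. \<phi> (x + s *\<^sub>R ?e)) x"
      by (simp add: partial_deriv_eqI) (simp add: partial_deriv_def)
    also have "\<dots> = partial_deriv j (\<lambda>x. \<phi> x + G (partial_deriv i \<phi>) s x) x"
      using FTC[OF that] by simp
    also have "\<dots> = partial_deriv j \<phi> x + partial_deriv j (G (partial_deriv i \<phi>) s) x"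
      by (intro partial_deriv_add smooth_onD[OF \<phi>] PI(1)) auto
    finally show ?thesis using PI(2)[of j] by simp
  qed
  then have eq: "partial_deriv j \<phi> (x + s *\<^sub>R ?e) =
      partial_deriv j \<phi> x + integral {0..s} (\<lambda>t. partial_deriv j (partial_deriv i \<phi>) (x + t *\<^sub>R ?e))"
    if "s \<in> {0..1}" for s
    using that by (simp add: G_def algebra_simps)
  have "continuous_on UNIV (partial_deriv j (partial_deriv i \<phi>))"
    by (intro smooth_on_imp_continuous_on smooth_on_partial_deriv \<phi>)
  then have "continuous_on {0..1} (\<lambda>t. partial_deriv j (partial_deriv i \<phi>) (x + t *\<^sub>R ?e))"
    by (rule continuous_on_compose2) (auto intro!: continuous_intros)
  then have "((\<lambda>s. integral {0..s} (\<lambda>t. partial_deriv j (partial_deriv i \<phi>) (x + t *\<^sub>R ?e))) has_real_derivative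
      partial_deriv j (partial_deriv i \<phi>) (x + 0 *\<^sub>R ?e)) (at 0 within {0..1})"
    by (rule integral_has_real_derivative) simp
  then have "((\<lambda>s. partial_deriv j \<phi> x + integral {0..s} (\<lambda>t. partial_deriv j (partial_deriv i \<phi>) (x + t *\<^sub>R ?e)))
      has_real_derivative partial_deriv j (partial_deriv i \<phi>) x) (at 0 within {0..1})"
    by (auto intro!: derivative_eq_intros)
  then have 1: "((\<lambda>s. partial_deriv j \<phi> (x + s *\<^sub>R ?e))
      has_real_derivative partial_deriv j (partial_deriv i \<phi>) x) (at 0 within {0..1})"
    by (rule has_field_derivative_transform_within[where d=1]) (use eq in auto)
  have 2: "((\<lambda>s. partial_deriv j \<phi> (x + s *\<^sub>R ?e))
      has_real_derivative partial_deriv i (partial_deriv j \<phi>) x) (at 0 within {0..1})"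
    using line[OF sm(2), of x 0] by simp
  \<comment> \<open>The increment formula is available only for \<open>s \<ge> 0\<close>, so both
    derivatives are one-sided; at an endpoint of a nondegenerate interval such a derivative is still
    unique.\<close>
  have nt: "at (0::real) within {0..1} \<noteq> bot"
    by (simp add: trivial_limit_within islimpt_Icc)
  show "partial_deriv i (partial_deriv j \<phi>) x = partial_deriv j (partial_deriv i \<phi>) x"
    using vector_derivative_unique_within[OF nt] 1 2
    unfolding has_real_derivative_iff_has_vector_derivative by blast
qed

section \<open>Independence of the order of differentiation\<close>

lemma foldr_partial_deriv_move:
  fixes \<phi> :: "real^'n::finite \<Rightarrow> real"
  assumes "smooth_on UNIV \<phi>"
  shows "foldr partial_deriv is (partial_deriv i \<phi>) = partial_deriv i (foldr partial_deriv is \<phi>)"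
  by (induction "is") (simp_all add: partial_deriv_commute[OF smooth_on_foldr_partial_deriv[OF assms]])

lemma foldr_partial_deriv_mset:
  fixes \<phi> :: "real^'n::finite \<Rightarrow> real"
  assumes "smooth_on UNIV \<phi>" "mset is = mset js"
  shows "foldr partial_deriv is \<phi> = foldr partial_deriv js \<phi>"
  using assms(2)
proof (induction "is" arbitrary: js)
  case (Cons i "is")
  then have "i \<in> set js" by (metis list.set_intros(1) mset_eq_setD)
  then obtain js1 js2 where js: "js = js1 @ i # js2" by (meson split_list)
  then have "mset is = mset (js1 @ js2)" using Cons.prems by simp
  then have "foldr partial_deriv is \<phi> = foldr partial_deriv (js1 @ js2) \<phi>" by (rule Cons.IH)
  then show ?case
    using foldr_partial_deriv_move[OF smooth_on_foldr_partial_deriv[OF assms(1)], of js1 i js2]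
    by (simp add: js)
qed simp

text \<open>A multi-index derivative becomes a fold over this list of directions, so identities
  between such derivatives of smooth scalar functions reduce to equality of multisets.\<close>

definition mi_list :: "('n::finite \<Rightarrow> nat) \<Rightarrow> 'n list" where
  "mi_list \<alpha> = concat (map (\<lambda>i. replicate (\<alpha> i) i) coord_list)"

lemma coord_list: "distinct (coord_list :: 'n::finite list)" "set (coord_list :: 'n list) = UNIV"
proof -
  have "\<exists>is::'n list. distinct is \<and> set is = UNIV" using finite_distinct_list[OF finite_class.finite_UNIV] by blast
  then have "distinct (coord_list :: 'n list) \<and> set (coord_list :: 'n list) = UNIV"
    unfolding coord_list_def by (rule someI_ex)
  then show "distinct (coord_list :: 'n list)" "set (coord_list :: 'n list) = UNIV" by auto
qed

lemma mi_deriv_eq_foldr: "mi_deriv \<alpha> f = foldr partial_deriv (mi_list \<alpha>) f"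
proof -
  have rep: "foldr partial_deriv (replicate m i) g = (partial_deriv i ^^ m) g" for m i and g :: "real^'a \<Rightarrow> 'b"
    by (induction m) auto
  have "foldr (\<lambda>i. partial_deriv i ^^ \<alpha> i) is f = foldr partial_deriv (concat (map (\<lambda>i. replicate (\<alpha> i) i) is)) f"
    for "is" by (induction "is") (auto simp: rep)
  then show ?thesis by (simp add: mi_deriv_def mi_list_def)
qed

lemma count_mset_mi_list: "count (mset (mi_list \<alpha>)) i = \<alpha> i"
proof -
  have *: "distinct is \<Longrightarrow> count (mset (concat (map (\<lambda>i. replicate (\<alpha> i) i) is))) i = (if i \<in> set is then \<alpha> i else 0)"
    for "is" :: "'a list" by (induction "is") (auto simp: count_mset count_list_0_iff)
  show ?thesis using *[OF coord_list(1)] by (simp only: mi_list_def coord_list(2)) simp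
qed

lemma length_mi_list: "length (mi_list \<alpha>) = mi_abs \<alpha>"
proof -
  have "size (mset (mi_list \<alpha>)) = (\<Sum>i\<in>set_mset (mset (mi_list \<alpha>)). \<alpha> i)"
    by (simp add: size_multiset_overloaded_eq count_mset_mi_list)
  also have "\<dots> = (\<Sum>i\<in>UNIV. \<alpha> i)"
    using count_mset_mi_list[of \<alpha>] by (intro sum.mono_neutral_left) (auto simp: count_eq_zero_iff[symmetric] simp del: set_mset_mset)
  finally show ?thesis by (simp add: mi_abs_def)
qed

lemma mi_deriv_partial_deriv:
  fixes \<phi> :: "real^'n::finite \<Rightarrow> real"
  assumes "smooth_on UNIV \<phi>"
  shows "mi_deriv \<alpha> (partial_deriv i \<phi>) = mi_deriv (\<alpha>(i := Suc (\<alpha> i))) \<phi>"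
proof -
  have "mset (mi_list \<alpha> @ [i]) = mset (mi_list (\<alpha>(i := Suc (\<alpha> i))))"
    by (intro multiset_eqI) (simp only: mset_append count_union count_mset_mi_list, simp)
  from foldr_partial_deriv_mset[OF assms this] show ?thesis by (simp add: mi_deriv_eq_foldr)
qed

lemma mi_deriv_0 [simp]: "mi_deriv (\<lambda>_. 0) f = f" "mi_deriv 0 f = f"
proof -
  have "mi_list (\<lambda>_. 0) = ([] :: 'a list)" using length_mi_list[of "\<lambda>_::'a. 0"] by (simp add: mi_abs_def)
  then show "mi_deriv (\<lambda>_. 0) f = f" by (simp add: mi_deriv_eq_foldr)
  then show "mi_deriv 0 f = f" by (simp add: zero_fun_def)
qed


section \<open>Test functions\<close>

abbreviation supp :: "(real^'n::finite \<Rightarrow> 'a::zero) \<Rightarrow> (real^'n) set" where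
  "supp \<phi> \<equiv> closure {x. \<phi> x \<noteq> 0}"

lemma test_functionsD:
  assumes "\<phi> \<in> test_functions \<Omega>"
  shows "smooth_on UNIV \<phi>" "compact (supp \<phi>)" "supp \<phi> \<subseteq> \<Omega>" "continuous_on S \<phi>"
    "\<phi> differentiable (at x)"
  using assms smooth_on_imp_continuous_on[of UNIV \<phi>] continuous_on_subset[of UNIV \<phi> S]
    smooth_onD[of UNIV \<phi> x]
  by (auto simp: test_functions_def)

lemma test_functionsI:
  assumes "smooth_on UNIV \<phi>" "compact K" "K \<subseteq> \<Omega>" "\<And>x. x \<notin> K \<Longrightarrow> \<phi> x = 0"
  shows "\<phi> \<in> test_functions \<Omega>"
proof -
  have "supp \<phi> \<subseteq> K" using assms by (intro closure_minimal compact_imp_closed) auto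
  moreover from this have "compact (supp \<phi>)"
    using assms(2) by (metis closed_closure compact_Int_closed inf.absorb_iff2)
  ultimately show ?thesis using assms by (auto simp: test_functions_def)
qed

lemma supp_zero: "x \<notin> supp \<phi> \<Longrightarrow> \<phi> x = 0"
  using closure_subset[of "{x. \<phi> x \<noteq> 0}"] by blast

lemma test_function_zero: "\<phi> \<in> test_functions \<Omega> \<Longrightarrow> x \<notin> \<Omega> \<Longrightarrow> \<phi> x = 0"
  using test_functionsD(3) supp_zero by blast

lemma test_functions_mono: "\<phi> \<in> test_functions S \<Longrightarrow> S \<subseteq> T \<Longrightarrow> \<phi> \<in> test_functions T"
  by (auto simp: test_functions_def)

lemma test_functions_0 [simp]: "(\<lambda>_. 0) \<in> test_functions S"
  by (rule test_functionsI[of _ "{}"]) auto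

lemma test_functions_add:
  assumes "\<phi> \<in> test_functions \<Omega>" "\<psi> \<in> test_functions \<Omega>"
  shows "(\<lambda>x. \<phi> x + \<psi> x) \<in> test_functions \<Omega>"
proof (rule test_functionsI[of _ "supp \<phi> \<union> supp \<psi>"])
  fix x assume "x \<notin> supp \<phi> \<union> supp \<psi>"
  then have "\<phi> x = 0" "\<psi> x = 0" by (auto intro: supp_zero)
  then show "\<phi> x + \<psi> x = 0" by simp
qed (use assms in \<open>auto simp: test_functions_def intro: smooth_on_add\<close>)

text \<open>Smoothness is a condition at each point, and the points outside \<open>K\<close> have a
  neighbourhood on which \<open>f\<close> vanishes. This makes products of test functions with
  functions smooth only on \<open>\<Omega>\<close> globally smooth.\<close>

lemma smooth_on_extend_zero:
  fixes f :: "real^'n::finite \<Rightarrow> 'a::real_normed_vector"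
  assumes "smooth_on S f" "closed K" "K \<subseteq> S" "\<And>x. x \<notin> K \<Longrightarrow> f x = 0"
  shows "smooth_on UNIV f"
proof -
  have "smooth_on (- K) f \<longleftrightarrow> smooth_on (- K) (\<lambda>_. 0 :: 'a)"
    using assms by (intro smooth_on_cong) auto
  then have "smooth_on (S \<union> - K) f" using assms(1) by (intro smooth_on_Un) auto
  moreover have "S \<union> - K = UNIV" using assms(3) by auto
  ultimately show ?thesis by simp
qed

lemma test_functions_mult:
  assumes \<phi>: "\<phi> \<in> test_functions \<Omega>" and u: "smooth_on \<Omega> u" and \<Omega>: "open \<Omega>"
  shows "(\<lambda>x. \<phi> x * u x) \<in> test_functions \<Omega>"
proof (rule test_functionsI[of _ "supp \<phi>"])
  show "smooth_on UNIV (\<lambda>x. \<phi> x * u x)"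
    using test_functionsD[OF \<phi>] smooth_on_subset[of UNIV \<phi> \<Omega>]
    by (intro smooth_on_extend_zero[of \<Omega> _ "supp \<phi>"] smooth_on_mult u \<Omega>) (auto dest: supp_zero)
qed (use test_functionsD[OF \<phi>] in \<open>auto dest: supp_zero\<close>)

lemma test_functions_cmult:
  assumes \<phi>: "\<phi> \<in> test_functions \<Omega>"
  shows "(\<lambda>x. c * \<phi> x) \<in> test_functions \<Omega>"
  using test_functionsD[OF \<phi>]
  by (intro test_functionsI[of _ "supp \<phi>"] smooth_on_cmult) (auto dest: supp_zero)

lemma partial_deriv_outside_supp:
  assumes "x \<notin> supp \<phi>"
  shows "partial_deriv i \<phi> x = 0"
proof -
  have "partial_deriv i \<phi> x = partial_deriv i (\<lambda>_. 0) x"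
    using assms by (intro partial_deriv_cong_open[of "- supp \<phi>"]) (auto dest: supp_zero simp: open_Compl)
  then show ?thesis by simp
qed

lemma test_functions_partial_deriv:
  assumes \<phi>: "\<phi> \<in> test_functions \<Omega>"
  shows "partial_deriv i \<phi> \<in> test_functions \<Omega>"
  using test_functionsD[OF \<phi>]
  by (intro test_functionsI[of _ "supp \<phi>"] smooth_on_partial_deriv) (auto simp: partial_deriv_outside_supp)

lemma test_functions_foldr_partial_deriv:
  "\<phi> \<in> test_functions \<Omega> \<Longrightarrow> foldr partial_deriv is \<phi> \<in> test_functions \<Omega>"
  by (induction "is") (auto intro: test_functions_partial_deriv)

lemma test_functions_mi_deriv: "\<phi> \<in> test_functions \<Omega> \<Longrightarrow> mi_deriv \<alpha> \<phi> \<in> test_functions \<Omega>"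
  unfolding mi_deriv_eq_foldr by (rule test_functions_foldr_partial_deriv)

lemma test_functions_funpow_partial_deriv:
  "\<phi> \<in> test_functions \<Omega> \<Longrightarrow> (partial_deriv i ^^ m) \<phi> \<in> test_functions \<Omega>"
  by (induction m) (auto intro: test_functions_partial_deriv)

text \<open>The numerators of the derivatives of \<open>exp (- 1 / t)\<close>, as polynomials in \<open>1 / t\<close>.\<close>

primrec bump_poly :: "nat \<Rightarrow> real poly" where
  "bump_poly 0 = 1"
| "bump_poly (Suc m) = monom 1 2 * (bump_poly m - pderiv (bump_poly m))"

definition bump_fun :: "nat \<Rightarrow> real \<Rightarrow> real" where
  "bump_fun m t = (if t > 0 then poly (bump_poly m) (1 / t) * exp (- (1 / t)) else 0)"

text \<open>The factor \<open>y ^ k\<close> is carried along for the induction over the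
  coefficients: splitting off the constant term of \<open>pCons a p\<close> leaves \<open>p\<close>
  with the exponent raised by one.\<close>

lemma poly_div_exp_tendsto_0: "((\<lambda>y::real. y ^ k * poly p y / exp y) \<longlongrightarrow> 0) at_top"
proof (induction p arbitrary: k)
  case (pCons a p)
  have "((\<lambda>y. a * (y ^ k / exp y) + y ^ Suc k * poly p y / exp y) \<longlongrightarrow> a * 0 + 0) at_top"
    by (intro tendsto_intros tendsto_power_div_exp_0 pCons.IH)
  then show ?case by (simp add: field_simps)
qed simp

lemma bump_fun_has_derivative: "(bump_fun m has_real_derivative bump_fun (Suc m) t) (at t)"
proof (cases t "0::real" rule: linorder_cases)
  case less
  have "(bump_fun m has_real_derivative 0) (at t)"
    by (rule has_field_derivative_transform_within_open[of "\<lambda>_. 0" _ _ "{..<0}"])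
      (use less in \<open>auto simp: bump_fun_def\<close>)
  then show ?thesis using less by (simp add: bump_fun_def)
next
  case greater
  have "((\<lambda>t. poly (bump_poly m) (1 / t) * exp (- (1 / t))) has_real_derivative bump_fun (Suc m) t) (at t)"
    using greater
    by (auto intro!: derivative_eq_intros poly_DERIV[THEN DERIV_chain2]
        simp: bump_fun_def poly_monom divide_simps power2_eq_square) (auto simp: algebra_simps)
  then show ?thesis
    by (rule has_field_derivative_transform_within_open[of _ _ _ "{0<..}"])
      (use greater in \<open>auto simp: bump_fun_def\<close>)
next
  \<comment> \<open>With \<open>y = 1 / h\<close> the right-hand difference quotient is
    \<open>y p(y) / exp y\<close>, which tends to 0; the left-hand one is identically 0.\<close>
  case equal
  have "((\<lambda>h. 1 / h ^ 1 * poly (bump_poly m) (1 / h) / exp (1 / h)) \<longlongrightarrow> 0) (at_right 0)"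
    using poly_div_exp_tendsto_0[of 1 "bump_poly m"] filterlim_inverse_at_top_right
    by (auto simp: inverse_eq_divide dest: filterlim_compose)
  then have "((\<lambda>h. bump_fun m h / h) \<longlongrightarrow> 0) (at_right 0)"
    by (rule Lim_transform_eventually)
      (auto simp: eventually_at_right_field bump_fun_def exp_minus field_simps intro!: exI[of _ 1])
  moreover have "((\<lambda>h. bump_fun m h / h) \<longlongrightarrow> 0) (at_left 0)"
    by (rule Lim_transform_eventually[of "\<lambda>_. 0"])
      (auto simp: eventually_at_left_field bump_fun_def intro!: exI[of _ "-1"])
  ultimately have "((\<lambda>h. bump_fun m h / h) \<longlongrightarrow> 0) (at 0)" by (simp add: filterlim_split_at)
  then show ?thesis using equal by (simp add: DERIV_def bump_fun_def)
qed

text \<open>The squared distance is a polynomial in \<open>x\<close>, so smoothness follows by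
  composing it with the family \<open>bump_fun\<close>.\<close>

definition bump :: "real^'n::finite \<Rightarrow> real \<Rightarrow> real^'n \<Rightarrow> real" where
  "bump x0 r x = bump_fun 0 (r\<^sup>2 - (x - x0) \<bullet> (x - x0))"

lemma bump_pos: "r > 0 \<Longrightarrow> x \<in> ball x0 r \<Longrightarrow> bump x0 r x > 0"
  and bump_zero: "r > 0 \<Longrightarrow> x \<notin> ball x0 r \<Longrightarrow> bump x0 r x = 0"
  and bump_nonneg: "bump x0 r x \<ge> 0"
proof -
  have "(x - x0) \<bullet> (x - x0) = (dist x0 x)\<^sup>2" by (simp add: dist_norm power2_norm_eq_inner norm_minus_commute)
  moreover have "(dist x0 x)\<^sup>2 < r\<^sup>2 \<longleftrightarrow> dist x0 x < r" if "r > 0" using that by (simp add: power_mono_iff not_le[symmetric])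
  ultimately show "r > 0 \<Longrightarrow> x \<in> ball x0 r \<Longrightarrow> bump x0 r x > 0"
    "r > 0 \<Longrightarrow> x \<notin> ball x0 r \<Longrightarrow> bump x0 r x = 0" "bump x0 r x \<ge> 0"
    by (auto simp: bump_def bump_fun_def)
qed

lemma bump_test_function:
  assumes "r > 0" "cball x0 r \<subseteq> \<Omega>"
  shows "bump x0 r \<in> test_functions \<Omega>"
proof (rule test_functionsI[of _ "cball x0 r"])
  have "real_polynomial_function (\<lambda>x. x \<bullet> b - x0 \<bullet> b)" for b
    by (intro real_polynomial_function_diff real_polynomial_function.intros(1,2) bounded_linear_inner_left)
  then have "real_polynomial_function (\<lambda>x. \<Sum>b\<in>Basis. (x \<bullet> b - x0 \<bullet> b) * (x \<bullet> b - x0 \<bullet> b))"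
    by (intro real_polynomial_function_sum real_polynomial_function.intros(4)) auto
  moreover have "(\<lambda>x. (x - x0) \<bullet> (x - x0)) =
    (\<lambda>x. \<Sum>b\<in>Basis. (x \<bullet> b - x0 \<bullet> b) * (x \<bullet> b - x0 \<bullet> b))"
    by (intro ext, subst euclidean_inner) (simp add: inner_diff_left)
  ultimately have "polynomial_function (\<lambda>x. (x - x0) \<bullet> (x - x0))"
    by (simp only: real_polynomial_function_eq)
  then have "polynomial_function (\<lambda>x. r\<^sup>2 - (x - x0) \<bullet> (x - x0))"
    by (intro polynomial_function_diff polynomial_function_const)
  then show "smooth_on UNIV (bump x0 r)"
    unfolding smooth_on_iff_k_diff bump_def
    by (intro allI k_diff_compose_real bump_fun_has_derivative smooth_on_polynomial_function) auto
qed (use assms in \<open>auto intro: bump_zero\<close>)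

section \<open>Functionals with vanishing gradient\<close>

lemma compact_support_integrable:
  fixes f :: "real^'n::finite \<Rightarrow> 'b::euclidean_space"
  assumes f: "continuous_on UNIV f" and K: "compact K" "\<And>x. x \<notin> K \<Longrightarrow> f x = 0"
  shows "integrable lborel f" and "integrable lebesgue f"
    and "integral\<^sup>L lebesgue f = integral\<^sup>L lborel f"
proof -
  have eq: "f = (\<lambda>x. indicator K x *\<^sub>R f x)" using K(2) by (auto simp: indicator_def fun_eq_iff)
  show 1: "integrable lborel f"
    using borel_integrable_compact[OF K(1) continuous_on_subset[OF f subset_UNIV]] eq by metis
  have m: "f \<in> borel_measurable lborel" using 1 by simp
  show "integrable lebesgue f" using 1 integrable_completion[OF m] by simp
  show "integral\<^sup>L lebesgue f = integral\<^sup>L lborel f" using integral_completion[OF m] .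
qed

text \<open>Parameter integrals are gauge integrals over boxes, while reflections and translations
  are carried out with Lebesgue integrals over the whole space; this is the passage between the
  two.\<close>

lemma integral_cbox_compact_support:
  fixes f :: "real^'n::finite \<Rightarrow> 'b::euclidean_space"
  assumes f: "continuous_on UNIV f" and K: "\<And>x. x \<notin> cbox a b \<Longrightarrow> f x = 0"
  shows "integral (cbox a b) f = integral\<^sup>L lborel f"
proof -
  have eq: "(\<lambda>x. if x \<in> cbox a b then f x else 0) = f" using K by (auto simp: fun_eq_iff)
  have "integral (cbox a b) f = integral UNIV f"
    using Henstock_Kurzweil_Integration.integral_restrict_UNIV[of "cbox a b" f] unfolding eq by simp
  then show ?thesis
    using integral_lborel[OF compact_support_integrable(1)[OF f compact_cbox K]] by simp
qed

text \<open>One reflection gives the commutativity of convolution, two in succession give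
  translation invariance.\<close>

lemma lborel_integral_reflect:
  fixes f :: "real^'n::finite \<Rightarrow> 'b::euclidean_space"
  assumes "f \<in> borel_measurable borel"
  shows "(\<integral>t. f (c - t) \<partial>lborel) = (\<integral>t. f t \<partial>lborel)"
proof -
  have "lborel = distr lborel borel (\<lambda>x::real^'n. c - x)"
    using lborel_affine[of "-1" c] by (simp add: density_1)
  then have "(\<integral>t. f t \<partial>lborel) = (\<integral>t. f t \<partial>distr lborel borel (\<lambda>x. c - x))" by metis
  also have "\<dots> = (\<integral>t. f (c - t) \<partial>lborel)" using assms by (intro integral_distr) auto
  finally show ?thesis ..
qed

lemma test_function_integrable:
  assumes "\<phi> \<in> test_functions \<Omega>"
  shows "integrable lborel \<phi>" "integral\<^sup>L lebesgue \<phi> = integral\<^sup>L lborel \<phi>"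
  using compact_support_integrable[OF test_functionsD(4)[OF assms] test_functionsD(2)[OF assms]]
    supp_zero by blast+

lemma integral_partial_deriv_test_function:
  fixes \<phi> :: "real^'n::finite \<Rightarrow> real"
  assumes \<phi>: "\<phi> \<in> test_functions \<Omega>"
  shows "integral\<^sup>L lborel (partial_deriv i \<phi>) = 0"
proof -
  text \<open>The integral of \<open>x \<mapsto> \<phi> (x + y)\<close> over a large box does not depend on \<open>y\<close>; differentiate
    in \<open>y\<close> at \<open>0\<close>.\<close>
  have sm: "smooth_on UNIV \<phi>" and cp: "compact (supp \<phi>)" using test_functionsD[OF \<phi>] by auto
  obtain c where c: "c > 0" "supp \<phi> \<subseteq> ball 0 c" using compact_imp_bounded[OF cp] bounded_subset_ballD by metis
  \<comment> \<open>The margin 1 keeps the support inside the box for every translation by a vector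
    of the unit ball, so \<open>F\<close> is constant there.\<close>
  have "bounded (ball (0::real^'n) (c + 1))" by simp
  then obtain a where a: "ball (0::real^'n) (c + 1) \<subseteq> cbox (- a) a" using bounded_subset_cbox_symmetric by metis
  define F where "F y = integral (cbox (- a) a) (\<lambda>t. 1 * \<phi> (y + t))" for y
  note PI = parameter_integral[OF sm, of "- a" a "\<lambda>_. 1" "\<lambda>t. t", folded F_def]
  have ci: "continuous_on UNIV (\<lambda>t. \<phi> (y + t))" for y
    by (intro continuous_on_compose2[OF test_functionsD(4)[OF \<phi>, of UNIV]] continuous_intros) auto
  have F: "F y = integral\<^sup>L lborel \<phi>" if "y \<in> ball 0 1" for y
  proof -
    have "\<phi> (y + t) = 0" if "t \<notin> cbox (- a) a" for t
    proof (rule supp_zero, rule notI)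
      assume "y + t \<in> supp \<phi>"
      then have "norm (y + t) < c" using c by auto
      moreover have "norm y < 1" using \<open>y \<in> ball 0 1\<close> by simp
      ultimately have "norm t < c + 1" using norm_triangle_ineq4[of "y + t" y] by simp
      then show False using a that by auto
    qed
    then have "F y = (\<integral>t. \<phi> (y + t) \<partial>lborel)"
      using integral_cbox_compact_support[OF ci, of "- a" a y] by (simp add: F_def)
    also have "\<dots> = (\<integral>t. \<phi> (y - t) \<partial>lborel)"
      using lborel_integral_reflect[of "\<lambda>t. \<phi> (y - t)" 0] ci[of y]
        borel_measurable_continuous_onI[of "\<lambda>t. \<phi> (y - t)"]
        continuous_on_compose2[OF test_functionsD(4)[OF \<phi>, of UNIV], of UNIV "\<lambda>t. y - t"]
      by (simp add: continuous_intros)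
    also have "\<dots> = integral\<^sup>L lborel \<phi>"
      using borel_measurable_continuous_onI[OF test_functionsD(4)[OF \<phi>, of UNIV]]
      by (rule lborel_integral_reflect)
    finally show ?thesis .
  qed
  have "partial_deriv i F 0 = partial_deriv i (\<lambda>_. integral\<^sup>L lborel \<phi>) 0"
    using F by (intro partial_deriv_cong_open[of "ball 0 1"]) auto
  then have "partial_deriv i F 0 = 0" by simp
  moreover have "partial_deriv i F 0 = integral (cbox (- a) a) (\<lambda>t. 1 * partial_deriv i \<phi> (0 + t))"
    by (subst parameter_integral(2)[OF sm, of "- a" a "\<lambda>_. 1" "\<lambda>t. t" i, folded F_def]) auto
  moreover have "partial_deriv i \<phi> t = 0" if "t \<notin> cbox (- a) a" for t
    using that a c by (intro partial_deriv_outside_supp) (force simp: subset_eq)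
  ultimately show ?thesis
    using integral_cbox_compact_support[OF smooth_on_imp_continuous_on[OF smooth_on_partial_deriv[OF sm]]]
    by fastforce
qed

text \<open>The algebraic part of being a distribution. It passes to the auxiliary functionals
  obtained below by composing with derivatives and with multiplication by coordinates.\<close>

definition linear_on_tests :: "(real^'n::finite) set \<Rightarrow> ((real^'n \<Rightarrow> real) \<Rightarrow> 'v::real_vector) \<Rightarrow> bool" where
  "linear_on_tests \<Omega> T \<longleftrightarrow>
     (\<forall>\<phi>\<in>test_functions \<Omega>. \<forall>\<psi>\<in>test_functions \<Omega>. T (\<lambda>x. \<phi> x + \<psi> x) = T \<phi> + T \<psi>) \<and>
     (\<forall>\<phi>\<in>test_functions \<Omega>. \<forall>c. T (\<lambda>x. c * \<phi> x) = c *\<^sub>R T \<phi>)"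

lemma linear_on_testsD:
  assumes "linear_on_tests \<Omega> T"
  shows "\<phi> \<in> test_functions \<Omega> \<Longrightarrow> \<psi> \<in> test_functions \<Omega> \<Longrightarrow> T (\<lambda>x. \<phi> x + \<psi> x) = T \<phi> + T \<psi>"
    "\<phi> \<in> test_functions \<Omega> \<Longrightarrow> T (\<lambda>x. c * \<phi> x) = c *\<^sub>R T \<phi>"
    "T (\<lambda>_. 0) = 0"
proof -
  have *: "T (\<lambda>x. c * \<phi> x) = c *\<^sub>R T \<phi>" if "\<phi> \<in> test_functions \<Omega>" for \<phi> c
    using assms that by (auto simp: linear_on_tests_def)
  show "\<phi> \<in> test_functions \<Omega> \<Longrightarrow> \<psi> \<in> test_functions \<Omega> \<Longrightarrow> T (\<lambda>x. \<phi> x + \<psi> x) = T \<phi> + T \<psi>"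
    using assms by (auto simp: linear_on_tests_def)
  show "\<phi> \<in> test_functions \<Omega> \<Longrightarrow> T (\<lambda>x. c * \<phi> x) = c *\<^sub>R T \<phi>" by (rule *)
  show "T (\<lambda>_. 0) = 0" using *[OF test_functions_0, of 0] by simp
qed

lemma linear_on_tests_sum:
  assumes "linear_on_tests \<Omega> T" "finite I" "\<And>i. i \<in> I \<Longrightarrow> \<phi> i \<in> test_functions \<Omega>"
  shows "(\<lambda>x. \<Sum>i\<in>I. \<phi> i x) \<in> test_functions \<Omega> \<and> T (\<lambda>x. \<Sum>i\<in>I. \<phi> i x) = (\<Sum>i\<in>I. T (\<phi> i))"
  using assms(2,3)
  by (induction I rule: finite_induct)
    (auto simp: linear_on_testsD[OF assms(1)] test_functions_add)

lemma linear_on_tests_mono: "linear_on_tests \<Omega> T \<Longrightarrow> S \<subseteq> \<Omega> \<Longrightarrow> linear_on_tests S T"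
  unfolding linear_on_tests_def using test_functions_mono by meson

text \<open>Points are displaced by at most \<open>r\<close> before \<open>\<phi>\<close>, supported
  in the ball of radius \<open>r\<close>, is evaluated; hence the doubled radius.\<close>

lemma conv_test_function:
  fixes \<phi> :: "real^'n::finite \<Rightarrow> real"
  assumes \<phi>: "\<phi> \<in> test_functions (ball x0 r)" and g: "continuous_on (cbox a b) g"
    and L: "continuous_on (cbox a b) L"
    and small: "\<And>t. t \<in> cbox a b \<Longrightarrow> g t \<noteq> 0 \<Longrightarrow> norm (L t) \<le> r"
    and \<Omega>: "cball x0 (2 * r) \<subseteq> \<Omega>"
  shows "(\<lambda>x. integral (cbox a b) (\<lambda>t. g t * \<phi> (x + L t))) \<in> test_functions \<Omega>"
proof (rule test_functionsI[of _ "cball x0 (2 * r)"])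
  show "smooth_on UNIV (\<lambda>x. integral (cbox a b) (\<lambda>t. g t * \<phi> (x + L t)))"
    by (rule parameter_integral(3)[OF test_functionsD(1)[OF \<phi>] g L])
  fix x assume x: "x \<notin> cball x0 (2 * r)"
  have "g t * \<phi> (x + L t) = 0" if t: "t \<in> cbox a b" for t
  proof (cases "g t = 0")
    case False
    then have "norm (L t) \<le> r" using small t by auto
    moreover have "norm (x - x0) \<le> norm (x + L t - x0) + norm (L t)"
      using norm_triangle_ineq4[of "x + L t - x0" "L t"] by (simp add: algebra_simps)
    ultimately have "norm (x + L t - x0) > r" using x by (simp add: dist_norm norm_minus_commute)
    then have "x + L t \<notin> ball x0 r" by (simp add: dist_norm norm_minus_commute)
    then show ?thesis using test_function_zero[OF \<phi>] by simp
  qed simp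
  then show "integral (cbox a b) (\<lambda>t. g t * \<phi> (x + L t)) = 0"
    using integral_cong[of "cbox a b" "\<lambda>t. g t * \<phi> (x + L t)" "\<lambda>_. 0"] by simp
qed (use \<Omega> in auto)

text \<open>If \<open>T\<close> annihilates all gradients, then \<open>T \<phi> \<integral>\<psi> = T (\<phi> * \<psi>)\<close> for the convolution
  centred at \<open>x0\<close>, because \<open>\<phi> - \<phi>(\<cdot> - h)\<close> is a divergence.\<close>

lemma conv_functional:
  fixes \<phi> \<psi> :: "real^'n::finite \<Rightarrow> real" and T :: "(real^'n \<Rightarrow> real) \<Rightarrow> 'v::real_vector"
  assumes T: "linear_on_tests \<Omega> T" and D: "\<And>\<phi> i. \<phi> \<in> test_functions \<Omega> \<Longrightarrow> T (partial_deriv i \<phi>) = 0"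
    and \<phi>: "\<phi> \<in> test_functions (ball x0 r)" and \<psi>: "\<psi> \<in> test_functions (ball x0 r)"
    and r: "r > 0" and \<Omega>: "cball x0 (2 * r) \<subseteq> \<Omega>" and box: "ball x0 r \<subseteq> cbox a b"
  shows "integral\<^sup>L lborel \<psi> *\<^sub>R T \<phi> = T (\<lambda>x. integral (cbox a b) (\<lambda>h. \<psi> h * \<phi> (x + (x0 - h))))"
proof -
  note c\<phi> = test_functionsD(4)[OF \<phi>] and c\<psi> = test_functionsD(4)[OF \<psi>] and sm\<phi> = test_functionsD(1)[OF \<phi>]
  have cpd: "continuous_on S (partial_deriv i \<phi>)" for i S
    using test_functionsD(4)[OF test_functions_partial_deriv[OF \<phi>]] .
  have \<psi>0: "norm (x0 - h) \<le> r" if "\<psi> h \<noteq> 0" for h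
    using that test_function_zero[OF \<psi>, of h] by (force simp: dist_norm)
  define C where "C x = integral (cbox a b) (\<lambda>h. \<psi> h * \<phi> (x + (x0 - h)))" for x
  \<comment> \<open>The vector field whose divergence is the convolution minus \<open>\<phi>\<close>
    times the integral of \<open>\<psi>\<close>: it averages \<open>(x0 - h) \<phi>\<close> over the
    segment from \<open>x\<close> to \<open>x + (x0 - h)\<close>, weighted by
    \<open>\<psi> h\<close>. The argument \<open>\<kappa>\<close> lets the same formula express its
    derivatives.\<close>
  define G where "G i \<kappa> x = integral (cbox (a, 0) (b, 1::real))
      (\<lambda>p. (\<psi> (fst p) * (x0 - fst p) $ i) * \<kappa> (x + snd p *\<^sub>R (x0 - fst p)))"
    for i and \<kappa> :: "real^'n \<Rightarrow> real" and x
  have cg: "continuous_on (cbox (a, 0) (b, 1::real)) (\<lambda>p. \<psi> (fst p) * (x0 - fst p) $ i)" for i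
    by (intro continuous_intros continuous_on_compose2[OF c\<psi>[of UNIV]]) auto
  have cL: "continuous_on (cbox (a, 0) (b, 1::real)) (\<lambda>p. snd p *\<^sub>R (x0 - fst p))"
    by (intro continuous_intros)
  have G: "G i \<phi> \<in> test_functions \<Omega>" for i
    unfolding G_def
  proof (rule conv_test_function[OF \<phi> cg cL _ \<Omega>])
    fix p assume p: "p \<in> cbox (a, 0) (b, 1::real)" "\<psi> (fst p) * (x0 - fst p) $ i \<noteq> 0"
    then have "norm (x0 - fst p) \<le> r" "0 \<le> snd p" "snd p \<le> 1" using \<psi>0 by (auto simp: cbox_Pair_eq)
    then show "norm (snd p *\<^sub>R (x0 - fst p)) \<le> r"
      using mult_mono[of "snd p" 1 "norm (x0 - fst p)" r] r by simp
  qed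
  have pdG: "partial_deriv i (G i \<phi>) = G i (partial_deriv i \<phi>)" for i
    unfolding G_def by (rule parameter_integral(2)[OF sm\<phi> cg cL])
  have eq: "C x = integral\<^sup>L lborel \<psi> * \<phi> x + (\<Sum>i\<in>UNIV. partial_deriv i (G i \<phi>) x)" for x
  proof -
    define f where "f i p = (\<psi> (fst p) * (x0 - fst p) $ i) * partial_deriv i \<phi> (x + snd p *\<^sub>R (x0 - fst p))"
      for i and p :: "(real^'n) \<times> real"
    have cf: "continuous_on S (f i)" for i S
      unfolding f_def
      by (intro continuous_intros continuous_on_compose2[OF c\<psi>[of UNIV]] continuous_on_compose2[OF cpd[of UNIV]]) auto
    have line: "\<phi> (x + (x0 - h)) - \<phi> x =
        integral {0..1} (\<lambda>t. \<Sum>i\<in>UNIV. (x0 - h) $ i * partial_deriv i \<phi> (x + t *\<^sub>R (x0 - h)))" for h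
    proof -
      have "((\<lambda>t. \<Sum>i\<in>UNIV. (x0 - h) $ i * partial_deriv i \<phi> (x + t *\<^sub>R (x0 - h))) has_integral
        \<phi> (x + 1 *\<^sub>R (x0 - h)) - \<phi> (x + 0 *\<^sub>R (x0 - h))) {0..1}"
        by (rule fundamental_theorem_of_calculus)
          (simp, unfold has_real_derivative_iff_has_vector_derivative[symmetric],
            rule has_real_derivative_line[OF sm\<phi>])
      then show ?thesis by (simp add: has_integral_iff)
    qed
    have in1: "(\<lambda>h. \<psi> h * \<phi> (x + (x0 - h))) integrable_on cbox a b"
      by (intro integrable_continuous continuous_intros c\<psi> continuous_on_compose2[OF c\<phi>[of UNIV]]) auto
    have in2: "(\<lambda>h. \<psi> h * \<phi> x) integrable_on cbox a b"
      by (intro integrable_continuous continuous_intros c\<psi>)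
    have "\<psi> h * \<phi> (x + (x0 - h)) - \<psi> h * \<phi> x = (\<Sum>i\<in>UNIV. integral (cbox 0 1) (\<lambda>t. f i (h, t)))" for h
    proof -
      have "\<psi> h * \<phi> (x + (x0 - h)) - \<psi> h * \<phi> x = \<psi> h * (\<phi> (x + (x0 - h)) - \<phi> x)"
        by (simp add: right_diff_distrib)
      also have "\<dots> = integral {0..1} (\<lambda>t. \<Sum>i\<in>UNIV. f i (h, t))"
        unfolding line by (simp add: f_def sum_distrib_left mult_ac flip: integral_mult_right)
      also have "\<dots> = (\<Sum>i\<in>UNIV. integral {0..1} (\<lambda>t. f i (h, t)))"
        by (intro integral_sum finite integrable_continuous_interval
            continuous_on_compose2[OF cf[of UNIV]] continuous_intros) auto
      finally show ?thesis by simp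
    qed
    then have "integral (cbox a b) (\<lambda>h. \<psi> h * \<phi> (x + (x0 - h)) - \<psi> h * \<phi> x) =
      integral (cbox a b) (\<lambda>h. \<Sum>i\<in>UNIV. integral (cbox 0 1) (\<lambda>t. f i (h, t)))" by simp
    also have "\<dots> = (\<Sum>i\<in>UNIV. integral (cbox a b) (\<lambda>h. integral (cbox 0 1) (\<lambda>t. f i (h, t))))"
    proof (intro integral_sum finite integrable_continuous)
      fix i
      show "continuous_on (cbox a b) (\<lambda>h. integral (cbox 0 1) (\<lambda>t. f i (h, t)))"
        by (rule integral_continuous_on_param) (auto intro: cf continuous_on_subset simp: case_prod_eta)
    qed
    also have "\<dots> = (\<Sum>i\<in>UNIV. integral (cbox (a, 0) (b, 1)) (f i))"
      by (simp add: integral_prod_continuous[OF cf])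
    also have "\<dots> = (\<Sum>i\<in>UNIV. partial_deriv i (G i \<phi>) x)"
      by (simp add: pdG G_def f_def[abs_def])
    also have "integral (cbox a b) (\<lambda>h. \<psi> h * \<phi> (x + (x0 - h)) - \<psi> h * \<phi> x) = C x - integral (cbox a b) \<psi> * \<phi> x"
      using in1 in2 by (simp add: integral_diff C_def)
    also have "integral (cbox a b) \<psi> = integral\<^sup>L lborel \<psi>"
      using box test_function_zero[OF \<psi>] by (intro integral_cbox_compact_support c\<psi>) blast
    finally show ?thesis by simp
  qed
  have \<phi>\<Omega>: "\<phi> \<in> test_functions \<Omega>"
    using \<phi> by (rule test_functions_mono) (use \<Omega> r in \<open>auto simp: subset_eq\<close>)
  have "T C = T (\<lambda>x. integral\<^sup>L lborel \<psi> * \<phi> x + (\<Sum>i\<in>UNIV. partial_deriv i (G i \<phi>) x))"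
    using ext[of C, OF eq] by (simp only:)
  also have "\<dots> = T (\<lambda>x. integral\<^sup>L lborel \<psi> * \<phi> x) + T (\<lambda>x. \<Sum>i\<in>UNIV. partial_deriv i (G i \<phi>) x)"
    using linear_on_tests_sum[OF T, of UNIV "\<lambda>i. partial_deriv i (G i \<phi>)"] G
    by (intro linear_on_testsD[OF T] test_functions_cmult \<phi>\<Omega>) (auto intro: test_functions_partial_deriv)
  also have "\<dots> = integral\<^sup>L lborel \<psi> *\<^sub>R T \<phi>"
    using linear_on_tests_sum[OF T, of UNIV "\<lambda>i. partial_deriv i (G i \<phi>)"] G \<phi>\<Omega>
    by (simp add: test_functions_partial_deriv D linear_on_testsD[OF T])
  finally show "integral\<^sup>L lborel \<psi> *\<^sub>R T \<phi> = T (\<lambda>x. integral (cbox a b) (\<lambda>h. \<psi> h * \<phi> (x + (x0 - h))))"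
    by (simp add: C_def[abs_def])
qed

lemma gradient_free_functional:
  fixes T :: "(real^'n::finite \<Rightarrow> real) \<Rightarrow> 'v::real_vector"
  assumes T: "linear_on_tests \<Omega> T" and D: "\<And>\<phi> i. \<phi> \<in> test_functions \<Omega> \<Longrightarrow> T (partial_deriv i \<phi>) = 0"
    and \<phi>: "\<phi> \<in> test_functions (ball x0 r)" and \<psi>: "\<psi> \<in> test_functions (ball x0 r)"
    and r: "r > 0" and \<Omega>: "cball x0 (2 * r) \<subseteq> \<Omega>"
  shows "integral\<^sup>L lborel \<psi> *\<^sub>R T \<phi> = integral\<^sup>L lborel \<phi> *\<^sub>R T \<psi>"
proof -
  obtain a where a: "ball x0 r \<subseteq> cbox (- a) a" using bounded_subset_cbox_symmetric[OF bounded_ball] by metis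
  have z: "\<phi> h = 0" "\<psi> h = 0" if "h \<notin> cbox (- a) a" for h
    using that a test_function_zero[OF \<phi>] test_function_zero[OF \<psi>] by blast+
  have "integral (cbox (- a) a) (\<lambda>h. \<psi> h * \<phi> (x + (x0 - h))) =
      integral (cbox (- a) a) (\<lambda>h. \<phi> h * \<psi> (x + (x0 - h)))" for x
  proof -
    have c: "continuous_on UNIV (\<lambda>h. \<psi> h * \<phi> (x + (x0 - h)))"
      "continuous_on UNIV (\<lambda>h. \<phi> h * \<psi> (x + (x0 - h)))"
      by (intro continuous_intros test_functionsD(4)[OF \<psi>] test_functionsD(4)[OF \<phi>]
        continuous_on_compose2[OF test_functionsD(4)[OF \<phi>, of UNIV]]
        continuous_on_compose2[OF test_functionsD(4)[OF \<psi>, of UNIV]]; simp)+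
    have "integral (cbox (- a) a) (\<lambda>h. \<psi> h * \<phi> (x + (x0 - h))) = (\<integral>h. \<psi> h * \<phi> (x + (x0 - h)) \<partial>lborel)"
      using z(2) by (intro integral_cbox_compact_support c) simp
    \<comment> \<open>Replacing \<open>h\<close> by \<open>x + x0 - h\<close> exchanges the
      arguments of the two factors and thereby the roles of \<open>\<phi>\<close> and
      \<open>\<psi>\<close>.\<close>
    also have "\<dots> = (\<integral>h. \<psi> (x + x0 - h) * \<phi> (x + (x0 - (x + x0 - h))) \<partial>lborel)"
      by (rule lborel_integral_reflect[symmetric]) (intro borel_measurable_continuous_onI c)
    also have "\<dots> = (\<integral>h. \<phi> h * \<psi> (x + (x0 - h)) \<partial>lborel)"
      by (simp add: algebra_simps)
    also have "\<dots> = integral (cbox (- a) a) (\<lambda>h. \<phi> h * \<psi> (x + (x0 - h)))"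
      using z(1) by (intro integral_cbox_compact_support[symmetric] c) simp
    finally show ?thesis .
  qed
  then show ?thesis
    using conv_functional[OF T D \<phi> \<psi> r \<Omega> a] conv_functional[OF T D \<psi> \<phi> r \<Omega> a] by simp
qed

section \<open>Functionals annihilating high derivatives are polynomials\<close>

lemma integral_bump_pos:
  assumes "r > 0"
  shows "integral\<^sup>L lborel (bump x0 r) > 0"
proof -
  have "bump x0 r \<in> test_functions UNIV" using assms by (intro bump_test_function) auto
  then have int: "integrable lborel (bump x0 r)" by (rule test_function_integrable)
  have "integral\<^sup>L lborel (bump x0 r) \<noteq> 0"
  proof
    assume "integral\<^sup>L lborel (bump x0 r) = 0"
    then have "AE x in lborel. bump x0 r x = 0"
      using integral_nonneg_eq_0_iff_AE[OF int] bump_nonneg by auto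
    then have "AE x in lborel. x \<notin> ball x0 r"
      by eventually_elim (use bump_pos[OF assms] in force)
    then have "AE x in lebesgue. x \<notin> ball x0 r" by (rule AE_completion)
    then have "negligible (ball x0 r)"
      by (simp add: negligible_iff_null_sets AE_iff_null_sets del: mem_ball)
    then show False using open_not_negligible[of "ball x0 r"] assms by auto
  qed
  moreover have "integral\<^sup>L lborel (bump x0 r) \<ge> 0" by (intro integral_nonneg_AE) (simp add: bump_nonneg)
  ultimately show ?thesis by simp
qed

lemma funpow_partial_deriv_foldr:
  "(partial_deriv i ^^ m) \<phi> = foldr partial_deriv (replicate m i) \<phi>"
  by (induction m) auto

lemma funpow_partial_deriv_commute:
  fixes \<phi> :: "real^'n::finite \<Rightarrow> real"
  assumes "smooth_on UNIV \<phi>"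
  shows "(partial_deriv i ^^ m) ((partial_deriv j ^^ l) \<phi>) = (partial_deriv j ^^ l) ((partial_deriv i ^^ m) \<phi>)"
  using foldr_partial_deriv_mset[OF assms, of "replicate m i @ replicate l j" "replicate l j @ replicate m i"]
  by simp

lemma partial_deriv_coord_power:
  "partial_deriv j (\<lambda>x::real^'n::finite. (x $ i) ^ m) x = (if i = j then real m * (x $ i) ^ (m - 1) else 0)"
proof -
  have "((\<lambda>x::real^'n. (x $ i) ^ m) has_derivative (\<lambda>v. real m * (x $ i) ^ (m - 1) * v $ i)) (at x)"
    by (rule has_derivative_eq_rhs, rule has_derivative_power,
        rule bounded_linear_imp_has_derivative[OF bounded_linear_vec_nth]) (simp add: mult_ac)
  then show ?thesis by (simp add: partial_deriv_eqI axis_def)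
qed

lemma polynomial_function_coord_power: "polynomial_function (\<lambda>x::real^'n::finite. (x $ i) ^ m)"
  unfolding real_polynomial_function_eq[symmetric]
  by (intro real_polynomial_function_power real_polynomial_function.intros(1) bounded_linear_vec_nth)

lemma smooth_on_coord_power: "smooth_on S (\<lambda>x::real^'n::finite. (x $ i) ^ m)"
  by (rule smooth_on_polynomial_function[OF polynomial_function_coord_power])

lemma partial_deriv_mult_coord_power:
  fixes \<phi> :: "real^'n::finite \<Rightarrow> real"
  assumes "smooth_on UNIV \<phi>"
  shows "partial_deriv j (\<lambda>x. \<phi> x * (x $ i) ^ m) =
    (\<lambda>x. partial_deriv j \<phi> x * (x $ i) ^ m + (if i = j then real m else 0) * (\<phi> x * (x $ i) ^ (m - 1)))"
proof
  fix x
  show "partial_deriv j (\<lambda>x. \<phi> x * (x $ i) ^ m) x =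
    partial_deriv j \<phi> x * (x $ i) ^ m + (if i = j then real m else 0) * (\<phi> x * (x $ i) ^ (m - 1))"
    by (subst partial_deriv_mult)
      (auto simp: partial_deriv_coord_power algebra_simps intro: smooth_onD[OF assms] smooth_onD[OF smooth_on_coord_power])
qed

lemma funpow_partial_deriv_mult_coord_power:
  fixes \<phi> :: "real^'n::finite \<Rightarrow> real"
  assumes "smooth_on UNIV \<phi>" "i \<noteq> j"
  shows "(partial_deriv j ^^ l) (\<lambda>x. \<phi> x * (x $ i) ^ m) = (\<lambda>x. (partial_deriv j ^^ l) \<phi> x * (x $ i) ^ m)"
proof (induction l)
  case (Suc l)
  have "smooth_on UNIV ((partial_deriv j ^^ l) \<phi>)"
    unfolding funpow_partial_deriv_foldr by (rule smooth_on_foldr_partial_deriv[OF assms(1)])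
  from partial_deriv_mult_coord_power[OF this, of j i m] show ?case using assms(2) by (simp add: Suc)
qed simp

lemma test_functions_mult_coord_power:
  "\<phi> \<in> test_functions \<Omega> \<Longrightarrow> open \<Omega> \<Longrightarrow> (\<lambda>x. \<phi> x * (x $ i) ^ m) \<in> test_functions \<Omega>"
  by (intro test_functions_mult smooth_on_coord_power)

text \<open>In terms of distributions: if \<open>\<partial>_i S = 0\<close>, then
  \<open>\<partial>_i^m (x_i^m S) = m! S\<close>. Since \<open>S\<close> annihilates the derivative
  of \<open>\<psi> x_i^(m+1)\<close>, the product rule contributes a factor \<open>-(m+1)\<close> at
  each step.\<close>

lemma functional_coord_power:
  fixes S :: "(real^'n::finite \<Rightarrow> real) \<Rightarrow> 'v::real_vector"
  assumes S: "linear_on_tests \<Omega> S" and \<Omega>: "open \<Omega>"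
    and D: "\<And>\<phi>. \<phi> \<in> test_functions \<Omega> \<Longrightarrow> S (partial_deriv i \<phi>) = 0"
    and \<phi>: "\<phi> \<in> test_functions \<Omega>"
  shows "S (\<lambda>x. (partial_deriv i ^^ m) \<phi> x * (x $ i) ^ m) = ((-1) ^ m * fact m) *\<^sub>R S \<phi>"
proof (induction m)
  case (Suc m)
  define \<psi> where "\<psi> = (partial_deriv i ^^ m) \<phi>"
  have \<psi>: "\<psi> \<in> test_functions \<Omega>" unfolding \<psi>_def by (rule test_functions_funpow_partial_deriv[OF \<phi>])
  have 1: "(\<lambda>x. partial_deriv i \<psi> x * (x $ i) ^ Suc m) \<in> test_functions \<Omega>"
    by (intro test_functions_mult_coord_power test_functions_partial_deriv \<psi> \<Omega>)
  have 2: "(\<lambda>x. \<psi> x * (x $ i) ^ m) \<in> test_functions \<Omega>"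
    by (intro test_functions_mult_coord_power \<psi> \<Omega>)
  have "0 = S (partial_deriv i (\<lambda>x. \<psi> x * (x $ i) ^ Suc m))"
    by (intro D[symmetric] test_functions_mult_coord_power \<psi> \<Omega>)
  also have "\<dots> = S (\<lambda>x. partial_deriv i \<psi> x * (x $ i) ^ Suc m + real (Suc m) * (\<psi> x * (x $ i) ^ m))"
    by (subst partial_deriv_mult_coord_power[OF test_functionsD(1)[OF \<psi>]]) simp
  also have "\<dots> = S (\<lambda>x. partial_deriv i \<psi> x * (x $ i) ^ Suc m) + S (\<lambda>x. real (Suc m) * (\<psi> x * (x $ i) ^ m))"
    by (rule linear_on_testsD(1)[OF S 1 test_functions_cmult[OF 2]])
  also have "S (\<lambda>x. real (Suc m) * (\<psi> x * (x $ i) ^ m)) = real (Suc m) *\<^sub>R S (\<lambda>x. \<psi> x * (x $ i) ^ m)"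
    by (rule linear_on_testsD(2)[OF S 2])
  finally have "S (\<lambda>x. partial_deriv i \<psi> x * (x $ i) ^ Suc m) = - (real (Suc m) *\<^sub>R S (\<lambda>x. \<psi> x * (x $ i) ^ m))"
    by (simp only: eq_neg_iff_add_eq_0)
  also have "S (\<lambda>x. \<psi> x * (x $ i) ^ m) = ((-1) ^ m * fact m) *\<^sub>R S \<phi>"
    unfolding \<psi>_def by (rule Suc)
  finally show ?case by (simp add: \<psi>_def mult_ac)
qed simp

text \<open>Induction on the total order of the exponents: \<open>S = \<partial>\<^sub>i\<^sup>m T\<close> with \<open>m = e i - 1\<close> satisfies
  \<open>\<partial>\<^sub>i S = 0\<close>, and subtracting a multiple of \<open>x\<^sub>i\<^sup>m S\<close> from \<open>T\<close> lowers the exponent \<open>e i\<close> to \<open>m\<close>.\<close>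

lemma nilpotent_functional_polynomial:
  fixes T :: "(real^'n::finite \<Rightarrow> real) \<Rightarrow> 'v::euclidean_space"
  assumes r: "r > 0" and T: "linear_on_tests (ball x0 (3 * r)) T"
    and e: "\<And>i \<phi>. \<phi> \<in> test_functions (ball x0 (3 * r)) \<Longrightarrow> T ((partial_deriv i ^^ e i) \<phi>) = 0"
  shows "\<exists>p. polynomial_function p \<and>
    (\<forall>\<phi>\<in>test_functions (ball x0 r). T \<phi> = (\<integral>x. \<phi> x *\<^sub>R p x \<partial>lborel))"
  using T e
proof (induction "\<Sum>i\<in>UNIV. e i" arbitrary: e T rule: less_induct)
  case less
  \<comment> \<open>The radius \<open>3 * r\<close> leaves room for the closed ball of radius
    \<open>2 * r\<close> that the convolution argument occupies.\<close>
  let ?B = "ball x0 (3 * r)"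
  have lin: "linear_on_tests ?B T" by (rule less.prems(1))
  have TF: "test_functions (ball x0 r) \<subseteq> test_functions ?B"
    using r by (auto intro: test_functions_mono)
  show ?case
  proof (cases "\<forall>i. e i \<le> 1")
    case True
    have D: "T (partial_deriv i \<phi>) = 0" if "\<phi> \<in> test_functions ?B" for i \<phi>
    proof (cases "e i")
      case 0
      then show ?thesis using less.prems(2)[of "partial_deriv i \<phi>" i] that test_functions_partial_deriv by auto
    next
      case (Suc l)
      then have "e i = 1" using True[rule_format, of i] by simp
      then show ?thesis using less.prems(2)[OF that, of i] by simp
    qed
    \<comment> \<open>A reference test function: once all first derivatives are annihilated,
      \<open>T\<close> is integration against the constant \<open>T \<psi>\<close> divided by the
      integral of \<open>\<psi>\<close>. The radius is halved so that the closed ball fits into the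
      open one.\<close>
    define \<psi> where "\<psi> = bump x0 (r / 2)"
    have \<psi>: "\<psi> \<in> test_functions (ball x0 r)"
      unfolding \<psi>_def using r by (intro bump_test_function) auto
    have I: "integral\<^sup>L lborel \<psi> > 0" unfolding \<psi>_def using r by (intro integral_bump_pos) simp
    have "T \<phi> = (\<integral>x. \<phi> x *\<^sub>R (T \<psi> /\<^sub>R integral\<^sup>L lborel \<psi>) \<partial>lborel)" if \<phi>: "\<phi> \<in> test_functions (ball x0 r)" for \<phi>
    proof -
      have "integral\<^sup>L lborel \<psi> *\<^sub>R T \<phi> = integral\<^sup>L lborel \<phi> *\<^sub>R T \<psi>"
        using r by (intro gradient_free_functional[OF lin D \<phi> \<psi>]) auto
      then have "(1 / integral\<^sup>L lborel \<psi>) *\<^sub>R integral\<^sup>L lborel \<psi> *\<^sub>R T \<phi> =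
          (1 / integral\<^sup>L lborel \<psi>) *\<^sub>R integral\<^sup>L lborel \<phi> *\<^sub>R T \<psi>" by simp
      then have "T \<phi> = integral\<^sup>L lborel \<phi> *\<^sub>R (T \<psi> /\<^sub>R integral\<^sup>L lborel \<psi>)"
        using I by (simp add: divide_inverse mult.commute)
      then show ?thesis using test_function_integrable(1)[OF \<phi>] by simp
    qed
    then show ?thesis by (intro exI[of _ "\<lambda>_. T \<psi> /\<^sub>R integral\<^sup>L lborel \<psi>"]) auto
  next
    case False
    then obtain i where i: "e i \<ge> 2" by (metis not_less_eq_eq numeral_2_eq_2 One_nat_def)
    define m where "m = e i - 1"
    have m: "m \<ge> 1" "e i = Suc m" using i by (auto simp: m_def)
    define S where "S \<phi> = T ((partial_deriv i ^^ m) \<phi>)" for \<phi>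
    have pw: "(partial_deriv j ^^ l) (\<lambda>x. \<phi> x + \<psi> x) = (\<lambda>x. (partial_deriv j ^^ l) \<phi> x + (partial_deriv j ^^ l) \<psi> x)"
      "(partial_deriv j ^^ l) (\<lambda>x. c * \<phi> x) = (\<lambda>x. c * (partial_deriv j ^^ l) \<phi> x)"
      if "\<phi> \<in> test_functions ?B" "\<psi> \<in> test_functions ?B" for j l \<phi> \<psi> c
    proof -
      note d = test_functionsD(5)[OF test_functions_funpow_partial_deriv]
      show "(partial_deriv j ^^ l) (\<lambda>x. \<phi> x + \<psi> x) = (\<lambda>x. (partial_deriv j ^^ l) \<phi> x + (partial_deriv j ^^ l) \<psi> x)"
      proof (induction l)
        case (Suc l)
        have "partial_deriv j (\<lambda>x. (partial_deriv j ^^ l) \<phi> x + (partial_deriv j ^^ l) \<psi> x) =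
          (\<lambda>x. partial_deriv j ((partial_deriv j ^^ l) \<phi>) x + partial_deriv j ((partial_deriv j ^^ l) \<psi>) x)"
          by (rule ext, rule partial_deriv_add[OF d[OF that(1)] d[OF that(2)]])
        then show ?case by (simp add: Suc)
      qed simp
      show "(partial_deriv j ^^ l) (\<lambda>x. c * \<phi> x) = (\<lambda>x. c * (partial_deriv j ^^ l) \<phi> x)"
      proof (induction l)
        case (Suc l)
        have "partial_deriv j (\<lambda>x. c * (partial_deriv j ^^ l) \<phi> x) =
          (\<lambda>x. c * partial_deriv j ((partial_deriv j ^^ l) \<phi>) x)"
          by (rule ext, rule partial_deriv_cmult[OF d[OF that(1)]])
        then show ?case by (simp add: Suc)
      qed simp
    qed
    have S_lin: "linear_on_tests ?B S"
      unfolding linear_on_tests_def S_def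
      by (simp add: pw linear_on_testsD[OF lin] test_functions_funpow_partial_deriv)
    have S_e: "S ((partial_deriv j ^^ (e(i := 1)) j) \<phi>) = 0" if \<phi>: "\<phi> \<in> test_functions ?B" for j \<phi>
    proof (cases "j = i")
      case True
      then show ?thesis using less.prems(2)[OF \<phi>, of i] m(2) by (simp add: S_def funpow_swap1)
    next
      case False
      have "S ((partial_deriv j ^^ e j) \<phi>) = T ((partial_deriv j ^^ e j) ((partial_deriv i ^^ m) \<phi>))"
        by (simp add: S_def funpow_partial_deriv_commute[OF test_functionsD(1)[OF \<phi>]])
      then show ?thesis
        using less.prems(2)[OF test_functions_funpow_partial_deriv[OF \<phi>]] False by simp
    qed
    \<comment> \<open>Used with \<open>l = 1\<close> for \<open>S\<close> and with
      \<open>l = m\<close> for \<open>T'\<close>; both lie strictly below \<open>e i\<close> because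
      \<open>e i \<ge> 2\<close> and \<open>m = e i - 1\<close>.\<close>
    have sum_upd: "(\<Sum>j\<in>UNIV. (e(i := l)) j) < (\<Sum>j\<in>UNIV. e j)" if "l < e i" for l
      by (rule sum_strict_mono_ex1) (use that in auto)
    obtain p where p: "polynomial_function p"
      "\<And>\<phi>. \<phi> \<in> test_functions (ball x0 r) \<Longrightarrow> S \<phi> = (\<integral>x. \<phi> x *\<^sub>R p x \<partial>lborel)"
      using less.hyps[OF sum_upd S_lin S_e] i by auto
    \<comment> \<open>The reciprocal of the factor \<open>(-1) ^ m * fact m\<close> produced by
      \<open>functional_coord_power\<close>, so that \<open>T'\<close> annihilates the derivatives
      of order \<open>m\<close> in direction \<open>i\<close>.\<close>
    define c where "c = ((-1) ^ m / fact m :: real)"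
    define T' where "T' \<phi> = T \<phi> - c *\<^sub>R S (\<lambda>x. \<phi> x * (x $ i) ^ m)" for \<phi>
    have tX: "(\<lambda>x. \<phi> x * (x $ i) ^ m) \<in> test_functions ?B" if "\<phi> \<in> test_functions ?B" for \<phi>
      using that by (rule test_functions_mult_coord_power) simp
    have "linear_on_tests ?B T'"
      unfolding linear_on_tests_def
    proof (intro conjI ballI allI)
      fix \<phi> \<psi> d assume \<phi>: "\<phi> \<in> test_functions ?B"
      have "S (\<lambda>x. d * \<phi> x * (x $ i) ^ m) = d *\<^sub>R S (\<lambda>x. \<phi> x * (x $ i) ^ m)"
        using linear_on_testsD(2)[OF S_lin tX[OF \<phi>], of d] by (simp add: mult.assoc)
      then show "T' (\<lambda>x. d * \<phi> x) = d *\<^sub>R T' \<phi>"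
        by (simp add: T'_def linear_on_testsD[OF lin] \<phi> scaleR_diff_right)
      assume \<psi>: "\<psi> \<in> test_functions ?B"
      have "S (\<lambda>x. (\<phi> x + \<psi> x) * (x $ i) ^ m) = S (\<lambda>x. \<phi> x * (x $ i) ^ m) + S (\<lambda>x. \<psi> x * (x $ i) ^ m)"
        using linear_on_testsD(1)[OF S_lin tX[OF \<phi>] tX[OF \<psi>]] by (simp add: distrib_right)
      then show "T' (\<lambda>x. \<phi> x + \<psi> x) = T' \<phi> + T' \<psi>"
        by (simp add: T'_def linear_on_testsD[OF lin] \<phi> \<psi> scaleR_add_right)
    qed
    moreover have "T' ((partial_deriv j ^^ (e(i := m)) j) \<phi>) = 0" if \<phi>: "\<phi> \<in> test_functions ?B" for j \<phi>
    proof (cases "j = i")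
      case True
      have "S (\<lambda>x. (partial_deriv i ^^ m) \<phi> x * (x $ i) ^ m) = ((-1) ^ m * fact m) *\<^sub>R S \<phi>"
        using S_e[of _ i] by (intro functional_coord_power[OF S_lin _ _ \<phi>]) auto
      moreover have "c * ((-1) ^ m * fact m) = 1" by (simp add: c_def power_mult_distrib[symmetric])
      ultimately have "c *\<^sub>R S (\<lambda>x. (partial_deriv i ^^ m) \<phi> x * (x $ i) ^ m) = S \<phi>" by simp
      then show ?thesis using True by (simp add: T'_def S_def)
    next
      case False
      have "S (\<lambda>x. (partial_deriv j ^^ e j) \<phi> x * (x $ i) ^ m) = 0"
        using S_e[OF tX[OF \<phi>], of j] False
        by (simp add: funpow_partial_deriv_mult_coord_power[OF test_functionsD(1)[OF \<phi>]])
      then show ?thesis using False less.prems(2)[OF \<phi>, of j] by (simp add: T'_def)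
    qed
    ultimately obtain q where q: "polynomial_function q"
      "\<And>\<phi>. \<phi> \<in> test_functions (ball x0 r) \<Longrightarrow> T' \<phi> = (\<integral>x. \<phi> x *\<^sub>R q x \<partial>lborel)"
      using less.hyps[OF sum_upd, of m T'] m by auto
    have "T \<phi> = (\<integral>x. \<phi> x *\<^sub>R (q x + (c * (x $ i) ^ m) *\<^sub>R p x) \<partial>lborel)" if \<phi>: "\<phi> \<in> test_functions (ball x0 r)" for \<phi>
    proof -
      have tX': "(\<lambda>x. \<phi> x * (x $ i) ^ m) \<in> test_functions (ball x0 r)"
        using \<phi> by (rule test_functions_mult_coord_power) simp
      have int: "integrable lborel (\<lambda>x. \<psi> x *\<^sub>R g x)"
        if "\<psi> \<in> test_functions (ball x0 r)" "polynomial_function g" for \<psi> and g :: "real^'n \<Rightarrow> 'v"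
      proof (rule compact_support_integrable(1)[of _ "supp \<psi>"])
        show "continuous_on UNIV (\<lambda>x. \<psi> x *\<^sub>R g x)"
          by (intro continuous_intros test_functionsD(4)[OF that(1)] continuous_on_polymonial_function that(2))
        show "compact (supp \<psi>)" by (rule test_functionsD(2)[OF that(1)])
        show "\<psi> x *\<^sub>R g x = 0" if "x \<notin> supp \<psi>" for x using supp_zero[OF that] by simp
      qed
      have "T \<phi> = T' \<phi> + c *\<^sub>R S (\<lambda>x. \<phi> x * (x $ i) ^ m)" by (simp add: T'_def)
      also have "\<dots> = (\<integral>x. \<phi> x *\<^sub>R q x \<partial>lborel) + c *\<^sub>R (\<integral>x. (\<phi> x * (x $ i) ^ m) *\<^sub>R p x \<partial>lborel)"
        using q(2)[OF \<phi>] p(2)[OF tX'] by simp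
      also have "\<dots> = (\<integral>x. \<phi> x *\<^sub>R q x + c *\<^sub>R ((\<phi> x * (x $ i) ^ m) *\<^sub>R p x) \<partial>lborel)"
        by (simp only: integral_scaleR_right Bochner_Integration.integral_add[OF int[OF \<phi> q(1)]
              integrable_scaleR_right[OF int[OF tX' p(1)]]] simp_thms refl)
      also have "\<dots> = (\<integral>x. \<phi> x *\<^sub>R (q x + (c * (x $ i) ^ m) *\<^sub>R p x) \<partial>lborel)"
        by (simp add: scaleR_add_right mult_ac)
      finally show ?thesis .
    qed
    moreover have "polynomial_function (\<lambda>x. q x + (c * (x $ i) ^ m) *\<^sub>R p x)"
      using polynomial_function_coord_power[of i m]
      by (intro polynomial_function_add polynomial_function_mult q p)
        (auto simp: real_polynomial_function_eq[symmetric] intro: real_polynomial_function.intros)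
    ultimately show ?thesis by (intro exI[of _ "\<lambda>x. q x + (c * (x $ i) ^ m) *\<^sub>R p x"]) auto
  qed
qed

section \<open>Localisation\<close>

text \<open>The indicator function of a box is mollified with a normalised bump. At points near the
  centre the whole mass of the bump stays inside the box, so the value is exactly 1. A box is used
  because parameter integrals are taken over boxes.\<close>

lemma ex_plateau:
  fixes x0 :: "real^'n::finite"
  assumes r: "r > 0"
  shows "\<exists>s>0. \<exists>\<beta>\<in>test_functions (ball x0 r). \<forall>x\<in>ball x0 s. \<beta> x = 1"
proof -
  obtain a b where ab: "cbox a b \<subseteq> ball x0 (r / 2)" "x0 \<in> box a b"
    by (rule open_contains_cbox[of "ball x0 (r / 2)" x0]) (use r in auto)
  obtain s' where s': "s' > 0" "ball x0 s' \<subseteq> box a b"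
    using open_contains_ball_eq[OF open_box] ab(2) by metis
  \<comment> \<open>The bound by \<open>s' / 2\<close> keeps a bump centred at a point of
    \<open>ball x0 s\<close> inside the box; the bound by \<open>r / 4\<close> keeps the support of
    the result within \<open>r / 2 + r / 4\<close> of \<open>x0\<close>.\<close>
  define s where "s = min (s' / 2) (r / 4)"
  have s: "s > 0" "2 * s \<le> s'" "s \<le> r / 4" using s'(1) r by (auto simp: s_def)
  define I where "I = integral\<^sup>L lborel (bump (0::real^'n) s)"
  have I: "I > 0" unfolding I_def by (rule integral_bump_pos[OF s(1)])
  have tb: "bump (0::real^'n) s \<in> test_functions UNIV" using s(1) by (intro bump_test_function) auto
  define \<beta> where "\<beta> y = integral (cbox a b) (\<lambda>t. (1 / I) * bump 0 s (y + (- t)))" for y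
  have cont: "continuous_on UNIV (\<lambda>t. (1 / I) * bump 0 s (y + (- t)))" for y :: "real^'n"
    by (intro continuous_intros continuous_on_compose2[OF test_functionsD(4)[OF tb, of UNIV]]) auto
  have "\<beta> \<in> test_functions (ball x0 r)"
  proof (rule test_functionsI[of _ "cball x0 (3 / 4 * r)"])
    show "smooth_on UNIV \<beta>"
      unfolding \<beta>_def by (intro parameter_integral(3) test_functionsD(1)[OF tb] continuous_intros)
    fix y assume y: "y \<notin> cball x0 (3 / 4 * r)"
    have "(1 / I) * bump 0 s (y + (- t)) = 0" if t: "t \<in> cbox a b" for t
    proof -
      have "dist x0 t < r / 2" using ab t by auto
      then have "dist t y > r / 4" using y dist_triangle[of x0 y t] by simp
      then have "y + (- t) \<notin> ball 0 s" using s by (simp add: dist_norm norm_minus_commute)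
      from bump_zero[OF s(1) this] show ?thesis by simp
    qed
    then show "\<beta> y = 0" unfolding \<beta>_def
      using integral_cong[of "cbox a b" "\<lambda>t. (1 / I) * bump 0 s (y + (- t))" "\<lambda>_. 0"] by simp
  qed (use r in auto)
  moreover have "\<beta> y = 1" if y: "y \<in> ball x0 s" for y
  proof -
    have "(1 / I) * bump 0 s (y + (- t)) = 0" if t: "t \<notin> cbox a b" for t
    proof -
      have "t \<notin> ball x0 s'" using s'(2) t box_subset_cbox[of a b] by blast
      then have "dist y t \<ge> s" using y s dist_triangle[of x0 t y] by simp
      then have "y + (- t) \<notin> ball 0 s" by (simp add: dist_norm norm_minus_commute)
      from bump_zero[OF s(1) this] show ?thesis by simp
    qed
    then have "\<beta> y = (\<integral>t. (1 / I) * bump 0 s (y + (- t)) \<partial>lborel)"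
      unfolding \<beta>_def by (intro integral_cbox_compact_support cont)
    also have "\<dots> = (1 / I) * (\<integral>t. bump 0 s (y - t) \<partial>lborel)" by simp
    also have "(\<integral>t. bump 0 s (y - t) \<partial>lborel) = I"
      unfolding I_def
      by (intro lborel_integral_reflect borel_measurable_continuous_onI test_functionsD(4)[OF tb])
    finally show ?thesis using I by simp
  qed
  ultimately show ?thesis using s(1) by blast
qed

text \<open>Plateau functions are peeled off one at a time along a finite cover of the support:
  \<open>\<beta> \<phi>\<close> lives in a ball where the functionals agree, and
  \<open>(1 - \<beta>) \<phi>\<close> is supported in the balls that remain.\<close>

lemma local_agree:
  fixes T1 T2 :: "(real^'n::finite \<Rightarrow> real) \<Rightarrow> 'v::real_vector"
  assumes T: "linear_on_tests \<Omega> T1" "linear_on_tests \<Omega> T2"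
    and loc: "\<And>x. x \<in> \<Omega> \<Longrightarrow> \<exists>r>0. ball x r \<subseteq> \<Omega> \<and> (\<forall>\<phi>\<in>test_functions (ball x r). T1 \<phi> = T2 \<phi>)"
    and \<phi>: "\<phi> \<in> test_functions \<Omega>"
  shows "T1 \<phi> = T2 \<phi>"
proof -
  obtain r where r: "\<And>x. x \<in> \<Omega> \<Longrightarrow> r x > 0" "\<And>x. x \<in> \<Omega> \<Longrightarrow> ball x (r x) \<subseteq> \<Omega>"
    "\<And>x \<phi>. x \<in> \<Omega> \<Longrightarrow> \<phi> \<in> test_functions (ball x (r x)) \<Longrightarrow> T1 \<phi> = T2 \<phi>"
    using loc by metis
  have "\<exists>s \<beta>. s > 0 \<and> \<beta> \<in> test_functions (ball x (r x)) \<and> (\<forall>y\<in>ball x s. \<beta> y = 1)" if "x \<in> \<Omega>" for x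
    using ex_plateau[OF r(1)[OF that], of x] by blast
  then obtain s \<beta> where s: "\<And>x. x \<in> \<Omega> \<Longrightarrow> s x > (0::real)"
    "\<And>x. x \<in> \<Omega> \<Longrightarrow> \<beta> x \<in> test_functions (ball x (r x))"
    "\<And>x y. x \<in> \<Omega> \<Longrightarrow> y \<in> ball x (s x) \<Longrightarrow> \<beta> x y = 1"
    by metis
  have cover: "T1 \<phi> = T2 \<phi>" if "finite F" "F \<subseteq> \<Omega>" "\<phi> \<in> test_functions \<Omega>" "supp \<phi> \<subseteq> (\<Union>x\<in>F. ball x (s x))" for F \<phi>
    using that
  proof (induction F arbitrary: \<phi> rule: finite_induct)
    case empty
    then have "\<phi> = (\<lambda>_. 0)" using closure_subset[of "{x. \<phi> x \<noteq> 0}"] by auto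
    then show ?case by (simp add: linear_on_testsD(3)[OF T(1)] linear_on_testsD(3)[OF T(2)])
  next
    case (insert x F)
    then have x: "x \<in> \<Omega>" by simp
    note \<phi> = \<open>\<phi> \<in> test_functions \<Omega>\<close>
    define \<phi>1 where "\<phi>1 y = \<beta> x y * \<phi> y" for y
    define \<phi>2 where "\<phi>2 y = \<phi> y * (1 - \<beta> x y)" for y
    have \<phi>1: "\<phi>1 \<in> test_functions (ball x (r x))"
      unfolding \<phi>1_def
      by (intro test_functions_mult s(2) x smooth_on_subset[OF test_functionsD(1)[OF \<phi>]]) auto
    then have \<phi>1': "\<phi>1 \<in> test_functions \<Omega>" using r(2)[OF x] by (rule test_functions_mono)
    have "smooth_on UNIV (\<lambda>y. 1 - \<beta> x y)"
      by (intro smooth_on_diff test_functionsD(1)[OF s(2)[OF x]]) auto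
    then have "smooth_on UNIV \<phi>2"
      unfolding \<phi>2_def by (intro smooth_on_mult test_functionsD(1)[OF \<phi>]) auto
    have z: "\<phi>2 y = 0" if "y \<notin> supp \<phi> - ball x (s x)" for y
      using that s(3)[OF x, of y] supp_zero[of y \<phi>] by (auto simp: \<phi>2_def)
    have K: "compact (supp \<phi> - ball x (s x))"
      by (intro compact_diff test_functionsD(2)[OF \<phi>]) simp
    have \<phi>2: "\<phi>2 \<in> test_functions \<Omega>"
      using test_functionsD(3)[OF \<phi>] by (intro test_functionsI[OF \<open>smooth_on UNIV \<phi>2\<close> K _ z]) auto
    have "supp \<phi>2 \<subseteq> supp \<phi> - ball x (s x)"
      using z by (intro closure_minimal compact_imp_closed K) blast
    then have "supp \<phi>2 \<subseteq> (\<Union>x\<in>F. ball x (s x))" using insert.prems(3) by auto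
    then have "T1 \<phi>2 = T2 \<phi>2" using insert.IH[OF _ \<phi>2] insert.prems(1) by auto
    moreover have "T1 \<phi>1 = T2 \<phi>1" by (rule r(3)[OF x \<phi>1])
    moreover have "\<phi> = (\<lambda>y. \<phi>1 y + \<phi>2 y)" by (auto simp: \<phi>1_def \<phi>2_def algebra_simps)
    ultimately show ?case
      using linear_on_testsD(1)[OF T(1) \<phi>1' \<phi>2] linear_on_testsD(1)[OF T(2) \<phi>1' \<phi>2] by metis
  qed
  have sub: "supp \<phi> \<subseteq> (\<Union>x\<in>\<Omega>. ball x (s x))"
  proof
    fix x assume "x \<in> supp \<phi>"
    then have "x \<in> \<Omega>" using test_functionsD(3)[OF \<phi>] by blast
    then show "x \<in> (\<Union>x\<in>\<Omega>. ball x (s x))" using s(1)[of x] by (intro UN_I[of x]) simp_all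
  qed
  obtain F where "F \<subseteq> \<Omega>" "finite F" "supp \<phi> \<subseteq> (\<Union>x\<in>F. ball x (s x))"
    by (rule compactE_image[OF test_functionsD(2)[OF \<phi>] _ sub]) (rule open_ball, blast)
  then show ?thesis using cover[of F \<phi>] \<phi> by blast
qed

section \<open>The fundamental lemma of the calculus of variations\<close>

text \<open>Stated for continuous weights of compact support, because the cut-off function will also
  be multiplied by functions that are merely continuous.\<close>

lemma L1_loc_integrable:
  fixes u :: "real^'n::finite \<Rightarrow> 'v::euclidean_space"
  assumes u: "u \<in> L1_loc \<Omega>" and K: "compact K" "K \<subseteq> \<Omega>" "\<And>x. x \<notin> K \<Longrightarrow> \<phi> x = 0"
    and \<phi>: "continuous_on UNIV \<phi>"
  shows "integrable lebesgue (\<lambda>x. \<phi> x *\<^sub>R u x)"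
proof -
  have int: "integrable lebesgue (\<lambda>x. indicator K x *\<^sub>R u x)"
    using u K(1,2) unfolding L1_loc_def set_integrable_def by blast
  have "bounded (\<phi> ` K)"
    using K(1) continuous_on_subset[OF \<phi>] by (intro compact_imp_bounded compact_continuous_image) auto
  then obtain M where M: "\<And>x. x \<in> K \<Longrightarrow> \<bar>\<phi> x\<bar> \<le> M" by (auto simp: bounded_iff)
  have m\<phi>: "\<phi> \<in> borel_measurable lebesgue"
    using borel_measurable_continuous_onI[OF \<phi>] by (simp add: measurable_completion)
  have eq: "(\<lambda>x. \<phi> x *\<^sub>R u x) = (\<lambda>x. \<phi> x *\<^sub>R (indicator K x *\<^sub>R u x))"
    using K(3) by (auto simp: fun_eq_iff indicator_def)
  show ?thesis
  proof (rule Bochner_Integration.integrable_bound)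
    show "integrable lebesgue (\<lambda>x. M *\<^sub>R (indicator K x *\<^sub>R u x))"
      using int by (rule integrable_scaleR_right)
    show "(\<lambda>x. \<phi> x *\<^sub>R u x) \<in> borel_measurable lebesgue"
      unfolding eq by (rule borel_measurable_scaleR[OF m\<phi> borel_measurable_integrable[OF int]])
    show "AE x in lebesgue. norm (\<phi> x *\<^sub>R u x) \<le> norm (M *\<^sub>R (indicator K x *\<^sub>R u x))"
    proof (rule AE_I2)
      fix x show "norm (\<phi> x *\<^sub>R u x) \<le> norm (M *\<^sub>R (indicator K x *\<^sub>R u x))"
        using M[of x] K(3)[of x] by (cases "x \<in> K") (auto intro: mult_right_mono)
    qed
  qed
qed

lemma test_L1_loc_integrable:
  fixes u :: "real^'n::finite \<Rightarrow> 'v::euclidean_space"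
  assumes "u \<in> L1_loc \<Omega>" "\<phi> \<in> test_functions \<Omega>"
  shows "integrable lebesgue (\<lambda>x. \<phi> x *\<^sub>R u x)"
  by (rule L1_loc_integrable[OF assms(1) test_functionsD(2,3)[OF assms(2)] _ test_functionsD(4)[OF assms(2)]])
    (rule supp_zero)

text \<open>With a bump as cut-off, \<open>f = \<chi>' u\<close> is integrable and orthogonal to
  every polynomial, as \<open>\<chi>'\<close> times a polynomial is a test function. Weierstrass
  approximation extends this to all continuous functions, and continuous approximations of
  \<open>sgn f\<close> then give that the integral of \<open>\<bar>f\<bar>\<close> is 0. On the ball
  the bump is positive, so \<open>u\<close> vanishes there almost everywhere.\<close>

lemma fundamental_lemma_ball:
  fixes u :: "real^'n::finite \<Rightarrow> real"
  assumes u: "u \<in> L1_loc \<Omega>" and \<Omega>: "open \<Omega>"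
    and z: "\<And>\<phi>. \<phi> \<in> test_functions \<Omega> \<Longrightarrow> (\<integral>x. \<phi> x *\<^sub>R u x \<partial>lebesgue) = 0"
    and r: "r > 0" "cball x0 r \<subseteq> \<Omega>"
  shows "AE x in lebesgue. x \<in> ball x0 r \<longrightarrow> u x = 0"
proof -
  define \<chi>' where "\<chi>' = bump x0 r"
  have \<chi>: "\<chi>' \<in> test_functions \<Omega>" unfolding \<chi>'_def by (rule bump_test_function[OF r])
  define f where "f x = \<chi>' x * u x" for x
  have f_int: "integrable lebesgue f"
    using test_L1_loc_integrable[OF u \<chi>] by (simp add: f_def[abs_def])
  have fg_int: "integrable lebesgue (\<lambda>x. f x * g x)" if g: "continuous_on UNIV g" for g
  proof -
    have "integrable lebesgue (\<lambda>x. (\<chi>' x * g x) *\<^sub>R u x)"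
    proof (rule L1_loc_integrable[OF u test_functionsD(2,3)[OF \<chi>]])
      show "\<chi>' x * g x = 0" if "x \<notin> supp \<chi>'" for x using supp_zero[OF that] by simp
      show "continuous_on UNIV (\<lambda>x. \<chi>' x * g x)" by (intro continuous_intros test_functionsD(4)[OF \<chi>] g)
    qed
    then show ?thesis by (simp add: f_def mult_ac)
  qed
  have fp: "(\<integral>x. f x * p x \<partial>lebesgue) = 0" if p: "real_polynomial_function p" for p
  proof -
    have "(\<lambda>x. \<chi>' x * p x) \<in> test_functions \<Omega>"
      using p by (intro test_functions_mult \<chi> \<Omega> smooth_on_polynomial_function) (simp add: real_polynomial_function_eq)
    from z[OF this] show ?thesis by (simp add: f_def mult_ac)
  qed
  have fg: "(\<integral>x. f x * g x \<partial>lebesgue) = 0" if g: "continuous_on UNIV g" for g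
  proof -
    define J where "J = (\<integral>x. \<bar>f x\<bar> \<partial>lebesgue)"
    have J: "J \<ge> 0" by (simp add: J_def)
    have "\<bar>\<integral>x. f x * g x \<partial>lebesgue\<bar> \<le> \<epsilon> * J" if \<epsilon>: "\<epsilon> > 0" for \<epsilon>
    proof -
      obtain p where p: "real_polynomial_function p" "\<And>x. x \<in> supp \<chi>' \<Longrightarrow> \<bar>g x - p x\<bar> < \<epsilon>"
        using Stone_Weierstrass_real_polynomial_function[OF test_functionsD(2)[OF \<chi>] continuous_on_subset[OF g subset_UNIV] \<epsilon>]
        by metis
      have cp: "continuous_on UNIV p"
        using p(1) by (simp add: real_polynomial_function_eq continuous_on_polymonial_function)
      have "(\<integral>x. f x * g x \<partial>lebesgue) = (\<integral>x. f x * g x - f x * p x \<partial>lebesgue)"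
        using fg_int[OF g] fg_int[OF cp] fp[OF p(1)] by simp
      moreover have "\<bar>\<integral>x. f x * g x - f x * p x \<partial>lebesgue\<bar> \<le> (\<integral>x. \<epsilon> * \<bar>f x\<bar> \<partial>lebesgue)"
      proof (rule integral_abs_bound_integral)
        show "integrable lebesgue (\<lambda>x. f x * g x - f x * p x)" using fg_int[OF g] fg_int[OF cp] by simp
        show "integrable lebesgue (\<lambda>x. \<epsilon> * \<bar>f x\<bar>)" using f_int by simp
        fix x
        show "\<bar>f x * g x - f x * p x\<bar> \<le> \<epsilon> * \<bar>f x\<bar>"
        proof (cases "x \<in> supp \<chi>'")
          case True
          have "\<bar>f x * g x - f x * p x\<bar> = \<bar>g x - p x\<bar> * \<bar>f x\<bar>"
            by (simp add: right_diff_distrib[symmetric] abs_mult)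
          then show ?thesis using p(2)[OF True] by (simp add: mult_right_mono)
        next
          case False
          then have "f x = 0" using supp_zero[OF False] by (simp only: f_def)
          then show ?thesis by simp
        qed
      qed
      ultimately show ?thesis by (simp add: J_def)
    qed
    then have "\<bar>\<integral>x. f x * g x \<partial>lebesgue\<bar> \<le> 0"
    proof (rule_tac field_le_epsilon)
      fix e :: real assume e: "e > 0"
      \<comment> \<open>Dividing by \<open>J + 1\<close> covers the case
        \<open>J = 0\<close>.\<close>
      have "\<bar>\<integral>x. f x * g x \<partial>lebesgue\<bar> \<le> (e / (J + 1)) * J"
        using \<open>\<And>\<epsilon>. \<epsilon> > 0 \<Longrightarrow> \<bar>\<integral>x. f x * g x \<partial>lebesgue\<bar> \<le> \<epsilon> * J\<close>[of "e / (J + 1)"] e J by simp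
      also have "\<dots> \<le> e" using e J by (simp add: field_simps)
      finally show "\<bar>\<integral>x. f x * g x \<partial>lebesgue\<bar> \<le> 0 + e" by simp
    qed
    then show ?thesis by simp
  qed
  have "(\<lambda>x. sgn (f x)) \<in> borel_measurable lebesgue" using f_int by measurable
  then have "(\<lambda>x. sgn (f x)) measurable_on UNIV" by (intro lebesgue_measurable_imp_measurable_on) auto
  then obtain N g where N: "negligible N" and g: "\<And>n. continuous_on UNIV (g n)"
    "\<And>x. x \<notin> N \<Longrightarrow> (\<lambda>n. g n x) \<longlonglongrightarrow> sgn (f x)" by (auto simp: measurable_on_def)
  \<comment> \<open>Truncation to \<open>[-1, 1]\<close> does not change the limit
    \<open>sgn (f x)\<close> and makes \<open>\<bar>f\<bar>\<close> a dominating function.\<close>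
  define h where "h n x = max (-1) (min 1 (g n x))" for n x
  have h: "continuous_on UNIV (h n)" for n unfolding h_def by (intro continuous_intros g)
  have AN: "AE x in lebesgue. x \<notin> N"
    using N by (simp add: negligible_iff_null_sets AE_not_in)
  have "(\<lambda>n. \<integral>x. f x * h n x \<partial>lebesgue) \<longlonglongrightarrow> (\<integral>x. \<bar>f x\<bar> \<partial>lebesgue)"
  proof (rule integral_dominated_convergence[where w="\<lambda>x. \<bar>f x\<bar>"])
    show "(\<lambda>x. \<bar>f x\<bar>) \<in> borel_measurable lebesgue" using f_int by simp
    show "(\<lambda>x. f x * h n x) \<in> borel_measurable lebesgue" for n using fg_int[OF h] by simp
    show "integrable lebesgue (\<lambda>x. \<bar>f x\<bar>)" using f_int by simp
    show "AE x in lebesgue. (\<lambda>n. f x * h n x) \<longlonglongrightarrow> \<bar>f x\<bar>"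
      using AN
    proof eventually_elim
      case (elim x)
      have "(\<lambda>n. f x * h n x) \<longlonglongrightarrow> f x * max (-1) (min 1 (sgn (f x)))"
        unfolding h_def by (intro tendsto_intros g(2)[OF elim])
      moreover have "f x * max (-1) (min 1 (sgn (f x))) = \<bar>f x\<bar>" by (simp add: sgn_if)
      ultimately show ?case by simp
    qed
    show "AE x in lebesgue. norm (f x * h n x) \<le> \<bar>f x\<bar>" for n
    proof (rule AE_I2)
      fix x
      have "\<bar>h n x\<bar> \<le> 1" by (simp add: h_def abs_le_iff)
      from mult_left_mono[OF this, of "\<bar>f x\<bar>"] show "norm (f x * h n x) \<le> \<bar>f x\<bar>" by (simp add: abs_mult)
    qed
  qed
  then have "(\<integral>x. \<bar>f x\<bar> \<partial>lebesgue) = 0" using fg[OF h] by (simp add: LIMSEQ_const_iff)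
  then have "AE x in lebesgue. \<bar>f x\<bar> = 0"
    using f_int by (subst (asm) integral_nonneg_eq_0_iff_AE) auto
  then show ?thesis
  proof eventually_elim
    case (elim x)
    then show ?case using bump_pos[OF r(1), of x x0] by (auto simp: f_def \<chi>'_def)
  qed
qed

text \<open>Almost-everywhere statements combine only countably: the scalar case on balls is applied
  to the finitely many coordinates of \<open>u\<close>, and then to a countable family of balls
  covering \<open>\<Omega>\<close>.\<close>

theorem fundamental_lemma:
  fixes u :: "real^'n::finite \<Rightarrow> 'v::euclidean_space"
  assumes u: "u \<in> L1_loc \<Omega>" and \<Omega>: "open \<Omega>"
    and z: "\<And>\<phi>. \<phi> \<in> test_functions \<Omega> \<Longrightarrow> (\<integral>x. \<phi> x *\<^sub>R u x \<partial>lebesgue) = 0"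
  shows "AE x in lebesgue. x \<in> \<Omega> \<longrightarrow> u x = 0"
proof -
  have comp: "AE x in lebesgue. x \<in> ball x0 r \<longrightarrow> u x \<bullet> b = 0" if r: "r > 0" "cball x0 r \<subseteq> \<Omega>" for x0 r b
  proof (rule fundamental_lemma_ball[OF _ \<Omega> _ r])
    show "(\<lambda>x. u x \<bullet> b) \<in> L1_loc \<Omega>"
      unfolding L1_loc_def
    proof (intro CollectI allI impI)
      fix K assume "compact K \<and> K \<subseteq> \<Omega>"
      then have "integrable lebesgue (\<lambda>x. indicat_real K x *\<^sub>R u x)"
        using u unfolding L1_loc_def set_integrable_def by blast
      then have "integrable lebesgue (\<lambda>x. (indicat_real K x *\<^sub>R u x) \<bullet> b)" by (rule integrable_inner_left)
      then show "(\<lambda>x. u x \<bullet> b) absolutely_integrable_on K" by (simp add: set_integrable_def)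
    qed
    fix \<phi> assume \<phi>: "\<phi> \<in> test_functions \<Omega>"
    have "(\<integral>x. (\<phi> x *\<^sub>R u x) \<bullet> b \<partial>lebesgue) = (\<integral>x. \<phi> x *\<^sub>R u x \<partial>lebesgue) \<bullet> b"
      by (rule integral_inner_left) (rule test_L1_loc_integrable[OF u \<phi>])
    then show "(\<integral>x. \<phi> x *\<^sub>R (u x \<bullet> b) \<partial>lebesgue) = 0" using z[OF \<phi>] by simp
  qed
  have ball: "AE x in lebesgue. x \<in> ball x0 r \<longrightarrow> u x = 0" if r: "r > 0" "cball x0 r \<subseteq> \<Omega>" for x0 r
  proof -
    have "AE x in lebesgue. \<forall>b\<in>Basis. x \<in> ball x0 r \<longrightarrow> u x \<bullet> b = 0"
      using comp[OF r] by (intro AE_ball_countable[THEN iffD2]) (auto intro: countable_finite)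
    then show ?thesis by eventually_elim (auto simp: euclidean_eq_iff[of _ "0::'v"])
  qed
  define \<F> where "\<F> = {ball x0 r |x0 r. r > 0 \<and> cball x0 r \<subseteq> \<Omega>}"
  have "\<Union>\<F> = \<Omega>"
  proof
    show "\<Union>\<F> \<subseteq> \<Omega>" using ball_subset_cball by (fastforce simp: \<F>_def)
    show "\<Omega> \<subseteq> \<Union>\<F>"
    proof
      fix x assume "x \<in> \<Omega>"
      then obtain r where "r > 0" "cball x r \<subseteq> \<Omega>" using \<Omega> open_contains_cball by metis
      then show "x \<in> \<Union>\<F>" unfolding \<F>_def by (intro UnionI[of "ball x r"]) auto
    qed
  qed
  moreover have "open S" if "S \<in> \<F>" for S using that by (auto simp: \<F>_def)
  ultimately obtain \<F>' where F: "\<F>' \<subseteq> \<F>" "countable \<F>'" "\<Union>\<F>' = \<Omega>"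
    using Lindelof[of \<F>] by metis
  have "AE x in lebesgue. \<forall>S\<in>\<F>'. x \<in> S \<longrightarrow> u x = 0"
    using F(1) ball by (intro AE_ball_countable[OF F(2), THEN iffD2]) (auto simp: \<F>_def)
  then show ?thesis by eventually_elim (use F(3) in auto)
qed

section \<open>The kernel of a C-elliptic operator\<close>

text \<open>Restricted to the line from \<open>y\<close> through \<open>x\<close>, each coordinate
  of \<open>p\<close> is a polynomial in one real variable with infinitely many zeros.\<close>

lemma polynomial_function_identity:
  fixes p :: "real^'n::finite \<Rightarrow> 'v::euclidean_space"
  assumes p: "polynomial_function p" and s: "s > 0" and z: "\<And>x. x \<in> ball y s \<Longrightarrow> p x = 0"
  shows "p x = 0"
proof -
  have "p x \<bullet> b = 0" if b: "b \<in> Basis" for b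
  proof -
    define h where "h t = p (y + t *\<^sub>R (x - y)) \<bullet> b" for t
    have "polynomial_function (\<lambda>t::real. y + t *\<^sub>R (x - y))"
      by (intro polynomial_function_add polynomial_function_mult polynomial_function_id polynomial_function_const)
    then have "polynomial_function (\<lambda>t. p (y + t *\<^sub>R (x - y)))"
      using polynomial_function_compose[of "\<lambda>t. y + t *\<^sub>R (x - y)" p] p by (simp add: o_def)
    then have "real_polynomial_function h"
      unfolding h_def polynomial_function_iff_Basis_inner using b by blast
    then obtain a n where h: "h = (\<lambda>t. \<Sum>i\<le>n. a i * t ^ i)"
      using real_polynomial_function_imp_sum by blast
    \<comment> \<open>For \<open>0 < t < d\<close> the point \<open>y + t (x - y)\<close> stays in
      the ball; the summand 1 covers the case \<open>x = y\<close>.\<close>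
    define d where "d = s / (norm (x - y) + 1)"
    have d: "d > 0" using s by (simp add: d_def add_nonneg_pos)
    have "h t = 0" if "t \<in> {0<..<d}" for t
    proof -
      have "t * norm (x - y) \<le> t * (norm (x - y) + 1)" using that by (intro mult_left_mono) auto
      also have "\<dots> < s" using that by (simp add: d_def pos_less_divide_eq add_nonneg_pos)
      finally have "y + t *\<^sub>R (x - y) \<in> ball y s" using that by (simp add: dist_norm)
      then show ?thesis using z by (simp add: h_def)
    qed
    then have "{0<..<d} \<subseteq> {t. (\<Sum>i\<le>n. a i * t ^ i) = 0}" by (auto simp: h)
    then have "infinite {t. (\<Sum>i\<le>n. a i * t ^ i) = 0}"
      using infinite_Ioo[OF d] finite_subset by blast
    then have "a i = 0" if "i \<le> n" for i using that polyfun_finite_roots[of a n] by blast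
    then have "h 1 = 0" by (simp add: h)
    then show ?thesis by (simp add: h_def)
  qed
  then show ?thesis by (simp add: euclidean_eq_iff[of _ "0::'v"])
qed

lemma AE_eq_imp_eq_open:
  fixes f g :: "real^'n::finite \<Rightarrow> 'v::euclidean_space"
  assumes S: "open S" and f: "continuous_on S f" "continuous_on S g"
    and ae: "AE x in lebesgue. x \<in> S \<longrightarrow> f x = g x" and x: "x \<in> S"
  shows "f x = g x"
proof (rule ccontr)
  assume ne: "f x \<noteq> g x"
  define N where "N = S \<inter> (\<lambda>x. f x - g x) -` (- {0})"
  have "open N" unfolding N_def using S f by (intro continuous_open_preimage continuous_on_diff) auto
  have "AE x in lebesgue. x \<notin> N" using ae by eventually_elim (auto simp: N_def)
  then have "negligible N"
    using \<open>open N\<close> by (simp add: negligible_iff_null_sets AE_iff_null_sets)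
  moreover have "x \<in> N" using x ne by (simp add: N_def)
  ultimately show False using open_not_negligible[OF \<open>open N\<close>] by auto
qed

section \<open>Distributions given by locally integrable functions\<close>

lemma dist_of_eq_lebesgue:
  assumes \<Omega>: "open \<Omega>" and \<phi>: "\<phi> \<in> test_functions \<Omega>"
  shows "dist_of \<Omega> u \<phi> = (\<integral>x. \<phi> x *\<^sub>R u x \<partial>lebesgue)"
proof -
  have "(\<lambda>x. indicator \<Omega> x *\<^sub>R (\<phi> x *\<^sub>R u x)) = (\<lambda>x. \<phi> x *\<^sub>R u x)"
    using test_function_zero[OF \<phi>] by (auto simp: fun_eq_iff indicator_def)
  then show ?thesis using \<phi> \<Omega> by (simp add: dist_of_def integral_restrict_space)
qed

lemma linear_on_tests_dist_of:
  assumes \<Omega>: "open \<Omega>" and u: "u \<in> L1_loc \<Omega>"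
  shows "linear_on_tests \<Omega> (dist_of \<Omega> u)"
  unfolding linear_on_tests_def
proof (intro conjI ballI allI)
  fix \<phi> \<psi> c assume \<phi>: "\<phi> \<in> test_functions \<Omega>"
  show "dist_of \<Omega> u (\<lambda>x. c * \<phi> x) = c *\<^sub>R dist_of \<Omega> u \<phi>"
    by (simp add: dist_of_eq_lebesgue[OF \<Omega>] test_functions_cmult \<phi> flip: scaleR_scaleR)
  assume \<psi>: "\<psi> \<in> test_functions \<Omega>"
  show "dist_of \<Omega> u (\<lambda>x. \<phi> x + \<psi> x) = dist_of \<Omega> u \<phi> + dist_of \<Omega> u \<psi>"
    using test_L1_loc_integrable[OF u \<phi>] test_L1_loc_integrable[OF u \<psi>]
    by (simp add: dist_of_eq_lebesgue[OF \<Omega>] test_functions_add \<phi> \<psi> scaleR_add_left)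
qed

lemma dist_of_eq_imp_AE:
  fixes u v :: "real^'n::finite \<Rightarrow> 'v::euclidean_space"
  assumes \<Omega>: "open \<Omega>" and u: "u \<in> L1_loc \<Omega>" "v \<in> L1_loc \<Omega>"
    and eq: "\<And>\<phi>. \<phi> \<in> test_functions \<Omega> \<Longrightarrow> dist_of \<Omega> u \<phi> = dist_of \<Omega> v \<phi>"
  shows "AE x in lebesgue. x \<in> \<Omega> \<longrightarrow> u x = v x"
proof -
  have "AE x in lebesgue. x \<in> \<Omega> \<longrightarrow> u x - v x = 0"
  proof (rule fundamental_lemma[OF _ \<Omega>])
    show "(\<lambda>x. u x - v x) \<in> L1_loc \<Omega>"
      using u by (auto simp: L1_loc_def)
    fix \<phi> assume \<phi>: "\<phi> \<in> test_functions \<Omega>"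
    show "(\<integral>x. \<phi> x *\<^sub>R (u x - v x) \<partial>lebesgue) = 0"
      using eq[OF \<phi>] test_L1_loc_integrable[OF u(1) \<phi>] test_L1_loc_integrable[OF u(2) \<phi>]
      by (simp add: dist_of_eq_lebesgue[OF \<Omega> \<phi>] scaleR_diff_right)
  qed
  then show ?thesis by eventually_elim simp
qed

lemma continuous_on_L1_loc:
  fixes u :: "real^'n::finite \<Rightarrow> 'v::euclidean_space"
  assumes "continuous_on \<Omega> u"
  shows "u \<in> L1_loc \<Omega>"
  unfolding L1_loc_def
proof (intro CollectI allI impI)
  fix K assume K: "compact K \<and> K \<subseteq> \<Omega>"
  then have 1: "integrable lborel (\<lambda>x. indicator K x *\<^sub>R u x)"
    using continuous_on_subset[OF assms] by (intro borel_integrable_compact) auto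
  show "u absolutely_integrable_on K"
    unfolding set_integrable_def using 1 integrable_completion[OF borel_measurable_integrable[OF 1]] by blast
qed

definition piecewise_polynomial :: "(real^'n::finite) set \<Rightarrow> (real^'n \<Rightarrow> 'v::euclidean_space) \<Rightarrow> bool" where
  "piecewise_polynomial \<Omega> u \<longleftrightarrow> (\<forall>\<omega>\<in>components \<Omega>. \<exists>p. polynomial_function p \<and> (\<forall>x\<in>\<omega>. u x = p x))"

lemma piecewise_polynomial_local:
  assumes "piecewise_polynomial \<Omega> u" "open \<Omega>" "x \<in> \<Omega>"
  obtains r p where "r > 0" "ball x r \<subseteq> \<Omega>" "polynomial_function p" "\<And>y. y \<in> ball x r \<Longrightarrow> u y = p y"
proof -
  obtain \<omega> where \<omega>: "\<omega> \<in> components \<Omega>" "x \<in> \<omega>" using assms(3) Union_components[of \<Omega>] by blast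
  moreover have "open \<omega>" using open_components[OF assms(2) \<omega>(1)] .
  ultimately obtain r where "r > 0" "ball x r \<subseteq> \<omega>" using open_contains_ball by blast
  moreover obtain p where "polynomial_function p" "\<forall>x\<in>\<omega>. u x = p x"
    using assms(1) \<omega>(1) by (auto simp: piecewise_polynomial_def)
  ultimately show ?thesis using that[of r p] in_components_subset[OF \<omega>(1)] by blast
qed

lemma piecewise_polynomial_smooth_on:
  assumes "piecewise_polynomial \<Omega> u" "open \<Omega>"
  shows "smooth_on \<Omega> u"
  unfolding smooth_on_def
proof (intro allI ballI)
  fix "is" x assume "x \<in> \<Omega>"
  then obtain r p where r: "r > 0" "polynomial_function p" "\<And>y. y \<in> ball x r \<Longrightarrow> u y = p y"
    using piecewise_polynomial_local[OF assms] by metis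
  have "smooth_on (ball x r) u"
    using smooth_on_cong[of "ball x r" u p] r(3) smooth_on_polynomial_function[OF r(2)] by blast
  then show "foldr partial_deriv is u differentiable (at x)" using r(1) by (simp add: smooth_on_def)
qed

lemma piecewise_polynomial_mi_deriv:
  assumes u: "piecewise_polynomial \<Omega> u" and \<Omega>: "open \<Omega>"
  shows "piecewise_polynomial \<Omega> (mi_deriv \<alpha> u)"
  unfolding piecewise_polynomial_def
proof
  fix \<omega> assume \<omega>: "\<omega> \<in> components \<Omega>"
  then obtain p where p: "polynomial_function p" "\<And>x. x \<in> \<omega> \<Longrightarrow> u x = p x"
    using u by (auto simp: piecewise_polynomial_def)
  have "mi_deriv \<alpha> u x = mi_deriv \<alpha> p x" if "x \<in> \<omega>" for x
    unfolding mi_deriv_eq_foldr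
    using foldr_partial_deriv_cong_open[OF open_components[OF \<Omega> \<omega>] that p(2)] .
  moreover have "polynomial_function (mi_deriv \<alpha> p)"
    unfolding mi_deriv_eq_foldr by (rule polynomial_function_foldr_partial_deriv[OF p(1)])
  ultimately show "\<exists>p. polynomial_function p \<and> (\<forall>x\<in>\<omega>. mi_deriv \<alpha> u x = p x)" by blast
qed

text \<open>The polynomial vector \<open>f\<close> acts as a differential operator: this is the
  value at \<open>\<phi>\<close> of the scalar distribution that sums
  \<open>f (\<beta>, b) \<partial>^\<beta> (T \<bullet> b)\<close>. The sign comes from moving the
  derivatives onto \<open>\<phi>\<close>.\<close>

definition pairing ::
  "((real^'n::finite \<Rightarrow> real) \<Rightarrow> 'v::euclidean_space) \<Rightarrow> (real^'n \<Rightarrow> real) \<Rightarrow> ('n, 'v) coeffs \<Rightarrow> complex" where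
  "pairing T \<phi> f = (\<Sum>p\<in>{p. f p \<noteq> 0}. f p * of_real ((-1) ^ mi_abs (fst p) * (T (mi_deriv (fst p) \<phi>) \<bullet> snd p)))"

lemma pairing_superset:
  assumes "finite S" "{p. f p \<noteq> 0} \<subseteq> S"
  shows "pairing T \<phi> f = (\<Sum>p\<in>S. f p * of_real ((-1) ^ mi_abs (fst p) * (T (mi_deriv (fst p) \<phi>) \<bullet> snd p)))"
  unfolding pairing_def using assms by (intro sum.mono_neutral_left) auto

lemma pairing_add:
  assumes "f \<in> poly_vecs" "g \<in> poly_vecs"
  shows "pairing T \<phi> (f + g) = pairing T \<phi> f + pairing T \<phi> g"
proof -
  let ?S = "{p. f p \<noteq> 0} \<union> {p. g p \<noteq> 0}"
  have S: "finite ?S" using assms by (simp add: poly_vecs_def)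
  show ?thesis
    by (subst (1 2 3) pairing_superset[OF S]) (auto simp: sum.distrib algebra_simps)
qed

lemma pairing_cscal:
  assumes "f \<in> poly_vecs"
  shows "pairing T \<phi> (cscal c f) = c * pairing T \<phi> f"
proof -
  let ?S = "{p. f p \<noteq> 0}"
  have S: "finite ?S" using assms by (simp add: poly_vecs_def)
  show ?thesis
    by (subst (1 2) pairing_superset[OF S]) (auto simp: cscal_def sum_distrib_left mult_ac)
qed

text \<open>Multiplication by \<open>x_i\<close> is differentiation of the distribution, which falls
  on the test function with a minus sign.\<close>

lemma pairing_shift:
  assumes f: "f \<in> poly_vecs" and \<phi>: "smooth_on UNIV \<phi>"
  shows "pairing T \<phi> (shift i f) = - pairing T (partial_deriv i \<phi>) f"
proof -
  let ?S = "{p. f p \<noteq> 0}"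
  define g where "g p = ((fst p)(i := Suc (fst p i)), snd p)" for p :: "('a \<Rightarrow> nat) \<times> 'b"
  have S: "finite ?S" using f by (simp add: poly_vecs_def)
  have sg: "shift i f (g p) = f p" for p by (simp add: shift_def g_def)
  have sub: "{p. shift i f p \<noteq> 0} \<subseteq> g ` ?S"
  proof
    fix p assume p: "p \<in> {p. shift i f p \<noteq> 0}"
    define q where "q = ((fst p)(i := fst p i - 1), snd p)"
    have "fst p i \<noteq> 0" "f q \<noteq> 0" using p by (auto simp: shift_def q_def split: prod.splits if_splits)
    moreover from this have "p = g q" by (simp add: g_def q_def)
    ultimately show "p \<in> g ` ?S" by blast
  qed
  have inj: "inj_on g ?S"
  proof (rule inj_onI)
    fix p q assume "g p = g q"
    then have "(fst p)(i := Suc (fst p i)) = (fst q)(i := Suc (fst q i))" "snd p = snd q"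
      by (auto simp: g_def)
    then have "fst p j = fst q j" for j by (cases "j = i") (metis fun_upd_same nat.inject, metis fun_upd_other)
    then show "p = q" using \<open>snd p = snd q\<close> by (auto simp: prod_eq_iff)
  qed
  have "pairing T \<phi> (shift i f) = (\<Sum>p\<in>g ` ?S. shift i f p *
      of_real ((-1) ^ mi_abs (fst p) * (T (mi_deriv (fst p) \<phi>) \<bullet> snd p)))"
    using S sub by (intro pairing_superset) auto
  also have "\<dots> = (\<Sum>p\<in>?S. f p * of_real ((-1) ^ mi_abs (fst (g p)) * (T (mi_deriv (fst (g p)) \<phi>) \<bullet> snd (g p))))"
    by (simp add: sum.reindex[OF inj] sg)
  also have "\<dots> = - pairing T (partial_deriv i \<phi>) f"
    by (simp add: pairing_def g_def mi_abs_upd_Suc mi_deriv_partial_deriv[OF \<phi>] sum_negf)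
  finally show ?thesis .
qed

text \<open>The elements of the module are the differential consequences of the equation: the rows
  express it componentwise, and multiplying by a variable differentiates it. The claim is kept
  general in \<open>\<phi>\<close> because the last case replaces \<open>\<phi>\<close> by its
  derivative.\<close>

lemma pairing_row_module:
  fixes A :: "('n::finite \<Rightarrow> nat) \<Rightarrow> 'v::euclidean_space \<Rightarrow> 'w::euclidean_space"
  assumes A: "diff_operator k A"
    and T: "\<And>\<phi>. \<phi> \<in> test_functions \<Omega> \<Longrightarrow> (\<Sum>\<alpha> | mi_abs \<alpha> = k. A \<alpha> ((-1) ^ k *\<^sub>R T (mi_deriv \<alpha> \<phi>))) = 0"
    and f: "f \<in> row_module k A"
  shows "\<phi> \<in> test_functions \<Omega> \<Longrightarrow> pairing T \<phi> f = 0"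
  using f
proof (induction arbitrary: \<phi> rule: row_module.induct)
  case (row w)
  let ?I = "{\<beta>::'n \<Rightarrow> nat. mi_abs \<beta> = k} \<times> (Basis :: 'v set)"
  have lin: "linear (A \<beta>)" if "mi_abs \<beta> = k" for \<beta> using A that by (simp add: diff_operator_def)
  have A_exp: "A \<beta> v \<bullet> w = (\<Sum>b\<in>Basis. (A \<beta> b \<bullet> w) * (v \<bullet> b))" if "mi_abs \<beta> = k" for \<beta> v
  proof -
    have "A \<beta> v = A \<beta> (\<Sum>b\<in>Basis. (v \<bullet> b) *\<^sub>R b)" by (simp add: euclidean_representation)
    also have "\<dots> = (\<Sum>b\<in>Basis. (v \<bullet> b) *\<^sub>R A \<beta> b)"
      by (simp add: linear_sum[OF lin[OF that]] linear_scale[OF lin[OF that]])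
    finally show ?thesis by (simp add: inner_sum_left mult.commute)
  qed
  have "pairing T \<phi> (symbol_row k A w) = (\<Sum>p\<in>?I. symbol_row k A w p *
      of_real ((-1) ^ mi_abs (fst p) * (T (mi_deriv (fst p) \<phi>) \<bullet> snd p)))"
    by (rule pairing_superset)
      (auto simp: symbol_row_def finite_mi_abs_eq split: if_splits)
  also have "\<dots> = (\<Sum>p\<in>?I. of_real ((A (fst p) (snd p) \<bullet> w) * (((-1) ^ k *\<^sub>R T (mi_deriv (fst p) \<phi>)) \<bullet> snd p)))"
    by (rule sum.cong) (auto simp: symbol_row_def)
  also have "\<dots> = of_real (\<Sum>\<beta> | mi_abs \<beta> = k. \<Sum>b\<in>Basis. (A \<beta> b \<bullet> w) * (((-1) ^ k *\<^sub>R T (mi_deriv \<beta> \<phi>)) \<bullet> b))"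
    unfolding of_real_sum[symmetric] sum.cartesian_product by (simp add: case_prod_unfold)
  also have "(\<Sum>\<beta> | mi_abs \<beta> = k. \<Sum>b\<in>Basis. (A \<beta> b \<bullet> w) * (((-1) ^ k *\<^sub>R T (mi_deriv \<beta> \<phi>)) \<bullet> b)) =
      (\<Sum>\<beta> | mi_abs \<beta> = k. A \<beta> ((-1) ^ k *\<^sub>R T (mi_deriv \<beta> \<phi>)) \<bullet> w)"
    by (rule sum.cong) (simp_all add: A_exp)
  also have "\<dots> = 0" using T[OF row] by (simp add: inner_sum_left[symmetric])
  finally show ?case by simp
next
  case zero
  show ?case by (simp add: pairing_def)
next
  case (add f g)
  have "pairing T \<phi> (f + g) = pairing T \<phi> f + pairing T \<phi> g"
    by (intro pairing_add row_module_poly_vecs[OF add.hyps(1)] row_module_poly_vecs[OF add.hyps(2)])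
  also have "\<dots> = 0" using add.IH[OF add.prems] by simp
  finally show ?case .
next
  case (scal f c)
  then show ?case by (simp add: pairing_cscal row_module_poly_vecs)
next
  case (shift f i)
  then show ?case
    using pairing_shift[OF row_module_poly_vecs[OF shift.hyps] test_functionsD(1)[OF shift.prems], of T i]
      test_functions_partial_deriv[OF shift.prems] by simp
qed

lemma mi_deriv_single: "mi_deriv ((\<lambda>_. 0)(i := m)) \<phi> = (partial_deriv i ^^ m) \<phi>" if "smooth_on UNIV \<phi>"
  for \<phi> :: "real^'n::finite \<Rightarrow> real"
proof -
  have "mset (mi_list ((\<lambda>_. 0)(i := m))) = mset (replicate m i)"
    by (intro multiset_eqI) (simp only: count_mset_mi_list, simp)
  from foldr_partial_deriv_mset[OF that this] show ?thesis by (simp add: mi_deriv_eq_foldr)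
qed

lemma funpow_shift_monom_vec: "(shift i ^^ m) (monom_vec 0 b) = monom_vec ((\<lambda>_. 0)(i := m)) b"
proof (induction m)
  case 0
  show ?case by (simp add: zero_fun_def)
next
  case (Suc m)
  have "((\<lambda>_. 0)(i := m))(i := Suc (((\<lambda>_. 0)(i := m)) i)) = ((\<lambda>_. 0)(i := Suc m))" by simp
  then show ?case by (simp only: funpow.simps comp_apply Suc shift_monom_vec)
qed

lemma pairing_monom_vec:
  "pairing T \<phi> (monom_vec \<beta> b) = of_real ((-1) ^ mi_abs \<beta> * (T (mi_deriv \<beta> \<phi>) \<bullet> b))"
  by (subst pairing_superset[of "{(\<beta>, b)}"]) (auto simp: monom_vec_def)

lemma dist_kernel_nilpotent:
  fixes A :: "('n::finite \<Rightarrow> nat) \<Rightarrow> 'v::euclidean_space \<Rightarrow> 'w::euclidean_space"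
  assumes A: "diff_operator k A" "C_elliptic k A" and T: "T \<in> dist_kernel \<Omega> k A"
  shows "\<exists>m. \<forall>\<phi>\<in>test_functions \<Omega>. T ((partial_deriv i ^^ m) \<phi>) = 0"
proof -
  have lin: "linear (A \<alpha>)" if "mi_abs \<alpha> = k" for \<alpha> using A(1) that by (simp add: diff_operator_def)
  have T0: "(\<Sum>\<alpha> | mi_abs \<alpha> = k. A \<alpha> ((-1) ^ k *\<^sub>R T (mi_deriv \<alpha> \<phi>))) = 0" if \<phi>: "\<phi> \<in> test_functions \<Omega>" for \<phi>
  proof -
    have "dist_op \<Omega> k A T \<phi> = 0" using T by (simp add: dist_kernel_def)
    then show ?thesis using \<phi> by (simp add: dist_op_def dist_deriv_def)
  qed
  have "\<forall>b\<in>Basis. \<exists>m. (shift i ^^ m) (monom_vec 0 b) \<in> row_module k A"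
    using row_module_contains_powers[OF A] by blast
  then obtain m where m: "\<And>b. b \<in> Basis \<Longrightarrow> (shift i ^^ m b) (monom_vec 0 b) \<in> row_module k A" by metis
  have Tb: "T ((partial_deriv i ^^ m b) \<phi>) \<bullet> b = 0" if b: "b \<in> Basis" and \<phi>: "\<phi> \<in> test_functions \<Omega>" for b \<phi>
    using pairing_row_module[OF A(1) T0 m[OF b] \<phi>] test_functionsD(1)[OF \<phi>]
    by (simp add: funpow_shift_monom_vec pairing_monom_vec mi_deriv_single)
  \<comment> \<open>One exponent for all coordinates of \<open>T\<close>: any derivatives in excess
    of \<open>m b\<close> are absorbed into the test function.\<close>
  define M where "M = Max (m ` (Basis :: 'v set))"
  have "T ((partial_deriv i ^^ M) \<phi>) = 0" if \<phi>: "\<phi> \<in> test_functions \<Omega>" for \<phi>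
  proof (rule euclidean_eqI)
    fix b :: 'v assume b: "b \<in> Basis"
    then have "m b \<le> M" by (simp add: M_def)
    then have "(partial_deriv i ^^ M) \<phi> = (partial_deriv i ^^ m b) ((partial_deriv i ^^ (M - m b)) \<phi>)"
      by (simp flip: funpow_add comp_apply[of "_ ^^ _" "_ ^^ _"])
    then show "T ((partial_deriv i ^^ M) \<phi>) \<bullet> b = 0 \<bullet> b"
      using Tb[OF b test_functions_funpow_partial_deriv[OF \<phi>]] by simp
  qed
  then show ?thesis by blast
qed

text \<open>On a small ball around each point \<open>T\<close> is integration against a polynomial.
  Where balls overlap the polynomials agree almost everywhere, hence identically, so the polynomial
  attached to a point is locally constant in that point and therefore constant on each
  component.\<close>

theorem dist_kernel_piecewise_polynomial:
  fixes A :: "('n::finite \<Rightarrow> nat) \<Rightarrow> 'v::euclidean_space \<Rightarrow> 'w::euclidean_space"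
  assumes A: "diff_operator k A" "C_elliptic k A" and \<Omega>: "open \<Omega>" and T: "T \<in> dist_kernel \<Omega> k A"
  obtains u where "piecewise_polynomial \<Omega> u" "T = dist_of \<Omega> u"
proof -
  have TD: "T \<in> distributions \<Omega>" using T by (simp add: dist_kernel_def)
  have lin: "linear_on_tests \<Omega> T" using TD by (auto simp: distributions_def linear_on_tests_def)
  obtain e where e: "\<And>i \<phi>. \<phi> \<in> test_functions \<Omega> \<Longrightarrow> T ((partial_deriv i ^^ e i) \<phi>) = 0"
    using dist_kernel_nilpotent[OF A T] by metis
  define Q where "Q x r p \<longleftrightarrow> r > 0 \<and> ball x r \<subseteq> \<Omega> \<and> polynomial_function p \<and>
      (\<forall>\<phi>\<in>test_functions (ball x r). T \<phi> = (\<integral>x. \<phi> x *\<^sub>R p x \<partial>lebesgue))" for x r p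
  have "\<exists>r p. Q x r p" if x: "x \<in> \<Omega>" for x
  proof -
    obtain r where r: "r > 0" "ball x r \<subseteq> \<Omega>" using \<Omega> x open_contains_ball by blast
    have lin': "linear_on_tests (ball x (3 * (r / 3))) T"
      using linear_on_tests_mono[OF lin r(2)] by simp
    have e': "T ((partial_deriv i ^^ e i) \<phi>) = 0" if "\<phi> \<in> test_functions (ball x (3 * (r / 3)))" for i \<phi>
      using that e test_functions_mono[OF _ r(2)] by simp
    have "r / 3 > 0" using r by simp
    from nilpotent_functional_polynomial[OF this lin' e'] obtain p where p: "polynomial_function p"
      "\<And>\<phi>. \<phi> \<in> test_functions (ball x (r / 3)) \<Longrightarrow> T \<phi> = (\<integral>x. \<phi> x *\<^sub>R p x \<partial>lborel)" by blast
    have "T \<phi> = (\<integral>x. \<phi> x *\<^sub>R p x \<partial>lebesgue)" if \<phi>: "\<phi> \<in> test_functions (ball x (r / 3))" for \<phi>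
    proof -
      have "continuous_on UNIV (\<lambda>x. \<phi> x *\<^sub>R p x)"
        by (intro continuous_intros test_functionsD(4)[OF \<phi>] continuous_on_polymonial_function p(1))
      moreover have "\<phi> x *\<^sub>R p x = 0" if "x \<notin> supp \<phi>" for x using supp_zero[OF that] by simp
      ultimately have "(\<integral>x. \<phi> x *\<^sub>R p x \<partial>lebesgue) = (\<integral>x. \<phi> x *\<^sub>R p x \<partial>lborel)"
        by (rule compact_support_integrable(3)[OF _ test_functionsD(2)[OF \<phi>]])
      then show ?thesis using p(2)[OF \<phi>] by simp
    qed
    moreover have "ball x (r / 3) \<subseteq> \<Omega>" using r by (auto intro: subset_trans[OF subset_ball])
    ultimately show ?thesis using r p(1) by (intro exI[of _ "r / 3"] exI[of _ p]) (auto simp: Q_def)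
  qed
  then obtain r p where "\<And>x. x \<in> \<Omega> \<Longrightarrow> Q x (r x) (p x)" by metis
  then have r: "\<And>x. x \<in> \<Omega> \<Longrightarrow> r x > 0" "\<And>x. x \<in> \<Omega> \<Longrightarrow> ball x (r x) \<subseteq> \<Omega>"
    and p: "\<And>x. x \<in> \<Omega> \<Longrightarrow> polynomial_function (p x)"
    and Tp: "\<And>x \<phi>. x \<in> \<Omega> \<Longrightarrow> \<phi> \<in> test_functions (ball x (r x)) \<Longrightarrow> T \<phi> = (\<integral>y. \<phi> y *\<^sub>R p x y \<partial>lebesgue)"
    unfolding Q_def by blast+
  have p_eq: "p x z = p y z" if x: "x \<in> \<Omega>" and y: "y \<in> ball x (r x)" for x y z
  proof -
    have y\<Omega>: "y \<in> \<Omega>" using r(2)[OF x] y by blast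
    obtain s where s: "s > 0" "ball y s \<subseteq> ball x (r x)" using y open_contains_ball open_ball by metis
    define t where "t = min s (r y)"
    have t: "t > 0" "ball y t \<subseteq> ball x (r x)" "ball y t \<subseteq> ball y (r y)"
      using s r(1)[OF y\<Omega>] by (auto simp: t_def)
    have c: "continuous_on S (p x)" "continuous_on S (p y)" for S
      by (intro continuous_on_polymonial_function p x y\<Omega>)+
    have "AE w in lebesgue. w \<in> ball y t \<longrightarrow> p x w = p y w"
    proof (rule dist_of_eq_imp_AE[OF open_ball])
      show "p x \<in> L1_loc (ball y t)" "p y \<in> L1_loc (ball y t)" by (intro continuous_on_L1_loc c)+
      fix \<phi> assume \<phi>: "\<phi> \<in> test_functions (ball y t)"
      show "dist_of (ball y t) (p x) \<phi> = dist_of (ball y t) (p y) \<phi>"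
        using Tp[OF x test_functions_mono[OF \<phi> t(2)]] Tp[OF y\<Omega> test_functions_mono[OF \<phi> t(3)]]
        by (simp add: dist_of_eq_lebesgue[OF open_ball \<phi>])
    qed
    then have "p x w = p y w" if "w \<in> ball y t" for w
      by (rule AE_eq_imp_eq_open[OF open_ball c]) (rule that)
    then have "p x z - p y z = 0"
      by (rule_tac polynomial_function_identity[OF polynomial_function_diff[OF p[OF x] p[OF y\<Omega>]] t(1)]) simp
    then show ?thesis by simp
  qed
  \<comment> \<open>At each point the value of its own local polynomial; by \<open>p_eq\<close> this
    agrees near \<open>x\<close> with the single polynomial \<open>p x\<close>.\<close>
  define u where "u y = p y y" for y
  have u_eq: "u y = p x y" if "x \<in> \<Omega>" "y \<in> ball x (r x)" for x y
    using p_eq[OF that] by (simp add: u_def)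
  have pw: "piecewise_polynomial \<Omega> u"
    unfolding piecewise_polynomial_def
  proof
    fix \<omega> assume \<omega>: "\<omega> \<in> components \<Omega>"
    have sub: "\<omega> \<subseteq> \<Omega>" and con: "connected \<omega>" and op: "open \<omega>" and ne: "\<omega> \<noteq> {}"
      using in_components_subset[OF \<omega>] in_components_connected[OF \<omega>] open_components[OF \<Omega> \<omega>]
        in_components_nonempty[OF \<omega>] by auto
    obtain x0 where x0: "x0 \<in> \<omega>" using ne by auto
    have "p x0 = p x" if x: "x \<in> \<omega>" for x
    proof (rule connected_local_const[OF con x0 x, rule_format])
      fix a assume a: "a \<in> \<omega>"
      have "eventually (\<lambda>b. b \<in> ball a (r a)) (at a within \<omega>)"
        unfolding eventually_at using r(1)[of a] a sub by (intro exI[of _ "r a"]) (auto simp: dist_commute)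
      then show "\<forall>\<^sub>F b in at a within \<omega>. p a = p b"
        by eventually_elim (use p_eq[of a] a sub in blast)
    qed
    then have "\<forall>x\<in>\<omega>. u x = p x0 x" by (simp add: u_def)
    then show "\<exists>p. polynomial_function p \<and> (\<forall>x\<in>\<omega>. u x = p x)" using p x0 sub by blast
  qed
  have uL: "u \<in> L1_loc \<Omega>"
    by (intro continuous_on_L1_loc smooth_on_imp_continuous_on piecewise_polynomial_smooth_on pw \<Omega>)
  have "T \<phi> = dist_of \<Omega> u \<phi>" for \<phi>
  proof (cases "\<phi> \<in> test_functions \<Omega>")
    case True
    show ?thesis
    proof (rule local_agree[OF lin linear_on_tests_dist_of[OF \<Omega> uL] _ True])
      fix x assume x: "x \<in> \<Omega>"
      have "T \<phi> = dist_of \<Omega> u \<phi>" if \<phi>: "\<phi> \<in> test_functions (ball x (r x))" for \<phi>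
      proof -
        have "(\<lambda>y. \<phi> y *\<^sub>R p x y) = (\<lambda>y. \<phi> y *\<^sub>R u y)"
        proof
          fix y show "\<phi> y *\<^sub>R p x y = \<phi> y *\<^sub>R u y"
            using u_eq[OF x, of y] test_function_zero[OF \<phi>, of y] by (cases "y \<in> ball x (r x)") simp_all
        qed
        then show ?thesis
          unfolding Tp[OF x \<phi>] dist_of_eq_lebesgue[OF \<Omega> test_functions_mono[OF \<phi> r(2)[OF x]]]
          by (simp only:)
      qed
      then show "\<exists>r>0. ball x r \<subseteq> \<Omega> \<and> (\<forall>\<phi>\<in>test_functions (ball x r). T \<phi> = dist_of \<Omega> u \<phi>)"
        using r[OF x] by blast
    qed
  next
    case False
    then show ?thesis using TD by (simp add: distributions_def dist_of_def)
  qed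
  then show ?thesis using that[OF pw] by blast
qed

section \<open>Banach function spaces\<close>

lemma ennreal_tendsto_0I:
  fixes f :: "'a \<Rightarrow> ennreal"
  assumes "\<And>e::real. 0 < e \<Longrightarrow> \<forall>\<^sub>F n in F. f n \<le> ennreal e"
  shows "(f \<longlongrightarrow> 0) F"
proof (rule order_tendstoI)
  fix a :: ennreal assume "0 < a"
  then obtain b where b: "0 < b" "b < a" using dense by blast
  obtain e where e: "b = ennreal e" "e > 0"
  proof (cases b)
    case (real r)
    then show ?thesis using b(1) that[of r] by (cases "r = 0") auto
  next
    case top
    then show ?thesis using b(2) top.extremum_strict by blast
  qed
  show "\<forall>\<^sub>F n in F. f n < a" using assms[OF e(2)] by eventually_elim (use b e in auto)
qed simp

lemma ennreal_tendsto_0D: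
  fixes f :: "'a \<Rightarrow> ennreal"
  assumes "(f \<longlongrightarrow> 0) F" "0 < e"
  shows "\<forall>\<^sub>F n in F. f n \<le> ennreal e"
  using order_tendstoD(2)[OF assms(1), of "ennreal e"] assms(2) by (auto elim: eventually_mono)

lemma ennreal_tendsto_0_mono:
  fixes f g :: "'a \<Rightarrow> ennreal"
  assumes "(f \<longlongrightarrow> 0) F" "\<And>n. g n \<le> f n"
  shows "(g \<longlongrightarrow> 0) F"
  by (rule tendsto_sandwich[OF _ _ tendsto_const assms(1)]) (use assms(2) in auto)

lemma ennreal_cmult_tendsto_0:
  fixes f :: "'a \<Rightarrow> ennreal"
  assumes "(f \<longlongrightarrow> 0) F" "0 \<le> c"
  shows "((\<lambda>n. ennreal c * f n) \<longlongrightarrow> 0) F"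
  using ennreal_tendsto_cmult[OF _ assms(1), of "ennreal c"] by simp

locale banach_function_space =
  fixes \<Omega> :: "(real^'n::finite) set" and \<rho> :: "(real^'n \<Rightarrow> ennreal) \<Rightarrow> ennreal"
  assumes \<Omega>: "open \<Omega>" "bounded \<Omega>" and \<rho>: "banach_function_norm \<Omega> \<rho>"
begin

abbreviation "BM \<equiv> borel_measurable (lebesgue_on \<Omega>)"

lemmas norm_axioms = \<rho>[unfolded banach_function_norm_def Let_def]

lemma \<rho>_eq_0: "u \<in> BM \<Longrightarrow> \<rho> u = 0 \<Longrightarrow> AE x in lebesgue_on \<Omega>. u x = 0"
  by (rule norm_axioms[THEN conjunct1, rule_format])

lemma \<rho>_scale: "u \<in> BM \<Longrightarrow> 0 \<le> c \<Longrightarrow> \<rho> (\<lambda>x. ennreal c * u x) = ennreal c * \<rho> u"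
  by (rule norm_axioms[THEN conjunct2, THEN conjunct1, rule_format])

lemma \<rho>_add: "u \<in> BM \<Longrightarrow> v \<in> BM \<Longrightarrow> \<rho> (\<lambda>x. u x + v x) \<le> \<rho> u + \<rho> v"
  by (rule norm_axioms[THEN conjunct2, THEN conjunct2, THEN conjunct1, rule_format])

lemma \<rho>_mono:
  "u \<in> BM \<Longrightarrow> v \<in> BM \<Longrightarrow> AE x in lebesgue_on \<Omega>. u x \<le> v x \<Longrightarrow> \<rho> u \<le> \<rho> v"
  by (rule norm_axioms[THEN conjunct2, THEN conjunct2, THEN conjunct2, THEN conjunct1, rule_format])

lemma \<rho>_Fatou:
  assumes "u \<in> BM" "\<And>j. U j \<in> BM"
    "AE x in lebesgue_on \<Omega>. incseq (\<lambda>j::nat. U j x) \<and> (\<lambda>j. U j x) \<longlonglongrightarrow> u x"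
  shows "(\<lambda>j. \<rho> (U j)) \<longlonglongrightarrow> \<rho> u"
proof -
  note Fatou = norm_axioms[THEN conjunct2, THEN conjunct2, THEN conjunct2, THEN conjunct2, THEN conjunct1]
  have "\<forall>j. U j \<in> BM" using assms(2) by simp
  with Fatou[THEN spec[of _ U], THEN bspec[OF _ assms(1)]] assms(3) show ?thesis by (elim impE conjE)
qed

lemma \<rho>_indicator:
  "A \<in> sets lebesgue \<Longrightarrow> A \<subseteq> \<Omega> \<Longrightarrow> emeasure lebesgue A < \<infinity> \<Longrightarrow> \<rho> (indicator A) < \<infinity>"
  by (rule norm_axioms[THEN conjunct2, THEN conjunct2, THEN conjunct2, THEN conjunct2, THEN conjunct2,
        THEN conjunct1, rule_format])

lemma \<Omega>_lmeasurable: "\<Omega> \<in> lmeasurable" "\<Omega> \<in> sets lebesgue" "emeasure lebesgue \<Omega> < \<infinity>"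
proof -
  show "\<Omega> \<in> lmeasurable" using \<Omega> lmeasurable_open by blast
  then show "\<Omega> \<in> sets lebesgue" "emeasure lebesgue \<Omega> < \<infinity>" by (auto simp: fmeasurable_def)
qed

lemma \<rho>_L1: "\<exists>c::real. 0 < c \<and> (\<forall>u\<in>BM. (\<integral>\<^sup>+x. u x \<partial>lebesgue_on \<Omega>) \<le> ennreal c * \<rho> u)"
  by (rule norm_axioms[THEN conjunct2, THEN conjunct2, THEN conjunct2, THEN conjunct2, THEN conjunct2,
        THEN conjunct2, rule_format]) (use \<Omega>_lmeasurable in auto)

text \<open>Finite subadditivity passes to series because the norm is continuous along increasing
  sequences.\<close>

lemma \<rho>_suminf:
  assumes d: "\<And>m::nat. d m \<in> BM"
  shows "\<rho> (\<lambda>x. \<Sum>m. d m x) \<le> (\<Sum>m. \<rho> (d m))"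
proof -
  have le: "\<rho> (\<lambda>x. \<Sum>m<N. d m x) \<le> (\<Sum>m<N. \<rho> (d m))" for N
  proof (induction N)
    case 0
    have "\<rho> (\<lambda>x. ennreal 0 * (0::ennreal)) = ennreal 0 * \<rho> (\<lambda>x. 0)" by (rule \<rho>_scale) auto
    then show ?case by simp
  next
    case (Suc N)
    have "\<rho> (\<lambda>x. (\<Sum>m<N. d m x) + d N x) \<le> \<rho> (\<lambda>x. \<Sum>m<N. d m x) + \<rho> (d N)"
      using d by (intro \<rho>_add borel_measurable_sum) auto
    also have "\<dots> \<le> (\<Sum>m<N. \<rho> (d m)) + \<rho> (d N)" using Suc by (intro add_mono) auto
    finally show ?case by simp
  qed
  have "(\<lambda>N. \<rho> (\<lambda>x. \<Sum>m<N. d m x)) \<longlonglongrightarrow> \<rho> (\<lambda>x. \<Sum>m. d m x)"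
    using d
    by (intro \<rho>_Fatou borel_measurable_sum borel_measurable_suminf AE_I2)
      (auto intro!: incseq_SucI summable_LIMSEQ)
  moreover have "(\<lambda>N. \<Sum>m<N. \<rho> (d m)) \<longlonglongrightarrow> (\<Sum>m. \<rho> (d m))" by (intro summable_LIMSEQ) simp
  ultimately show ?thesis by (rule LIMSEQ_le) (use le in auto)
qed

section \<open>The norm of vector-valued maps\<close>

lemma norm_BM: "f \<in> BM \<Longrightarrow> (\<lambda>x. ennreal (norm (f x))) \<in> BM"
  for f :: "real^'n \<Rightarrow> 'a::euclidean_space"
  by measurable

lemma X_norm_mono:
  fixes f :: "real^'n \<Rightarrow> 'a::euclidean_space" and g :: "real^'n \<Rightarrow> 'b::euclidean_space"
  assumes "f \<in> BM" "g \<in> BM" "AE x in lebesgue_on \<Omega>. norm (f x) \<le> norm (g x)"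
  shows "X_norm \<rho> f \<le> X_norm \<rho> g"
  unfolding X_norm_def using assms by (intro \<rho>_mono norm_BM) (auto elim: eventually_mono intro: ennreal_leI)

lemma X_norm_cong:
  fixes f g :: "real^'n \<Rightarrow> 'a::euclidean_space"
  assumes "f \<in> BM" "g \<in> BM" "AE x in lebesgue_on \<Omega>. f x = g x"
  shows "X_norm \<rho> f = X_norm \<rho> g"
  using assms by (intro antisym X_norm_mono) (auto elim: eventually_mono)

lemma X_norm_add:
  fixes f g :: "real^'n \<Rightarrow> 'a::euclidean_space"
  assumes "f \<in> BM" "g \<in> BM"
  shows "X_norm \<rho> (\<lambda>x. f x + g x) \<le> X_norm \<rho> f + X_norm \<rho> g"
proof -
  have "X_norm \<rho> (\<lambda>x. f x + g x) \<le> \<rho> (\<lambda>x. ennreal (norm (f x)) + ennreal (norm (g x)))"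
    unfolding X_norm_def using assms
    by (intro \<rho>_mono norm_BM borel_measurable_add AE_I2)
      (auto simp: norm_triangle_ineq simp flip: ennreal_plus intro!: ennreal_leI)
  also have "\<dots> \<le> X_norm \<rho> f + X_norm \<rho> g"
    unfolding X_norm_def using assms by (intro \<rho>_add norm_BM)
  finally show ?thesis .
qed

lemma X_norm_scaleR:
  fixes f :: "real^'n \<Rightarrow> 'a::euclidean_space"
  assumes "f \<in> BM"
  shows "X_norm \<rho> (\<lambda>x. c *\<^sub>R f x) = ennreal \<bar>c\<bar> * X_norm \<rho> f"
  unfolding X_norm_def using \<rho>_scale[OF norm_BM[OF assms], of "\<bar>c\<bar>"] by (simp add: ennreal_mult)

lemma X_norm_diff:
  fixes f g :: "real^'n \<Rightarrow> 'a::euclidean_space"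
  assumes "f \<in> BM" "g \<in> BM"
  shows "X_norm \<rho> (\<lambda>x. f x - g x) \<le> X_norm \<rho> f + X_norm \<rho> g"
  using X_norm_add[OF assms(1), of "\<lambda>x. (-1) *\<^sub>R g x"] X_norm_scaleR[OF assms(2), of "-1"] assms(2)
  by simp

lemma X_norm_minus_commute: "X_norm \<rho> (\<lambda>x. f x - g x) = X_norm \<rho> (\<lambda>x. g x - f x)"
  by (simp add: X_norm_def norm_minus_commute)

lemma X_norm_diff_triangle:
  fixes f g h :: "real^'n \<Rightarrow> 'a::euclidean_space"
  assumes "f \<in> BM" "g \<in> BM" "h \<in> BM"
  shows "X_norm \<rho> (\<lambda>x. f x - h x) \<le> X_norm \<rho> (\<lambda>x. f x - g x) + X_norm \<rho> (\<lambda>x. g x - h x)"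
  using X_norm_add[of "\<lambda>x. f x - g x" "\<lambda>x. g x - h x"] assms by simp

lemma X_norm_0: "X_norm \<rho> (\<lambda>_. 0 :: 'a::euclidean_space) = 0"
  using X_norm_scaleR[of "\<lambda>_. 0 :: 'a" 0] by simp

lemma X_norm_eq_0D:
  fixes f :: "real^'n \<Rightarrow> 'a::euclidean_space"
  assumes "f \<in> BM" "X_norm \<rho> f = 0"
  shows "AE x in lebesgue_on \<Omega>. f x = 0"
  using \<rho>_eq_0[OF norm_BM[OF assms(1)]] assms(2) by (simp add: X_norm_def ennreal_eq_0_iff)

lemma X_norm_eq_0_iff:
  fixes f :: "real^'n \<Rightarrow> 'a::euclidean_space"
  assumes "f \<in> BM"
  shows "X_norm \<rho> f = 0 \<longleftrightarrow> (AE x in lebesgue_on \<Omega>. f x = 0)"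
  using X_norm_eq_0D[OF assms] X_norm_cong[OF assms, of "\<lambda>_. 0"] X_norm_0 by auto

lemma X_norm_sum:
  fixes f :: "'i \<Rightarrow> real^'n \<Rightarrow> 'a::euclidean_space"
  assumes "finite I" "\<And>i. i \<in> I \<Longrightarrow> f i \<in> BM"
  shows "X_norm \<rho> (\<lambda>x. \<Sum>i\<in>I. f i x) \<le> (\<Sum>i\<in>I. X_norm \<rho> (f i))"
  using assms
proof (induction I rule: finite_induct)
  case (insert i I)
  have "X_norm \<rho> (\<lambda>x. f i x + (\<Sum>i\<in>I. f i x)) \<le> X_norm \<rho> (f i) + X_norm \<rho> (\<lambda>x. \<Sum>i\<in>I. f i x)"
    using insert.prems by (intro X_norm_add borel_measurable_sum) auto
  also have "\<dots> \<le> X_norm \<rho> (f i) + (\<Sum>i\<in>I. X_norm \<rho> (f i))"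
    using insert by (intro add_mono) auto
  finally show ?case using insert.hyps by simp
qed (simp add: X_norm_0)

lemma X_norm_linear:
  fixes f :: "real^'n \<Rightarrow> 'a::euclidean_space" and L :: "'a \<Rightarrow> 'b::euclidean_space"
  assumes f: "f \<in> BM" and L: "linear L"
  shows "(\<lambda>x. L (f x)) \<in> BM" "X_norm \<rho> (\<lambda>x. L (f x)) \<le> ennreal (onorm L) * X_norm \<rho> f"
proof -
  have bl: "bounded_linear L" using L by (simp add: linear_conv_bounded_linear)
  show m: "(\<lambda>x. L (f x)) \<in> BM"
    using f borel_measurable_continuous_onI[OF linear_continuous_on[OF bl]]
    by (rule measurable_compose)
  have "X_norm \<rho> (\<lambda>x. L (f x)) \<le> X_norm \<rho> (\<lambda>x. onorm L *\<^sub>R f x)"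
    using f onorm[OF bl] onorm_pos_le[OF bl] by (intro X_norm_mono m AE_I2) auto
  then show "X_norm \<rho> (\<lambda>x. L (f x)) \<le> ennreal (onorm L) * X_norm \<rho> f"
    using X_norm_scaleR[OF f, of "onorm L"] onorm_pos_le[OF bl] by simp
qed

lemma X_norm_bounded:
  fixes f :: "real^'n \<Rightarrow> 'a::euclidean_space"
  assumes f: "f \<in> BM" and B: "\<And>x. x \<in> \<Omega> \<Longrightarrow> norm (f x) \<le> B"
  shows "X_norm \<rho> f < \<infinity>"
proof -
  define C where "C = max 0 B"
  have ind: "(indicator \<Omega> :: _ \<Rightarrow> ennreal) \<in> BM" using \<Omega>_lmeasurable(2)
    by (intro borel_measurable_indicator) (simp add: sets_restrict_space_iff)
  have "X_norm \<rho> f \<le> \<rho> (\<lambda>x. ennreal C * indicator \<Omega> x)"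
    unfolding X_norm_def
    using B ind by (intro \<rho>_mono norm_BM f AE_I2 borel_measurable_times) (auto simp: C_def intro!: ennreal_leI max.coboundedI2)
  also have "\<dots> = ennreal C * \<rho> (indicator \<Omega>)" using ind by (intro \<rho>_scale) (auto simp: C_def)
  also have "\<dots> < \<infinity>" using \<rho>_indicator[OF \<Omega>_lmeasurable(2) order_refl \<Omega>_lmeasurable(3)]
    by (simp add: ennreal_mult_less_top)
  finally show ?thesis .
qed

lemma X_norm_integrable:
  fixes f :: "real^'n \<Rightarrow> 'a::euclidean_space"
  assumes "f \<in> BM" "X_norm \<rho> f < \<infinity>"
  shows "integrable (lebesgue_on \<Omega>) f"
proof -
  obtain c where c: "c > 0" "\<And>u. u \<in> BM \<Longrightarrow> (\<integral>\<^sup>+x. u x \<partial>lebesgue_on \<Omega>) \<le> ennreal c * \<rho> u"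
    using \<rho>_L1 by blast
  have "(\<integral>\<^sup>+x. ennreal (norm (f x)) \<partial>lebesgue_on \<Omega>) \<le> ennreal c * X_norm \<rho> f"
    unfolding X_norm_def by (intro c norm_BM assms)
  also have "\<dots> < \<infinity>" using assms(2) by (simp add: ennreal_mult_less_top)
  finally show ?thesis using assms(1) by (simp add: integrable_iff_bounded)
qed

lemma integrable_L1_loc:
  fixes f :: "real^'n \<Rightarrow> 'a::euclidean_space"
  assumes "integrable (lebesgue_on \<Omega>) f"
  shows "f \<in> L1_loc \<Omega>"
  unfolding L1_loc_def
proof (intro CollectI allI impI)
  fix K assume K: "compact K \<and> K \<subseteq> \<Omega>"
  have 1: "integrable lebesgue (\<lambda>x. indicator \<Omega> x *\<^sub>R f x)"
    using assms \<Omega>_lmeasurable(2) by (simp add: integrable_restrict_space)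
  have "K \<in> sets lebesgue" using K by (simp add: compact_imp_closed)
  from integrable_mult_indicator[OF this 1]
  have "integrable lebesgue (\<lambda>x. indicator K x *\<^sub>R (indicator \<Omega> x *\<^sub>R f x))" .
  moreover have "(\<lambda>x. indicat_real K x *\<^sub>R (indicat_real \<Omega> x *\<^sub>R f x)) = (\<lambda>x. indicator K x *\<^sub>R f x)"
    using K by (auto simp: indicator_def fun_eq_iff)
  ultimately show "f absolutely_integrable_on K" by (simp add: set_integrable_def)
qed

text \<open>Local integrability gives measurability only after restriction to compact sets; along a
  compact exhaustion the restrictions converge pointwise to \<open>f\<close> on
  \<open>\<Omega>\<close>.\<close>

lemma L1_loc_measurable:
  fixes f :: "real^'n \<Rightarrow> 'a::euclidean_space"
  assumes f: "f \<in> L1_loc \<Omega>"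
  shows "f \<in> BM"
proof -
  obtain C where C: "\<And>n. compact (C n)" "\<And>n. C n \<subseteq> \<Omega>" "\<And>n. C n \<subseteq> interior (C (Suc n))"
    "\<Union> (range C) = \<Omega>" "\<And>K. compact K \<Longrightarrow> K \<subseteq> \<Omega> \<Longrightarrow> \<exists>N. \<forall>n\<ge>N. K \<subseteq> C n"
    by (rule open_Union_compact_subsets[OF \<Omega>(1)]) (rule that; simp)
  have "(\<lambda>x. indicator \<Omega> x *\<^sub>R f x) \<in> borel_measurable lebesgue"
  proof (rule borel_measurable_LIMSEQ_metric)
    fix n
    have "integrable lebesgue (\<lambda>x. indicator (C n) x *\<^sub>R f x)"
      using f C(1,2) by (auto simp: L1_loc_def set_integrable_def)
    then show "(\<lambda>x. indicat_real (C n) x *\<^sub>R f x) \<in> borel_measurable lebesgue"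
      by (rule borel_measurable_integrable)
  next
    fix x :: "real^'n"
    show "(\<lambda>n. indicat_real (C n) x *\<^sub>R f x) \<longlonglongrightarrow> indicator \<Omega> x *\<^sub>R f x"
    proof (cases "x \<in> \<Omega>")
      case True
      then obtain N where "\<And>n. n \<ge> N \<Longrightarrow> x \<in> C n" using C(5)[of "{x}"] by auto
      then have "\<forall>\<^sub>F n in sequentially. indicat_real (C n) x *\<^sub>R f x = indicator \<Omega> x *\<^sub>R f x"
        using True by (intro eventually_sequentiallyI[of N]) auto
      then show ?thesis by (rule tendsto_eventually)
    next
      case False
      then have "x \<notin> C n" for n using C(2)[of n] by blast
      then show ?thesis using False by simp
    qed
  qed
  then show ?thesis using \<Omega>_lmeasurable(2) by (subst borel_measurable_restrict_space_iff) auto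
qed

lemma X_L1_loc:
  fixes f :: "real^'n \<Rightarrow> 'a::euclidean_space"
  shows "f \<in> BM \<Longrightarrow> X_norm \<rho> f < \<infinity> \<Longrightarrow> f \<in> L1_loc \<Omega>"
  by (intro integrable_L1_loc X_norm_integrable)

text \<open>The Riesz-Fischer argument. Along a rapidly converging subsequence the sum
  \<open>V 0\<close> of the increments has finite norm, so by the embedding into the integrable
  functions it is finite almost everywhere and the subsequence converges pointwise there; the tails
  \<open>V n\<close> bound the remaining error.\<close>

theorem X_complete:
  fixes F :: "nat \<Rightarrow> real^'n \<Rightarrow> 'a::euclidean_space"
  assumes F: "\<And>j. F j \<in> BM"
    and Cauchy: "\<And>e::real. e > 0 \<Longrightarrow> \<exists>N. \<forall>i\<ge>N. \<forall>j\<ge>N. X_norm \<rho> (\<lambda>x. F i x - F j x) \<le> ennreal e"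
  shows "\<exists>f\<in>BM. (\<lambda>j. X_norm \<rho> (\<lambda>x. F j x - f x)) \<longlonglongrightarrow> 0"
proof -
  have "\<exists>N. \<forall>i\<ge>N. \<forall>j\<ge>N. X_norm \<rho> (\<lambda>x. F i x - F j x) \<le> ennreal ((1/2) ^ n)" for n :: nat
    by (rule Cauchy) simp
  then obtain N where N: "\<And>n i j. i \<ge> N n \<Longrightarrow> j \<ge> N n \<Longrightarrow> X_norm \<rho> (\<lambda>x. F i x - F j x) \<le> ennreal ((1/2) ^ n)"
    by metis
  \<comment> \<open>Partial sums rather than \<open>N\<close> itself, because both
    \<open>s n\<close> and \<open>s (Suc n)\<close> must reach \<open>N n\<close>.\<close>
  define s where "s n = (\<Sum>m\<le>n. N m)" for n
  have sN: "s n \<ge> N n" "s (Suc n) \<ge> N n" for n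
  proof -
    show "s n \<ge> N n" unfolding s_def by (rule member_le_sum) auto
    then show "s (Suc n) \<ge> N n" by (simp add: s_def)
  qed
  define d where "d n x = ennreal (norm (F (s (Suc n)) x - F (s n) x))" for n x
  have dM: "d n \<in> BM" for n unfolding d_def using F by measurable
  have d: "\<rho> (d n) \<le> ennreal ((1/2) ^ n)" for n
    using N[of n "s (Suc n)" "s n"] sN by (simp add: X_norm_def d_def[abs_def])
  define V where "V n x = (\<Sum>m. d (m + n) x)" for n x
  have VM: "V n \<in> BM" for n unfolding V_def[abs_def] using dM by measurable
  have V: "\<rho> (V n) \<le> ennreal (2 * (1/2) ^ n)" for n
  proof -
    have "\<rho> (V n) \<le> (\<Sum>m. \<rho> (d (m + n)))" unfolding V_def[abs_def] using dM by (intro \<rho>_suminf)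
    also have "\<dots> \<le> (\<Sum>m. ennreal ((1/2) ^ (m + n)))" by (intro suminf_le d) auto
    also have "\<dots> = ennreal (\<Sum>m. (1/2) ^ n * (1/2) ^ m)"
      by (subst suminf_ennreal2) (auto simp: power_add mult.commute intro!: summable_mult summable_mult2 summable_geometric)
    also have "(\<Sum>m. (1/2) ^ n * (1/2) ^ m) = (1/2) ^ n * (2::real)"
      by (subst suminf_mult) (auto simp: suminf_geometric intro!: summable_geometric)
    finally show ?thesis by (simp add: mult.commute)
  qed
  obtain c where c: "c > 0" "\<And>u. u \<in> BM \<Longrightarrow> (\<integral>\<^sup>+x. u x \<partial>lebesgue_on \<Omega>) \<le> ennreal c * \<rho> u"
    using \<rho>_L1 by blast
  have "(\<integral>\<^sup>+x. V 0 x \<partial>lebesgue_on \<Omega>) \<le> ennreal c * \<rho> (V 0)" by (intro c VM)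
  also have "\<dots> \<le> ennreal c * ennreal 2" using V[of 0] by (intro mult_left_mono) auto
  finally have "(\<integral>\<^sup>+x. V 0 x \<partial>lebesgue_on \<Omega>) \<noteq> \<infinity>" by (auto simp: top_unique ennreal_mult_eq_top_iff)
  then have V_fin: "AE x in lebesgue_on \<Omega>. V 0 x \<noteq> \<infinity>" by (intro nn_integral_noteq_infinite VM)
  \<comment> \<open>Where the subsequence diverges, \<open>lim\<close> is an unspecified value; this
    happens only on a null set, and measurability holds regardless.\<close>
  define f where "f x = lim (\<lambda>n. F (s n) x)" for x
  have fM: "f \<in> BM" unfolding f_def[abs_def] using F by (intro borel_measurable_lim_metric)
  have bound: "AE x in lebesgue_on \<Omega>. ennreal (norm (F (s n) x - f x)) \<le> V n x" for n
    using V_fin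
  proof eventually_elim
    case (elim x)
    define D where "D m = F (s (Suc m)) x - F (s m) x" for m
    have sum: "summable (\<lambda>m. norm (D m))"
      using elim by (intro summable_suminf_not_top) (auto simp: V_def d_def D_def)
    then have sD: "summable D" by (rule summable_norm_cancel)
    have tel: "F (s m) x = F (s 0) x + (\<Sum>l<m. D l)" for m
      by (induction m) (auto simp: D_def)
    have "(\<lambda>m. F (s 0) x + (\<Sum>l<m. D l)) \<longlonglongrightarrow> F (s 0) x + suminf D"
      by (intro tendsto_intros summable_LIMSEQ sD)
    then have "(\<lambda>m. F (s m) x) \<longlonglongrightarrow> F (s 0) x + suminf D" by (simp only: tel[symmetric])
    then have fx: "f x = F (s 0) x + suminf D" unfolding f_def by (rule limI)
    have "F (s n) x - f x = - (\<Sum>m. D (m + n))"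
      using suminf_split_initial_segment[OF sD, of n] by (simp add: fx tel[of n])
    then have "norm (F (s n) x - f x) \<le> (\<Sum>m. norm (D (m + n)))"
      using summable_norm[OF summable_ignore_initial_segment[OF sum, of n]] by simp
    then have "ennreal (norm (F (s n) x - f x)) \<le> ennreal (\<Sum>m. norm (D (m + n)))" by (rule ennreal_leI)
    also have "\<dots> = V n x"
      unfolding V_def d_def D_def[symmetric]
      by (rule suminf_ennreal2[symmetric]) (auto intro: summable_ignore_initial_segment[OF sum])
    finally show ?case .
  qed
  have sub: "X_norm \<rho> (\<lambda>x. F (s n) x - f x) \<le> ennreal (2 * (1/2) ^ n)" for n
  proof -
    have "X_norm \<rho> (\<lambda>x. F (s n) x - f x) \<le> \<rho> (V n)"
      unfolding X_norm_def using F fM by (intro \<rho>_mono VM bound norm_BM) auto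
    then show ?thesis using V[of n] by (rule order_trans)
  qed
  have "(\<lambda>j. X_norm \<rho> (\<lambda>x. F j x - f x)) \<longlonglongrightarrow> 0"
  proof (rule ennreal_tendsto_0I)
    fix e :: real assume e: "e > 0"
    \<comment> \<open>A third, because the two error terms add up to
      \<open>3 * (1/2) ^ n\<close>.\<close>
    obtain n where n: "(1/2) ^ n < e / 3" using real_arch_pow_inv[of "e / 3" "1/2"] e by auto
    show "\<forall>\<^sub>F j in sequentially. X_norm \<rho> (\<lambda>x. F j x - f x) \<le> ennreal e"
    proof (rule eventually_sequentiallyI[of "N n"])
      fix j assume "N n \<le> j"
      have "X_norm \<rho> (\<lambda>x. F j x - f x) \<le>
          X_norm \<rho> (\<lambda>x. F j x - F (s n) x) + X_norm \<rho> (\<lambda>x. F (s n) x - f x)"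
        by (intro X_norm_diff_triangle F fM)
      also have "\<dots> \<le> ennreal ((1/2) ^ n) + ennreal (2 * (1/2) ^ n)"
        using N[OF \<open>N n \<le> j\<close> sN(1)] sub by (intro add_mono)
      also have "\<dots> \<le> ennreal e" using n by (simp flip: ennreal_plus add: ennreal_leI)
      finally show "X_norm \<rho> (\<lambda>x. F j x - f x) \<le> ennreal e" .
    qed
  qed
  then show ?thesis using fM by blast
qed

end

section \<open>Weak derivatives\<close>

text \<open>Tested against a basis vector, the product of \<open>\<phi>\<close> and \<open>u\<close>
  is again a scalar test function, whose derivatives have integral zero; hence no boundary term
  appears.\<close>

lemma integral_by_parts:
  fixes u :: "real^'n::finite \<Rightarrow> 'v::euclidean_space"
  assumes \<Omega>: "open \<Omega>" and u: "smooth_on \<Omega> u" and \<phi>: "\<phi> \<in> test_functions \<Omega>"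
  shows "(\<integral>x. partial_deriv i \<phi> x *\<^sub>R u x \<partial>lebesgue) = - (\<integral>x. \<phi> x *\<^sub>R partial_deriv i u x \<partial>lebesgue)"
proof (rule euclidean_eqI)
  fix b :: 'v assume "b \<in> Basis"
  have cu: "u \<in> L1_loc \<Omega>" "partial_deriv i u \<in> L1_loc \<Omega>"
    using u by (auto intro!: continuous_on_L1_loc smooth_on_imp_continuous_on smooth_on_partial_deriv)
  have sb: "smooth_on \<Omega> (\<lambda>x. u x \<bullet> b)"
    by (rule smooth_on_bounded_linear[OF \<Omega> bounded_linear_inner_left u])
  have tf: "(\<lambda>x. \<phi> x * (u x \<bullet> b)) \<in> test_functions \<Omega>" by (rule test_functions_mult[OF \<phi> sb \<Omega>])
  note int1 = test_L1_loc_integrable[OF cu(1) test_functions_partial_deriv[OF \<phi>, of i]]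
  note int2 = test_L1_loc_integrable[OF cu(2) \<phi>]
  have pd: "partial_deriv i (\<lambda>x. \<phi> x * (u x \<bullet> b)) x =
      (partial_deriv i \<phi> x *\<^sub>R u x) \<bullet> b + (\<phi> x *\<^sub>R partial_deriv i u x) \<bullet> b" for x
  proof (cases "x \<in> \<Omega>")
    case True
    have "partial_deriv i (\<lambda>x. u x \<bullet> b) x = partial_deriv i u x \<bullet> b"
      by (rule partial_deriv_bounded_linear[OF smooth_onD[OF u True] bounded_linear_inner_left])
    then show ?thesis
      using partial_deriv_mult[OF test_functionsD(5)[OF \<phi>] smooth_onD[OF sb True], of i] by simp
  next
    case False
    then show ?thesis
      using test_function_zero[OF test_functions_partial_deriv[OF tf]] test_function_zero[OF \<phi>]
        test_function_zero[OF test_functions_partial_deriv[OF \<phi>]] by simp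
  qed
  have "0 = (\<integral>x. partial_deriv i (\<lambda>x. \<phi> x * (u x \<bullet> b)) x \<partial>lebesgue)"
    using integral_partial_deriv_test_function[OF tf]
      test_function_integrable(2)[OF test_functions_partial_deriv[OF tf]] by metis
  also have "\<dots> = (\<integral>x. (partial_deriv i \<phi> x *\<^sub>R u x) \<bullet> b + (\<phi> x *\<^sub>R partial_deriv i u x) \<bullet> b \<partial>lebesgue)"
    by (simp only: pd)
  also have "\<dots> = (\<integral>x. (partial_deriv i \<phi> x *\<^sub>R u x) \<bullet> b \<partial>lebesgue) +
      (\<integral>x. (\<phi> x *\<^sub>R partial_deriv i u x) \<bullet> b \<partial>lebesgue)"
    by (rule Bochner_Integration.integral_add[OF integrable_inner_left[OF int1] integrable_inner_left[OF int2]])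
  also have "\<dots> = (\<integral>x. partial_deriv i \<phi> x *\<^sub>R u x \<partial>lebesgue) \<bullet> b + (\<integral>x. \<phi> x *\<^sub>R partial_deriv i u x \<partial>lebesgue) \<bullet> b"
    by (simp only: integral_inner_left[OF int1] integral_inner_left[OF int2])
  finally show "(\<integral>x. partial_deriv i \<phi> x *\<^sub>R u x \<partial>lebesgue) \<bullet> b = (- (\<integral>x. \<phi> x *\<^sub>R partial_deriv i u x \<partial>lebesgue)) \<bullet> b"
    by simp
qed

text \<open>The outermost derivative of \<open>\<phi>\<close> is moved first and so becomes the
  innermost one on \<open>u\<close>; hence the reversed list.\<close>

lemma integral_by_parts_foldr:
  fixes u :: "real^'n::finite \<Rightarrow> 'v::euclidean_space"
  assumes \<Omega>: "open \<Omega>" and u: "smooth_on \<Omega> u" and \<phi>: "\<phi> \<in> test_functions \<Omega>"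
  shows "(\<integral>x. foldr partial_deriv is \<phi> x *\<^sub>R u x \<partial>lebesgue) =
    (-1) ^ length is *\<^sub>R (\<integral>x. \<phi> x *\<^sub>R foldr partial_deriv (rev is) u x \<partial>lebesgue)"
  using u
proof (induction "is" arbitrary: u)
  case (Cons i "is")
  have "(\<integral>x. foldr partial_deriv (i # is) \<phi> x *\<^sub>R u x \<partial>lebesgue) =
      - (\<integral>x. foldr partial_deriv is \<phi> x *\<^sub>R partial_deriv i u x \<partial>lebesgue)"
    using integral_by_parts[OF \<Omega> Cons.prems test_functions_foldr_partial_deriv[OF \<phi>]] by simp
  then show ?case using Cons.IH[OF smooth_on_partial_deriv[OF Cons.prems]] by simp
qed simp

section \<open>Rules for weak derivatives\<close>

lemma is_weak_deriv_iff:
  fixes u g :: "real^'n::finite \<Rightarrow> 'v::euclidean_space"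
  assumes \<Omega>: "open \<Omega>"
  shows "is_weak_deriv \<Omega> \<alpha> u g \<longleftrightarrow> u \<in> L1_loc \<Omega> \<and> g \<in> L1_loc \<Omega> \<and>
    (\<forall>\<phi>\<in>test_functions \<Omega>. (-1) ^ mi_abs \<alpha> *\<^sub>R (\<integral>x. mi_deriv \<alpha> \<phi> x *\<^sub>R u x \<partial>lebesgue) = (\<integral>x. \<phi> x *\<^sub>R g x \<partial>lebesgue))"
proof -
  have in_tests: "(dist_deriv \<Omega> \<alpha> (dist_of \<Omega> u) \<phi> = dist_of \<Omega> g \<phi>) =
    ((-1) ^ mi_abs \<alpha> *\<^sub>R (\<integral>x. mi_deriv \<alpha> \<phi> x *\<^sub>R u x \<partial>lebesgue) = (\<integral>x. \<phi> x *\<^sub>R g x \<partial>lebesgue))"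
    if \<phi>: "\<phi> \<in> test_functions \<Omega>" for \<phi>
    using \<phi> by (simp add: dist_deriv_def dist_of_eq_lebesgue[OF \<Omega>] test_functions_mi_deriv)
  have "dist_deriv \<Omega> \<alpha> (dist_of \<Omega> u) \<phi> = dist_of \<Omega> g \<phi>" if "\<phi> \<notin> test_functions \<Omega>" for \<phi>
    using that by (simp add: dist_deriv_def dist_of_def)
  then have "dist_deriv \<Omega> \<alpha> (dist_of \<Omega> u) = dist_of \<Omega> g \<longleftrightarrow>
    (\<forall>\<phi>\<in>test_functions \<Omega>. dist_deriv \<Omega> \<alpha> (dist_of \<Omega> u) \<phi> = dist_of \<Omega> g \<phi>)"
    by (auto simp: fun_eq_iff)
  then show ?thesis by (simp only: is_weak_deriv_def in_tests cong: ball_cong)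
qed

lemma smooth_is_weak_deriv:
  fixes u :: "real^'n::finite \<Rightarrow> 'v::euclidean_space"
  assumes \<Omega>: "open \<Omega>" and u: "smooth_on \<Omega> u"
  shows "is_weak_deriv \<Omega> \<alpha> u (mi_deriv \<alpha> u)"
  unfolding is_weak_deriv_iff[OF \<Omega>]
proof (intro conjI ballI)
  show "u \<in> L1_loc \<Omega>" "mi_deriv \<alpha> u \<in> L1_loc \<Omega>"
    unfolding mi_deriv_eq_foldr
    by (intro continuous_on_L1_loc smooth_on_imp_continuous_on smooth_on_foldr_partial_deriv u)+
  fix \<phi> assume \<phi>: "\<phi> \<in> test_functions \<Omega>"
  \<comment> \<open>The reversal is undone on the test function, which is scalar and smooth on the
    whole space, as the commutation of derivatives was established for such functions.\<close>
  have "mi_deriv \<alpha> \<phi> = foldr partial_deriv (rev (mi_list \<alpha>)) \<phi>"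
    unfolding mi_deriv_eq_foldr by (rule foldr_partial_deriv_mset[OF test_functionsD(1)[OF \<phi>]]) simp
  then show "(-1) ^ mi_abs \<alpha> *\<^sub>R (\<integral>x. mi_deriv \<alpha> \<phi> x *\<^sub>R u x \<partial>lebesgue) = (\<integral>x. \<phi> x *\<^sub>R mi_deriv \<alpha> u x \<partial>lebesgue)"
    using integral_by_parts_foldr[OF \<Omega> u \<phi>, of "rev (mi_list \<alpha>)"]
    by (simp add: mi_deriv_eq_foldr length_mi_list flip: power_add power_mult_distrib)
qed

lemma L1_loc_lincomb:
  fixes u v :: "real^'n::finite \<Rightarrow> 'v::euclidean_space"
  assumes "u \<in> L1_loc \<Omega>" "v \<in> L1_loc \<Omega>"
  shows "(\<lambda>x. a *\<^sub>R u x + b *\<^sub>R v x) \<in> L1_loc \<Omega>"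
  using assms unfolding L1_loc_def by (auto intro!: set_integral_add absolutely_integrable_scaleR_left)

lemma is_weak_deriv_lincomb:
  fixes u v :: "real^'n::finite \<Rightarrow> 'v::euclidean_space"
  assumes \<Omega>: "open \<Omega>" and "is_weak_deriv \<Omega> \<alpha> u g" "is_weak_deriv \<Omega> \<alpha> v h"
  shows "is_weak_deriv \<Omega> \<alpha> (\<lambda>x. a *\<^sub>R u x + b *\<^sub>R v x) (\<lambda>x. a *\<^sub>R g x + b *\<^sub>R h x)"
  unfolding is_weak_deriv_iff[OF \<Omega>]
proof (intro conjI ballI)
  have L: "u \<in> L1_loc \<Omega>" "g \<in> L1_loc \<Omega>" "v \<in> L1_loc \<Omega>" "h \<in> L1_loc \<Omega>"
    using assms by (auto simp: is_weak_deriv_def)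
  then show "(\<lambda>x. a *\<^sub>R u x + b *\<^sub>R v x) \<in> L1_loc \<Omega>" "(\<lambda>x. a *\<^sub>R g x + b *\<^sub>R h x) \<in> L1_loc \<Omega>"
    by (auto intro: L1_loc_lincomb)
  fix \<phi> assume \<phi>: "\<phi> \<in> test_functions \<Omega>"
  have lin: "(\<integral>x. \<psi> x *\<^sub>R (a *\<^sub>R w x + b *\<^sub>R z x) \<partial>lebesgue) =
      a *\<^sub>R (\<integral>x. \<psi> x *\<^sub>R w x \<partial>lebesgue) + b *\<^sub>R (\<integral>x. \<psi> x *\<^sub>R z x \<partial>lebesgue)"
    if "\<psi> \<in> test_functions \<Omega>" "w \<in> L1_loc \<Omega>" "z \<in> L1_loc \<Omega>" for \<psi> and w z :: "real^'n \<Rightarrow> 'v"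
  proof -
    have "(\<lambda>x. \<psi> x *\<^sub>R (a *\<^sub>R w x + b *\<^sub>R z x)) = (\<lambda>x. a *\<^sub>R (\<psi> x *\<^sub>R w x) + b *\<^sub>R (\<psi> x *\<^sub>R z x))"
      by (simp add: scaleR_add_right mult.commute)
    then show ?thesis
      by (simp only: integral_scaleR_right Bochner_Integration.integral_add
          [OF integrable_scaleR_right[OF test_L1_loc_integrable[OF that(2,1)]]
            integrable_scaleR_right[OF test_L1_loc_integrable[OF that(3,1)]]])
  qed
  have "(-1) ^ mi_abs \<alpha> *\<^sub>R (\<integral>x. mi_deriv \<alpha> \<phi> x *\<^sub>R (a *\<^sub>R u x + b *\<^sub>R v x) \<partial>lebesgue) =
     a *\<^sub>R ((-1) ^ mi_abs \<alpha> *\<^sub>R (\<integral>x. mi_deriv \<alpha> \<phi> x *\<^sub>R u x \<partial>lebesgue)) +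
     b *\<^sub>R ((-1) ^ mi_abs \<alpha> *\<^sub>R (\<integral>x. mi_deriv \<alpha> \<phi> x *\<^sub>R v x \<partial>lebesgue))"
    unfolding lin[OF test_functions_mi_deriv[OF \<phi>] L(1,3)] by (simp add: scaleR_add_right mult.commute)
  then show "(-1) ^ mi_abs \<alpha> *\<^sub>R (\<integral>x. mi_deriv \<alpha> \<phi> x *\<^sub>R (a *\<^sub>R u x + b *\<^sub>R v x) \<partial>lebesgue) =
      (\<integral>x. \<phi> x *\<^sub>R (a *\<^sub>R g x + b *\<^sub>R h x) \<partial>lebesgue)"
    using assms(2,3) \<phi> unfolding is_weak_deriv_iff[OF \<Omega>] lin[OF \<phi> L(2,4)] by simp
qed

lemma AE_lebesgue_on_iff:
  assumes "open \<Omega>"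
  shows "(AE x in lebesgue_on \<Omega>. P x) \<longleftrightarrow> (AE x in lebesgue. x \<in> \<Omega> \<longrightarrow> P x)"
  using assms by (intro AE_restrict_space_iff) simp

lemma is_weak_deriv_unique:
  fixes u :: "real^'n::finite \<Rightarrow> 'v::euclidean_space"
  assumes "open \<Omega>" "is_weak_deriv \<Omega> \<alpha> u g" "is_weak_deriv \<Omega> \<alpha> u h"
  shows "AE x in lebesgue_on \<Omega>. g x = h x"
  unfolding AE_lebesgue_on_iff[OF assms(1)]
  using assms by (intro dist_of_eq_imp_AE) (auto simp: is_weak_deriv_def)

lemma dist_of_cong_AE:
  fixes u v :: "real^'n::finite \<Rightarrow> 'v::euclidean_space"
  assumes \<Omega>: "open \<Omega>" and "u \<in> L1_loc \<Omega>" "v \<in> L1_loc \<Omega>" and ae: "AE x in lebesgue_on \<Omega>. u x = v x"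
  shows "dist_of \<Omega> u = dist_of \<Omega> v"
proof
  fix \<phi>
  show "dist_of \<Omega> u \<phi> = dist_of \<Omega> v \<phi>"
  proof (cases "\<phi> \<in> test_functions \<Omega>")
    case True
    have "(\<integral>x. \<phi> x *\<^sub>R u x \<partial>lebesgue) = (\<integral>x. \<phi> x *\<^sub>R v x \<partial>lebesgue)"
    proof (rule integral_cong_AE)
      show "AE x in lebesgue. \<phi> x *\<^sub>R u x = \<phi> x *\<^sub>R v x"
        using ae unfolding AE_lebesgue_on_iff[OF \<Omega>]
        by eventually_elim (use test_function_zero[OF True] in force)
    qed (intro borel_measurable_integrable test_L1_loc_integrable[OF _ True] assms)+
    then show ?thesis by (simp add: dist_of_eq_lebesgue[OF \<Omega> True])
  qed (simp add: dist_of_def)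
qed

text \<open>Equality of the predicates makes the choice in \<open>weak_deriv\<close> return the
  identical representative for both functions, not merely one that agrees almost everywhere.\<close>

lemma is_weak_deriv_cong:
  assumes "u \<in> L1_loc \<Omega>" "v \<in> L1_loc \<Omega>" "dist_of \<Omega> u = dist_of \<Omega> v"
  shows "is_weak_deriv \<Omega> \<alpha> u = is_weak_deriv \<Omega> \<alpha> v"
  by (rule ext) (simp add: is_weak_deriv_def assms)

lemma is_weak_deriv_0:
  fixes u :: "real^'n::finite \<Rightarrow> 'v::euclidean_space"
  assumes "open \<Omega>" "u \<in> L1_loc \<Omega>"
  shows "is_weak_deriv \<Omega> (\<lambda>_. 0) u u"
  using assms by (simp add: is_weak_deriv_iff mi_abs_def)

text \<open>Such a distribution has order 0: on test functions supported in \<open>K\<close> it is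
  bounded by the integral of the norm of \<open>u\<close> over \<open>K\<close> times the supremum
  of the test function.\<close>

lemma dist_of_distributions:
  fixes u :: "real^'n::finite \<Rightarrow> 'v::euclidean_space"
  assumes \<Omega>: "open \<Omega>" and u: "u \<in> L1_loc \<Omega>"
  shows "dist_of \<Omega> u \<in> distributions \<Omega>"
  unfolding distributions_def
proof (intro CollectI conjI)
  have lin: "linear_on_tests \<Omega> (dist_of \<Omega> u)" by (rule linear_on_tests_dist_of[OF \<Omega> u])
  show "\<forall>\<phi>. \<phi> \<notin> test_functions \<Omega> \<longrightarrow> dist_of \<Omega> u \<phi> = 0" by (simp add: dist_of_def)
  show "\<forall>\<phi>\<in>test_functions \<Omega>. \<forall>\<psi>\<in>test_functions \<Omega>. dist_of \<Omega> u (\<lambda>x. \<phi> x + \<psi> x) = dist_of \<Omega> u \<phi> + dist_of \<Omega> u \<psi>"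
    "\<forall>\<phi>\<in>test_functions \<Omega>. \<forall>c. dist_of \<Omega> u (\<lambda>x. c * \<phi> x) = c *\<^sub>R dist_of \<Omega> u \<phi>"
    using lin by (auto simp: linear_on_tests_def)
  show "\<forall>K. compact K \<and> K \<subseteq> \<Omega> \<longrightarrow> (\<exists>C m. \<forall>\<phi>\<in>test_functions \<Omega>. supp \<phi> \<subseteq> K \<longrightarrow>
      norm (dist_of \<Omega> u \<phi>) \<le> C * (\<Sum>\<alpha> | mi_abs \<alpha> \<le> m. SUP x. \<bar>mi_deriv \<alpha> \<phi> x\<bar>))"
  proof (intro allI impI)
    fix K assume K: "compact K \<and> K \<subseteq> \<Omega>"
    have int: "integrable lebesgue (\<lambda>x. indicator K x *\<^sub>R u x)"
      using u K by (auto simp: L1_loc_def set_integrable_def)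
    define C where "C = (\<integral>x. norm (indicat_real K x *\<^sub>R u x) \<partial>lebesgue)"
    have "norm (dist_of \<Omega> u \<phi>) \<le> C * (\<Sum>\<alpha> | mi_abs \<alpha> \<le> 0. SUP x. \<bar>mi_deriv \<alpha> \<phi> x\<bar>)"
      if \<phi>: "\<phi> \<in> test_functions \<Omega>" and s: "supp \<phi> \<subseteq> K" for \<phi>
    proof -
      have "bounded (\<phi> ` supp \<phi>)"
        by (intro compact_imp_bounded compact_continuous_image test_functionsD(2,4)[OF \<phi>])
      then obtain B where B: "\<And>x. x \<in> supp \<phi> \<Longrightarrow> \<bar>\<phi> x\<bar> \<le> B" by (auto simp: bounded_iff)
      have "\<bar>\<phi> x\<bar> \<le> max 0 B" for x
      proof (cases "x \<in> supp \<phi>")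
        case True
        then show ?thesis using B[OF True] by simp
      next
        case False
        then have "\<phi> x = 0" by (rule supp_zero)
        then show ?thesis by simp
      qed
      then have bdd: "bdd_above (range (\<lambda>x. \<bar>\<phi> x\<bar>))" by (intro bdd_aboveI[of _ "max 0 B"]) auto
      define S where "S = (SUP x. \<bar>\<phi> x\<bar>)"
      have S: "\<bar>\<phi> x\<bar> \<le> S" for x unfolding S_def using bdd by (rule cSUP_upper[OF UNIV_I])
      have "{\<alpha>::'n \<Rightarrow> nat. mi_abs \<alpha> \<le> 0} = {\<lambda>_. 0}" by (auto simp: mi_abs_eq_0_iff)
      then have sum: "(\<Sum>\<alpha> | mi_abs \<alpha> \<le> 0. SUP x. \<bar>mi_deriv \<alpha> \<phi> x\<bar>) = S" by (simp add: S_def)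
      have "norm (dist_of \<Omega> u \<phi>) \<le> (\<integral>x. S * norm (indicat_real K x *\<^sub>R u x) \<partial>lebesgue)"
        unfolding dist_of_eq_lebesgue[OF \<Omega> \<phi>]
      proof (rule Bochner_Integration.integral_norm_bound_integral)
        show "integrable lebesgue (\<lambda>x. \<phi> x *\<^sub>R u x)" by (rule test_L1_loc_integrable[OF u \<phi>])
        show "integrable lebesgue (\<lambda>x. S * norm (indicat_real K x *\<^sub>R u x))"
          using int by (intro integrable_mult_right integrable_norm)
        fix x
        show "norm (\<phi> x *\<^sub>R u x) \<le> S * norm (indicat_real K x *\<^sub>R u x)"
        proof (cases "x \<in> K")
          case True
          then show ?thesis using S[of x] by (simp add: mult_right_mono)
        next
          case False
          then have "\<phi> x = 0" using s supp_zero[of x \<phi>] by blast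
          then show ?thesis using False by simp
        qed
      qed
      then show ?thesis unfolding sum by (simp add: C_def mult.commute)
    qed
    then show "\<exists>C m. \<forall>\<phi>\<in>test_functions \<Omega>. supp \<phi> \<subseteq> K \<longrightarrow>
      norm (dist_of \<Omega> u \<phi>) \<le> C * (\<Sum>\<alpha> | mi_abs \<alpha> \<le> m. SUP x. \<bar>mi_deriv \<alpha> \<phi> x\<bar>)" by blast
  qed
qed

section \<open>Sobolev spaces over Banach function spaces\<close>

context banach_function_space
begin

lemma weak_deriv_measurable:
  fixes u g :: "real^'n \<Rightarrow> 'v::euclidean_space"
  shows "is_weak_deriv \<Omega> \<alpha> u g \<Longrightarrow> u \<in> BM" "is_weak_deriv \<Omega> \<alpha> u g \<Longrightarrow> g \<in> BM"
  by (auto simp: is_weak_deriv_def intro: L1_loc_measurable)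

lemma is_weak_deriv_weak_deriv: "is_weak_deriv \<Omega> \<alpha> u g \<Longrightarrow> is_weak_deriv \<Omega> \<alpha> u (weak_deriv \<Omega> \<alpha> u)"
  unfolding weak_deriv_def by (rule someI[where P = "is_weak_deriv \<Omega> \<alpha> u"])

lemma weak_deriv_AE:
  fixes u g :: "real^'n \<Rightarrow> 'v::euclidean_space"
  assumes "is_weak_deriv \<Omega> \<alpha> u g"
  shows "AE x in lebesgue_on \<Omega>. weak_deriv \<Omega> \<alpha> u x = g x"
  using is_weak_deriv_unique[OF \<Omega>(1) is_weak_deriv_weak_deriv[OF assms] assms] .

lemma X_norm_weak_deriv:
  fixes u g :: "real^'n \<Rightarrow> 'v::euclidean_space"
  assumes "is_weak_deriv \<Omega> \<alpha> u g"
  shows "X_norm \<rho> (weak_deriv \<Omega> \<alpha> u) = X_norm \<rho> g"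
  using weak_deriv_measurable(2)[OF is_weak_deriv_weak_deriv[OF assms]] weak_deriv_measurable(2)[OF assms]
    weak_deriv_AE[OF assms] by (rule X_norm_cong)

lemma W_norm_eq:
  fixes u :: "real^'n \<Rightarrow> 'v::euclidean_space"
  assumes "\<And>\<alpha>. mi_abs \<alpha> \<le> k \<Longrightarrow> is_weak_deriv \<Omega> \<alpha> u (g \<alpha>)"
  shows "W_norm \<Omega> k \<rho> u = (\<Sum>\<alpha> | mi_abs \<alpha> \<le> k. X_norm \<rho> (g \<alpha>))"
  unfolding W_norm_def using X_norm_weak_deriv[OF assms] by (intro sum.cong) auto

lemma W_spaceI:
  fixes u :: "real^'n \<Rightarrow> 'v::euclidean_space"
  assumes "\<And>\<alpha>. mi_abs \<alpha> \<le> k \<Longrightarrow> is_weak_deriv \<Omega> \<alpha> u (g \<alpha>)"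
    and "\<And>\<alpha>. mi_abs \<alpha> \<le> k \<Longrightarrow> X_norm \<rho> (g \<alpha>) < \<infinity>"
  shows "u \<in> W_space \<Omega> k \<rho>"
proof -
  have "W_norm \<Omega> k \<rho> u = (\<Sum>\<alpha> | mi_abs \<alpha> \<le> k. X_norm \<rho> (g \<alpha>))" by (rule W_norm_eq[OF assms(1)])
  also have "\<dots> < \<infinity>" using assms(2) by (simp add: finite_mi_abs_le)
  finally have "W_norm \<Omega> k \<rho> u < \<infinity>" .
  then show ?thesis unfolding W_space_def using assms(1) by blast
qed

lemma W_spaceD:
  fixes u :: "real^'n \<Rightarrow> 'v::euclidean_space"
  assumes u: "u \<in> W_space \<Omega> k \<rho>"
  shows "mi_abs \<alpha> \<le> k \<Longrightarrow> is_weak_deriv \<Omega> \<alpha> u (weak_deriv \<Omega> \<alpha> u)"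
    and "mi_abs \<alpha> \<le> k \<Longrightarrow> weak_deriv \<Omega> \<alpha> u \<in> BM"
    and "mi_abs \<alpha> \<le> k \<Longrightarrow> X_norm \<rho> (weak_deriv \<Omega> \<alpha> u) \<le> W_norm \<Omega> k \<rho> u"
    and "W_norm \<Omega> k \<rho> u < \<infinity>" and "u \<in> L1_loc \<Omega>" and "u \<in> BM"
    and "X_norm \<rho> u \<le> W_norm \<Omega> k \<rho> u" and "X_norm \<rho> u < \<infinity>"
proof -
  show wd: "is_weak_deriv \<Omega> \<alpha> u (weak_deriv \<Omega> \<alpha> u)" if "mi_abs \<alpha> \<le> k" for \<alpha>
    using u that is_weak_deriv_weak_deriv unfolding W_space_def by blast
  then show "mi_abs \<alpha> \<le> k \<Longrightarrow> weak_deriv \<Omega> \<alpha> u \<in> BM" by (rule weak_deriv_measurable)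
  show le: "X_norm \<rho> (weak_deriv \<Omega> \<alpha> u) \<le> W_norm \<Omega> k \<rho> u" if "mi_abs \<alpha> \<le> k" for \<alpha>
    unfolding W_norm_def using that by (intro member_le_sum) (auto simp: finite_mi_abs_le)
  show fin: "W_norm \<Omega> k \<rho> u < \<infinity>" using u unfolding W_space_def by blast
  have 0: "mi_abs (\<lambda>_::'n. 0) \<le> k" by (simp add: mi_abs_def)
  show L: "u \<in> L1_loc \<Omega>" using wd[OF 0] by (simp add: is_weak_deriv_def)
  then show "u \<in> BM" by (rule L1_loc_measurable)
  show "X_norm \<rho> u \<le> W_norm \<Omega> k \<rho> u"
    using le[OF 0] X_norm_weak_deriv[OF is_weak_deriv_0[OF \<Omega>(1) L]] by simp
  then show "X_norm \<rho> u < \<infinity>" using fin by (rule order_le_less_trans)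
qed

lemma W_space_lincomb:
  fixes u v :: "real^'n \<Rightarrow> 'v::euclidean_space"
  assumes u: "u \<in> W_space \<Omega> k \<rho>" and v: "v \<in> W_space \<Omega> k \<rho>"
  shows "(\<lambda>x. a *\<^sub>R u x + b *\<^sub>R v x) \<in> W_space \<Omega> k \<rho>"
    and "W_norm \<Omega> k \<rho> (\<lambda>x. a *\<^sub>R u x + b *\<^sub>R v x) \<le> ennreal \<bar>a\<bar> * W_norm \<Omega> k \<rho> u + ennreal \<bar>b\<bar> * W_norm \<Omega> k \<rho> v"
    and "mi_abs \<alpha> \<le> k \<Longrightarrow> AE x in lebesgue_on \<Omega>. weak_deriv \<Omega> \<alpha> (\<lambda>x. a *\<^sub>R u x + b *\<^sub>R v x) x =
      a *\<^sub>R weak_deriv \<Omega> \<alpha> u x + b *\<^sub>R weak_deriv \<Omega> \<alpha> v x"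
proof -
  let ?g = "\<lambda>\<alpha> x. a *\<^sub>R weak_deriv \<Omega> \<alpha> u x + b *\<^sub>R weak_deriv \<Omega> \<alpha> v x"
  have wd: "is_weak_deriv \<Omega> \<alpha> (\<lambda>x. a *\<^sub>R u x + b *\<^sub>R v x) (?g \<alpha>)" if "mi_abs \<alpha> \<le> k" for \<alpha>
    by (rule is_weak_deriv_lincomb[OF \<Omega>(1) W_spaceD(1)[OF u that] W_spaceD(1)[OF v that]])
  have le: "X_norm \<rho> (?g \<alpha>) \<le> ennreal \<bar>a\<bar> * X_norm \<rho> (weak_deriv \<Omega> \<alpha> u) + ennreal \<bar>b\<bar> * X_norm \<rho> (weak_deriv \<Omega> \<alpha> v)"
    if "mi_abs \<alpha> \<le> k" for \<alpha>
    using X_norm_add[of "\<lambda>x. a *\<^sub>R weak_deriv \<Omega> \<alpha> u x" "\<lambda>x. b *\<^sub>R weak_deriv \<Omega> \<alpha> v x"]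
      W_spaceD(2)[OF u that] W_spaceD(2)[OF v that]
    by (simp add: X_norm_scaleR)
  show "W_norm \<Omega> k \<rho> (\<lambda>x. a *\<^sub>R u x + b *\<^sub>R v x) \<le> ennreal \<bar>a\<bar> * W_norm \<Omega> k \<rho> u + ennreal \<bar>b\<bar> * W_norm \<Omega> k \<rho> v"
  proof -
    have "W_norm \<Omega> k \<rho> (\<lambda>x. a *\<^sub>R u x + b *\<^sub>R v x) = (\<Sum>\<alpha> | mi_abs \<alpha> \<le> k. X_norm \<rho> (?g \<alpha>))"
      by (rule W_norm_eq[OF wd])
    also have "\<dots> \<le> ennreal \<bar>a\<bar> * W_norm \<Omega> k \<rho> u + ennreal \<bar>b\<bar> * W_norm \<Omega> k \<rho> v"
      unfolding W_norm_def sum_distrib_left sum.distrib[symmetric] by (intro sum_mono le) simp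
    finally show ?thesis .
  qed
  show "(\<lambda>x. a *\<^sub>R u x + b *\<^sub>R v x) \<in> W_space \<Omega> k \<rho>"
  proof (rule W_spaceI[OF wd])
    fix \<alpha> :: "'n \<Rightarrow> nat" assume "mi_abs \<alpha> \<le> k"
    note le[OF this]
    also have "ennreal \<bar>a\<bar> * X_norm \<rho> (weak_deriv \<Omega> \<alpha> u) + ennreal \<bar>b\<bar> * X_norm \<rho> (weak_deriv \<Omega> \<alpha> v) < \<infinity>"
      using W_spaceD(3)[OF u \<open>mi_abs \<alpha> \<le> k\<close>] W_spaceD(3)[OF v \<open>mi_abs \<alpha> \<le> k\<close>] W_spaceD(4)[OF u] W_spaceD(4)[OF v]
      by (auto simp: ennreal_mult_less_top)
    finally show "X_norm \<rho> (?g \<alpha>) < \<infinity>" .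
  qed
  show "mi_abs \<alpha> \<le> k \<Longrightarrow> AE x in lebesgue_on \<Omega>. weak_deriv \<Omega> \<alpha> (\<lambda>x. a *\<^sub>R u x + b *\<^sub>R v x) x = ?g \<alpha> x"
    by (rule weak_deriv_AE[OF wd])
qed

lemma W_space_scaleR:
  fixes u :: "real^'n \<Rightarrow> 'v::euclidean_space"
  assumes u: "u \<in> W_space \<Omega> k \<rho>"
  shows "(\<lambda>x. a *\<^sub>R u x) \<in> W_space \<Omega> k \<rho>" and "W_norm \<Omega> k \<rho> (\<lambda>x. a *\<^sub>R u x) = ennreal \<bar>a\<bar> * W_norm \<Omega> k \<rho> u"
proof -
  show "(\<lambda>x. a *\<^sub>R u x) \<in> W_space \<Omega> k \<rho>" using W_space_lincomb(1)[OF u u, of a 0] by simp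
  have wd: "is_weak_deriv \<Omega> \<alpha> (\<lambda>x. a *\<^sub>R u x) (\<lambda>x. a *\<^sub>R weak_deriv \<Omega> \<alpha> u x)" if "mi_abs \<alpha> \<le> k" for \<alpha>
    using is_weak_deriv_lincomb[OF \<Omega>(1) W_spaceD(1)[OF u that] W_spaceD(1)[OF u that], of a 0] by simp
  show "W_norm \<Omega> k \<rho> (\<lambda>x. a *\<^sub>R u x) = ennreal \<bar>a\<bar> * W_norm \<Omega> k \<rho> u"
  proof -
    have "W_norm \<Omega> k \<rho> (\<lambda>x. a *\<^sub>R u x) = (\<Sum>\<alpha> | mi_abs \<alpha> \<le> k. X_norm \<rho> (\<lambda>x. a *\<^sub>R weak_deriv \<Omega> \<alpha> u x))"
      by (rule W_norm_eq[OF wd])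
    also have "\<dots> = ennreal \<bar>a\<bar> * W_norm \<Omega> k \<rho> u"
      unfolding W_norm_def sum_distrib_left by (intro sum.cong X_norm_scaleR W_spaceD(2)[OF u]) auto
    finally show ?thesis .
  qed
qed

lemma W_space_diff:
  fixes u v :: "real^'n \<Rightarrow> 'v::euclidean_space"
  assumes u: "u \<in> W_space \<Omega> k \<rho>" and v: "v \<in> W_space \<Omega> k \<rho>"
  shows "(\<lambda>x. u x - v x) \<in> W_space \<Omega> k \<rho>"
    and "W_norm \<Omega> k \<rho> (\<lambda>x. u x - v x) \<le> W_norm \<Omega> k \<rho> u + W_norm \<Omega> k \<rho> v"
    and "mi_abs \<alpha> \<le> k \<Longrightarrow> AE x in lebesgue_on \<Omega>. weak_deriv \<Omega> \<alpha> (\<lambda>x. u x - v x) x =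
      weak_deriv \<Omega> \<alpha> u x - weak_deriv \<Omega> \<alpha> v x"
  using W_space_lincomb[OF u v, where a = 1 and b = "-1"] by simp_all

lemma W_norm_triangle:
  fixes u v :: "real^'n \<Rightarrow> 'v::euclidean_space"
  assumes u: "u \<in> W_space \<Omega> k \<rho>" and v: "v \<in> W_space \<Omega> k \<rho>"
  shows "W_norm \<Omega> k \<rho> u \<le> W_norm \<Omega> k \<rho> (\<lambda>x. u x - v x) + W_norm \<Omega> k \<rho> v"
  using W_space_lincomb(2)[OF W_space_diff(1)[OF u v] v, of 1 1] by simp

lemma X_norm_diff_weak_deriv_le:
  fixes u v :: "real^'n \<Rightarrow> 'v::euclidean_space"
  assumes u: "u \<in> W_space \<Omega> k \<rho>" and v: "v \<in> W_space \<Omega> k \<rho>" and \<alpha>: "mi_abs \<alpha> \<le> k"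
  shows "X_norm \<rho> (\<lambda>x. weak_deriv \<Omega> \<alpha> u x - weak_deriv \<Omega> \<alpha> v x) \<le> W_norm \<Omega> k \<rho> (\<lambda>x. u x - v x)"
proof -
  have "X_norm \<rho> (\<lambda>x. weak_deriv \<Omega> \<alpha> u x - weak_deriv \<Omega> \<alpha> v x) = X_norm \<rho> (weak_deriv \<Omega> \<alpha> (\<lambda>x. u x - v x))"
    using W_space_diff(3)[OF u v \<alpha>] W_spaceD(2)[OF u \<alpha>] W_spaceD(2)[OF v \<alpha>]
      W_spaceD(2)[OF W_space_diff(1)[OF u v] \<alpha>]
    by (intro X_norm_cong[symmetric]) auto
  then show ?thesis using W_spaceD(3)[OF W_space_diff(1)[OF u v] \<alpha>] by simp
qed

text \<open>A test function is bounded and vanishes off \<open>\<Omega>\<close>, and on the bounded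
  set \<open>\<Omega>\<close> the norm of \<open>X\<close> controls the integral.\<close>

lemma pairing_tendsto:
  fixes h :: "nat \<Rightarrow> real^'n \<Rightarrow> 'v::euclidean_space"
  assumes h: "\<And>j. h j \<in> L1_loc \<Omega>" "g \<in> L1_loc \<Omega>" and lim: "(\<lambda>j. X_norm \<rho> (\<lambda>x. h j x - g x)) \<longlonglongrightarrow> 0"
    and \<phi>: "\<phi> \<in> test_functions \<Omega>"
  shows "(\<lambda>j. \<integral>x. \<phi> x *\<^sub>R h j x \<partial>lebesgue) \<longlonglongrightarrow> (\<integral>x. \<phi> x *\<^sub>R g x \<partial>lebesgue)"
proof -
  note int = test_L1_loc_integrable[OF _ \<phi>]
  have hM: "h j \<in> BM" "g \<in> BM" for j using h by (auto intro: L1_loc_measurable)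
  have "bounded (\<phi> ` supp \<phi>)"
    by (intro compact_imp_bounded compact_continuous_image test_functionsD(2,4)[OF \<phi>])
  then obtain B where B: "B > 0" "\<And>x. x \<in> supp \<phi> \<Longrightarrow> \<bar>\<phi> x\<bar> \<le> B" by (auto simp: bounded_pos)
  have B': "\<bar>\<phi> x\<bar> \<le> B" for x
  proof (cases "x \<in> supp \<phi>")
    case False
    then have "\<phi> x = 0" by (rule supp_zero)
    then show ?thesis using B(1) by simp
  qed (rule B(2))
  obtain c where c: "c > 0" "\<And>u. u \<in> BM \<Longrightarrow> (\<integral>\<^sup>+x. u x \<partial>lebesgue_on \<Omega>) \<le> ennreal c * \<rho> u"
    using \<rho>_L1 by blast
  have bound: "ennreal (norm ((\<integral>x. \<phi> x *\<^sub>R h j x \<partial>lebesgue) - (\<integral>x. \<phi> x *\<^sub>R g x \<partial>lebesgue))) \<le>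
      ennreal (B * c) * X_norm \<rho> (\<lambda>x. h j x - g x)" for j
  proof -
    have "(\<integral>x. \<phi> x *\<^sub>R h j x \<partial>lebesgue) - (\<integral>x. \<phi> x *\<^sub>R g x \<partial>lebesgue) =
        (\<integral>x. \<phi> x *\<^sub>R h j x - \<phi> x *\<^sub>R g x \<partial>lebesgue)"
      by (rule Bochner_Integration.integral_diff[symmetric, OF int[OF h(1)] int[OF h(2)]])
    then have "ennreal (norm ((\<integral>x. \<phi> x *\<^sub>R h j x \<partial>lebesgue) - (\<integral>x. \<phi> x *\<^sub>R g x \<partial>lebesgue))) \<le>
        (\<integral>\<^sup>+x. ennreal (norm (\<phi> x *\<^sub>R h j x - \<phi> x *\<^sub>R g x)) \<partial>lebesgue)"
      using integral_norm_bound_ennreal[OF Bochner_Integration.integrable_diff[OF int[OF h(1)] int[OF h(2)]]] by simp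
    also have "\<dots> \<le> (\<integral>\<^sup>+x. ennreal B * ennreal (norm (h j x - g x)) * indicator \<Omega> x \<partial>lebesgue)"
    proof (rule nn_integral_mono)
      fix x
      show "ennreal (norm (\<phi> x *\<^sub>R h j x - \<phi> x *\<^sub>R g x)) \<le> ennreal B * ennreal (norm (h j x - g x)) * indicator \<Omega> x"
      proof (cases "x \<in> \<Omega>")
        case True
        have "norm (\<phi> x *\<^sub>R h j x - \<phi> x *\<^sub>R g x) = \<bar>\<phi> x\<bar> * norm (h j x - g x)"
          by (simp add: scaleR_diff_right[symmetric])
        also have "\<dots> \<le> B * norm (h j x - g x)" by (intro mult_right_mono B') simp
        finally show ?thesis using True B(1) by (simp add: ennreal_leI flip: ennreal_mult)
      qed (simp add: test_function_zero[OF \<phi>])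
    qed
    also have "\<dots> = (\<integral>\<^sup>+x. ennreal B * ennreal (norm (h j x - g x)) \<partial>lebesgue_on \<Omega>)"
      using \<Omega>_lmeasurable(2) by (subst nn_integral_restrict_space) auto
    also have "\<dots> = ennreal B * (\<integral>\<^sup>+x. ennreal (norm (h j x - g x)) \<partial>lebesgue_on \<Omega>)"
      using hM by (intro nn_integral_cmult) auto
    also have "\<dots> \<le> ennreal B * (ennreal c * X_norm \<rho> (\<lambda>x. h j x - g x))"
      unfolding X_norm_def using hM by (intro mult_left_mono c(2) norm_BM) auto
    finally show ?thesis using B(1) c(1) by (simp add: ennreal_mult mult.assoc)
  qed
  have "(\<lambda>j. ennreal (B * c) * X_norm \<rho> (\<lambda>x. h j x - g x)) \<longlonglongrightarrow> 0"
    using B(1) c(1) by (intro ennreal_cmult_tendsto_0 lim) simp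
  from ennreal_tendsto_0_mono[OF this bound] have "(\<lambda>j. ennreal (norm ((\<integral>x. \<phi> x *\<^sub>R h j x \<partial>lebesgue) - (\<integral>x. \<phi> x *\<^sub>R g x \<partial>lebesgue)))) \<longlonglongrightarrow> ennreal 0"
    by (simp only: ennreal_0)
  then have "(\<lambda>j. norm ((\<integral>x. \<phi> x *\<^sub>R h j x \<partial>lebesgue) - (\<integral>x. \<phi> x *\<^sub>R g x \<partial>lebesgue))) \<longlonglongrightarrow> 0"
    by (subst (asm) tendsto_ennreal_iff) auto
  then show ?thesis by (simp add: tendsto_norm_zero_iff LIM_zero_iff)
qed

text \<open>The derivatives converge separately in \<open>X\<close>; by
  \<open>pairing_tendsto\<close> the defining identity of weak derivatives passes to the limits, so
  these are the derivatives of the limit of order zero.\<close>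

lemma W_complete:
  fixes U :: "nat \<Rightarrow> real^'n \<Rightarrow> 'v::euclidean_space"
  assumes U: "\<And>j. U j \<in> W_space \<Omega> k \<rho>"
    and Cauchy: "\<And>e::real. e > 0 \<Longrightarrow> \<exists>N. \<forall>i\<ge>N. \<forall>j\<ge>N. W_norm \<Omega> k \<rho> (\<lambda>x. U i x - U j x) \<le> ennreal e"
  shows "\<exists>u\<in>W_space \<Omega> k \<rho>. (\<lambda>j. W_norm \<Omega> k \<rho> (\<lambda>x. U j x - u x)) \<longlonglongrightarrow> 0"
proof -
  have "\<exists>f\<in>BM. (\<lambda>j. X_norm \<rho> (\<lambda>x. weak_deriv \<Omega> \<alpha> (U j) x - f x)) \<longlonglongrightarrow> 0" if \<alpha>: "mi_abs \<alpha> \<le> k" for \<alpha>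
  proof (rule X_complete)
    show "weak_deriv \<Omega> \<alpha> (U j) \<in> BM" for j by (rule W_spaceD(2)[OF U \<alpha>])
    fix e :: real assume "e > 0"
    then obtain N where "\<forall>i\<ge>N. \<forall>j\<ge>N. W_norm \<Omega> k \<rho> (\<lambda>x. U i x - U j x) \<le> ennreal e"
      using Cauchy by blast
    then show "\<exists>N. \<forall>i\<ge>N. \<forall>j\<ge>N. X_norm \<rho> (\<lambda>x. weak_deriv \<Omega> \<alpha> (U i) x - weak_deriv \<Omega> \<alpha> (U j) x) \<le> ennreal e"
      using X_norm_diff_weak_deriv_le[OF U U \<alpha>] order_trans by meson
  qed
  then have "\<forall>\<alpha>. \<exists>f. mi_abs \<alpha> \<le> k \<longrightarrow>
      f \<in> BM \<and> (\<lambda>j. X_norm \<rho> (\<lambda>x. weak_deriv \<Omega> \<alpha> (U j) x - f x)) \<longlonglongrightarrow> 0" by blast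
  from choice[OF this] obtain g where gM: "\<And>\<alpha>. mi_abs \<alpha> \<le> k \<Longrightarrow> g \<alpha> \<in> BM"
    and g: "\<And>\<alpha>. mi_abs \<alpha> \<le> k \<Longrightarrow> (\<lambda>j. X_norm \<rho> (\<lambda>x. weak_deriv \<Omega> \<alpha> (U j) x - g \<alpha> x)) \<longlonglongrightarrow> 0"
    by blast
  have g_fin: "X_norm \<rho> (g \<alpha>) < \<infinity>" if \<alpha>: "mi_abs \<alpha> \<le> k" for \<alpha>
  proof -
    obtain j where j: "X_norm \<rho> (\<lambda>x. weak_deriv \<Omega> \<alpha> (U j) x - g \<alpha> x) \<le> ennreal 1"
      using ennreal_tendsto_0D[OF g[OF \<alpha>] zero_less_one] eventually_happens'[OF sequentially_bot] by blast
    have "X_norm \<rho> (g \<alpha>) \<le> X_norm \<rho> (weak_deriv \<Omega> \<alpha> (U j)) + X_norm \<rho> (\<lambda>x. weak_deriv \<Omega> \<alpha> (U j) x - g \<alpha> x)"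
      using X_norm_diff[of "weak_deriv \<Omega> \<alpha> (U j)" "\<lambda>x. weak_deriv \<Omega> \<alpha> (U j) x - g \<alpha> x"]
        W_spaceD(2)[OF U \<alpha>] gM[OF \<alpha>] by simp
    also have "\<dots> \<le> W_norm \<Omega> k \<rho> (U j) + ennreal 1"
      by (intro add_mono W_spaceD(3)[OF U \<alpha>] j)
    also have "\<dots> < \<infinity>" using W_spaceD(4)[OF U] by simp
    finally show ?thesis .
  qed
  have gL: "g \<alpha> \<in> L1_loc \<Omega>" if "mi_abs \<alpha> \<le> k" for \<alpha> using that by (intro X_L1_loc gM g_fin)
  define u where "u = g (\<lambda>_. 0)"
  have 0: "mi_abs (\<lambda>_::'n. 0) \<le> k" by (simp add: mi_abs_def)
  have wdL: "weak_deriv \<Omega> \<alpha> (U j) \<in> L1_loc \<Omega>" if "mi_abs \<alpha> \<le> k" for \<alpha> j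
    using W_spaceD(1)[OF U that] by (simp add: is_weak_deriv_def)
  have u_lim: "(\<lambda>j. X_norm \<rho> (\<lambda>x. U j x - u x)) \<longlonglongrightarrow> 0"
  proof -
    have "X_norm \<rho> (\<lambda>x. U j x - u x) = X_norm \<rho> (\<lambda>x. weak_deriv \<Omega> (\<lambda>_. 0) (U j) x - g (\<lambda>_. 0) x)" for j
      unfolding u_def
      using weak_deriv_AE[OF is_weak_deriv_0[OF \<Omega>(1) W_spaceD(5)[OF U]], of j]
        W_spaceD(2)[OF U 0] W_spaceD(6)[OF U] gM[OF 0]
      by (intro X_norm_cong) auto
    then show ?thesis using g[OF 0] by simp
  qed
  have wd: "is_weak_deriv \<Omega> \<alpha> u (g \<alpha>)" if \<alpha>: "mi_abs \<alpha> \<le> k" for \<alpha>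
    unfolding is_weak_deriv_iff[OF \<Omega>(1)]
  proof (intro conjI ballI)
    show "u \<in> L1_loc \<Omega>" "g \<alpha> \<in> L1_loc \<Omega>" unfolding u_def by (intro gL 0 \<alpha>)+
    fix \<phi> assume \<phi>: "\<phi> \<in> test_functions \<Omega>"
    have "(\<lambda>j. (-1) ^ mi_abs \<alpha> *\<^sub>R (\<integral>x. mi_deriv \<alpha> \<phi> x *\<^sub>R U j x \<partial>lebesgue)) \<longlonglongrightarrow>
        (-1) ^ mi_abs \<alpha> *\<^sub>R (\<integral>x. mi_deriv \<alpha> \<phi> x *\<^sub>R u x \<partial>lebesgue)"
      by (intro tendsto_scaleR tendsto_const pairing_tendsto W_spaceD(5)[OF U] \<open>u \<in> L1_loc \<Omega>\<close> u_lim
          test_functions_mi_deriv \<phi>)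
    moreover have "(-1) ^ mi_abs \<alpha> *\<^sub>R (\<integral>x. mi_deriv \<alpha> \<phi> x *\<^sub>R U j x \<partial>lebesgue) =
        (\<integral>x. \<phi> x *\<^sub>R weak_deriv \<Omega> \<alpha> (U j) x \<partial>lebesgue)" for j
      using W_spaceD(1)[OF U \<alpha>, of j] \<phi> unfolding is_weak_deriv_iff[OF \<Omega>(1)] by blast
    moreover have "(\<lambda>j. \<integral>x. \<phi> x *\<^sub>R weak_deriv \<Omega> \<alpha> (U j) x \<partial>lebesgue) \<longlonglongrightarrow> (\<integral>x. \<phi> x *\<^sub>R g \<alpha> x \<partial>lebesgue)"
      by (intro pairing_tendsto wdL gL g \<alpha> \<phi>)
    ultimately show "(-1) ^ mi_abs \<alpha> *\<^sub>R (\<integral>x. mi_deriv \<alpha> \<phi> x *\<^sub>R u x \<partial>lebesgue) = (\<integral>x. \<phi> x *\<^sub>R g \<alpha> x \<partial>lebesgue)"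
      using LIMSEQ_unique by auto
  qed
  have uW: "u \<in> W_space \<Omega> k \<rho>" by (rule W_spaceI[OF wd g_fin])
  have "W_norm \<Omega> k \<rho> (\<lambda>x. U j x - u x) = (\<Sum>\<alpha> | mi_abs \<alpha> \<le> k. X_norm \<rho> (\<lambda>x. weak_deriv \<Omega> \<alpha> (U j) x - g \<alpha> x))" for j
  proof (rule W_norm_eq)
    fix \<alpha> :: "'n \<Rightarrow> nat" assume \<alpha>: "mi_abs \<alpha> \<le> k"
    show "is_weak_deriv \<Omega> \<alpha> (\<lambda>x. U j x - u x) (\<lambda>x. weak_deriv \<Omega> \<alpha> (U j) x - g \<alpha> x)"
      using is_weak_deriv_lincomb[OF \<Omega>(1) W_spaceD(1)[OF U \<alpha>] wd[OF \<alpha>], of 1 j "-1"] by simp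
  qed
  moreover have "(\<lambda>j. \<Sum>\<alpha> | mi_abs \<alpha> \<le> k. X_norm \<rho> (\<lambda>x. weak_deriv \<Omega> \<alpha> (U j) x - g \<alpha> x)) \<longlonglongrightarrow>
      (\<Sum>\<alpha>\<in>{\<alpha>::'n \<Rightarrow> nat. mi_abs \<alpha> \<le> k}. 0)"
    by (intro tendsto_sum g) simp
  ultimately have "(\<lambda>j. W_norm \<Omega> k \<rho> (\<lambda>x. U j x - u x)) \<longlonglongrightarrow> 0" by (simp only: sum.neutral_const)
  with uW show ?thesis by blast
qed

section \<open>Finitely many components\<close>

lemma piecewise_polynomial_indicator:
  assumes \<omega>: "\<omega> \<in> components \<Omega>"
  shows "piecewise_polynomial \<Omega> (\<lambda>x. if x \<in> \<omega> then v else 0)"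
  unfolding piecewise_polynomial_def
proof
  fix \<omega>' assume \<omega>': "\<omega>' \<in> components \<Omega>"
  show "\<exists>p. polynomial_function p \<and> (\<forall>x\<in>\<omega>'. (if x \<in> \<omega> then v else 0) = p x)"
  proof (cases "\<omega>' = \<omega>")
    case True
    then show ?thesis by (intro exI[of _ "\<lambda>_. v"]) auto
  next
    case False
    then have "\<omega>' \<inter> \<omega> = {}" using components_nonoverlap[OF \<omega>' \<omega>] by blast
    then show ?thesis by (intro exI[of _ "\<lambda>_. 0"]) auto
  qed
qed

lemma mi_deriv_indicator_component:
  fixes v :: "'v::euclidean_space"
  assumes \<omega>: "\<omega> \<in> components \<Omega>" and \<alpha>: "\<alpha> \<noteq> (\<lambda>_. 0)" and x: "x \<in> \<Omega>"
  shows "mi_deriv \<alpha> (\<lambda>x. if x \<in> \<omega> then v else 0) x = 0"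
proof -
  let ?f = "\<lambda>x. if x \<in> \<omega> then v else 0"
  obtain \<omega>' where \<omega>': "\<omega>' \<in> components \<Omega>" "x \<in> \<omega>'" using x Union_components[of \<Omega>] by blast
  have "\<exists>c. \<forall>y\<in>\<omega>'. ?f y = c"
  proof (cases "\<omega>' = \<omega>")
    case False
    then have "\<omega>' \<inter> \<omega> = {}" using components_nonoverlap[OF \<omega>'(1) \<omega>] by blast
    then show ?thesis by (intro exI[of _ 0]) auto
  qed auto
  then obtain c where c: "\<And>y. y \<in> \<omega>' \<Longrightarrow> ?f y = c" by blast
  have "mi_deriv \<alpha> ?f x = mi_deriv \<alpha> (\<lambda>_. c) x"
    unfolding mi_deriv_eq_foldr
    by (rule foldr_partial_deriv_cong_open[OF open_components[OF \<Omega>(1) \<omega>'(1)] \<omega>'(2) c])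
  also have "mi_deriv \<alpha> (\<lambda>_. c) = (\<lambda>_. 0)"
  proof -
    have "mi_abs \<alpha> \<noteq> 0" using \<alpha> by (auto simp: mi_abs_eq_0_iff)
    then have "mi_list \<alpha> \<noteq> []" using length_mi_list[of \<alpha>] by force
    then obtain js j where "mi_list \<alpha> = js @ [j]" by (metis rev_exhaust)
    then show ?thesis by (simp add: mi_deriv_eq_foldr foldr_partial_deriv_0)
  qed
  finally show ?thesis .
qed

lemma finite_components:
  assumes "compact_embedding \<Omega> k \<rho> TYPE(real^'n \<Rightarrow> 'v::euclidean_space)"
  shows "finite (components \<Omega>)"
proof (rule ccontr)
  assume "infinite (components \<Omega>)"
  from infinite_countable_subset[OF this] obtain \<omega> :: "nat \<Rightarrow> (real^'n) set"
    where inj: "inj \<omega>" and range: "range \<omega> \<subseteq> components \<Omega>" by (elim exE conjE)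
  have \<omega>: "\<omega> j \<in> components \<Omega>" for j using range by auto
  obtain b :: 'v where b: "b \<in> Basis" using nonempty_Basis by blast
  define f where "f j = (\<lambda>x. if x \<in> \<omega> j then b else 0)" for j
  have fpw: "piecewise_polynomial \<Omega> (f j)" for j unfolding f_def by (rule piecewise_polynomial_indicator[OF \<omega>])
  have wd: "is_weak_deriv \<Omega> \<alpha> (f j) (mi_deriv \<alpha> (f j))" for \<alpha> j
    by (rule smooth_is_weak_deriv[OF \<Omega>(1) piecewise_polynomial_smooth_on[OF fpw \<Omega>(1)]])
  have fM: "f j \<in> BM" for j using weak_deriv_measurable(1)[OF wd] .
  have f_fin: "X_norm \<rho> (f j) < \<infinity>" for j
    using b by (intro X_norm_bounded[of _ 1] fM) (auto simp: f_def)
  have f_pos: "X_norm \<rho> (f j) \<noteq> 0" for j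
  proof
    assume "X_norm \<rho> (f j) = 0"
    then have "AE x in lebesgue. x \<in> \<Omega> \<longrightarrow> f j x = 0"
      using X_norm_eq_0D[OF fM, of j] by (simp only: AE_lebesgue_on_iff[OF \<Omega>(1)])
    then have "AE x in lebesgue. x \<notin> \<omega> j"
      by eventually_elim (use b in_components_subset[OF \<omega>] in \<open>auto simp: f_def\<close>)
    moreover have "open (\<omega> j)" by (rule open_components[OF \<Omega>(1) \<omega>])
    ultimately have "negligible (\<omega> j)" by (simp add: negligible_iff_null_sets AE_iff_null_sets)
    then show False using open_not_negligible[OF \<open>open (\<omega> j)\<close>] in_components_nonempty[OF \<omega>] by blast
  qed
  have X_mi: "X_norm \<rho> (mi_deriv \<alpha> (f j)) = (if \<alpha> = (\<lambda>_. 0) then X_norm \<rho> (f j) else 0)" for \<alpha> j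
  proof (cases "\<alpha> = (\<lambda>_. 0)")
    case False
    have "mi_deriv \<alpha> (f j) x = 0" if "x \<in> \<Omega>" for x
      unfolding f_def by (rule mi_deriv_indicator_component[OF \<omega> False that])
    then have "AE x in lebesgue_on \<Omega>. mi_deriv \<alpha> (f j) x = 0"
      unfolding AE_lebesgue_on_iff[OF \<Omega>(1)] by (intro AE_I2) blast
    then have "X_norm \<rho> (mi_deriv \<alpha> (f j)) = 0"
      using X_norm_eq_0_iff[OF weak_deriv_measurable(2)[OF wd]] by blast
    then show ?thesis using False by simp
  qed simp
  have fW: "f j \<in> W_space \<Omega> k \<rho>" for j
    by (rule W_spaceI[OF wd]) (use X_mi f_fin in auto)
  \<comment> \<open>All derivatives of positive order vanish, so normalising in \<open>X\<close>
    also normalises in \<open>W^kX\<close>.\<close>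
  have W_f: "W_norm \<Omega> k \<rho> (f j) = X_norm \<rho> (f j)" for j
  proof -
    have "W_norm \<Omega> k \<rho> (f j) = (\<Sum>\<alpha> | mi_abs \<alpha> \<le> k. X_norm \<rho> (mi_deriv \<alpha> (f j)))" by (rule W_norm_eq[OF wd])
    also have "\<dots> = X_norm \<rho> (f j)"
      by (simp add: X_mi sum.delta' finite_mi_abs_le) (simp add: mi_abs_def)
    finally show ?thesis .
  qed
  define c where "c j = enn2real (X_norm \<rho> (f j))" for j
  have c: "X_norm \<rho> (f j) = ennreal (c j)" "c j > 0" for j
    using f_fin[of j] f_pos[of j] by (auto simp: c_def enn2real_positive_iff zero_less_iff_neq_zero)
  define U where "U j = (\<lambda>x. (1 / c j) *\<^sub>R f j x)" for j
  have U: "U j \<in> W_space \<Omega> k \<rho>" "W_norm \<Omega> k \<rho> (U j) = 1" "X_norm \<rho> (U j) = 1" for j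
  proof -
    have "ennreal (1 / c j) * ennreal (c j) = 1" using c(2)[of j] by (simp flip: ennreal_mult)
    then show "W_norm \<Omega> k \<rho> (U j) = 1" "X_norm \<rho> (U j) = 1" "U j \<in> W_space \<Omega> k \<rho>"
      unfolding U_def using W_space_scaleR[OF fW] X_norm_scaleR[OF fM] c(2)[of j] by (auto simp: W_f c(1))
  qed
  have "\<exists>m::real. \<forall>j. W_norm \<Omega> k \<rho> (U j) \<le> ennreal m" by (intro exI[of _ 1]) (simp add: U)
  then obtain r u where r: "strict_mono r" and u: "u \<in> X_space \<Omega> \<rho>"
    and lim: "(\<lambda>j. X_norm \<rho> (\<lambda>x. U (r j) x - u x)) \<longlonglongrightarrow> 0"
    using assms U(1) unfolding compact_embedding_def by blast
  have uM: "u \<in> BM" using u by (simp add: X_space_def)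
  have UM: "U j \<in> BM" for j by (rule W_spaceD(6)[OF U(1)])
  \<comment> \<open>Two errors of at most \<open>1/3\<close> add up to less than 1, the lower bound
    for the mutual distance.\<close>
  obtain N where N: "\<And>j. j \<ge> N \<Longrightarrow> X_norm \<rho> (\<lambda>x. U (r j) x - u x) \<le> ennreal (1/3)"
    using ennreal_tendsto_0D[OF lim, of "1/3"] by (auto simp: eventually_sequentially)
  have ne: "\<omega> (r N) \<noteq> \<omega> (r (Suc N))" using inj strict_mono_eq[OF r] by (auto simp: inj_eq)
  then have disj: "\<omega> (r N) \<inter> \<omega> (r (Suc N)) = {}" using components_nonoverlap[OF \<omega> \<omega>] by blast
  have "1 = X_norm \<rho> (U (r N))" by (simp add: U)
  \<comment> \<open>The two functions live on disjoint components, so their difference dominates the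
    first of them pointwise.\<close>
  also have "\<dots> \<le> X_norm \<rho> (\<lambda>x. U (r N) x - U (r (Suc N)) x)"
    using disj UM by (intro X_norm_mono AE_I2) (auto simp: U_def f_def)
  also have "\<dots> \<le> X_norm \<rho> (\<lambda>x. U (r N) x - u x) + X_norm \<rho> (\<lambda>x. u x - U (r (Suc N)) x)"
    by (intro X_norm_diff_triangle UM uM)
  also have "\<dots> \<le> ennreal (1/3) + ennreal (1/3)"
    using N[of N] N[of "Suc N"] X_norm_minus_commute[of u "U (r (Suc N))"] by (intro add_mono) simp_all
  also have "\<dots> < 1" by (simp flip: ennreal_plus ennreal_1 add: ennreal_less_iff del: ennreal_1)
  finally show False by simp
qed

end

section \<open>Differential operators on Sobolev spaces\<close>

locale sobolev_operator = banach_function_space \<Omega> \<rho>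
  for \<Omega> :: "(real^'n::finite) set" and \<rho> :: "(real^'n \<Rightarrow> ennreal) \<Rightarrow> ennreal" +
  fixes k :: nat and A :: "('n \<Rightarrow> nat) \<Rightarrow> 'v::euclidean_space \<Rightarrow> 'w::euclidean_space"
  assumes A: "diff_operator k A"
begin

abbreviation "W \<equiv> W_space \<Omega> k \<rho> :: (real^'n \<Rightarrow> 'v) set"
abbreviation "W_n \<equiv> W_norm \<Omega> k \<rho> :: (real^'n \<Rightarrow> 'v) \<Rightarrow> ennreal"
abbreviation "op \<equiv> weak_op \<Omega> k A"

lemma linear_A: "mi_abs \<alpha> = k \<Longrightarrow> linear (A \<alpha>)"
  using A by (simp add: diff_operator_def)

lemma A_weak_deriv:
  assumes u: "u \<in> W" and \<alpha>: "mi_abs \<alpha> = k"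
  shows "(\<lambda>x. A \<alpha> (weak_deriv \<Omega> \<alpha> u x)) \<in> BM"
    and "X_norm \<rho> (\<lambda>x. A \<alpha> (weak_deriv \<Omega> \<alpha> u x)) \<le> ennreal (onorm (A \<alpha>)) * X_norm \<rho> (weak_deriv \<Omega> \<alpha> u)"
  using X_norm_linear[OF W_spaceD(2)[OF u] linear_A[OF \<alpha>]] \<alpha> by simp_all

lemma op_measurable: "u \<in> W \<Longrightarrow> op u \<in> BM"
  unfolding weak_op_def by (rule borel_measurable_sum) (auto intro: A_weak_deriv(1))

lemma op_bound: "\<exists>C>0. \<forall>u\<in>W. X_norm \<rho> (op u) \<le> ennreal C * W_n u"
proof -
  \<comment> \<open>The summand 1 keeps the constant positive even if all the operator norms
    vanish.\<close>
  define C where "C = (\<Sum>\<alpha> | mi_abs \<alpha> = k. onorm (A \<alpha>)) + 1"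
  have on: "onorm (A \<alpha>) \<ge> 0" if "mi_abs \<alpha> = k" for \<alpha>
    using linear_A[OF that] by (simp add: onorm_pos_le linear_conv_bounded_linear)
  have C: "C > 0" unfolding C_def using on by (intro add_nonneg_pos sum_nonneg) auto
  have "X_norm \<rho> (op u) \<le> ennreal C * W_n u" if u: "u \<in> W" for u
  proof -
    have "X_norm \<rho> (op u) \<le> (\<Sum>\<alpha> | mi_abs \<alpha> = k. X_norm \<rho> (\<lambda>x. A \<alpha> (weak_deriv \<Omega> \<alpha> u x)))"
      unfolding weak_op_def
      by (rule X_norm_sum[OF finite_mi_abs_eq]) (auto intro: A_weak_deriv(1)[OF u])
    also have "\<dots> \<le> (\<Sum>\<alpha> | mi_abs \<alpha> = k. ennreal (onorm (A \<alpha>)) * W_n u)"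
    proof (rule sum_mono)
      fix \<alpha> :: "'n \<Rightarrow> nat" assume "\<alpha> \<in> {\<alpha>. mi_abs \<alpha> = k}"
      then have \<alpha>: "mi_abs \<alpha> = k" by simp
      have "X_norm \<rho> (\<lambda>x. A \<alpha> (weak_deriv \<Omega> \<alpha> u x)) \<le> ennreal (onorm (A \<alpha>)) * X_norm \<rho> (weak_deriv \<Omega> \<alpha> u)"
        by (rule A_weak_deriv(2)[OF u \<alpha>])
      also have "\<dots> \<le> ennreal (onorm (A \<alpha>)) * W_n u"
        using \<alpha> by (intro mult_left_mono W_spaceD(3)[OF u]) auto
      finally show "X_norm \<rho> (\<lambda>x. A \<alpha> (weak_deriv \<Omega> \<alpha> u x)) \<le> ennreal (onorm (A \<alpha>)) * W_n u" .
    qed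
    also have "\<dots> = (\<Sum>\<alpha> | mi_abs \<alpha> = k. ennreal (onorm (A \<alpha>))) * W_n u"
      by (rule sum_distrib_right[symmetric])
    also have "(\<Sum>\<alpha> | mi_abs \<alpha> = k. ennreal (onorm (A \<alpha>))) = ennreal (\<Sum>\<alpha> | mi_abs \<alpha> = k. onorm (A \<alpha>))"
      by (rule sum_ennreal) (use on in blast)
    also have "\<dots> * W_n u \<le> ennreal C * W_n u" by (intro mult_right_mono ennreal_leI) (auto simp: C_def)
    finally show ?thesis .
  qed
  then show ?thesis using C by blast
qed

lemma op_finite: "u \<in> W \<Longrightarrow> X_norm \<rho> (op u) < \<infinity>"
proof -
  assume u: "u \<in> W"
  obtain C where C: "\<forall>u\<in>W. X_norm \<rho> (op u) \<le> ennreal C * W_n u" using op_bound by blast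
  have "ennreal C * W_n u < \<infinity>" using W_spaceD(4)[OF u] by (simp add: ennreal_mult_less_top)
  then show ?thesis using C u order_le_less_trans by blast
qed

lemma op_lincomb:
  assumes u: "u \<in> W" and v: "v \<in> W"
  shows "AE x in lebesgue_on \<Omega>. op (\<lambda>x. a *\<^sub>R u x + b *\<^sub>R v x) x = a *\<^sub>R op u x + b *\<^sub>R op v x"
proof -
  have "AE x in lebesgue_on \<Omega>. \<forall>\<alpha>\<in>{\<alpha>. mi_abs \<alpha> = k}. weak_deriv \<Omega> \<alpha> (\<lambda>x. a *\<^sub>R u x + b *\<^sub>R v x) x =
      a *\<^sub>R weak_deriv \<Omega> \<alpha> u x + b *\<^sub>R weak_deriv \<Omega> \<alpha> v x"
    using W_space_lincomb(3)[OF u v]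
    by (intro AE_ball_countable[THEN iffD2]) (auto intro: countable_finite finite_mi_abs_eq)
  then show ?thesis
  proof eventually_elim
    case (elim x)
    have "op (\<lambda>x. a *\<^sub>R u x + b *\<^sub>R v x) x =
        (\<Sum>\<alpha> | mi_abs \<alpha> = k. A \<alpha> (a *\<^sub>R weak_deriv \<Omega> \<alpha> u x + b *\<^sub>R weak_deriv \<Omega> \<alpha> v x))"
      unfolding weak_op_def using elim by (intro sum.cong) auto
    also have "\<dots> = (\<Sum>\<alpha> | mi_abs \<alpha> = k. a *\<^sub>R A \<alpha> (weak_deriv \<Omega> \<alpha> u x) + b *\<^sub>R A \<alpha> (weak_deriv \<Omega> \<alpha> v x))"
      by (intro sum.cong refl) (simp add: linear_add linear_scale linear_A)
    finally show ?case by (simp add: weak_op_def sum.distrib scaleR_sum_right)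
  qed
qed

lemma X_norm_op_lincomb:
  assumes u: "u \<in> W" and v: "v \<in> W"
  shows "X_norm \<rho> (op (\<lambda>x. a *\<^sub>R u x + b *\<^sub>R v x)) \<le> ennreal \<bar>a\<bar> * X_norm \<rho> (op u) + ennreal \<bar>b\<bar> * X_norm \<rho> (op v)"
proof -
  note m = op_measurable[OF u] op_measurable[OF v]
  have "X_norm \<rho> (op (\<lambda>x. a *\<^sub>R u x + b *\<^sub>R v x)) = X_norm \<rho> (\<lambda>x. a *\<^sub>R op u x + b *\<^sub>R op v x)"
    using m by (intro X_norm_cong op_lincomb[OF u v] op_measurable W_space_lincomb[OF u v]) auto
  also have "\<dots> \<le> X_norm \<rho> (\<lambda>x. a *\<^sub>R op u x) + X_norm \<rho> (\<lambda>x. b *\<^sub>R op v x)"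
    using m by (intro X_norm_add) auto
  finally show ?thesis by (simp add: X_norm_scaleR m)
qed

lemma X_norm_op_diff:
  "u \<in> W \<Longrightarrow> v \<in> W \<Longrightarrow> X_norm \<rho> (op (\<lambda>x. u x - v x)) \<le> X_norm \<rho> (op u) + X_norm \<rho> (op v)"
  using X_norm_op_lincomb[of u v 1 "-1"] by simp

lemma dist_op_dist_of:
  assumes u: "u \<in> W" and \<phi>: "\<phi> \<in> test_functions \<Omega>"
  shows "dist_op \<Omega> k A (dist_of \<Omega> u) \<phi> = (\<integral>x. \<phi> x *\<^sub>R op u x \<partial>lebesgue)"
proof -
  have "A \<alpha> (dist_deriv \<Omega> \<alpha> (dist_of \<Omega> u) \<phi>) = (\<integral>x. \<phi> x *\<^sub>R A \<alpha> (weak_deriv \<Omega> \<alpha> u x) \<partial>lebesgue) \<and>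
      integrable lebesgue (\<lambda>x. \<phi> x *\<^sub>R A \<alpha> (weak_deriv \<Omega> \<alpha> u x))" if \<alpha>: "mi_abs \<alpha> = k" for \<alpha>
  proof -
    have wd: "is_weak_deriv \<Omega> \<alpha> u (weak_deriv \<Omega> \<alpha> u)" using \<alpha> by (intro W_spaceD(1)[OF u]) simp
    then have int: "integrable lebesgue (\<lambda>x. \<phi> x *\<^sub>R weak_deriv \<Omega> \<alpha> u x)"
      by (intro test_L1_loc_integrable[OF _ \<phi>]) (simp add: is_weak_deriv_def)
    have bl: "bounded_linear (A \<alpha>)" using linear_A[OF \<alpha>] by (simp add: linear_conv_bounded_linear)
    have "dist_deriv \<Omega> \<alpha> (dist_of \<Omega> u) \<phi> = (\<integral>x. \<phi> x *\<^sub>R weak_deriv \<Omega> \<alpha> u x \<partial>lebesgue)"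
      using wd dist_of_eq_lebesgue[OF \<Omega>(1) \<phi>] by (simp add: is_weak_deriv_def)
    then show ?thesis
      using integral_bounded_linear[OF bl int] integrable_bounded_linear[OF bl int]
      by (simp add: linear_scale[OF linear_A[OF \<alpha>]])
  qed
  then have "dist_op \<Omega> k A (dist_of \<Omega> u) \<phi> = (\<Sum>\<alpha> | mi_abs \<alpha> = k. \<integral>x. \<phi> x *\<^sub>R A \<alpha> (weak_deriv \<Omega> \<alpha> u x) \<partial>lebesgue)"
    and "\<And>\<alpha>. mi_abs \<alpha> = k \<Longrightarrow> integrable lebesgue (\<lambda>x. \<phi> x *\<^sub>R A \<alpha> (weak_deriv \<Omega> \<alpha> u x))"
    unfolding dist_op_def by (auto intro!: sum.cong)
  then show ?thesis by (simp add: weak_op_def scaleR_sum_right)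
qed

text \<open>By the fundamental lemma the distributional equation is the same as
  \<open>op u = 0\<close> almost everywhere. This turns membership in the kernel into a condition on
  norms that can be passed to limits.\<close>

lemma dist_of_in_kernel_iff:
  assumes u: "u \<in> W"
  shows "dist_of \<Omega> u \<in> dist_kernel \<Omega> k A \<longleftrightarrow> X_norm \<rho> (op u) = 0"
proof -
  have L: "op u \<in> L1_loc \<Omega>" by (intro X_L1_loc op_measurable op_finite u)
  have D: "dist_of \<Omega> u \<in> distributions \<Omega>" by (intro dist_of_distributions \<Omega> W_spaceD(5)[OF u])
  have out: "dist_op \<Omega> k A (dist_of \<Omega> u) \<phi> = 0" if "\<phi> \<notin> test_functions \<Omega>" for \<phi>
    using that by (auto simp: dist_op_def dist_deriv_def linear_0[OF linear_A] intro!: sum.neutral)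
  have "dist_of \<Omega> u \<in> dist_kernel \<Omega> k A \<longleftrightarrow> (\<forall>\<phi>\<in>test_functions \<Omega>. dist_op \<Omega> k A (dist_of \<Omega> u) \<phi> = 0)"
    using D out unfolding dist_kernel_def fun_eq_iff by blast
  also have "\<dots> \<longleftrightarrow> (\<forall>\<phi>\<in>test_functions \<Omega>. (\<integral>x. \<phi> x *\<^sub>R op u x \<partial>lebesgue) = 0)"
    by (simp add: dist_op_dist_of[OF u])
  also have "\<dots> \<longleftrightarrow> (AE x in lebesgue. x \<in> \<Omega> \<longrightarrow> op u x = 0)"
  proof
    assume ae: "AE x in lebesgue. x \<in> \<Omega> \<longrightarrow> op u x = 0"
    show "\<forall>\<phi>\<in>test_functions \<Omega>. (\<integral>x. \<phi> x *\<^sub>R op u x \<partial>lebesgue) = 0"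
    proof
      fix \<phi> assume \<phi>: "\<phi> \<in> test_functions \<Omega>"
      have "AE x in lebesgue. \<phi> x *\<^sub>R op u x = 0"
        using ae by eventually_elim (use test_function_zero[OF \<phi>] in force)
      then show "(\<integral>x. \<phi> x *\<^sub>R op u x \<partial>lebesgue) = 0" by (rule integral_eq_zero_AE)
    qed
  qed (use fundamental_lemma[OF L \<Omega>(1)] in blast)
  also have "\<dots> \<longleftrightarrow> X_norm \<rho> (op u) = 0"
    unfolding X_norm_eq_0_iff[OF op_measurable[OF u]] AE_lebesgue_on_iff[OF \<Omega>(1)] ..
  finally show ?thesis .
qed

lemma W_kernel_iff: "u \<in> W_kernel \<Omega> k \<rho> A \<longleftrightarrow> u \<in> W \<and> X_norm \<rho> (op u) = 0"
  unfolding W_kernel_def using dist_of_in_kernel_iff by auto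

text \<open>On each component every derivative is a polynomial, which is its own continuous
  extension to the closure and is bounded because \<open>\<Omega>\<close> is. Finitely many
  components give one common bound, and bounded functions have finite norm.\<close>

lemma kernel_in_W:
  assumes "C_elliptic k A" "finite (components \<Omega>)" and T: "T \<in> dist_kernel \<Omega> k A"
  obtains u where "u \<in> W" "u \<in> smooth_upto_boundary \<Omega>" "T = dist_of \<Omega> u"
proof -
  obtain u where u: "piecewise_polynomial \<Omega> u" "T = dist_of \<Omega> u"
    using dist_kernel_piecewise_polynomial[OF A assms(1) \<Omega>(1) T] by blast
  have sm: "smooth_on \<Omega> u" by (rule piecewise_polynomial_smooth_on[OF u(1) \<Omega>(1)])
  have wd: "is_weak_deriv \<Omega> \<alpha> u (mi_deriv \<alpha> u)" for \<alpha> by (rule smooth_is_weak_deriv[OF \<Omega>(1) sm])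
  have pw: "piecewise_polynomial \<Omega> (mi_deriv \<alpha> u)" for \<alpha>
    by (rule piecewise_polynomial_mi_deriv[OF u(1) \<Omega>(1)])
  have "X_norm \<rho> (mi_deriv \<alpha> u) < \<infinity>" for \<alpha>
  proof -
    have "bounded (mi_deriv \<alpha> u ` \<omega>)" if \<omega>: "\<omega> \<in> components \<Omega>" for \<omega>
    proof -
      obtain p where p: "polynomial_function p" "\<And>x. x \<in> \<omega> \<Longrightarrow> mi_deriv \<alpha> u x = p x"
        using pw[of \<alpha>] \<omega> by (auto simp: piecewise_polynomial_def)
      have "compact (closure \<Omega>)" using \<Omega>(2) by simp
      then have "bounded (p ` closure \<Omega>)"
        by (intro compact_imp_bounded compact_continuous_image continuous_on_polymonial_function p(1))
      moreover have "mi_deriv \<alpha> u ` \<omega> \<subseteq> p ` closure \<Omega>"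
        using p(2) in_components_subset[OF \<omega>] closure_subset by force
      ultimately show ?thesis by (rule bounded_subset)
    qed
    then have "bounded (\<Union>\<omega>\<in>components \<Omega>. mi_deriv \<alpha> u ` \<omega>)" using assms(2) by (intro bounded_UN) auto
    moreover have "(\<Union>\<omega>\<in>components \<Omega>. mi_deriv \<alpha> u ` \<omega>) = mi_deriv \<alpha> u ` \<Omega>"
      using Union_components[of \<Omega>] by blast
    ultimately obtain B where "\<And>x. x \<in> \<Omega> \<Longrightarrow> norm (mi_deriv \<alpha> u x) \<le> B" by (auto simp: bounded_iff)
    then show ?thesis by (intro X_norm_bounded weak_deriv_measurable(2)[OF wd])
  qed
  then have "u \<in> W" by (intro W_spaceI[of k u "\<lambda>\<alpha>. mi_deriv \<alpha> u"] wd) auto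
  moreover have "u \<in> smooth_upto_boundary \<Omega>"
    unfolding smooth_upto_boundary_def
  proof (intro CollectI conjI sm ballI allI)
    fix \<omega> \<alpha> assume "\<omega> \<in> components \<Omega>"
    then obtain p where "polynomial_function p" "\<forall>x\<in>\<omega>. mi_deriv \<alpha> u x = p x"
      using pw[of \<alpha>] by (auto simp: piecewise_polynomial_def)
    then show "\<exists>g. continuous_on (closure \<omega>) g \<and> (\<forall>x\<in>\<omega>. g x = mi_deriv \<alpha> u x)"
      using continuous_on_polymonial_function by (intro exI[of _ p]) auto
  qed
  ultimately show ?thesis using that u(2) by blast
qed

lemma korn_compactness:
  fixes U :: "nat \<Rightarrow> real^'n \<Rightarrow> 'v"
  assumes korn: "korn_estimate \<Omega> k \<rho> A" and cpt: "compact_embedding \<Omega> k \<rho> TYPE(real^'n \<Rightarrow> 'v)"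
    and U: "\<And>j. U j \<in> W" and bdd: "\<And>j. W_n (U j) \<le> ennreal m"
    and op0: "(\<lambda>j. X_norm \<rho> (op (U j))) \<longlonglongrightarrow> 0"
  obtains r u where "strict_mono r" "u \<in> W_kernel \<Omega> k \<rho> A" "(\<lambda>j. W_n (\<lambda>x. U (r j) x - u x)) \<longlonglongrightarrow> 0"
proof -
  obtain C where C: "C > 0" "\<And>u. u \<in> W \<Longrightarrow> W_n u \<le> ennreal C * (X_norm \<rho> u + X_norm \<rho> (op u))"
    using korn unfolding korn_estimate_def by blast
  obtain r v where r: "strict_mono r" and v: "v \<in> X_space \<Omega> \<rho>"
    and lim: "(\<lambda>j. X_norm \<rho> (\<lambda>x. U (r j) x - v x)) \<longlonglongrightarrow> 0"
    using cpt U bdd unfolding compact_embedding_def by blast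
  have vM: "v \<in> BM" using v by (simp add: X_space_def)
  have UM: "U j \<in> BM" for j by (rule W_spaceD(6)[OF U])
  have op0r: "(\<lambda>j. X_norm \<rho> (op (U (r j)))) \<longlonglongrightarrow> 0"
    using LIMSEQ_subseq_LIMSEQ[OF op0 r] by (simp add: o_def)
  have "\<exists>u\<in>W. (\<lambda>j. W_n (\<lambda>x. U (r j) x - u x)) \<longlonglongrightarrow> 0"
  proof (rule W_complete[OF U])
    fix e :: real assume e: "e > 0"
    \<comment> \<open>The Korn estimate for a difference collects four terms of size
      \<open>d\<close>: two distances to the limit \<open>v\<close> in \<open>X\<close> and two
      norms of images under \<open>op\<close>.\<close>
    define d where "d = e / (4 * C)"
    have d: "d > 0" using e C(1) by (simp add: d_def)
    obtain N where N: "\<And>j. j \<ge> N \<Longrightarrow> X_norm \<rho> (\<lambda>x. U (r j) x - v x) \<le> ennreal d"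
      "\<And>j. j \<ge> N \<Longrightarrow> X_norm \<rho> (op (U (r j))) \<le> ennreal d"
      using eventually_conj[OF ennreal_tendsto_0D[OF lim d] ennreal_tendsto_0D[OF op0r d]]
      by (auto simp: eventually_sequentially)
    have "W_n (\<lambda>x. U (r i) x - U (r j) x) \<le> ennreal e" if ij: "i \<ge> N" "j \<ge> N" for i j
    proof -
      have "X_norm \<rho> (\<lambda>x. U (r i) x - U (r j) x) \<le> X_norm \<rho> (\<lambda>x. U (r i) x - v x) + X_norm \<rho> (\<lambda>x. v x - U (r j) x)"
        by (intro X_norm_diff_triangle UM vM)
      also have "\<dots> \<le> ennreal d + ennreal d"
        using N(1)[OF ij(1)] N(1)[OF ij(2)] X_norm_minus_commute[of v "U (r j)"] by (intro add_mono) simp_all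
      finally have 1: "X_norm \<rho> (\<lambda>x. U (r i) x - U (r j) x) \<le> ennreal d + ennreal d" .
      have "X_norm \<rho> (op (\<lambda>x. U (r i) x - U (r j) x)) \<le> X_norm \<rho> (op (U (r i))) + X_norm \<rho> (op (U (r j)))"
        by (intro X_norm_op_diff U)
      also have "\<dots> \<le> ennreal d + ennreal d" using N(2) ij by (intro add_mono) auto
      finally have 2: "X_norm \<rho> (op (\<lambda>x. U (r i) x - U (r j) x)) \<le> ennreal d + ennreal d" .
      have "W_n (\<lambda>x. U (r i) x - U (r j) x) \<le> ennreal C * ((ennreal d + ennreal d) + (ennreal d + ennreal d))"
        using C(2)[OF W_space_diff(1)[OF U U]] add_mono[OF 1 2] by (meson mult_left_mono order_trans zero_le)
      also have "(ennreal d + ennreal d) + (ennreal d + ennreal d) = ennreal ((d + d) + (d + d))"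
        using d by (simp only: ennreal_plus add_nonneg_nonneg less_imp_le)
      also have "ennreal C * \<dots> = ennreal (C * (4 * d))" using d C(1) by (simp flip: ennreal_mult)
      also have "C * (4 * d) = e" using C(1) by (simp add: d_def)
      finally show ?thesis .
    qed
    then show "\<exists>N. \<forall>i\<ge>N. \<forall>j\<ge>N. W_n (\<lambda>x. U (r i) x - U (r j) x) \<le> ennreal e" by blast
  qed
  then obtain u where u: "u \<in> W" and ulim: "(\<lambda>j. W_n (\<lambda>x. U (r j) x - u x)) \<longlonglongrightarrow> 0" by blast
  obtain D where D: "D > 0" "\<And>u. u \<in> W \<Longrightarrow> X_norm \<rho> (op u) \<le> ennreal D * W_n u"
    using op_bound by blast
  have "(\<lambda>j. ennreal D * W_n (\<lambda>x. U (r j) x - u x) + X_norm \<rho> (op (U (r j)))) \<longlonglongrightarrow> 0 + 0"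
    using D(1) by (intro tendsto_add ennreal_cmult_tendsto_0 ulim op0r) simp
  moreover have "X_norm \<rho> (op u) \<le> ennreal D * W_n (\<lambda>x. U (r j) x - u x) + X_norm \<rho> (op (U (r j)))" for j
  proof -
    \<comment> \<open>The limit is written as a difference: the image of the first term tends to 0
      by hypothesis, that of the second by boundedness of \<open>op\<close>.\<close>
    have "X_norm \<rho> (op u) = X_norm \<rho> (op (\<lambda>x. U (r j) x - (U (r j) x - u x)))" by simp
    also have "\<dots> \<le> X_norm \<rho> (op (U (r j))) + X_norm \<rho> (op (\<lambda>x. U (r j) x - u x))"
      by (intro X_norm_op_diff U u W_space_diff)
    also have "\<dots> \<le> X_norm \<rho> (op (U (r j))) + ennreal D * W_n (\<lambda>x. U (r j) x - u x)"
      by (intro add_mono D(2) W_space_diff U u) simp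
    finally show ?thesis by (simp add: add.commute)
  qed
  ultimately have "X_norm \<rho> (op u) \<le> 0 + 0" by (intro LIMSEQ_le_const) auto
  then have "u \<in> W_kernel \<Omega> k \<rho> A" using u by (simp add: W_kernel_iff)
  then show ?thesis using that r ulim by blast
qed

lemma W_scale_one:
  assumes u: "u \<in> W" and c: "W_n u = ennreal c" "c > 0"
  shows "(\<lambda>x. (1 / c) *\<^sub>R u x) \<in> W" "W_n (\<lambda>x. (1 / c) *\<^sub>R u x) = 1"
  using W_space_scaleR[OF u, of "1 / c"] c by (simp_all flip: ennreal_mult)

end

section \<open>The equivalence\<close>

context sobolev_operator
begin

section \<open>The norm of X as a continuous seminorm\<close>

lemma enn2real_X_norm: "u \<in> W \<Longrightarrow> ennreal (enn2real (X_norm \<rho> u)) = X_norm \<rho> u"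
  using W_spaceD(8)[of u k] by simp

text \<open>Seminorms are real-valued, hence \<open>enn2real\<close>; on \<open>W\<close> the norm
  is finite, so nothing is lost in the conversion.\<close>

lemma seminorm_enn2real_X_norm: "seminorm_ae \<Omega> W (\<lambda>u. enn2real (X_norm \<rho> u))"
  unfolding seminorm_ae_def
proof (intro conjI ballI allI impI)
  fix u v assume u: "u \<in> W" and v: "v \<in> W"
  note m = W_spaceD(6)[OF u] W_spaceD(6)[OF v]
  have "X_norm \<rho> (\<lambda>x. u x + v x) \<le> X_norm \<rho> u + X_norm \<rho> v" by (rule X_norm_add[OF m])
  moreover have fin: "X_norm \<rho> u < top" "X_norm \<rho> v < top" using W_spaceD(8)[OF u] W_spaceD(8)[OF v] by auto
  ultimately show "enn2real (X_norm \<rho> (\<lambda>x. u x + v x)) \<le> enn2real (X_norm \<rho> u) + enn2real (X_norm \<rho> v)"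
    using enn2real_mono[of "X_norm \<rho> (\<lambda>x. u x + v x)" "X_norm \<rho> u + X_norm \<rho> v"] by (simp add: enn2real_plus)
  assume "AE x in lebesgue_on \<Omega>. u x = v x"
  then show "enn2real (X_norm \<rho> u) = enn2real (X_norm \<rho> v)" using X_norm_cong[OF m] by simp
next
  fix u c assume u: "u \<in> W"
  show "enn2real (X_norm \<rho> (\<lambda>x. c *\<^sub>R u x)) = \<bar>c\<bar> * enn2real (X_norm \<rho> u)"
    by (simp add: X_norm_scaleR W_spaceD(6)[OF u] enn2real_mult)
qed simp

lemma X_norm_diff_W_norm: "u \<in> W \<Longrightarrow> v \<in> W \<Longrightarrow> X_norm \<rho> (\<lambda>x. u x - v x) \<le> W_n (\<lambda>x. u x - v x)"
  by (intro W_spaceD(7) W_space_diff)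

lemma W_continuous_enn2real_X_norm: "W_continuous \<Omega> k \<rho> (\<lambda>u::real^'n \<Rightarrow> 'v. enn2real (X_norm \<rho> u))"
  unfolding W_continuous_def
proof (intro allI ballI impI)
  fix U :: "nat \<Rightarrow> real^'n \<Rightarrow> 'v" and u
  assume u: "u \<in> W" and "\<forall>j. U j \<in> W" and lim: "(\<lambda>j. W_n (\<lambda>x. U j x - u x)) \<longlonglongrightarrow> 0"
  then have U: "U j \<in> W" for j by blast
  define N where "N w = enn2real (X_norm \<rho> w)" for w :: "real^'n \<Rightarrow> 'v"
  have N: "ennreal (N w) = X_norm \<rho> w" "N w \<ge> 0" if "w \<in> W" for w
    using enn2real_X_norm[OF that] by (auto simp: N_def)
  have "ennreal (N (\<lambda>x. U j x - u x)) \<le> W_n (\<lambda>x. U j x - u x)" for j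
    using X_norm_diff_W_norm[OF U u] N(1)[OF W_space_diff(1)[OF U u]] by simp
  from ennreal_tendsto_0_mono[OF lim this] have "(\<lambda>j. ennreal (N (\<lambda>x. U j x - u x))) \<longlonglongrightarrow> ennreal 0" by simp
  then have lim0: "(\<lambda>j. N (\<lambda>x. U j x - u x)) \<longlonglongrightarrow> 0"
    by (subst (asm) tendsto_ennreal_iff) (auto simp: N_def)
  have "\<bar>N (U j) - N u\<bar> \<le> N (\<lambda>x. U j x - u x)" for j
  proof -
    note tri = seminorm_enn2real_X_norm[unfolded seminorm_ae_def, THEN conjunct2, THEN conjunct2, THEN conjunct1,
        rule_format, folded N_def]
    have "N (\<lambda>x. (U j x - u x) + u x) \<le> N (\<lambda>x. U j x - u x) + N u" by (intro tri W_space_diff U u)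
    moreover have "N (\<lambda>x. (u x - U j x) + U j x) \<le> N (\<lambda>x. u x - U j x) + N (U j)" by (intro tri W_space_diff U u)
    moreover have "N (\<lambda>x. u x - U j x) = N (\<lambda>x. U j x - u x)" by (simp add: N_def X_norm_minus_commute[of u])
    ultimately show ?thesis by simp
  qed
  then have "(\<lambda>j. N (U j) - N u) \<longlonglongrightarrow> 0"
    by (intro Lim_null_comparison[OF _ lim0]) auto
  then show "(\<lambda>j. enn2real (X_norm \<rho> (U j))) \<longlonglongrightarrow> enn2real (X_norm \<rho> u)"
    by (simp add: N_def LIM_zero_iff)
qed

lemma seminorm_ae_subset: "seminorm_ae \<Omega> S N \<Longrightarrow> T \<subseteq> S \<Longrightarrow> seminorm_ae \<Omega> T N"
  unfolding seminorm_ae_def by blast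

lemma W_kernel_subset: "W_kernel \<Omega> k \<rho> A \<subseteq> W"
  by (auto simp: W_kernel_def)

text \<open>The step from (a) to (b). Elements violating the estimate with constants
  \<open>j + 1\<close> are normalised in \<open>W^kX\<close>; a subsequence converges to some
  \<open>w\<close> in the kernel. Continuity gives \<open>N w = 0\<close>, so \<open>w\<close>
  vanishes almost everywhere, although it is a limit of elements of norm 1.\<close>

lemma kernel_estimate:
  assumes korn: "korn_estimate \<Omega> k \<rho> A" and cpt: "compact_embedding \<Omega> k \<rho> TYPE(real^'n \<Rightarrow> 'v)"
    and N: "seminorm_ae \<Omega> W N" "W_continuous \<Omega> k \<rho> N"
    and inj: "\<And>u. u \<in> W_kernel \<Omega> k \<rho> A \<Longrightarrow> N u = 0 \<Longrightarrow> AE x in lebesgue_on \<Omega>. u x = 0"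
  shows "\<exists>c::real. 0 < c \<and> (\<forall>u\<in>W. W_n u \<le> ennreal c * (ennreal (N u) + X_norm \<rho> (op u)))"
proof (rule ccontr)
  assume no: "\<not> ?thesis"
  have N_nonneg: "N u \<ge> 0" if "u \<in> W" for u using N(1) that unfolding seminorm_ae_def by blast
  have N_scale: "N (\<lambda>x. c *\<^sub>R u x) = \<bar>c\<bar> * N u" if "u \<in> W" for u c
    using N(1) that unfolding seminorm_ae_def by blast
  have no': "\<not> (0 < c \<and> (\<forall>u\<in>W. W_n u \<le> ennreal c * (ennreal (N u) + X_norm \<rho> (op u))))" for c :: real
    using no by blast
  have "\<exists>u\<in>W. \<not> W_n u \<le> ennreal (real (Suc j)) * (ennreal (N u) + X_norm \<rho> (op u))" for j
    using no'[of "real (Suc j)"] by simp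
  then obtain u where u: "\<And>j. u j \<in> W"
    "\<And>j. \<not> W_n (u j) \<le> ennreal (real (Suc j)) * (ennreal (N (u j)) + X_norm \<rho> (op (u j)))"
    by metis
  define c where "c j = enn2real (W_n (u j))" for j
  have c: "W_n (u j) = ennreal (c j)" "c j > 0" for j
  proof -
    show eq: "W_n (u j) = ennreal (c j)" using W_spaceD(4)[OF u(1)] by (simp add: c_def)
    have "W_n (u j) \<noteq> 0" using u(2)[of j] by auto
    then have "c j \<noteq> 0" using eq by (metis ennreal_0)
    moreover have "c j \<ge> 0" by (simp add: c_def)
    ultimately show "c j > 0" by linarith
  qed
  define v where "v j = (\<lambda>x. (1 / c j) *\<^sub>R u j x)" for j
  have v: "v j \<in> W" "W_n (v j) = 1" for j
    unfolding v_def using W_scale_one[OF u(1) c] by auto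
  have c_Suc: "ennreal (1 / (c j * real (Suc j))) * ennreal (real (Suc j)) = ennreal (1 / c j)" for j
    using c(2)[of j] by (subst ennreal_mult[symmetric]) (auto simp del: of_nat_Suc)
  \<comment> \<open>The violated inequality bounds \<open>j + 1\<close> times the right-hand side by
    \<open>c j\<close>; dividing by \<open>c j\<close> and by \<open>j + 1\<close> leaves
    \<open>1 / (j + 1)\<close>.\<close>
  have small: "ennreal (N (v j)) + X_norm \<rho> (op (v j)) \<le> ennreal (1 / real (Suc j))" for j
  proof -
    have "X_norm \<rho> (op (v j)) \<le> ennreal (1 / c j) * X_norm \<rho> (op (u j))"
      unfolding v_def using X_norm_op_lincomb[OF u(1) u(1), of "1 / c j" j 0 j] c(2)[of j] by simp
    moreover have "ennreal (N (v j)) = ennreal (1 / c j) * ennreal (N (u j))"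
      unfolding v_def using c(2)[of j] N_nonneg[OF u(1)] by (simp add: N_scale[OF u(1)] ennreal_mult[symmetric])
    ultimately have "ennreal (N (v j)) + X_norm \<rho> (op (v j)) \<le>
        ennreal (1 / c j) * (ennreal (N (u j)) + X_norm \<rho> (op (u j)))"
      by (simp add: distrib_left add_left_mono)
    also have "\<dots> = ennreal (1 / (c j * real (Suc j))) *
        (ennreal (real (Suc j)) * (ennreal (N (u j)) + X_norm \<rho> (op (u j))))"
      by (simp only: mult.assoc[symmetric] c_Suc)
    also have "\<dots> \<le> ennreal (1 / (c j * real (Suc j))) * ennreal (c j)"
      using u(2)[of j] c(1)[of j] by (intro mult_left_mono) auto
    also have "\<dots> = ennreal (1 / real (Suc j))"
      using c(2)[of j] by (simp flip: ennreal_mult)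
    finally show ?thesis .
  qed
  have "(\<lambda>j. ennreal (1 / real (Suc j))) \<longlonglongrightarrow> ennreal 0"
    by (intro tendsto_ennrealI LIMSEQ_Suc lim_1_over_n)
  then have lim: "(\<lambda>j. ennreal (1 / real (Suc j))) \<longlonglongrightarrow> 0" by simp
  have op0: "(\<lambda>j. X_norm \<rho> (op (v j))) \<longlonglongrightarrow> 0"
    by (rule ennreal_tendsto_0_mono[OF lim], rule order_trans[OF _ small]) (rule add_increasing; simp)
  have "(\<lambda>j. ennreal (N (v j))) \<longlonglongrightarrow> ennreal 0"
    unfolding ennreal_0
    by (rule ennreal_tendsto_0_mono[OF lim], rule order_trans[OF _ small]) (rule add_increasing2; simp)
  then have N0: "(\<lambda>j. N (v j)) \<longlonglongrightarrow> 0" using N_nonneg[OF v(1)] by (subst (asm) tendsto_ennreal_iff) auto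
  obtain r w where r: "strict_mono r" and w: "w \<in> W_kernel \<Omega> k \<rho> A"
    and wlim: "(\<lambda>j. W_n (\<lambda>x. v (r j) x - w x)) \<longlonglongrightarrow> 0"
    by (rule korn_compactness[OF korn cpt v(1) _ op0, of 1]) (simp_all add: v(2))
  have wW: "w \<in> W" using w W_kernel_subset by blast
  from N(2)[unfolded W_continuous_def, THEN spec[of _ "\<lambda>j. v (r j)"], THEN bspec[OF _ wW], rule_format, OF v(1) wlim]
  have "(\<lambda>j. N (v (r j))) \<longlonglongrightarrow> N w" .
  moreover have "(\<lambda>j. N (v (r j))) \<longlonglongrightarrow> 0" using LIMSEQ_subseq_LIMSEQ[OF N0 r] by (simp add: o_def)
  ultimately have "N w = 0" using LIMSEQ_unique by blast
  then have ae: "AE x in lebesgue_on \<Omega>. w x = 0" by (rule inj[OF w])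
  \<comment> \<open>A function vanishing almost everywhere induces the zero distribution, so all its
    weak derivatives vanish almost everywhere as well.\<close>
  have "W_n w = 0"
  proof -
    have "dist_of \<Omega> w = dist_of \<Omega> (\<lambda>_. 0 :: 'v)"
      by (rule dist_of_cong_AE[OF \<Omega>(1) W_spaceD(5)[OF wW] _ ae]) (intro continuous_on_L1_loc continuous_on_const)
    then have "is_weak_deriv \<Omega> \<alpha> w = is_weak_deriv \<Omega> \<alpha> (\<lambda>_. 0 :: 'v)" for \<alpha>
      by (intro is_weak_deriv_cong W_spaceD(5)[OF wW] continuous_on_L1_loc continuous_on_const)
    moreover have "is_weak_deriv \<Omega> \<alpha> (\<lambda>_. 0 :: 'v) (\<lambda>_. 0)" for \<alpha>
      unfolding is_weak_deriv_iff[OF \<Omega>(1)] by (auto intro: continuous_on_L1_loc)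
    ultimately have wd: "is_weak_deriv \<Omega> \<alpha> w (\<lambda>_. 0)" for \<alpha> by simp
    have "W_n w = (\<Sum>\<alpha>\<in>{\<alpha>::'n \<Rightarrow> nat. mi_abs \<alpha> \<le> k}. X_norm \<rho> (\<lambda>_::real^'n. 0 :: 'v))"
      by (rule W_norm_eq[where g = "\<lambda>_ _. 0", OF wd])
    then show ?thesis by (simp add: X_norm_0)
  qed
  \<comment> \<open>Since \<open>W_n w = 0\<close>, the triangle inequality turns this into a bound
    by \<open>1 / 2\<close> for an element of norm 1.\<close>
  obtain j where "W_n (\<lambda>x. v (r j) x - w x) \<le> ennreal (1 / 2)"
    using ennreal_tendsto_0D[OF wlim, of "1 / 2"] by (auto simp: eventually_sequentially)
  then have "1 \<le> ennreal (1 / 2)"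
    using W_norm_triangle[OF v(1) wW, of "r j"] \<open>W_n w = 0\<close> v(2) by (simp add: order_trans)
  then have "ennreal 1 \<le> ennreal (1 / 2)" by (simp only: ennreal_1)
  then show False by (subst (asm) ennreal_le_iff) auto
qed

text \<open>In the forward direction (a), (b), (c) are proved in a cycle. Compactness enters in
  passing from (a) to (b); (b) gives (c) by restriction to \<open>N u = 0\<close>, and (c) gives (a)
  because \<open>op u\<close> has norm zero on the kernel.\<close>

theorem korn_iff_seminorm_equivalences:
  assumes cpt: "compact_embedding \<Omega> k \<rho> TYPE(real^'n \<Rightarrow> 'v)"
  shows "korn_estimate \<Omega> k \<rho> A \<longleftrightarrow> seminorm_equivalences \<Omega> k \<rho> A"
proof
  assume korn: "korn_estimate \<Omega> k \<rho> A"
  show "seminorm_equivalences \<Omega> k \<rho> A"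
    unfolding seminorm_equivalences_def Let_def
  proof (intro allI impI)
    fix N assume N: "seminorm_ae \<Omega> W N \<and> W_continuous \<Omega> k \<rho> N"
    let ?a = "norm_ae \<Omega> (W_kernel \<Omega> k \<rho> A) N"
    let ?b = "\<exists>c::real. 0 < c \<and> (\<forall>u\<in>W. W_n u \<le> ennreal c * (ennreal (N u) + X_norm \<rho> (op u)))"
    let ?c = "\<exists>c::real. 0 < c \<and> (\<forall>u\<in>W. N u = 0 \<longrightarrow> W_n u \<le> ennreal c * X_norm \<rho> (op u))"
    have "?b" if "?a"
      using that N by (intro kernel_estimate[OF korn cpt]) (auto simp: norm_ae_def)
    moreover have "?c" if b: "?b"
    proof -
      from b obtain c :: real where c: "0 < c \<and> (\<forall>u\<in>W. W_n u \<le> ennreal c * (ennreal (N u) + X_norm \<rho> (op u)))"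
        by (rule exE)
      have "W_n u \<le> ennreal c * X_norm \<rho> (op u)" if "u \<in> W" "N u = 0" for u
        using c[THEN conjunct2, THEN bspec, OF that(1)] that(2) by simp
      with c show ?thesis by (intro exI[of _ c] conjI ballI impI) simp_all
    qed
    moreover have "?a" if c_ex: "?c"
      unfolding norm_ae_def
    proof (intro conjI ballI impI)
      show "seminorm_ae \<Omega> (W_kernel \<Omega> k \<rho> A) N"
        using N W_kernel_subset by (blast intro: seminorm_ae_subset)
      fix u assume u: "u \<in> W_kernel \<Omega> k \<rho> A" and Nu: "N u = 0"
      have uW: "u \<in> W" "X_norm \<rho> (op u) = 0" using u by (simp_all add: W_kernel_iff)
      from c_ex obtain c :: real where c: "0 < c \<and> (\<forall>u\<in>W. N u = 0 \<longrightarrow> W_n u \<le> ennreal c * X_norm \<rho> (op u))"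
        by (rule exE)
      have "W_n u = 0" using c[THEN conjunct2, THEN bspec, OF uW(1)] Nu uW(2) by simp
      then have "X_norm \<rho> u = 0" using W_spaceD(7)[OF uW(1)] by simp
      then show "AE x in lebesgue_on \<Omega>. u x = 0" by (rule X_norm_eq_0D[OF W_spaceD(6)[OF uW(1)]])
    qed
    ultimately show "(?a \<longleftrightarrow> ?b) \<and> (?b \<longleftrightarrow> ?c)" by argo
  qed
next
  assume se: "seminorm_equivalences \<Omega> k \<rho> A"
  let ?N = "\<lambda>u::real^'n \<Rightarrow> 'v. enn2real (X_norm \<rho> u)"
  have "norm_ae \<Omega> (W_kernel \<Omega> k \<rho> A) ?N"
    unfolding norm_ae_def
  proof (intro conjI ballI impI)
    show "seminorm_ae \<Omega> (W_kernel \<Omega> k \<rho> A) ?N"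
      by (rule seminorm_ae_subset[OF seminorm_enn2real_X_norm W_kernel_subset])
    fix u :: "real^'n \<Rightarrow> 'v" assume u: "u \<in> W_kernel \<Omega> k \<rho> A" and z: "?N u = 0"
    have uW: "u \<in> W" using u W_kernel_subset by blast
    then have "X_norm \<rho> u = 0" using enn2real_X_norm[OF uW] z by simp
    then show "AE x in lebesgue_on \<Omega>. u x = 0" by (rule X_norm_eq_0D[OF W_spaceD(6)[OF uW]])
  qed
  then have "\<exists>c::real. 0 < c \<and> (\<forall>u\<in>W. W_n u \<le> ennreal c * (ennreal (?N u) + X_norm \<rho> (op u)))"
    using se[unfolded seminorm_equivalences_def Let_def, rule_format, of ?N]
      seminorm_enn2real_X_norm W_continuous_enn2real_X_norm by blast
  then show "korn_estimate \<Omega> k \<rho> A"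
    unfolding korn_estimate_def using enn2real_X_norm by (metis (no_types, lifting))
qed

text \<open>From a violating \<open>u j\<close> at distance \<open>c j\<close> from the kernel, a
  kernel element \<open>s j\<close> at distance less than \<open>2 * c j\<close> is subtracted and
  the difference divided by \<open>c j\<close>. The results are bounded in \<open>W^kX\<close> by
  the Korn estimate, and some subsequence tends to a kernel element \<open>w\<close>. Then
  \<open>s j + c j w\<close> is at some stage closer to \<open>u j\<close> than \<open>c j\<close>,
  which is impossible.\<close>

theorem kernel_distance_estimate:
  assumes korn: "korn_estimate \<Omega> k \<rho> A" and cpt: "compact_embedding \<Omega> k \<rho> TYPE(real^'n \<Rightarrow> 'v)"
    and ell: "C_elliptic k A"
  shows "\<exists>c::real. 0 < c \<and> (\<forall>u\<in>W.
    (INF v\<in>{v \<in> L1_loc \<Omega>. dist_of \<Omega> v \<in> dist_kernel \<Omega> k A}. X_norm \<rho> (\<lambda>x. u x - v x)) \<le> ennreal c * X_norm \<rho> (op u))"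
proof (rule ccontr)
  assume no: "\<not> ?thesis"
  define K where "K = {v \<in> L1_loc \<Omega>. dist_of \<Omega> v \<in> dist_kernel \<Omega> k A}"
  define d where "d u = (INF v\<in>K. X_norm \<rho> (\<lambda>x. u x - v x))" for u :: "real^'n \<Rightarrow> 'v"
  \<comment> \<open>The infimum runs over all locally integrable representatives of kernel
    distributions. They belong to \<open>W\<close> because membership depends only on the induced
    distribution, and every kernel distribution has a representative in \<open>W\<close>.\<close>
  have KW: "v \<in> W \<and> X_norm \<rho> (op v) = 0" if v: "v \<in> K" for v
  proof -
    have vL: "v \<in> L1_loc \<Omega>" and vk: "dist_of \<Omega> v \<in> dist_kernel \<Omega> k A" using v by (auto simp: K_def)
    obtain w where w: "w \<in> W" "dist_of \<Omega> v = dist_of \<Omega> w"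
      using kernel_in_W[OF ell finite_components[OF cpt] vk] by blast
    have eq: "is_weak_deriv \<Omega> \<alpha> v = is_weak_deriv \<Omega> \<alpha> w" for \<alpha>
      by (rule is_weak_deriv_cong[OF vL W_spaceD(5)[OF w(1)] w(2)])
    then have "weak_deriv \<Omega> \<alpha> v = weak_deriv \<Omega> \<alpha> w" for \<alpha> by (simp add: weak_deriv_def)
    then have "v \<in> W" using w(1) eq unfolding W_space_def W_norm_def by simp
    then show ?thesis using dist_of_in_kernel_iff vk by blast
  qed
  have K_iff: "v \<in> K \<longleftrightarrow> v \<in> W \<and> X_norm \<rho> (op v) = 0" for v
    using KW W_spaceD(5) dist_of_in_kernel_iff unfolding K_def by blast
  have K_lincomb: "(\<lambda>x. a *\<^sub>R v x + b *\<^sub>R w x) \<in> K" if "v \<in> K" "w \<in> K" for v w a b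
    using W_space_lincomb(1)[of v k w a b] X_norm_op_lincomb[of v w a b] that by (simp add: K_iff)
  have "(\<lambda>_. 0) \<in> W"
    using smooth_is_weak_deriv[OF \<Omega>(1) smooth_on_const[of \<Omega> "0::'v"]]
    by (rule_tac W_spaceI[of k _ "\<lambda>_ _. 0"])
      (auto simp: mi_deriv_eq_foldr foldr_partial_deriv_0 X_norm_0)
  then have K0: "(\<lambda>_. 0) \<in> K"
    using X_norm_op_lincomb[of "\<lambda>_. 0" "\<lambda>_. 0" 0 0] by (simp add: K_iff)
  have no': "\<not> (0 < c \<and> (\<forall>u\<in>W. d u \<le> ennreal c * X_norm \<rho> (op u)))" for c :: real
    using no unfolding d_def K_def by blast
  have "\<exists>u\<in>W. \<not> d u \<le> ennreal (real (Suc j)) * X_norm \<rho> (op u)" for j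
    using no'[of "real (Suc j)"] by simp
  then obtain u where u: "\<And>j. u j \<in> W" "\<And>j. \<not> d (u j) \<le> ennreal (real (Suc j)) * X_norm \<rho> (op (u j))"
    by metis
  define c where "c j = enn2real (d (u j))" for j
  have c: "d (u j) = ennreal (c j)" "c j > 0" for j
  proof -
    have "d (u j) \<le> X_norm \<rho> (u j)" unfolding d_def using K0 by (rule INF_lower2) simp
    then have "d (u j) < top" using W_spaceD(8)[OF u(1)] by (simp add: order_le_less_trans)
    then show eq: "d (u j) = ennreal (c j)" by (simp add: c_def)
    have "d (u j) \<noteq> 0" using u(2)[of j] by auto
    then have "c j \<noteq> 0" using eq by (metis ennreal_0)
    moreover have "c j \<ge> 0" by (simp add: c_def)
    ultimately show "c j > 0" by linarith
  qed
  \<comment> \<open>The infimum need not be attained; since \<open>c j > 0\<close>, twice its value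
    leaves room for a near minimiser.\<close>
  have "\<exists>v\<in>K. X_norm \<rho> (\<lambda>x. u j x - v x) < ennreal (2 * c j)" for j
  proof -
    have "d (u j) < ennreal (2 * c j)" using c[of j] by (simp add: ennreal_less_iff)
    then show ?thesis unfolding d_def by (simp add: INF_less_iff)
  qed
  then obtain s where s: "\<And>j. s j \<in> K" "\<And>j. X_norm \<rho> (\<lambda>x. u j x - s j x) < ennreal (2 * c j)" by metis
  have sW: "s j \<in> W" "X_norm \<rho> (op (s j)) = 0" for j using s(1)[of j] by (auto simp: K_iff)
  define v where "v j = (\<lambda>x. (1 / c j) *\<^sub>R (u j x - s j x))" for j
  have us: "(\<lambda>x. u j x - s j x) \<in> W" for j by (intro W_space_diff u sW)
  have v: "v j \<in> W" for j unfolding v_def by (rule W_space_scaleR(1)[OF us])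
  have vX: "X_norm \<rho> (v j) \<le> ennreal 2" for j
  proof -
    have "X_norm \<rho> (v j) = ennreal (1 / c j) * X_norm \<rho> (\<lambda>x. u j x - s j x)"
      unfolding v_def using c(2)[of j] by (simp add: X_norm_scaleR W_spaceD(6)[OF us])
    also have "\<dots> \<le> ennreal (1 / c j) * ennreal (2 * c j)" using s(2)[of j] by (intro mult_left_mono) auto
    also have "\<dots> = ennreal 2" using c(2)[of j] by (simp flip: ennreal_mult)
    finally show ?thesis .
  qed
  have c_Suc: "ennreal (1 / (c j * real (Suc j))) * ennreal (real (Suc j)) = ennreal (1 / c j)" for j
    using c(2)[of j] by (subst ennreal_mult[symmetric]) (auto simp del: of_nat_Suc)
  have v_op: "X_norm \<rho> (op (v j)) \<le> ennreal (1 / real (Suc j))" for j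
  proof -
    have "X_norm \<rho> (op (v j)) \<le> ennreal (1 / c j) * X_norm \<rho> (op (u j))"
      unfolding v_def using X_norm_op_lincomb[OF u(1) sW(1), of "1 / c j" j "- (1 / c j)" j] c(2)[of j]
      by (simp add: sW(2) scaleR_diff_right)
    also have "\<dots> = ennreal (1 / (c j * real (Suc j))) * (ennreal (real (Suc j)) * X_norm \<rho> (op (u j)))"
      by (simp only: mult.assoc[symmetric] c_Suc)
    also have "\<dots> \<le> ennreal (1 / (c j * real (Suc j))) * ennreal (c j)"
      using u(2)[of j] c(1)[of j] by (intro mult_left_mono) auto
    also have "\<dots> = ennreal (1 / real (Suc j))" using c(2)[of j] by (simp flip: ennreal_mult)
    finally show ?thesis .
  qed
  obtain C where C: "C > 0" "\<And>u. u \<in> W \<Longrightarrow> W_n u \<le> ennreal C * (X_norm \<rho> u + X_norm \<rho> (op u))"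
    using korn unfolding korn_estimate_def by blast
  \<comment> \<open>The constant 3 adds the bound 2 for the norm in \<open>X\<close> and the bound 1
    for the image under \<open>op\<close>.\<close>
  have bdd: "W_n (v j) \<le> ennreal (C * 3)" for j
  proof -
    have "X_norm \<rho> (v j) + X_norm \<rho> (op (v j)) \<le> ennreal 2 + ennreal 1"
      using vX[of j] order_trans[OF v_op[of j] ennreal_leI[of "1 / real (Suc j)" 1]] by (intro add_mono) auto
    also have "ennreal 2 + ennreal 1 = ennreal 3" by (simp flip: ennreal_plus del: ennreal_1 ennreal_numeral)
    finally have "ennreal C * (X_norm \<rho> (v j) + X_norm \<rho> (op (v j))) \<le> ennreal C * ennreal 3"
      by (intro mult_left_mono) auto
    then show ?thesis using C(2)[OF v, of j] C(1) by (simp add: ennreal_mult del: ennreal_numeral)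
  qed
  have "(\<lambda>j. ennreal (1 / real (Suc j))) \<longlonglongrightarrow> ennreal 0"
    by (intro tendsto_ennrealI LIMSEQ_Suc lim_1_over_n)
  then have lim: "(\<lambda>j. ennreal (1 / real (Suc j))) \<longlonglongrightarrow> 0" by simp
  have op0: "(\<lambda>j. X_norm \<rho> (op (v j))) \<longlonglongrightarrow> 0"
    by (rule ennreal_tendsto_0_mono[OF lim v_op])
  obtain r w where "strict_mono r" and w: "w \<in> W_kernel \<Omega> k \<rho> A"
    and wlim: "(\<lambda>j. W_n (\<lambda>x. v (r j) x - w x)) \<longlonglongrightarrow> 0"
    by (rule korn_compactness[OF korn cpt v bdd op0])
  have wK: "w \<in> K" and wW: "w \<in> W" using w by (auto simp: K_iff W_kernel_iff)
  obtain j where j: "W_n (\<lambda>x. v (r j) x - w x) \<le> ennreal (1 / 2)"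
    using ennreal_tendsto_0D[OF wlim, of "1 / 2"] by (auto simp: eventually_sequentially)
  define i where "i = r j"
  \<comment> \<open>Undoing the normalisation: correcting \<open>s i\<close> by \<open>c i\<close>
    times \<open>w\<close> gives a kernel element within \<open>c i / 2\<close> of
    \<open>u i\<close>, less than its distance \<open>c i\<close> from the kernel.\<close>
  have "(\<lambda>x. 1 *\<^sub>R s i x + c i *\<^sub>R w x) \<in> K" by (rule K_lincomb[OF s(1) wK])
  then have "d (u i) \<le> X_norm \<rho> (\<lambda>x. u i x - (1 *\<^sub>R s i x + c i *\<^sub>R w x))"
    unfolding d_def by (rule INF_lower)
  also have "(\<lambda>x. u i x - (1 *\<^sub>R s i x + c i *\<^sub>R w x)) = (\<lambda>x. c i *\<^sub>R (v i x - w x))"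
    using c(2)[of i] by (simp add: v_def fun_eq_iff scaleR_diff_right)
  also have "X_norm \<rho> \<dots> = ennreal (c i) * X_norm \<rho> (\<lambda>x. v i x - w x)"
    using c(2)[of i] W_spaceD(6)[OF v] W_spaceD(6)[OF wW] by (subst X_norm_scaleR) auto
  also have "\<dots> \<le> ennreal (c i) * ennreal (1 / 2)"
    using X_norm_diff_W_norm[OF v wW, of i] j by (intro mult_left_mono) (auto simp: i_def)
  also have "\<dots> = ennreal (c i / 2)" using c(2)[of i] by (subst ennreal_mult[symmetric]) auto
  finally show False using c[of i] by simp
qed

end

theorem theorem2p8:
  fixes \<Omega> :: "(real^'n::finite) set"
    and k :: nat
    and A :: "('n \<Rightarrow> nat) \<Rightarrow> 'v::euclidean_space \<Rightarrow> 'w::euclidean_space"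
    and \<rho> :: "(real^'n \<Rightarrow> ennreal) \<Rightarrow> ennreal"
  assumes "CARD('n) \<ge> 2" and "k \<ge> 1"
    and "open \<Omega>" and "bounded \<Omega>"
    and "diff_operator k A" and "C_elliptic k A"
    and "banach_function_norm \<Omega> \<rho>"
    and "infinite_dim_ae \<Omega> (X_space \<Omega> \<rho> :: (real^'n \<Rightarrow> 'v) set)"
    and "(X_space \<Omega> \<rho> :: (real^'n \<Rightarrow> 'v) set) \<subseteq> L1_loc \<Omega>"
    and "compact_embedding \<Omega> k \<rho> TYPE(real^'n \<Rightarrow> 'v)"
  shows "(korn_estimate \<Omega> k \<rho> A \<longleftrightarrow> seminorm_equivalences \<Omega> k \<rho> A) \<and>
    (korn_estimate \<Omega> k \<rho> A \<or> seminorm_equivalences \<Omega> k \<rho> A \<longrightarrow>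
      dist_kernel \<Omega> k A = dist_kernel \<Omega> k A \<inter> dist_of \<Omega> ` W_space \<Omega> k \<rho> \<and>
      dist_kernel \<Omega> k A \<inter> dist_of \<Omega> ` W_space \<Omega> k \<rho> =
        dist_kernel \<Omega> k A \<inter> dist_of \<Omega> ` smooth_upto_boundary \<Omega> \<and>
      (\<exists>c::real. 0 < c \<and> (\<forall>u\<in>W_space \<Omega> k \<rho>.
         (INF v\<in>{v \<in> L1_loc \<Omega>. dist_of \<Omega> v \<in> dist_kernel \<Omega> k A}. X_norm \<rho> (\<lambda>x. u x - v x))
           \<le> ennreal c * X_norm \<rho> (weak_op \<Omega> k A u))))"
proof -
  interpret sobolev_operator \<Omega> \<rho> k A
    using assms by unfold_locales
  note cpt = assms(10) and ell = assms(6)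
  have iff: "korn_estimate \<Omega> k \<rho> A \<longleftrightarrow> seminorm_equivalences \<Omega> k \<rho> A"
    by (rule korn_iff_seminorm_equivalences[OF cpt])
  have "dist_kernel \<Omega> k A \<subseteq> dist_of \<Omega> ` W" "dist_kernel \<Omega> k A \<subseteq> dist_of \<Omega> ` smooth_upto_boundary \<Omega>"
    using kernel_in_W[OF ell finite_components[OF cpt]] by (blast, blast)
  then have "dist_kernel \<Omega> k A = dist_kernel \<Omega> k A \<inter> dist_of \<Omega> ` W \<and>
      dist_kernel \<Omega> k A \<inter> dist_of \<Omega> ` W = dist_kernel \<Omega> k A \<inter> dist_of \<Omega> ` smooth_upto_boundary \<Omega>"
    by blast
  then show ?thesis using iff kernel_distance_estimate[OF _ cpt ell] by blast
qed

end
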